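(* Fix $\beta>0$. For almost every initial data $\vec S(0)=\{\vec S_n(0)\}_{n\in\mathbb Z}$ distributed according to the Gibbs measure $d\mu^\beta_{Gibbs}$, there exists a unique global good solution $\vec S:\mathbb R\times\mathbb Z\to\mathbb S^2$ to the spin chain model $$\frac{d}{dt}\vec S_n=-\vec S_n\times\biggl(\frac{2\vec S_{n+1}}{1+\vec S_n\cdot\vec S_{n+1}}+\frac{2\vec S_{n-1}}{1+\vec S_n\cdot\vec S_{n-1}}\biggr),\qquad n\in\mathbb Z, \qquad (\mathrm{LHM})$$ with this initial data. Moreover, the Gibbs measure $d\mu^\beta_{Gibbs}$ is left invariant by the flow of (LHM): for every $t\in\mathbb R$, if $\vec S(0)$ has law $\mu^\beta_{Gibbs}$ and $\vec S(t)$ denotes the value at time $t$ of the (almost surely defined) unique global good solution with initial data $\vec S(0)$, then $\vec S(t)$ has law $\mu^\beta_{Gibbs}$.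
   Context: $\mathbb S^2\subset\mathbb R^3$ is the unit sphere, $\langle n\rangle=(1+n^2)^{1/2}$, and $ds$ denotes area measure on $\mathbb S^2$ (total mass $4\pi$). Good solution: a global (classical) solution $\vec S:\mathbb R\times\mathbb Z\to\mathbb S^2$ of (LHM) is a good solution if $$\int_{-T}^T\sum_{n\in\mathbb Z}\frac{\langle n\rangle^{-q}}{[1+\vec S_n(t)\cdot\vec S_{n+1}(t)]^p}\,dt<\infty\quad\text{for some }p>q>1\text{ and all }T>0,$$ $$\sup_{|t|\le T}\sum_{n\in\mathbb Z}\frac{e^{-c\langle n\rangle}}{1+\vec S_n(t)\cdot\vec S_{n+1}(t)}<\infty\quad\text{for some }c>0\text{ and all }T>0.$$ Gibbs measure: put $$p(s,\sigma)=\tfrac{1+2\beta}{4\pi}\Bigl(\tfrac{1+s\cdot\sigma}{2}\Bigr)^{2\beta},\qquad s,\sigma\in\mathbb S^2 .$$ A probability measure on spin fields $\{\vec S_n\}_{n\in\mathbb Z}\in(\mathbb S^2)^{\mathbb Z}$, with expectation $\mathbb E_\beta$, is a Gibbs measure at inverse temperature $\beta$ if it satisfies the DLR condition: for all integers $a\le b$ and all bounded continuous $f$, $$\mathbb E_\beta\{f(\vec S_a,\dots,\vec S_b)\mid\vec S_{a-1},\vec S_{b+1}\}=\frac1{Z_{ab}}\int_{\mathbb S^2}\!\cdots\!\int_{\mathbb S^2}f(s_a,\dots,s_b)\,p(\vec S_{a-1},s_a)\,p(s_b,\vec S_{b+1})\prod_{k=a}^{b-1}p(s_k,s_{k+1})\,ds_a\cdots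 ds_b,$$ where $Z_{ab}$ is the same integral with $f\equiv1$. There is exactly one such measure, denoted $\mu^\beta_{Gibbs}$; its marginals are $$\mathbb E_\beta\{f(\vec S_n,\dots,\vec S_m)\}=\frac1{4\pi}\int_{\mathbb S^2}\!\cdots\!\int_{\mathbb S^2}f(s_n,\dots,s_m)\prod_{k=n}^{m-1}p(s_k,s_{k+1})\,ds_n\cdots ds_m\qquad (n\le m).$$ *)

theory Defs
  imports "HOL-Probability.Probability"
begin

unbundle cross3_syntax

abbreviation S2 :: "(real^3) set" where
  "S2 \<equiv> sphere 0 1"

definition jbracket :: "int \<Rightarrow> real" where
  "jbracket n = sqrt (1 + (real_of_int n)\<^sup>2)"


text \<open>
  Area measure on the unit sphere, as in polar integration: the area of \<open>A\<close> is three times the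
  volume of the cone over \<open>A\<close> in the unit ball. On the punctured ball \<open>sgn x = x / norm x\<close>.
\<close>

definition sphere_area :: "(real^3) measure" where
  "sphere_area =
     distr (scale_measure 3 (restrict_space lborel (cball 0 1 - {0}))) (restrict_space borel S2) sgn"

lemma emeasure_sphere_area_space: "emeasure sphere_area S2 = ennreal (4 * pi)"
proof -
  have ball: "cball (0::real^3) 1 - {0} \<in> sets lborel" by simp
  let ?M = "scale_measure 3 (restrict_space lborel (cball (0::real^3) 1 - {0}))"
  have sp: "space ?M = cball (0::real^3) 1 - {0}"
    by (simp add: space_restrict_space space_scale_measure)
  have "sgn \<in> restrict_space lborel (cball (0::real^3) 1 - {0})
                \<rightarrow>\<^sub>M restrict_space borel S2"
  proof (rule measurable_restrict_space2)
    show "sgn \<in> space (restrict_space lborel (cball (0::real^3) 1 - {0})) \<rightarrow> S2"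
      by (auto simp: space_restrict_space norm_sgn)
    show "sgn \<in> restrict_space lborel (cball (0::real^3) 1 - {0}) \<rightarrow>\<^sub>M borel"
      unfolding sgn_div_norm by (intro measurable_restrict_space1) measurable
  qed
  then have meas: "sgn \<in> ?M \<rightarrow>\<^sub>M restrict_space borel S2"
    by (simp cong: measurable_cong_sets)
  have "S2 \<in> sets (restrict_space borel S2)"
    using sets.top[of "restrict_space borel S2"] by (simp add: space_restrict_space)
  then have "emeasure sphere_area S2 = emeasure ?M (sgn -` S2 \<inter> space ?M)"
    unfolding sphere_area_def using meas by (rule emeasure_distr[rotated])
  also have "sgn -` S2 \<inter> space ?M = cball 0 1 - {0}"
    unfolding sp by (auto simp: norm_sgn)
  also have "emeasure ?M (cball 0 1 - {0}) = 3 * emeasure lborel (cball (0::real^3) 1 - {0})"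
    using ball by (simp add: emeasure_restrict_space)
  also have "emeasure lborel (cball (0::real^3) 1 - {0}) = emeasure lborel (cball (0::real^3) 1)"
    by (subst emeasure_Diff) auto
  also have "\<dots> = ennreal (4 / 3 * pi)"
    by (simp add: emeasure_cball eval_unit_ball_vol)
  also have "3 * ennreal (4 / 3 * pi) = ennreal (4 * pi)"
    by (subst ennreal_numeral[symmetric], subst ennreal_mult[symmetric]) auto
  finally show ?thesis .
qed


definition spin_space :: "(int \<Rightarrow> real^3) measure" where
  "spin_space = Pi\<^sub>M UNIV (\<lambda>_. restrict_space borel S2)"


text \<open>
  The non-vanishing clause says that the right-hand side of the equation is defined; it cannot be
  dropped, since division by zero yields \<open>0\<close>.
\<close>

definition lhm_solution :: "(real \<Rightarrow> int \<Rightarrow> real^3) \<Rightarrow> bool" where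
  "lhm_solution S \<longleftrightarrow>
     (\<forall>t n. S t n \<in> S2) \<and>
     (\<forall>t n. 1 + S t n \<bullet> S t (n + 1) \<noteq> 0) \<and>
     (\<forall>t n. ((\<lambda>\<tau>. S \<tau> n) has_vector_derivative
              - (S t n \<times> ((2 / (1 + S t n \<bullet> S t (n + 1))) *\<^sub>R S t (n + 1)
                        + (2 / (1 + S t n \<bullet> S t (n - 1))) *\<^sub>R S t (n - 1)))) (at t))"

definition good_solution :: "(real \<Rightarrow> int \<Rightarrow> real^3) \<Rightarrow> bool" where
  "good_solution S \<longleftrightarrow>
     lhm_solution S \<and>
     (\<exists>p q::real. p > q \<and> q > 1 \<and> (\<forall>T>0.
        (\<integral>\<^sup>+t\<in>{-T..T}. (\<integral>\<^sup>+n. ennreal (jbracket n powr (- q)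
             / (1 + S t n \<bullet> S t (n + 1)) powr p) \<partial>count_space UNIV) \<partial>lborel) < \<infinity>)) \<and>
     (\<exists>c::real. c > 0 \<and> (\<forall>T>0.
        (SUP t\<in>{-T..T}. \<integral>\<^sup>+n. ennreal (exp (- c * jbracket n)
             / (1 + S t n \<bullet> S t (n + 1))) \<partial>count_space UNIV) < \<infinity>))"

text \<open>
  The flow is meaningful only for data with a unique global good solution; the value chosen
  elsewhere merely makes it a total map on spin fields. Being determined only almost everywhere,
  the flow is to be read as a random variable on the completion of the initial law.
\<close>

definition lhm_flow :: "real \<Rightarrow> (int \<Rightarrow> real^3) \<Rightarrow> (int \<Rightarrow> real^3)" where
  "lhm_flow t S0 =
     (if \<exists>!S. good_solution S \<and> S 0 = S0 then (THE S. good_solution S \<and> S 0 = S0) t else S0)"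


definition spin_kernel :: "real \<Rightarrow> real^3 \<Rightarrow> real^3 \<Rightarrow> real" where
  "spin_kernel \<beta> s \<sigma> = (1 + 2 * \<beta>) / (4 * pi) * ((1 + s \<bullet> \<sigma>) / 2) powr (2 * \<beta>)"

definition block_weight ::
    "real \<Rightarrow> int \<Rightarrow> int \<Rightarrow> real^3 \<Rightarrow> real^3 \<Rightarrow> (int \<Rightarrow> real^3) \<Rightarrow> real" where
  "block_weight \<beta> a b l r s =
     spin_kernel \<beta> l (s a) * spin_kernel \<beta> (s b) r * (\<Prod>k\<in>{a..<b}. spin_kernel \<beta> (s k) (s (k + 1)))"

definition block_integral ::
    "real \<Rightarrow> int \<Rightarrow> int \<Rightarrow> ((int \<Rightarrow> real^3) \<Rightarrow> real) \<Rightarrow> real^3 \<Rightarrow> real^3 \<Rightarrow> real" where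
  "block_integral \<beta> a b f l r =
     (\<integral>s. f s * block_weight \<beta> a b l r s \<partial>(Pi\<^sub>M {a..b} (\<lambda>_. sphere_area)))"

text \<open>
  The DLR condition. A function of \<open>(s\<^sub>a, \<dots>, s\<^sub>b)\<close> is a function on the extensional product
  \<open>\<Pi>\<^sub>E k\<in>{a..b}. S2\<close>, whose subspace topology in \<open>int \<Rightarrow> real^3\<close> is the product topology.
  Conditioning is on the \<open>\<sigma>\<close>-algebra generated by the two boundary spins.
\<close>

definition is_gibbs_measure :: "real \<Rightarrow> (int \<Rightarrow> real^3) measure \<Rightarrow> bool" where
  "is_gibbs_measure \<beta> \<mu> \<longleftrightarrow>
     prob_space \<mu> \<and> sets \<mu> = sets spin_space \<and>
     (\<forall>a b f. a \<le> b \<and> continuous_on (\<Pi>\<^sub>E k\<in>{a..b}. S2) f \<and> bounded (f ` (\<Pi>\<^sub>E k\<in>{a..b}. S2)) \<longrightarrow>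
        (AE S in \<mu>.
           real_cond_exp \<mu> (vimage_algebra (space \<mu>) (\<lambda>S. (S (a - 1), S (b + 1))) borel)
             (\<lambda>S. f (restrict S {a..b})) S
           = block_integral \<beta> a b f (S (a - 1)) (S (b + 1))
             / block_integral \<beta> a b (\<lambda>_. 1) (S (a - 1)) (S (b + 1))))"

end

theory Submission
  imports Defs
begin

text \<open>
  Iterating the DLR condition over growing blocks, Dobrushin contraction of the kernel shows that
  the law of a block is the chain density with free ends.

  On a finite chain with free ends the flow conserves \<open>\<Sum> 2 ln (1 + S\<^sub>n \<bullet> S\<^sub>n\<^sub>+\<^sub>1)\<close>, which is, up to the factor
  \<open>\<beta>\<close> and a constant, the logarithm of the density; so neighbours never become antipodal and it is
  global. It is a limit of compositions of twists, that
  is, rotations of one spin about a neighbour by an angle depending only on their inner product,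
  and twists preserve area. Hence the finite flows preserve the block marginals of the Gibbs measure.

  The law of \<open>1 + S\<^sub>n \<bullet> S\<^sub>n\<^sub>+\<^sub>1\<close> has density proportional to the power \<open>2\<beta>\<close>, so \<open>(1 + S\<^sub>n \<bullet> S\<^sub>n\<^sub>+\<^sub>1) powr (- p)\<close> has
  finite expectation for some \<open>p > 1\<close>. By invariance, the space-time moments of the finite flows are
  bounded uniformly in the block; so, almost surely, the time integral of the Lipschitz rate of the
  equation grows sublinearly along blocks of dyadic size. Gronwall's inequality for
  an exponentially weighted difference then beats the influence of the ends of the block: it gives
  convergence along dyadic blocks, and uniqueness among good solutions by the same estimate.
  The limit stays away from antipodal neighbours since the logarithmic derivative of
  \<open>1 + S\<^sub>n \<bullet> S\<^sub>n\<^sub>+\<^sub>1\<close> is bounded by the adjacent inverses, whose time integrals are finite.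
\<close>

section \<open>Area measure and twists of the sphere\<close>

text \<open>The coupling is singular at antipodal neighbours and nothing keeps the bonds of an
  infinite configuration away from 0, so the whole chain has no Lipschitz theory. Control comes from
  moments of the inverse bond, and these are finite only below the order
  \<open>1 + 2 * \<beta>\<close>, barely more than the first for small \<open>\<beta>\<close>. Hence
  the Lipschitz constant of a pair has to be of the order of the inverse bond and not of its square,
  and the largest rate among the sites up to N is bounded through the p-th moment with a loss
  \<open>N powr (q / p)\<close>, which stays sublinear because q < p. Uniform expectations do not
  bound a single path at all scales. They give growth of at most
  \<open>2 powr (\<epsilon> * real j)\<close> at every dyadic scale, which suffices for convergence,
  and by Fatou a bound independent of the scale infinitely often, which suffices for the limit.
  Finite chains are reached through a cut-off of the coupling, as existence, splitting into twists
  and preservation of area are proved for bounded Lipschitz couplings. Flows are defined as limits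
  of explicit maps, so that they are measurable.\<close>

lemma nn_integral_lborel_orthogonal:
  fixes A :: "real^3 \<Rightarrow> real^3"
  assumes A: "orthogonal_transformation A" and f: "f \<in> borel_measurable borel"
  shows "(\<integral>\<^sup>+x. f (A x) \<partial>lborel) = (\<integral>\<^sup>+x. f x \<partial>lborel)"
proof -
  have Am [measurable]: "A \<in> borel_measurable borel"
    using A by (intro borel_measurable_continuous_onI linear_continuous_on)
      (simp add: linear_linear orthogonal_transformation_linear)
  have "lborel = distr lborel borel A"
  proof (rule lborel_eqI)
    fix l u :: "real^3" assume lu: "\<And>b. b \<in> Basis \<Longrightarrow> l \<bullet> b \<le> u \<bullet> b"
    have inv: "orthogonal_transformation (inv A)"
      by (rule orthogonal_transformation_inv[OF A])
    have pre: "A -` box l u = inv A ` box l u"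
      using orthogonal_transformation_bij[OF A] by (simp add: bij_vimage_eq_inv_image)
    have "emeasure (distr lborel borel A) (box l u) = emeasure lborel (A -` box l u)"
      by (subst emeasure_distr) auto
    also have "\<dots> = emeasure lebesgue (A -` box l u)"
      using measurable_sets_borel[OF Am, of "box l u"] by simp
    also have "\<dots> = ennreal (measure lebesgue (inv A ` box l u))"
      unfolding pre by (intro emeasure_eq_measure2 measurable_orthogonal_image[OF inv]) simp
    also have "\<dots> = ennreal (measure lebesgue (box l u))"
      by (subst measure_orthogonal_image[OF inv]) auto
    also have "\<dots> = (\<Prod>b\<in>Basis. (u - l) \<bullet> b)"
      using lu by (simp add: measure_lborel_box_eq)
    finally show "emeasure (distr lborel borel A) (box l u) = (\<Prod>b\<in>Basis. (u - l) \<bullet> b)" .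
  qed simp
  then have "(\<integral>\<^sup>+x. f x \<partial>lborel) = (\<integral>\<^sup>+x. f x \<partial>distr lborel borel A)" by simp
  also have "\<dots> = (\<integral>\<^sup>+x. f (A x) \<partial>lborel)"
    using f by (intro nn_integral_distr) auto
  finally show ?thesis by simp
qed

lemma space_sphere_area [simp]: "space sphere_area = S2"
  by (simp add: sphere_area_def space_restrict_space)

lemma sets_sphere_area [measurable_cong]: "sets sphere_area = sets (restrict_space borel S2)"
  by (simp add: sphere_area_def)

lemma borel_measurable_sphere_area: "f \<in> borel_measurable borel \<Longrightarrow> f \<in> borel_measurable sphere_area"
  by (subst measurable_cong_sets[OF sets_sphere_area refl]) (rule measurable_restrict_space1)

lemma sgn_measurable_cball:
  "sgn \<in> restrict_space lborel (cball (0::real^3) 1 - {0}) \<rightarrow>\<^sub>M restrict_space borel S2"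
proof (rule measurable_restrict_space2)
  show "sgn \<in> space (restrict_space lborel (cball (0::real^3) 1 - {0})) \<rightarrow> S2"
    by (auto simp: space_restrict_space norm_sgn)
  show "sgn \<in> restrict_space lborel (cball (0::real^3) 1 - {0}) \<rightarrow>\<^sub>M borel"
    unfolding sgn_div_norm by (intro measurable_restrict_space1) measurable
qed

lemma nn_integral_sphere_area:
  assumes f: "f \<in> borel_measurable borel"
  shows "(\<integral>\<^sup>+s. f s \<partial>sphere_area) = 3 * (\<integral>\<^sup>+x. f (sgn x) * indicator (cball 0 1 - {0}) x \<partial>lborel)"
proof -
  have fr: "f \<in> borel_measurable (restrict_space borel S2)"
    using f by (rule measurable_restrict_space1)
  have fs: "(\<lambda>x. f (sgn x)) \<in> borel_measurable (restrict_space lborel (cball (0::real^3) 1 - {0}))"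
    using measurable_compose[OF sgn_measurable_cball fr] by simp
  have "(\<integral>\<^sup>+s. f s \<partial>sphere_area) =
      (\<integral>\<^sup>+x. f (sgn x) \<partial>scale_measure 3 (restrict_space lborel (cball 0 1 - {0})))"
    unfolding sphere_area_def
    using sgn_measurable_cball fr by (intro nn_integral_distr) (auto cong: measurable_cong_sets)
  then show ?thesis
    using fs by (simp add: nn_integral_scale_measure nn_integral_restrict_space)
qed

lemma finite_measure_sphere_area: "finite_measure sphere_area"
  by standard (simp add: emeasure_sphere_area_space)

interpretation sphere_area: finite_measure sphere_area
  by (rule finite_measure_sphere_area)

lemma measure_sphere_area_S2: "measure sphere_area S2 = 4 * pi"
  by (simp add: measure_def emeasure_sphere_area_space)

lemma integrable_sphere_area:
  fixes f :: "real^3 \<Rightarrow> real"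
  assumes "f \<in> borel_measurable borel" "\<And>s. s \<in> S2 \<Longrightarrow> \<bar>f s\<bar> \<le> B"
  shows "integrable sphere_area f"
  using assms by (intro sphere_area.integrable_const_bound[where B=B])
    (auto intro!: AE_I2 borel_measurable_sphere_area)

text \<open>\<open>A\<close> commutes with \<open>sgn\<close> and maps the punctured unit ball onto
  itself, so the invariance descends from Lebesgue measure through the cone construction of the
  area.\<close>

lemma sphere_area_orthogonal:
  assumes A: "orthogonal_transformation A" and f: "f \<in> borel_measurable borel"
  shows "(\<integral>\<^sup>+s. f (A s) \<partial>sphere_area) = (\<integral>\<^sup>+s. f s \<partial>sphere_area)"
proof -
  have lin: "linear A" using A by (rule orthogonal_transformation_linear)
  have nrm: "norm (A x) = norm x" for x using A by (rule orthogonal_transformation_norm)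
  have A0: "A x = 0 \<longleftrightarrow> x = 0" for x using nrm[of x] by (metis norm_eq_zero)
  have Am [measurable]: "A \<in> borel_measurable borel"
    using lin by (intro borel_measurable_continuous_onI linear_continuous_on) (simp add: linear_linear)
  have sgnA: "A (sgn x) = sgn (A x)" for x
    by (simp add: sgn_div_norm nrm linear_cmul[OF lin])
  have sg [measurable]: "sgn \<in> borel_measurable (borel :: (real^3) measure)"
    unfolding sgn_div_norm by measurable
  have "(\<integral>\<^sup>+x. f (A (sgn x)) * indicator (cball 0 1 - {0}) x \<partial>lborel) =
      (\<integral>\<^sup>+x. f (sgn (A x)) * indicator (cball 0 1 - {0}) (A x) \<partial>lborel)"
    by (intro nn_integral_cong) (auto simp: sgnA nrm A0 indicator_def)
  also have "\<dots> = (\<integral>\<^sup>+x. f (sgn x) * indicator (cball 0 1 - {0}) x \<partial>lborel)"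
    using f[measurable] by (intro nn_integral_lborel_orthogonal[OF A] borel_measurable_times_ennreal
      borel_measurable_indicator) auto
  finally show ?thesis
    using f by (simp add: nn_integral_sphere_area)
qed

text \<open>Rodrigues' formula for the rotation by the angle \<open>\<phi>\<close> about a unit
  vector \<open>e\<close>. It is algebraic in \<open>e\<close>, \<open>s\<close> and the sine and
  cosine of the angle, hence jointly continuous.\<close>

definition rot :: "real^3 \<Rightarrow> real \<Rightarrow> real^3 \<Rightarrow> real^3" where
  "rot e \<phi> s = cos \<phi> *\<^sub>R s + sin \<phi> *\<^sub>R (e \<times> s) + ((1 - cos \<phi>) * (e \<bullet> s)) *\<^sub>R e"

lemma continuous_on_rot [continuous_intros]:
  fixes e s :: "'a::t2_space \<Rightarrow> real^3"
  assumes "continuous_on S e" "continuous_on S p" "continuous_on S s"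
  shows "continuous_on S (\<lambda>x. rot (e x) (p x) (s x))"
  unfolding rot_def using assms
  by (intro continuous_on_add continuous_on_scaleR continuous_on_mult continuous_on_diff
      continuous_on_cos continuous_on_sin continuous_on_const continuous_on_inner continuous_on_cross)

lemma orthogonal_rot:
  assumes e: "norm e = 1" shows "orthogonal_transformation (rot e \<phi>)"
  unfolding orthogonal_transformation
proof (intro conjI allI)
  show "linear (rot e \<phi>)"
    by (rule linearI) (simp_all add: rot_def cross_add_right cross_mult_right inner_add_right
        scaleR_add_right scaleR_add_left ring_distribs mult_ac)
  fix v
  have ee: "e \<bullet> e = 1" using e by (simp add: dot_square_norm)
  have c: "(e \<times> v) \<bullet> (e \<times> v) = v \<bullet> v - (e \<bullet> v)\<^sup>2"
    using norm_cross_dot[of e v] e by (simp add: dot_square_norm)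
  have cs: "(sin \<phi>)\<^sup>2 = 1 - (cos \<phi>)\<^sup>2" by (simp add: sin_squared_eq)
  have ve: "v \<bullet> e = e \<bullet> v" by (rule inner_commute)
  have "rot e \<phi> v \<bullet> rot e \<phi> v = (cos \<phi>)\<^sup>2 * (v \<bullet> v) + (sin \<phi>)\<^sup>2 * (v \<bullet> v - (e \<bullet> v)\<^sup>2)
      + (1 - cos \<phi>)\<^sup>2 * (e \<bullet> v)\<^sup>2 + 2 * cos \<phi> * (1 - cos \<phi>) * (e \<bullet> v)\<^sup>2"
    unfolding rot_def c[symmetric]
    by (simp add: inner_add_left inner_add_right dot_cross_self ve ee power2_eq_square algebra_simps)
  also have "\<dots> = v \<bullet> v" unfolding cs by (simp add: power2_eq_square algebra_simps)
  finally show "norm (rot e \<phi> v) = norm v" by (simp add: norm_eq_sqrt_inner)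
qed

lemma rot_inner_axis: "norm e = 1 \<Longrightarrow> e \<bullet> rot e \<phi> s = e \<bullet> s"
  by (simp add: rot_def inner_add_right dot_cross_self dot_square_norm algebra_simps)

lemma norm_rot [simp]: "norm e = 1 \<Longrightarrow> norm (rot e \<phi> s) = norm s"
  using orthogonal_rot orthogonal_transformation_norm by blast

text \<open>With countably many angles the sphere splits into level sets on which the map is a fixed
  rotation. A rotation about \<open>e\<close> keeps \<open>e \<bullet> s\<close>, hence maps each
  level set to itself, and invariance under rotations applies piece by piece.\<close>

lemma nn_integral_twist_step:
  fixes \<theta> :: "real \<Rightarrow> real"
  assumes e: "norm e = 1" and f: "f \<in> borel_measurable borel"
    and \<theta>: "\<theta> \<in> borel_measurable borel"
  shows "(\<integral>\<^sup>+s. f (rot e (c \<lfloor>\<theta> (e \<bullet> s)\<rfloor>) s) \<partial>sphere_area) = (\<integral>\<^sup>+s. f s \<partial>sphere_area)"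
proof -
  note f [measurable] \<theta> [measurable]
  have rm [measurable]: "rot e \<phi> \<in> borel_measurable borel" for \<phi>
    by (intro borel_measurable_continuous_onI continuous_on_rot) (auto intro: continuous_intros)
  have ind: "(\<integral>\<^sup>+j. g j * indicator {s. \<lfloor>\<theta> (e \<bullet> s)\<rfloor> = j} s \<partial>count_space UNIV) = g \<lfloor>\<theta> (e \<bullet> s)\<rfloor>"
    for g :: "int \<Rightarrow> ennreal" and s
    by (subst nn_integral_count_space'[where A="{\<lfloor>\<theta> (e \<bullet> s)\<rfloor>}"]) (auto simp: indicator_def)
  have ms [measurable]: "{s. \<lfloor>\<theta> (e \<bullet> s)\<rfloor> = j} \<in> sets borel" for j
  proof -
    have "{s. \<lfloor>\<theta> (e \<bullet> s)\<rfloor> = j} = {s. of_int j \<le> \<theta> (e \<bullet> s) \<and> \<theta> (e \<bullet> s) < of_int j + 1}"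
      by (auto simp: floor_eq_iff)
    also have "\<dots> \<in> sets borel" by measurable
    finally show ?thesis .
  qed
  have "(\<integral>\<^sup>+s. f (rot e (c \<lfloor>\<theta> (e \<bullet> s)\<rfloor>) s) \<partial>sphere_area) =
     (\<integral>\<^sup>+s. \<integral>\<^sup>+j. f (rot e (c j) s) * indicator {s. \<lfloor>\<theta> (e \<bullet> s)\<rfloor> = j} s \<partial>count_space UNIV \<partial>sphere_area)"
    by (rule nn_integral_cong, rule ind[symmetric])
  also have "\<dots> = (\<integral>\<^sup>+j. \<integral>\<^sup>+s. f (rot e (c j) s) * indicator {s. \<lfloor>\<theta> (e \<bullet> s)\<rfloor> = j} s \<partial>sphere_area \<partial>count_space UNIV)"
    using ms by (intro nn_integral_count_space_nn_integral borel_measurable_sphere_area) measurable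
  also have "\<dots> = (\<integral>\<^sup>+j. \<integral>\<^sup>+s. f s * indicator {s. \<lfloor>\<theta> (e \<bullet> s)\<rfloor> = j} s \<partial>sphere_area \<partial>count_space UNIV)"
  proof (rule nn_integral_cong)
    fix j
    have "(\<lambda>s. f s * indicator {s. \<lfloor>\<theta> (e \<bullet> s)\<rfloor> = j} s) \<in> borel_measurable borel"
      using ms by measurable
    from sphere_area_orthogonal[OF orthogonal_rot[OF e, of "c j"] this]
    show "(\<integral>\<^sup>+s. f (rot e (c j) s) * indicator {s. \<lfloor>\<theta> (e \<bullet> s)\<rfloor> = j} s \<partial>sphere_area) =
        (\<integral>\<^sup>+s. f s * indicator {s. \<lfloor>\<theta> (e \<bullet> s)\<rfloor> = j} s \<partial>sphere_area)"
      by (simp add: rot_inner_axis[OF e] indicator_def)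
  qed
  also have "\<dots> = (\<integral>\<^sup>+s. \<integral>\<^sup>+j. f s * indicator {s. \<lfloor>\<theta> (e \<bullet> s)\<rfloor> = j} s \<partial>count_space UNIV \<partial>sphere_area)"
    using ms by (intro nn_integral_count_space_nn_integral[symmetric] borel_measurable_sphere_area) measurable
  also have "\<dots> = (\<integral>\<^sup>+s. f s \<partial>sphere_area)"
    by (rule nn_integral_cong, rule ind)
  finally show ?thesis .
qed

text \<open>A continuous angle is the limit of angles rounded down to multiples of
  \<open>1 / real (Suc k)\<close>. The rounded twists leave the area measure unchanged, and bounded
  convergence passes this to the limit.\<close>

lemma integral_twist:
  fixes f :: "real^3 \<Rightarrow> real"
  assumes e: "norm e = 1" and f: "continuous_on UNIV f" and B: "\<And>s. \<bar>f s\<bar> \<le> B"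
    and \<theta>: "continuous_on UNIV \<theta>"
  shows "(\<integral>s. f (rot e (\<theta> (e \<bullet> s)) s) \<partial>sphere_area) = (\<integral>s. f s \<partial>sphere_area)"
proof -
  have fm [measurable]: "f \<in> borel_measurable borel"
    using f by (rule borel_measurable_continuous_onI)
  have \<theta>m [measurable]: "\<theta> \<in> borel_measurable borel"
    using \<theta> by (rule borel_measurable_continuous_onI)
  define T where "T k s = rot e (real_of_int \<lfloor>real (Suc k) * \<theta> (e \<bullet> s)\<rfloor> / real (Suc k)) s" for k s
  have rm: "continuous_on UNIV (\<lambda>p::real \<times> (real^3). rot e (fst p) (snd p))"
    by (intro continuous_on_rot continuous_intros)
  have Tm [measurable]: "T k \<in> borel_measurable borel" for k
    unfolding T_def by (rule borel_measurable_continuous_Pair[OF _ _ rm]) measurable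
  have Tm2: "T k \<in> measurable sphere_area borel" for k
    by (rule borel_measurable_sphere_area) simp
  have idm: "(\<lambda>x. x) \<in> measurable sphere_area borel"
    by (rule borel_measurable_sphere_area) simp
  have eq: "distr sphere_area borel (T k) = distr sphere_area borel (\<lambda>x. x)" for k
  proof (rule measure_eqI)
    fix A assume "A \<in> sets (distr sphere_area borel (T k))"
    then have A: "A \<in> sets borel" by simp
    have "emeasure (distr sphere_area borel (T k)) A = (\<integral>\<^sup>+x. indicator A x \<partial>distr sphere_area borel (T k))"
      using A by simp
    also have "\<dots> = (\<integral>\<^sup>+s. indicator A (T k s) \<partial>sphere_area)"
      using A Tm2 by (intro nn_integral_distr) auto
    also have "\<dots> = (\<integral>\<^sup>+s. indicator A s \<partial>sphere_area)"
      unfolding T_def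
      by (rule nn_integral_twist_step[OF e, where c="\<lambda>j. real_of_int j / real (Suc k)" and f="indicator A"
            and \<theta>="\<lambda>z. real (Suc k) * \<theta> z"]) (use A in auto)
    also have "\<dots> = (\<integral>\<^sup>+x. indicator A x \<partial>distr sphere_area borel (\<lambda>x. x))"
      using A idm by (intro nn_integral_distr[symmetric]) auto
    also have "\<dots> = emeasure (distr sphere_area borel (\<lambda>x. x)) A"
      using A by simp
    finally show "emeasure (distr sphere_area borel (T k)) A = emeasure (distr sphere_area borel (\<lambda>x. x)) A" .
  qed simp
  have I: "(\<integral>s. f (T k s) \<partial>sphere_area) = (\<integral>s. f s \<partial>sphere_area)" for k
  proof -
    have "(\<integral>s. f (T k s) \<partial>sphere_area) = (\<integral>x. f x \<partial>distr sphere_area borel (T k))"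
      using Tm2 by (intro integral_distr[symmetric]) auto
    also have "\<dots> = (\<integral>s. f s \<partial>sphere_area)"
      unfolding eq using idm by (intro integral_distr) auto
    finally show ?thesis .
  qed
  have lim: "(\<lambda>k. T k s) \<longlonglongrightarrow> rot e (\<theta> (e \<bullet> s)) s" for s
  proof -
    let ?z = "\<theta> (e \<bullet> s)"
    have l0: "(\<lambda>k. real_of_int \<lfloor>real (Suc k) * ?z\<rfloor> / real (Suc k)) \<longlonglongrightarrow> ?z"
    proof (rule tendsto_sandwich)
      show "\<forall>\<^sub>F k in sequentially. ?z - 1 / real (Suc k) \<le> real_of_int \<lfloor>real (Suc k) * ?z\<rfloor> / real (Suc k)"
      proof (intro always_eventually allI)
        fix k
        have "real (Suc k) * ?z - 1 \<le> real_of_int \<lfloor>real (Suc k) * ?z\<rfloor>" by linarith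
        then have "(real (Suc k) * ?z - 1) / real (Suc k) \<le> real_of_int \<lfloor>real (Suc k) * ?z\<rfloor> / real (Suc k)"
          by (intro divide_right_mono) auto
        then show "?z - 1 / real (Suc k) \<le> real_of_int \<lfloor>real (Suc k) * ?z\<rfloor> / real (Suc k)"
          by (simp add: diff_divide_distrib)
      qed
      show "\<forall>\<^sub>F k in sequentially. real_of_int \<lfloor>real (Suc k) * ?z\<rfloor> / real (Suc k) \<le> ?z"
      proof (intro always_eventually allI)
        fix k
        have "real_of_int \<lfloor>real (Suc k) * ?z\<rfloor> \<le> real (Suc k) * ?z" by linarith
        then show "real_of_int \<lfloor>real (Suc k) * ?z\<rfloor> / real (Suc k) \<le> ?z"
          by (simp add: divide_le_eq mult.commute)
      qed
      show "(\<lambda>k. ?z - 1 / real (Suc k)) \<longlonglongrightarrow> ?z"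
        using tendsto_diff[OF tendsto_const[of ?z] LIMSEQ_inverse_real_of_nat] by (simp add: inverse_eq_divide)
    qed simp
    have "continuous_on UNIV (\<lambda>z. rot e z s)"
      by (intro continuous_on_rot continuous_intros)
    from continuous_on_tendsto_compose[OF this l0] show ?thesis
      unfolding T_def by simp
  qed
  have "(\<lambda>k. \<integral>s. f (T k s) \<partial>sphere_area) \<longlonglongrightarrow> (\<integral>s. f (rot e (\<theta> (e \<bullet> s)) s) \<partial>sphere_area)"
  proof (rule integral_dominated_convergence[where w="\<lambda>_. B"])
    show "(\<lambda>s. f (rot e (\<theta> (e \<bullet> s)) s)) \<in> borel_measurable sphere_area"
      by (intro borel_measurable_sphere_area measurable_compose[OF _ fm]
          borel_measurable_continuous_Pair[OF _ _ rm]) measurable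
    show "(\<lambda>s. f (T k s)) \<in> borel_measurable sphere_area" for k
      by (intro borel_measurable_sphere_area) measurable
    show "AE s in sphere_area. (\<lambda>k. f (T k s)) \<longlonglongrightarrow> f (rot e (\<theta> (e \<bullet> s)) s)"
      using continuous_on_tendsto_compose[OF f lim] by auto
  qed (use B in auto)
  then show ?thesis
    unfolding I by (rule LIMSEQ_unique[OF _ tendsto_const])
qed

section \<open>Areas of caps and negative powers near the antipode\<close>

lemma orthogonal_axis_exists:
  fixes a b :: "real^3"
  assumes "norm a = norm b"
  obtains A where "orthogonal_transformation A" "A a = b"
  using rotation_exists[of a b] assms by auto

text \<open>After a rotation the axis is the third coordinate vector, and the cone over the cap
  around \<open>- e\<close> lies in a box with half-sides \<open>sqrt (2 * \<delta>)\<close>,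
  \<open>sqrt (2 * \<delta>)\<close> and 1. The box has volume \<open>16 * \<delta>\<close>, which
  the factor 3 in the definition of area turns into \<open>48 * \<delta>\<close>.\<close>

lemma emeasure_cap_le:
  assumes e: "norm e = 1" and d: "\<delta> > 0"
  shows "emeasure sphere_area {s\<in>S2. 1 + e \<bullet> s < \<delta>} \<le> ennreal (48 * \<delta>)"
proof -
  have "norm e = norm (axis 3 1 :: real^3)" using e by simp
  then obtain A where A: "orthogonal_transformation A" and Ae: "A e = (axis 3 1 :: real^3)"
    by (rule orthogonal_axis_exists)
  let ?f = "\<lambda>s::real^3. indicator {s. 1 + axis 3 1 \<bullet> s < \<delta>} s :: ennreal"
  have fm: "?f \<in> borel_measurable borel" by measurable
  have m1: "{s\<in>S2. 1 + e \<bullet> s < \<delta>} \<in> sets sphere_area"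
  proof -
    have "{s. 1 + e \<bullet> s < \<delta>} \<in> sets borel" by measurable
    then show ?thesis by (auto simp: sets_sphere_area sets_restrict_space)
  qed
  let ?r = "sqrt (2 * \<delta>)"
  let ?l = "(\<chi> i. if i = 3 then -1 else - ?r) :: real^3" and ?u = "(\<chi> i. if i = 3 then 1 else ?r) :: real^3"
  have box: "x \<in> cbox ?l ?u" if x: "norm x \<le> 1" "x \<noteq> 0" and c: "1 + axis 3 1 \<bullet> sgn x < \<delta>" for x :: "real^3"
  proof -
    have nx: "(norm x)\<^sup>2 = (x $ 1)\<^sup>2 + (x $ 2)\<^sup>2 + (x $ 3)\<^sup>2"
      unfolding power2_norm_eq_inner by (simp add: inner_vec_def sum_3 power2_eq_square)
    have n1: "(norm x)\<^sup>2 \<le> 1" using x by (simp add: power_le_one)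
    have n0: "norm x > 0" using x by simp
    have "1 + x $ 3 / norm x < \<delta>"
      using c by (simp add: sgn_div_norm inner_axis' divide_inverse mult.commute)
    then have c3: "x $ 3 < - ((1 - \<delta>) * norm x)" using n0 by (simp add: field_simps)
    \<comment> \<open>A vector of the cone satisfies
      \<open>(1 - \<delta>) * norm x < - x $ 3\<close>, and for \<open>\<delta> \<le> 1\<close> this
      may be squared. For larger \<open>\<delta>\<close> the unit ball alone gives the
      bound.\<close>
    have s12: "(x $ 1)\<^sup>2 + (x $ 2)\<^sup>2 \<le> 2 * \<delta>"
    proof (cases "\<delta> \<le> 1")
      case True
      have "((1 - \<delta>) * norm x)\<^sup>2 \<le> (x $ 3)\<^sup>2"
        using c3 True n0 power_mono[of "(1 - \<delta>) * norm x" "- x $ 3" 2] by simp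
      moreover have "((1 - \<delta>) * norm x)\<^sup>2 = (norm x)\<^sup>2 - (2 * \<delta> - \<delta>\<^sup>2) * (norm x)\<^sup>2"
        by (simp add: power2_eq_square algebra_simps)
      ultimately have "(x $ 1)\<^sup>2 + (x $ 2)\<^sup>2 \<le> (2 * \<delta> - \<delta>\<^sup>2) * (norm x)\<^sup>2"
        using nx by simp
      also have "\<dots> \<le> (2 * \<delta> - \<delta>\<^sup>2) * 1"
        using n1 True d by (intro mult_left_mono) (auto simp: power2_eq_square)
      also have "\<dots> \<le> 2 * \<delta>" by simp
      finally show ?thesis .
    next
      case False
      have "0 \<le> (x $ 3)\<^sup>2" by simp
      then have "(x $ 1)\<^sup>2 + (x $ 2)\<^sup>2 \<le> 1" using nx n1 by linarith
      then show ?thesis using False by linarith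
    qed
    have s3: "(x $ 3)\<^sup>2 \<le> 1" using nx n1 zero_le_power2[of "x $ 1"] zero_le_power2[of "x $ 2"] by linarith
    have b12: "\<bar>x $ 1\<bar> \<le> ?r" "\<bar>x $ 2\<bar> \<le> ?r"
      using s12 zero_le_power2[of "x $ 1"] zero_le_power2[of "x $ 2"]
      by (intro real_le_rsqrt; unfold power2_abs; linarith)+
    have b3: "\<bar>x $ 3\<bar> \<le> 1" using s3 by (simp add: abs_square_le_1)
    show ?thesis
      using b12 b3 unfolding mem_box_cart by (simp add: forall_3 abs_le_iff)
  qed
  have "emeasure sphere_area {s\<in>S2. 1 + e \<bullet> s < \<delta>} = (\<integral>\<^sup>+s. indicator {s\<in>S2. 1 + e \<bullet> s < \<delta>} s \<partial>sphere_area)"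
    using m1 by simp
  also have "\<dots> = (\<integral>\<^sup>+s. ?f (A s) \<partial>sphere_area)"
  proof (rule nn_integral_cong)
    fix s :: "real^3" assume "s \<in> space sphere_area"
    moreover have "axis 3 1 \<bullet> A s = e \<bullet> s"
      using A unfolding Ae[symmetric] by (simp add: orthogonal_transformation_def)
    ultimately show "indicator {s\<in>S2. 1 + e \<bullet> s < \<delta>} s = ?f (A s)" by (simp add: indicator_def)
  qed
  also have "\<dots> = 3 * (\<integral>\<^sup>+x. ?f (sgn x) * indicator (cball 0 1 - {0}) x \<partial>lborel)"
    by (simp only: sphere_area_orthogonal[OF A fm] nn_integral_sphere_area[OF fm])
  also have "\<dots> \<le> 3 * (\<integral>\<^sup>+x. indicator (cbox ?l ?u) x \<partial>lborel)"
    using box by (intro mult_left_mono nn_integral_mono) (auto simp: indicator_def)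
  also have "(\<integral>\<^sup>+x. indicator (cbox ?l ?u) x \<partial>lborel) = emeasure lborel (cbox ?l ?u)"
    by simp
  also have "\<dots> = ennreal (measure lborel (cbox ?l ?u))"
    using emeasure_lborel_cbox_finite[of ?l ?u] by (intro emeasure_eq_ennreal_measure) auto
  also have "measure lborel (cbox ?l ?u) = 16 * \<delta>"
  proof -
    have "cbox ?l ?u \<noteq> {}" using d unfolding interval_ne_empty_cart by (simp add: forall_3)
    then have "measure lborel (cbox ?l ?u) = (\<Prod>i\<in>UNIV. ?u $ i - ?l $ i)"
      by (rule content_cbox_cart)
    also have "\<dots> = 8 * (?r)\<^sup>2" unfolding UNIV_3 by (simp add: power2_eq_square)
    also have "(?r)\<^sup>2 = 2 * \<delta>" using d by simp
    finally show ?thesis by simp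
  qed
  also have "3 * ennreal (16 * \<delta>) = ennreal (48 * \<delta>)"
    by (subst ennreal_numeral[symmetric], subst ennreal_mult[symmetric]) (use d in auto)
  finally show ?thesis .
qed


lemma one_plus_inner_bounds:
  fixes a b :: "'a::real_inner"
  assumes "norm a = 1" "norm b = 1"
  shows "0 \<le> 1 + a \<bullet> b" "1 + a \<bullet> b \<le> 2"
  using Cauchy_Schwarz_ineq2[of a b] assms by (auto simp: abs_le_iff)

lemma cap_sets: "{s\<in>S2. 1 + e \<bullet> s < \<delta>} \<in> sets sphere_area"
proof -
  have "{s. 1 + e \<bullet> s < \<delta>} \<in> sets borel" by measurable
  then show ?thesis by (auto simp: sets_sphere_area sets_restrict_space)
qed

text \<open>A layer-cake bound: if \<open>w\<close> lies in the dyadic interval that ends at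
  \<open>2 powr (- real n)\<close>, the term with index \<open>n\<close> already dominates. The
  threshold is doubled so that the strict inequality used for caps holds also at the right end. The
  summand 1 covers \<open>w \<ge> 1\<close>; at \<open>w = 0\<close> the power is 0.\<close>

lemma powr_neg_le_dyadic:
  fixes w \<gamma> :: real
  assumes "w \<ge> 0" "0 < \<gamma>"
  shows "ennreal (w powr (-\<gamma>)) \<le>
     1 + (\<Sum>k. ennreal (2 powr (\<gamma> * (real k + 1))) * (if w < 2 * 2 powr (- real k) then 1 else 0))"
proof (cases "0 < w \<and> w < 1")
  case True
  define n where "n = nat \<lfloor>- log 2 w\<rfloor>"
  have l: "0 \<le> - log 2 w" using True by simp
  then have n: "real n \<le> - log 2 w" "- log 2 w < real n + 1"
    unfolding n_def by linarith+
  have w: "w = 2 powr (log 2 w)" using True by simp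
  have "w \<le> 2 powr (- real n)" using n by (subst w, intro powr_mono) auto
  also have "\<dots> < 2 * 2 powr (- real n)" by simp
  finally have a: "w < 2 * 2 powr (- real n)" .
  have "w powr (-\<gamma>) = 2 powr (\<gamma> * (- log 2 w))"
    by (subst w) (simp add: powr_powr mult.commute)
  also have "\<dots> \<le> 2 powr (\<gamma> * (real n + 1))"
    using n assms by (intro powr_mono mult_left_mono) auto
  finally have "ennreal (w powr (-\<gamma>)) \<le> ennreal (2 powr (\<gamma> * (real n + 1)))
      * (if w < 2 * 2 powr (- real n) then 1 else 0)"
    using a by (simp add: ennreal_leI)
  also have "\<dots> \<le> (\<Sum>k. ennreal (2 powr (\<gamma> * (real k + 1))) * (if w < 2 * 2 powr (- real k) then 1 else 0))"
    using sum_le_suminf[of "\<lambda>k. ennreal (2 powr (\<gamma> * (real k + 1))) * (if w < 2 * 2 powr (- real k) then 1 else 0)" "{n}"]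
    by simp
  also have "\<dots> \<le> 1 + \<dots>" by simp
  finally show ?thesis .
next
  case False
  have "w powr (-\<gamma>) \<le> 1"
  proof (cases "w = 0")
    case False
    with \<open>\<not> (0 < w \<and> w < 1)\<close> assms have "1 \<le> w" by auto
    then have "w powr (-\<gamma>) \<le> w powr 0" using assms by (intro powr_mono) auto
    then show ?thesis using \<open>1 \<le> w\<close> by simp
  qed simp
  then have "ennreal (w powr (-\<gamma>)) \<le> 1" by simp
  then show ?thesis by (simp add: add_increasing2)
qed

text \<open>The cap of height \<open>2 * 2 powr (- real k)\<close> has area of order
  \<open>2 powr (- real k)\<close>, so the dyadic bound sums to a geometric series of ratio
  \<open>2 powr (\<gamma> - 1)\<close>. The bound on caps does not depend on the axis, whence the
  uniformity in \<open>e\<close>. For nonpositive \<open>\<gamma>\<close> the integrand is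
  bounded.\<close>

lemma nn_integral_cap_powr:
  assumes "\<gamma> < 1"
  shows "\<exists>C\<ge>0. \<forall>e. norm e = 1 \<longrightarrow> (\<integral>\<^sup>+s. ennreal ((1 + e \<bullet> s) powr (-\<gamma>)) \<partial>sphere_area) \<le> ennreal C"
proof (cases "\<gamma> \<le> 0")
  case True
  show ?thesis
  proof (intro exI[of _ "2 powr (-\<gamma>) * (4 * pi)"] conjI allI impI)
    fix e :: "real^3" assume e: "norm e = 1"
    have "(\<integral>\<^sup>+s. ennreal ((1 + e \<bullet> s) powr (-\<gamma>)) \<partial>sphere_area) \<le> (\<integral>\<^sup>+s. ennreal (2 powr (-\<gamma>)) \<partial>sphere_area)"
      using True one_plus_inner_bounds[OF e]
      by (intro nn_integral_mono ennreal_leI powr_mono2) auto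
    also have "\<dots> = ennreal (2 powr (-\<gamma>) * (4 * pi))"
      by (simp add: emeasure_sphere_area_space ennreal_mult)
    finally show "(\<integral>\<^sup>+s. ennreal ((1 + e \<bullet> s) powr (-\<gamma>)) \<partial>sphere_area) \<le> ennreal (2 powr (-\<gamma>) * (4 * pi))" .
  qed simp
next
  case False
  then have g: "0 < \<gamma>" by simp
  let ?a = "\<lambda>k. 2 powr (\<gamma> * (real k + 1)) * (48 * (2 * 2 powr (- real k)))"
  have ae: "?a k = (2 powr \<gamma> * 96) * (2 powr (\<gamma> - 1)) ^ k" for k
  proof -
    have "2 powr (\<gamma> * (real k + 1)) * 2 powr (- real k) = 2 powr \<gamma> * 2 powr ((\<gamma> - 1) * real k)"
      unfolding powr_add[symmetric] by (simp add: algebra_simps)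
    also have "2 powr ((\<gamma> - 1) * real k) = (2 powr (\<gamma> - 1)) ^ k"
      by (simp add: powr_powr[symmetric] powr_realpow)
    finally show ?thesis by (simp add: mult_ac)
  qed
  have "2 powr (\<gamma> - 1) < 2 powr 0" using assms by (intro powr_less_mono) auto
  then have "summable ?a" unfolding ae by (intro summable_mult summable_geometric) simp
  then have sm: "?a sums (suminf ?a)" by (rule summable_sums)
  show ?thesis
  proof (intro exI[of _ "4 * pi + suminf ?a"] conjI allI impI)
    show "0 \<le> 4 * pi + suminf ?a"
      using \<open>summable ?a\<close> by (intro add_nonneg_nonneg suminf_nonneg) auto
    fix e :: "real^3" assume e: "norm e = 1"
    let ?c = "\<lambda>k. {s\<in>S2. 1 + e \<bullet> s < 2 * 2 powr (- real k)}"
    have "(\<integral>\<^sup>+s. ennreal ((1 + e \<bullet> s) powr (-\<gamma>)) \<partial>sphere_area) \<le>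
       (\<integral>\<^sup>+s. 1 + (\<Sum>k. ennreal (2 powr (\<gamma> * (real k + 1))) * indicator (?c k) s) \<partial>sphere_area)"
    proof (intro nn_integral_mono)
      fix s :: "real^3" assume "s \<in> space sphere_area"
      then have s: "norm s = 1" by simp
      show "ennreal ((1 + e \<bullet> s) powr (-\<gamma>)) \<le> 1 + (\<Sum>k. ennreal (2 powr (\<gamma> * (real k + 1))) * indicator (?c k) s)"
        using powr_neg_le_dyadic[OF one_plus_inner_bounds(1)[OF e s] g] s
        by (simp add: indicator_def of_bool_def)
    qed
    also have "\<dots> = ennreal (4 * pi) + (\<Sum>k. ennreal (2 powr (\<gamma> * (real k + 1))) * emeasure sphere_area (?c k))"
      using cap_sets by (subst nn_integral_add)
        (auto simp: nn_integral_suminf nn_integral_cmult emeasure_sphere_area_space)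
    also have "\<dots> \<le> ennreal (4 * pi) + (\<Sum>k. ennreal (?a k))"
    proof (intro add_left_mono suminf_le)
      fix k
      show "ennreal (2 powr (\<gamma> * (real k + 1))) * emeasure sphere_area (?c k) \<le> ennreal (?a k)"
        using emeasure_cap_le[OF e, of "2 * 2 powr (- real k)"]
        by (subst ennreal_mult) (auto intro!: mult_left_mono)
    qed auto
    also have "\<dots> = ennreal (4 * pi + suminf ?a)"
      using \<open>summable ?a\<close> by (subst suminf_ennreal_eq[OF _ sm]) (auto simp: suminf_nonneg ennreal_plus)
    finally show "(\<integral>\<^sup>+s. ennreal ((1 + e \<bullet> s) powr (-\<gamma>)) \<partial>sphere_area) \<le> ennreal (4 * pi + suminf ?a)" .
  qed
qed

section \<open>Mass and overlap of the kernel\<close>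

lemma spin_kernel_measurable_left [measurable]: "(\<lambda>s. spin_kernel \<beta> l s) \<in> borel_measurable borel"
  and spin_kernel_measurable_right [measurable]: "(\<lambda>s. spin_kernel \<beta> s l) \<in> borel_measurable borel"
  unfolding spin_kernel_def by measurable

lemma spin_kernel_commute: "spin_kernel \<beta> s l = spin_kernel \<beta> l s"
  by (simp add: spin_kernel_def inner_commute)

lemma spin_kernel_nonneg: "\<beta> > 0 \<Longrightarrow> 0 \<le> spin_kernel \<beta> s l"
  by (simp add: spin_kernel_def)

lemma spin_kernel_le:
  assumes "\<beta> > 0" "norm s = 1" "norm l = 1"
  shows "spin_kernel \<beta> s l \<le> (1 + 2 * \<beta>) / (4 * pi)"
proof -
  have "((1 + s \<bullet> l) / 2) powr (2 * \<beta>) \<le> 1 powr (2 * \<beta>)"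
    using one_plus_inner_bounds[OF assms(2,3)] assms(1) by (intro powr_mono2) auto
  then have "(1 + 2 * \<beta>) / (4 * pi) * ((1 + s \<bullet> l) / 2) powr (2 * \<beta>) \<le> (1 + 2 * \<beta>) / (4 * pi) * 1"
    using assms(1) by (intro mult_left_mono) auto
  then show ?thesis unfolding spin_kernel_def by simp
qed

text \<open>The normalisation in \<open>spin_kernel\<close> makes this 1. It is carried as a symbol
  that is positive and independent of the axis, and it cancels in the ratios of block
  integrals.\<close>

definition kernel_mass :: "real \<Rightarrow> real" where
  "kernel_mass \<beta> = (\<integral>s. spin_kernel \<beta> (axis 3 1) s \<partial>sphere_area)"

lemma integrable_spin_kernel:
  assumes "\<beta> > 0" "norm l = 1"
  shows "integrable sphere_area (spin_kernel \<beta> l)"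
  using spin_kernel_le[OF assms(1,2)] spin_kernel_nonneg[OF assms(1)]
  by (intro integrable_sphere_area[where B="(1 + 2 * \<beta>) / (4 * pi)"]) auto

lemma integral_spin_kernel:
  assumes b: "\<beta> > 0" and l: "norm l = 1"
  shows "(\<integral>s. spin_kernel \<beta> l s \<partial>sphere_area) = kernel_mass \<beta>"
proof -
  have "norm l = norm (axis 3 1 :: real^3)" using l by simp
  then obtain A where A: "orthogonal_transformation A" and Ae: "A l = (axis 3 1 :: real^3)"
    by (rule orthogonal_axis_exists)
  have "(\<integral>\<^sup>+s. ennreal (spin_kernel \<beta> (axis 3 1) s) \<partial>sphere_area) =
      (\<integral>\<^sup>+s. ennreal (spin_kernel \<beta> (axis 3 1) (A s)) \<partial>sphere_area)"
    by (rule sphere_area_orthogonal[OF A, symmetric]) measurable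
  also have "\<dots> = (\<integral>\<^sup>+s. ennreal (spin_kernel \<beta> l s) \<partial>sphere_area)"
    using A by (simp add: spin_kernel_def Ae[symmetric] orthogonal_transformation_def)
  finally show ?thesis
    unfolding kernel_mass_def using spin_kernel_nonneg[OF b]
    by (simp add: integral_eq_nn_integral borel_measurable_sphere_area)
qed

text \<open>The value of the kernel where \<open>1 + s \<bullet> \<sigma> = 1 / 16\<close>. There
  the bound \<open>48 * \<delta>\<close> for the area of the excluded cap is 3, and two such caps
  leave at least \<open>2 * pi\<close> of the sphere, since \<open>pi > 3\<close>.\<close>

definition kernel_floor :: "real \<Rightarrow> real" where
  "kernel_floor \<beta> = (1 + 2 * \<beta>) / (4 * pi) * (1 / 32) powr (2 * \<beta>)"

lemma kernel_floor_pos: "\<beta> > 0 \<Longrightarrow> kernel_floor \<beta> > 0"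
  by (simp add: kernel_floor_def)

text \<open>The two caps that are cut off have total area less than half the sphere.\<close>

lemma spin_kernel_overlap:
  assumes b: "\<beta> > 0" and "norm l = 1" "norm l' = 1"
  shows "2 * pi * kernel_floor \<beta> \<le> (\<integral>s. min (spin_kernel \<beta> l s) (spin_kernel \<beta> l' s) \<partial>sphere_area)"
proof -
  let ?c = "\<lambda>e. {s\<in>S2. 1 + e \<bullet> s < 1 / 16}"
  let ?G = "S2 - (?c l \<union> ?c l')"
  have cap: "measure sphere_area (?c e) \<le> 3" if "norm e = 1" for e
  proof -
    have "ennreal (measure sphere_area (?c e)) \<le> ennreal (48 * (1/16))"
      using emeasure_cap_le[OF that, of "1/16"] sphere_area.emeasure_eq_measure by simp
    then show ?thesis by (subst (asm) ennreal_le_iff) auto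
  qed
  have G: "?G \<in> sets sphere_area" using cap_sets sets.top[of sphere_area] unfolding space_sphere_area by (intro sets.Diff sets.Un)
  have "measure sphere_area ?G = 4 * pi - measure sphere_area (?c l \<union> ?c l')"
    using cap_sets[of l "1/16"] cap_sets[of l' "1/16"] sphere_area.finite_measure_compl[of "?c l \<union> ?c l'"]
    by (simp add: measure_sphere_area_S2)
  moreover have "measure sphere_area (?c l \<union> ?c l') \<le> 3 + 3"
    using measure_Un_le[OF cap_sets[of l "1/16"] cap_sets[of l' "1/16"]]
      cap[of l] cap[of l'] assms by linarith
  ultimately have mG: "2 * pi \<le> measure sphere_area ?G"
    using pi_gt3 by linarith
  have "2 * pi * kernel_floor \<beta> \<le> kernel_floor \<beta> * measure sphere_area ?G"
    using mG kernel_floor_pos[OF b] by simp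
  also have "\<dots> = (\<integral>s. kernel_floor \<beta> * indicator ?G s \<partial>sphere_area)"
  proof -
    have "?G \<inter> space sphere_area = ?G" by auto
    then show ?thesis by (simp only: integral_mult_right_zero Bochner_Integration.integral_indicator)
  qed
  also have "\<dots> \<le> (\<integral>s. min (spin_kernel \<beta> l s) (spin_kernel \<beta> l' s) \<partial>sphere_area)"
  proof (rule integral_mono)
    show "integrable sphere_area (\<lambda>s. kernel_floor \<beta> * indicator ?G s)"
    proof (intro integrable_mult_right integrable_real_indicator[OF G])
      show "emeasure sphere_area ?G < \<infinity>"
        unfolding infinity_ennreal_def less_top[symmetric] by (rule sphere_area.emeasure_finite)
    qed
    show "integrable sphere_area (\<lambda>s. min (spin_kernel \<beta> l s) (spin_kernel \<beta> l' s))"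
      using integrable_spin_kernel[OF b] assms by simp
    fix s :: "real^3" assume "s \<in> space sphere_area"
    have fl: "kernel_floor \<beta> \<le> spin_kernel \<beta> e s" if "\<not> 1 + e \<bullet> s < 1 / 16" for e
      unfolding kernel_floor_def spin_kernel_def using b that
      by (intro mult_left_mono powr_mono2) auto
    show "kernel_floor \<beta> * indicator ?G s \<le> min (spin_kernel \<beta> l s) (spin_kernel \<beta> l' s)"
      using fl[of l] fl[of l'] spin_kernel_nonneg[OF b] by (auto simp: indicator_def)
  qed
  finally show ?thesis .
qed

lemma kernel_mass_pos: "\<beta> > 0 \<Longrightarrow> kernel_mass \<beta> > 0"
proof -
  assume b: "\<beta> > 0"
  have "0 < 2 * pi * kernel_floor \<beta>" using kernel_floor_pos[OF b] by simp
  also have "\<dots> \<le> kernel_mass \<beta>"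
    using spin_kernel_overlap[OF b, of "axis 3 1" "axis 3 1"] by (simp add: kernel_mass_def)
  finally show ?thesis .
qed

section \<open>Block marginals of the Gibbs measure\<close>

text \<open>Indicators of closed sets are decreasing limits of the continuous functions
  \<open>max 0 (1 - real k * infdist x C)\<close>, and the closed sets form an intersection-stable
  generator of the Borel sets. All laws below are compared by such test functions.\<close>

lemma finite_measure_eqI_continuous:
  fixes M N :: "'a::metric_space measure"
  assumes "finite_measure M" "finite_measure N" and sM: "sets M = sets borel" and sN: "sets N = sets borel"
    and eq: "\<And>f::'a \<Rightarrow> real. continuous_on UNIV f \<Longrightarrow> (\<And>x. 0 \<le> f x \<and> f x \<le> 1) \<Longrightarrow> (\<integral>x. f x \<partial>M) = (\<integral>x. f x \<partial>N)"
  shows "M = N"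
proof -
  interpret M: finite_measure M by fact
  interpret N: finite_measure N by fact
  have spM: "space M = UNIV" and spN: "space N = UNIV"
    using sets_eq_imp_space_eq[OF sM] sets_eq_imp_space_eq[OF sN] by auto
  have closed_eq: "measure M C = measure N C" if C: "closed C" "C \<noteq> {}" for C
  proof -
    define g where "g k x = max 0 (1 - real k * infdist x C)" for k x
    have g01: "0 \<le> g k x \<and> g k x \<le> 1" for k x
      by (simp add: g_def infdist_nonneg)
    have cont: "continuous_on UNIV (g k)" for k
      unfolding g_def by (intro continuous_intros)
    have lim: "(\<lambda>k. g k x) \<longlonglongrightarrow> indicator C x" for x
    proof (cases "x \<in> C")
      case True
      then show ?thesis by (simp add: g_def)
    next
      case False
      then have "infdist x C > 0"
        using C infdist_nonneg[of x C] in_closed_iff_infdist_zero[of C x] by linarith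
      then obtain K where K: "1 < real K * infdist x C"
        using reals_Archimedean3 by blast
      have "g k x = 0" if "k \<ge> K" for k
      proof -
        have "real K * infdist x C \<le> real k * infdist x C"
          using that infdist_nonneg by (intro mult_right_mono) auto
        then show ?thesis using K by (simp add: g_def)
      qed
      then have "\<forall>\<^sub>F k in sequentially. g k x = indicator C x"
        using False by (auto simp: eventually_sequentially)
      then show ?thesis by (rule tendsto_eventually)
    qed
    have meas: "f \<in> borel_measurable borel \<Longrightarrow> f \<in> borel_measurable M" "f \<in> borel_measurable borel \<Longrightarrow> f \<in> borel_measurable N"
      for f :: "'a \<Rightarrow> real"
      using sM sN measurable_cong_sets by blast+
    have cm: "(indicator C :: 'a \<Rightarrow> real) \<in> borel_measurable borel" using C by simp
    have gm: "g k \<in> borel_measurable borel" for k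
      using cont by (rule borel_measurable_continuous_onI)
    have "(\<lambda>k. \<integral>x. g k x \<partial>M) \<longlonglongrightarrow> (\<integral>x. indicator C x \<partial>M)"
      using lim g01 meas(1)[OF cm] meas(1)[OF gm] by (intro integral_dominated_convergence[where w="\<lambda>_. 1"]) auto
    moreover have "(\<lambda>k. \<integral>x. g k x \<partial>N) \<longlonglongrightarrow> (\<integral>x. indicator C x \<partial>N)"
      using lim g01 meas(2)[OF cm] meas(2)[OF gm] by (intro integral_dominated_convergence[where w="\<lambda>_. 1"]) auto
    moreover have "(\<integral>x. g k x \<partial>M) = (\<integral>x. g k x \<partial>N)" for k
      using eq[OF cont g01] .
    ultimately have "(\<integral>x. indicator C x \<partial>M :: real) = (\<integral>x. indicator C x \<partial>N)"
      using LIMSEQ_unique by auto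
    then show ?thesis by (simp add: spM spN)
  qed
  show ?thesis
  proof (rule measure_eqI_generator_eq[where E="Collect closed" and \<Omega>=UNIV and A="\<lambda>_. UNIV"])
    show "Int_stable (Collect closed :: 'a set set)" by (auto simp: Int_stable_def)
    \<comment> \<open>The empty set is treated apart: \<open>infdist x {} = 0\<close> would make the
      approximating functions constantly 1.\<close>
    show "emeasure M X = emeasure N X" if "X \<in> Collect closed" for X
      using that closed_eq[of X] by (cases "X = {}") (auto simp: M.emeasure_eq_measure N.emeasure_eq_measure)
    show "sets M = sigma_sets UNIV (Collect closed)" "sets N = sigma_sets UNIV (Collect closed)"
      unfolding sM sN by (simp_all add: borel_eq_closed)
    show "emeasure M UNIV \<noteq> \<infinity>" for i :: nat using M.emeasure_finite by simp
  qed auto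
qed

section \<open>Configurations on a finite block\<close>

abbreviation block_space :: "int set \<Rightarrow> (int \<Rightarrow> real^3) measure" where
  "block_space I \<equiv> Pi\<^sub>M I (\<lambda>_. sphere_area)"

interpretation sphere_prod: product_sigma_finite "\<lambda>_::int. sphere_area"
  by (rule product_sigma_finite.intro) (rule sphere_area.sigma_finite_measure_axioms)

lemma space_block: "space (block_space I) = (\<Pi>\<^sub>E i\<in>I. S2)"
  by (simp add: space_PiM)

lemma finite_measure_block: "finite I \<Longrightarrow> finite_measure (block_space I)"
proof (rule finite_measureI)
  assume I: "finite I"
  have "emeasure (block_space I) (\<Pi>\<^sub>E i\<in>I. S2) = (\<Prod>i\<in>I. emeasure sphere_area S2)"
    using I sets.top[of sphere_area] by (intro sphere_prod.emeasure_PiM) auto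
  also have "\<dots> = ennreal ((4 * pi) ^ card I)"
    by (simp add: emeasure_sphere_area_space ennreal_power)
  finally show "emeasure (block_space I) (space (block_space I)) \<noteq> \<infinity>"
    by (simp add: space_block)
qed

text \<open>Block configurations are viewed inside the full Borel space of maps
  \<open>int \<Rightarrow> real^3\<close>, where the continuous test functions live. Off the block
  such a configuration has the constant value \<open>undefined\<close>, so the remaining coordinates
  are measurable as well.\<close>

lemma measurable_block_borel: "(\<lambda>x. x) \<in> block_space I \<rightarrow>\<^sub>M (borel :: (int \<Rightarrow> real^3) measure)"
proof -
  have "(\<lambda>x. x) \<in> block_space I \<rightarrow>\<^sub>M Pi\<^sub>M UNIV (\<lambda>_::int. borel :: (real^3) measure)"
  proof (rule measurable_PiM_single')
    fix i :: int
    show "(\<lambda>x. x i) \<in> borel_measurable (block_space I)"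
    proof (cases "i \<in> I")
      case True
      have "(\<lambda>s. s) \<in> sphere_area \<rightarrow>\<^sub>M (borel :: (real^3) measure)"
        by (rule borel_measurable_sphere_area) simp
      from measurable_compose[OF measurable_component_singleton[OF True] this] show ?thesis by simp
    next
      case False
      have "(\<lambda>x. x i) \<in> borel_measurable (block_space I) \<longleftrightarrow> (\<lambda>x. undefined :: real^3) \<in> borel_measurable (block_space I)"
        using False by (intro measurable_cong) (auto simp: space_block PiE_def extensional_def)
      then show ?thesis by simp
    qed
  qed (auto simp: space_PiM)
  then show ?thesis by (simp add: measurable_cong_sets[OF refl sets_PiM_equal_borel])
qed

lemma borel_measurable_block: "f \<in> borel_measurable borel \<Longrightarrow> f \<in> borel_measurable (block_space I)"
  using measurable_compose[OF measurable_block_borel] .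

lemma measurable_apply_borel: "(\<lambda>x::int \<Rightarrow> real^3. x i) \<in> borel_measurable borel"
  by (intro borel_measurable_continuous_onI) simp

lemma continuous_on_restrict_config: "continuous_on UNIV (\<lambda>x::int \<Rightarrow> real^3. restrict x I)"
proof (rule continuous_on_coordinatewise_then_product)
  fix i show "continuous_on UNIV (\<lambda>x::int \<Rightarrow> real^3. restrict x I i)" by (cases "i \<in> I") auto
qed

lemma integrable_block:
  fixes f :: "(int \<Rightarrow> real^3) \<Rightarrow> real"
  assumes "finite I" "f \<in> borel_measurable borel" "\<And>x. x \<in> (\<Pi>\<^sub>E i\<in>I. S2) \<Longrightarrow> \<bar>f x\<bar> \<le> B"
  shows "integrable (block_space I) f"
proof (rule finite_measure.integrable_const_bound[OF finite_measure_block[OF assms(1)], where B=B])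
  show "AE x in block_space I. norm (f x) \<le> B"
    by (rule AE_I2) (simp only: space_block real_norm_def assms(3))
qed (rule borel_measurable_block[OF assms(2)])

section \<open>Integrating out the end spins of a block\<close>

definition chain_weight :: "real \<Rightarrow> int \<Rightarrow> int \<Rightarrow> (int \<Rightarrow> real^3) \<Rightarrow> real" where
  "chain_weight \<beta> a b s = (\<Prod>k\<in>{a..<b}. spin_kernel \<beta> (s k) (s (k + 1)))"

text \<open>Boundary spins enter only through the weights \<open>u\<close> and \<open>v\<close> of
  the two end spins. This class of integrals is closed under integrating out an end spin, which
  merely changes \<open>u\<close> or \<open>v\<close>.\<close>

definition weighted_block ::
    "real \<Rightarrow> int \<Rightarrow> int \<Rightarrow> (real^3 \<Rightarrow> real) \<Rightarrow> (real^3 \<Rightarrow> real) \<Rightarrow> ((int \<Rightarrow> real^3) \<Rightarrow> real) \<Rightarrow> real" where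
  "weighted_block \<beta> a b u v f =
     (\<integral>s. f s * (u (s a) * v (s b) * chain_weight \<beta> a b s) \<partial>block_space {a..b})"

lemma chain_weight_measurable: "chain_weight \<beta> a b \<in> borel_measurable borel"
proof -
  note [measurable] = measurable_apply_borel
  show ?thesis unfolding chain_weight_def spin_kernel_def by measurable
qed

lemma chain_weight_nonneg: "\<beta> > 0 \<Longrightarrow> 0 \<le> chain_weight \<beta> a b s"
  unfolding chain_weight_def by (intro prod_nonneg) (simp add: spin_kernel_nonneg)

lemma chain_weight_le:
  assumes "\<beta> > 0" "\<And>k. k \<in> {a..b} \<Longrightarrow> norm (s k) = 1"
  shows "chain_weight \<beta> a b s \<le> ((1 + 2 * \<beta>) / (4 * pi)) ^ card {a..<b}"
  unfolding chain_weight_def prod_constant[symmetric] using assms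
  by (intro prod_mono) (auto simp: spin_kernel_nonneg intro!: spin_kernel_le)

text \<open>The Markov operator of the chain, acting on functions on the sphere. Dividing by
  \<open>kernel_mass\<close> makes constants fixed points.\<close>

definition kernel_avg :: "real \<Rightarrow> (real^3 \<Rightarrow> real) \<Rightarrow> real^3 \<Rightarrow> real" where
  "kernel_avg \<beta> u s = (\<integral>y. u y * spin_kernel \<beta> y s \<partial>sphere_area) / kernel_mass \<beta>"

lemma kernel_avg_measurable:
  assumes u: "u \<in> borel_measurable borel" shows "kernel_avg \<beta> u \<in> borel_measurable borel"
proof -
  have [measurable]: "(\<lambda>s. s) \<in> sphere_area \<rightarrow>\<^sub>M (borel :: (real^3) measure)"
    by (rule borel_measurable_sphere_area) simp
  have s: "snd \<in> borel \<Otimes>\<^sub>M sphere_area \<rightarrow>\<^sub>M (borel :: (real^3) measure)"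
    using measurable_compose[OF measurable_snd, of "\<lambda>s. s" sphere_area borel borel] by (simp add: \<open>(\<lambda>s. s) \<in> _\<close>)
  have "(\<lambda>p. u (snd p) * spin_kernel \<beta> (snd p) (fst p)) \<in> borel_measurable (borel \<Otimes>\<^sub>M sphere_area)"
    unfolding spin_kernel_def using s u by measurable
  then have "(\<lambda>s. \<integral>y. u y * spin_kernel \<beta> y s \<partial>sphere_area) \<in> borel_measurable borel"
    by (intro sphere_area.borel_measurable_lebesgue_integral) (simp add: case_prod_unfold)
  then show ?thesis unfolding kernel_avg_def by simp
qed

lemma integrable_times_kernel:
  assumes b: "\<beta> > 0" and u: "u \<in> borel_measurable borel" and U: "\<And>s. s \<in> S2 \<Longrightarrow> \<bar>u s\<bar> \<le> U" and s: "norm s = 1"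
  shows "integrable sphere_area (\<lambda>y. u y * spin_kernel \<beta> y s)"
proof (rule integrable_sphere_area[where B="U * ((1 + 2 * \<beta>) / (4 * pi))"])
  show "\<bar>u y * spin_kernel \<beta> y s\<bar> \<le> U * ((1 + 2 * \<beta>) / (4 * pi))" if "y \<in> S2" for y
    unfolding abs_mult using that U[OF that] spin_kernel_le[OF b, of y s] s spin_kernel_nonneg[OF b, of y s]
    by (intro mult_mono) auto
qed (use u in measurable)

lemma integral_spin_kernel': "\<beta> > 0 \<Longrightarrow> norm l = 1 \<Longrightarrow> (\<integral>s. spin_kernel \<beta> s l \<partial>sphere_area) = kernel_mass \<beta>"
  unfolding spin_kernel_commute[of \<beta> _ l] by (rule integral_spin_kernel)

lemma kernel_avg_bound:
  assumes b: "\<beta> > 0" and u: "u \<in> borel_measurable borel" and U: "\<And>s. s \<in> S2 \<Longrightarrow> \<bar>u s\<bar> \<le> U" and s: "norm s = 1"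
  shows "\<bar>kernel_avg \<beta> u s\<bar> \<le> U"
proof -
  have "\<bar>\<integral>y. u y * spin_kernel \<beta> y s \<partial>sphere_area\<bar> \<le> (\<integral>y. \<bar>u y * spin_kernel \<beta> y s\<bar> \<partial>sphere_area)"
    using integral_norm_bound[of sphere_area "\<lambda>y. u y * spin_kernel \<beta> y s"] by simp
  also have "\<dots> \<le> (\<integral>y. U * spin_kernel \<beta> y s \<partial>sphere_area)"
  proof (rule integral_mono)
    show "integrable sphere_area (\<lambda>y. \<bar>u y * spin_kernel \<beta> y s\<bar>)"
      by (intro integrable_abs integrable_times_kernel[OF b u U s])
    show "integrable sphere_area (\<lambda>y. U * spin_kernel \<beta> y s)"
      by (rule integrable_times_kernel[OF b, of "\<lambda>_. U" "\<bar>U\<bar>" s]) (use s in auto)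
  qed (use U spin_kernel_nonneg[OF b] in \<open>auto simp: abs_mult intro!: mult_right_mono\<close>)
  also have "\<dots> = U * kernel_mass \<beta>" by (simp add: integral_spin_kernel'[OF b s])
  finally show ?thesis using kernel_mass_pos[OF b] unfolding kernel_avg_def by (simp add: divide_le_eq)
qed

text \<open>The kernel is symmetric, so area measure is stationary for the Markov operator: after
  Fubini the inner integral is again \<open>kernel_mass\<close>.\<close>

lemma kernel_avg_integral:
  assumes b: "\<beta> > 0" and u: "u \<in> borel_measurable borel" and U: "\<And>s. s \<in> S2 \<Longrightarrow> \<bar>u s\<bar> \<le> U"
  shows "(\<integral>s. kernel_avg \<beta> u s \<partial>sphere_area) = (\<integral>s. u s \<partial>sphere_area)"
proof -
  interpret P: pair_sigma_finite sphere_area sphere_area by standard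
  have [measurable]: "(\<lambda>s. s) \<in> sphere_area \<rightarrow>\<^sub>M (borel :: (real^3) measure)"
    by (rule borel_measurable_sphere_area) simp
  have fs: "fst \<in> sphere_area \<Otimes>\<^sub>M sphere_area \<rightarrow>\<^sub>M (borel :: (real^3) measure)"
    using measurable_compose[OF measurable_fst, of "\<lambda>s. s" sphere_area borel sphere_area] by (simp add: \<open>(\<lambda>s. s) \<in> _\<close>)
  have sn: "snd \<in> sphere_area \<Otimes>\<^sub>M sphere_area \<rightarrow>\<^sub>M (borel :: (real^3) measure)"
    using measurable_compose[OF measurable_snd, of "\<lambda>s. s" sphere_area borel sphere_area] by (simp add: \<open>(\<lambda>s. s) \<in> _\<close>)
  have m: "(\<lambda>p. u (fst p) * spin_kernel \<beta> (fst p) (snd p)) \<in> borel_measurable (sphere_area \<Otimes>\<^sub>M sphere_area)"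
    unfolding spin_kernel_def using fs sn u by measurable
  interpret F: finite_measure "sphere_area \<Otimes>\<^sub>M sphere_area"
    by (rule finite_measure_pair_measure) (rule finite_measure_sphere_area)+
  have "integrable (sphere_area \<Otimes>\<^sub>M sphere_area) (\<lambda>p. u (fst p) * spin_kernel \<beta> (fst p) (snd p))"
  proof (rule F.integrable_const_bound[where B="U * ((1 + 2 * \<beta>) / (4 * pi))"])
    show "AE p in sphere_area \<Otimes>\<^sub>M sphere_area. norm (u (fst p) * spin_kernel \<beta> (fst p) (snd p)) \<le> U * ((1 + 2 * \<beta>) / (4 * pi))"
    proof (rule AE_I2)
      fix p assume "p \<in> space (sphere_area \<Otimes>\<^sub>M sphere_area)"
      then have p: "norm (fst p) = 1" "norm (snd p) = 1" by (auto simp: space_pair_measure)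
      show "norm (u (fst p) * spin_kernel \<beta> (fst p) (snd p)) \<le> U * ((1 + 2 * \<beta>) / (4 * pi))"
        unfolding real_norm_def abs_mult using p U[of "fst p"] spin_kernel_le[OF b p] spin_kernel_nonneg[OF b, of "fst p" "snd p"]
        by (intro mult_mono) auto
    qed
  qed (rule m)
  from P.Fubini_integral[of "\<lambda>y s. u y * spin_kernel \<beta> y s"] this
  have "(\<integral>s. (\<integral>y. u y * spin_kernel \<beta> y s \<partial>sphere_area) \<partial>sphere_area) =
      (\<integral>y. (\<integral>s. u y * spin_kernel \<beta> y s \<partial>sphere_area) \<partial>sphere_area)"
    by (simp add: case_prod_unfold)
  also have "\<dots> = (\<integral>y. u y * kernel_mass \<beta> \<partial>sphere_area)"
    by (intro Bochner_Integration.integral_cong) (auto simp: integral_spin_kernel[OF b])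
  finally show ?thesis
    using kernel_mass_pos[OF b] unfolding kernel_avg_def by (simp add: integral_divide_zero)
qed

text \<open>One minus the guaranteed overlap of two normalised kernels: an upper bound for the
  Dobrushin coefficient.\<close>

definition kernel_rate :: "real \<Rightarrow> real" where
  "kernel_rate \<beta> = 1 - 2 * pi * kernel_floor \<beta> / kernel_mass \<beta>"

lemma kernel_rate_bounds:
  assumes b: "\<beta> > 0" shows "0 \<le> kernel_rate \<beta>" "kernel_rate \<beta> < 1"
proof -
  have "2 * pi * kernel_floor \<beta> \<le> kernel_mass \<beta>"
    using spin_kernel_overlap[OF b, of "axis 3 1" "axis 3 1"] by (simp add: kernel_mass_def)
  then show "0 \<le> kernel_rate \<beta>" "kernel_rate \<beta> < 1"
    using kernel_mass_pos[OF b] kernel_floor_pos[OF b] by (simp_all add: kernel_rate_def)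
qed

text \<open>Dobrushin's argument: the overlap of two kernels is bounded below.\<close>

lemma kernel_avg_contract:
  assumes b: "\<beta> > 0" and u: "u \<in> borel_measurable borel" and U: "\<And>s. s \<in> S2 \<Longrightarrow> \<bar>u s\<bar> \<le> U"
    and D: "\<And>s s'. s \<in> S2 \<Longrightarrow> s' \<in> S2 \<Longrightarrow> u s - u s' \<le> D"
    and s: "s \<in> S2" and s': "s' \<in> S2"
  shows "kernel_avg \<beta> u s - kernel_avg \<beta> u s' \<le> kernel_rate \<beta> * D"
proof -
  \<comment> \<open>Subtracting the infimum of \<open>u\<close> changes nothing, since both kernels
    have the same mass. Afterwards the factor \<open>u y - m\<close> lies between 0 and
    \<open>D\<close>, and only the part of the kernel above the common minimum counts.\<close>
  define m where "m = Inf (u ` S2)"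
  have ne: "u ` S2 \<noteq> {}" using s by auto
  have "bdd_below (u ` S2)" using U by (intro bdd_belowI[where m="-U"]) (force simp: abs_le_iff)
  then have m: "m \<le> u y" if "y \<in> S2" for y unfolding m_def using that by (intro cInf_lower) auto
  have M: "u y \<le> m + D" if "y \<in> S2" for y
  proof -
    have "u y - D \<le> m" unfolding m_def using D[OF that] by (intro cInf_greatest ne) (force simp: algebra_simps)
    then show ?thesis by simp
  qed
  let ?k = "\<lambda>y. spin_kernel \<beta> y s" and ?k' = "\<lambda>y. spin_kernel \<beta> y s'"
  have ik: "integrable sphere_area ?k" "integrable sphere_area ?k'"
    using integrable_times_kernel[OF b, of "\<lambda>_. 1" 1] s s' by auto
  have iu: "integrable sphere_area (\<lambda>y. u y * ?k y)" "integrable sphere_area (\<lambda>y. u y * ?k' y)"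
    using integrable_times_kernel[OF b u U] s s' by auto
  have "(\<integral>y. u y * ?k y \<partial>sphere_area) - (\<integral>y. u y * ?k' y \<partial>sphere_area) =
      (\<integral>y. u y * ?k y - u y * ?k' y - m * (?k y - ?k' y) \<partial>sphere_area)"
    using iu ik s s' by (simp add: integral_spin_kernel'[OF b])
  also have "\<dots> \<le> (\<integral>y. D * (?k y - min (?k y) (?k' y)) \<partial>sphere_area)"
  proof (rule integral_mono)
    fix y :: "real^3" assume "y \<in> space sphere_area"
    then have y: "y \<in> S2" by simp
    have "u y * ?k y - u y * ?k' y - m * (?k y - ?k' y) = (u y - m) * (?k y - ?k' y)"
      by (simp add: algebra_simps)
    also have "\<dots> \<le> (u y - m) * (?k y - min (?k y) (?k' y))"
      using m[OF y] by (intro mult_left_mono) auto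
    also have "\<dots> \<le> D * (?k y - min (?k y) (?k' y))"
      using M[OF y] by (intro mult_right_mono) auto
    finally show "u y * ?k y - u y * ?k' y - m * (?k y - ?k' y) \<le> D * (?k y - min (?k y) (?k' y))" .
  qed (use iu ik in auto)
  also have "\<dots> = D * (kernel_mass \<beta> - (\<integral>y. min (?k y) (?k' y) \<partial>sphere_area))"
    using ik s by (simp add: integral_spin_kernel'[OF b])
  also have "\<dots> \<le> D * (kernel_mass \<beta> - 2 * pi * kernel_floor \<beta>)"
    using spin_kernel_overlap[OF b, of s s'] s s' D[OF s s]
    by (intro mult_left_mono) (auto simp: spin_kernel_commute)
  also have "\<dots> = kernel_mass \<beta> * (kernel_rate \<beta> * D)"
    using kernel_mass_pos[OF b] by (simp add: kernel_rate_def field_simps)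
  finally show ?thesis
    using kernel_mass_pos[OF b] unfolding kernel_avg_def diff_divide_distrib[symmetric]
    by (simp add: pos_divide_le_eq mult.commute)
qed

lemma kernel_avg_iterate:
  assumes b: "\<beta> > 0" and u: "u \<in> borel_measurable borel" and U: "\<And>s. s \<in> S2 \<Longrightarrow> \<bar>u s\<bar> \<le> U"
  defines "w k \<equiv> (kernel_avg \<beta> ^^ k) u"
  shows "w k \<in> borel_measurable borel" "\<And>s. s \<in> S2 \<Longrightarrow> \<bar>w k s\<bar> \<le> U"
    "(\<integral>s. w k s \<partial>sphere_area) = (\<integral>s. u s \<partial>sphere_area)"
    "\<And>s s'. s \<in> S2 \<Longrightarrow> s' \<in> S2 \<Longrightarrow> w k s - w k s' \<le> kernel_rate \<beta> ^ k * (2 * U)"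
proof -
  have "w k \<in> borel_measurable borel \<and> (\<forall>s\<in>S2. \<bar>w k s\<bar> \<le> U) \<and>
    (\<integral>s. w k s \<partial>sphere_area) = (\<integral>s. u s \<partial>sphere_area) \<and>
    (\<forall>s\<in>S2. \<forall>s'\<in>S2. w k s - w k s' \<le> kernel_rate \<beta> ^ k * (2 * U))"
  proof (induction k)
    case 0
    have "u s - u s' \<le> 2 * U" if "s \<in> S2" "s' \<in> S2" for s s'
      using U[OF that(1)] U[OF that(2)] by (simp add: abs_le_iff)
    then show ?case using u U by (simp add: w_def)
  next
    case (Suc k)
    have S: "w (Suc k) = kernel_avg \<beta> (w k)" by (simp add: w_def)
    have IH: "w k \<in> borel_measurable borel" "\<And>s. s \<in> S2 \<Longrightarrow> \<bar>w k s\<bar> \<le> U"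
      "(\<integral>s. w k s \<partial>sphere_area) = (\<integral>s. u s \<partial>sphere_area)"
      "\<And>s s'. s \<in> S2 \<Longrightarrow> s' \<in> S2 \<Longrightarrow> w k s - w k s' \<le> kernel_rate \<beta> ^ k * (2 * U)"
      using Suc by auto
    show ?case
      unfolding S using kernel_avg_measurable[OF IH(1)] kernel_avg_bound[OF b IH(1,2)]
        kernel_avg_integral[OF b IH(1,2)] IH(3) kernel_avg_contract[OF b IH(1,2) IH(4)]
      by (auto simp: mult.assoc)
  qed
  then show "w k \<in> borel_measurable borel" "\<And>s. s \<in> S2 \<Longrightarrow> \<bar>w k s\<bar> \<le> U"
    "(\<integral>s. w k s \<partial>sphere_area) = (\<integral>s. u s \<partial>sphere_area)"
    "\<And>s s'. s \<in> S2 \<Longrightarrow> s' \<in> S2 \<Longrightarrow> w k s - w k s' \<le> kernel_rate \<beta> ^ k * (2 * U)"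
    by auto
qed

text \<open>The iterates keep the integral while their oscillation decays geometrically. A function
  of small oscillation is close to its mean: integrate the oscillation bound in the second
  point.\<close>

lemma kernel_avg_iterate_mean:
  assumes b: "\<beta> > 0" and u: "u \<in> borel_measurable borel" and U: "\<And>s. s \<in> S2 \<Longrightarrow> \<bar>u s\<bar> \<le> U" and s: "s \<in> S2"
  shows "\<bar>(kernel_avg \<beta> ^^ k) u s - (\<integral>s. u s \<partial>sphere_area) / (4 * pi)\<bar> \<le> kernel_rate \<beta> ^ k * (2 * U)"
proof -
  let ?w = "(kernel_avg \<beta> ^^ k) u" and ?D = "kernel_rate \<beta> ^ k * (2 * U)"
  note w = kernel_avg_iterate[OF b u U, where k=k]
  have i: "integrable sphere_area ?w"
    using w by (intro integrable_sphere_area[where B=U]) auto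
  have "(\<integral>s'. ?w s - ?w s' \<partial>sphere_area) \<le> (\<integral>s'. ?D \<partial>sphere_area)"
    using i w(4) s by (intro integral_mono) auto
  moreover have "(\<integral>s'. ?w s' - ?w s \<partial>sphere_area) \<le> (\<integral>s'. ?D \<partial>sphere_area)"
    using i w(4) s by (intro integral_mono) auto
  ultimately have "\<bar>4 * pi * ?w s - (\<integral>s. u s \<partial>sphere_area)\<bar> \<le> 4 * pi * ?D"
    using i w(3) by (simp add: measure_sphere_area_S2 abs_le_iff)
  then have "\<bar>4 * pi * ?w s - (\<integral>s. u s \<partial>sphere_area)\<bar> / (4 * pi) \<le> ?D"
    by (simp add: pos_divide_le_eq mult.commute)
  moreover have "?w s - (\<integral>s. u s \<partial>sphere_area) / (4 * pi) = (4 * pi * ?w s - (\<integral>s. u s \<partial>sphere_area)) / (4 * pi)"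
    by (simp add: field_simps)
  ultimately show ?thesis by (simp only: abs_divide) simp
qed


lemma weighted_block_integrable:
  assumes b: "\<beta> > 0" and f: "f \<in> borel_measurable borel" and B: "\<And>x. \<bar>f x\<bar> \<le> B"
    and u: "u \<in> borel_measurable borel" "\<And>s. s \<in> S2 \<Longrightarrow> \<bar>u s\<bar> \<le> U"
    and v: "v \<in> borel_measurable borel" "\<And>s. s \<in> S2 \<Longrightarrow> \<bar>v s\<bar> \<le> V"
    and I: "finite I" "{a..b} \<subseteq> I" "a \<le> b"
  shows "integrable (block_space I) (\<lambda>s. f s * (u (s a) * v (s b) * chain_weight \<beta> a b s))"
    and "\<And>s. (\<And>i. i \<in> {a..b} \<Longrightarrow> norm (s i) = 1) \<Longrightarrow>
      \<bar>f s * (u (s a) * v (s b) * chain_weight \<beta> a b s)\<bar> \<le> B * (U * V * ((1 + 2 * \<beta>) / (4 * pi)) ^ card {a..<b})"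
proof -
  show bd: "\<bar>f s * (u (s a) * v (s b) * chain_weight \<beta> a b s)\<bar> \<le> B * (U * V * ((1 + 2 * \<beta>) / (4 * pi)) ^ card {a..<b})"
    if s: "\<And>i. i \<in> {a..b} \<Longrightarrow> norm (s i) = 1" for s
  proof -
    have "\<bar>u (s a)\<bar> \<le> U" "\<bar>v (s b)\<bar> \<le> V" using s[of a] s[of b] u(2) v(2) I by auto
    moreover have "\<bar>chain_weight \<beta> a b s\<bar> \<le> ((1 + 2 * \<beta>) / (4 * pi)) ^ card {a..<b}"
      using chain_weight_le[OF b, of a b s] s chain_weight_nonneg[OF b, of a b s] by simp
    moreover have "0 \<le> B" using B[of s] by linarith
    ultimately show ?thesis
      unfolding abs_mult using B[of s] by (intro mult_mono) (auto intro: order_trans[OF abs_ge_zero])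
  qed
  have [measurable]: "(\<lambda>s. u (s a)) \<in> borel_measurable borel" "(\<lambda>s. v (s b)) \<in> borel_measurable borel"
    by (rule measurable_compose[OF measurable_apply_borel] u v)+
  note [measurable] = chain_weight_measurable f
  show "integrable (block_space I) (\<lambda>s. f s * (u (s a) * v (s b) * chain_weight \<beta> a b s))"
  proof (rule integrable_block[OF I(1)])
    fix x assume "x \<in> I \<rightarrow>\<^sub>E S2"
    then have "norm (x i) = 1" if "i \<in> {a..b}" for i using that I by (auto simp: PiE_def Pi_def)
    then show "\<bar>f x * (u (x a) * v (x b) * chain_weight \<beta> a b x)\<bar> \<le>
        B * (U * V * ((1 + 2 * \<beta>) / (4 * pi)) ^ card {a..<b})" by (rule bd)
  qed measurable
qed

text \<open>Fubini in the outermost spin: neither \<open>f\<close> nor the inner bonds see it, so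
  its integral is the kernel average of \<open>u\<close> at the next site.\<close>

lemma weighted_block_peel_left:
  assumes b: "\<beta> > 0" and f: "f \<in> borel_measurable borel" and B: "\<And>x. \<bar>f x\<bar> \<le> B"
    and dep: "\<And>x y. (\<And>i. i \<in> {a..b} \<Longrightarrow> x i = y i) \<Longrightarrow> f x = f y"
    and u: "u \<in> borel_measurable borel" "\<And>s. s \<in> S2 \<Longrightarrow> \<bar>u s\<bar> \<le> U"
    and v: "v \<in> borel_measurable borel" "\<And>s. s \<in> S2 \<Longrightarrow> \<bar>v s\<bar> \<le> V"
    and ab: "a \<le> b"
  shows "weighted_block \<beta> (a - 1) b u v f = kernel_mass \<beta> * weighted_block \<beta> a b (kernel_avg \<beta> u) v f"
proof -
  let ?F = "\<lambda>s. f s * (u (s (a - 1)) * v (s b) * chain_weight \<beta> (a - 1) b s)"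
  have I: "{a - 1..b} = insert (a - 1) {a..b}" "{a - 1..<b} = insert (a - 1) {a..<b}" using ab by auto
  have int: "integrable (block_space (insert (a - 1) {a..b})) ?F"
    by (rule weighted_block_integrable(1)[OF b f B u v]) (use ab in auto)
  have "weighted_block \<beta> (a - 1) b u v f =
    (\<integral>x. (\<integral>y. ?F (x(a - 1 := y)) \<partial>sphere_area) \<partial>block_space {a..b})"
    unfolding weighted_block_def I(1) by (rule sphere_prod.product_integral_insert[OF _ _ int]) auto
  also have "\<dots> = (\<integral>x. kernel_mass \<beta> * (f x * (kernel_avg \<beta> u (x a) * v (x b) * chain_weight \<beta> a b x)) \<partial>block_space {a..b})"
  proof (rule Bochner_Integration.integral_cong[OF refl])
    fix x :: "int \<Rightarrow> real^3"
    have ch: "chain_weight \<beta> (a - 1) b (x(a - 1 := y)) = spin_kernel \<beta> y (x a) * chain_weight \<beta> a b x" for y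
      unfolding chain_weight_def I(2) by (subst prod.insert) (auto intro!: prod.cong)
    have fx: "f (x(a - 1 := y)) = f x" for y by (rule dep) auto
    have "(\<integral>y. ?F (x(a - 1 := y)) \<partial>sphere_area) =
        (\<integral>y. (f x * v (x b) * chain_weight \<beta> a b x) * (u y * spin_kernel \<beta> y (x a)) \<partial>sphere_area)"
      unfolding ch fx using ab by (simp add: mult_ac)
    also have "\<dots> = (f x * v (x b) * chain_weight \<beta> a b x) * (kernel_mass \<beta> * kernel_avg \<beta> u (x a))"
      using kernel_mass_pos[OF b] by (simp add: kernel_avg_def)
    finally show "(\<integral>y. ?F (x(a - 1 := y)) \<partial>sphere_area) =
        kernel_mass \<beta> * (f x * (kernel_avg \<beta> u (x a) * v (x b) * chain_weight \<beta> a b x))"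
      by (simp add: mult_ac)
  qed
  finally show ?thesis by (simp add: weighted_block_def)
qed

lemma weighted_block_peel_right:
  assumes b: "\<beta> > 0" and f: "f \<in> borel_measurable borel" and B: "\<And>x. \<bar>f x\<bar> \<le> B"
    and dep: "\<And>x y. (\<And>i. i \<in> {a..b} \<Longrightarrow> x i = y i) \<Longrightarrow> f x = f y"
    and u: "u \<in> borel_measurable borel" "\<And>s. s \<in> S2 \<Longrightarrow> \<bar>u s\<bar> \<le> U"
    and v: "v \<in> borel_measurable borel" "\<And>s. s \<in> S2 \<Longrightarrow> \<bar>v s\<bar> \<le> V"
    and ab: "a \<le> b"
  shows "weighted_block \<beta> a (b + 1) u v f = kernel_mass \<beta> * weighted_block \<beta> a b u (kernel_avg \<beta> v) f"
proof -
  let ?F = "\<lambda>s. f s * (u (s a) * v (s (b + 1)) * chain_weight \<beta> a (b + 1) s)"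
  have I: "{a..b + 1} = insert (b + 1) {a..b}" "{a..<b + 1} = insert b {a..<b}" using ab by auto
  have int: "integrable (block_space (insert (b + 1) {a..b})) ?F"
    by (rule weighted_block_integrable(1)[OF b f B u v]) (use ab in auto)
  have "weighted_block \<beta> a (b + 1) u v f =
    (\<integral>x. (\<integral>y. ?F (x(b + 1 := y)) \<partial>sphere_area) \<partial>block_space {a..b})"
    unfolding weighted_block_def I(1) by (rule sphere_prod.product_integral_insert[OF _ _ int]) auto
  also have "\<dots> = (\<integral>x. kernel_mass \<beta> * (f x * (u (x a) * kernel_avg \<beta> v (x b) * chain_weight \<beta> a b x)) \<partial>block_space {a..b})"
  proof (rule Bochner_Integration.integral_cong[OF refl])
    fix x :: "int \<Rightarrow> real^3"
    have ch: "chain_weight \<beta> a (b + 1) (x(b + 1 := y)) = spin_kernel \<beta> y (x b) * chain_weight \<beta> a b x" for y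
      unfolding chain_weight_def I(2) by (subst prod.insert) (auto intro!: prod.cong simp: spin_kernel_commute)
    have fx: "f (x(b + 1 := y)) = f x" for y by (rule dep) auto
    have "(\<integral>y. ?F (x(b + 1 := y)) \<partial>sphere_area) =
        (\<integral>y. (f x * u (x a) * chain_weight \<beta> a b x) * (v y * spin_kernel \<beta> y (x b)) \<partial>sphere_area)"
      unfolding ch fx using ab by (simp add: mult_ac)
    also have "\<dots> = (f x * u (x a) * chain_weight \<beta> a b x) * (kernel_mass \<beta> * kernel_avg \<beta> v (x b))"
      using kernel_mass_pos[OF b] by (simp add: kernel_avg_def)
    finally show "(\<integral>y. ?F (x(b + 1 := y)) \<partial>sphere_area) =
        kernel_mass \<beta> * (f x * (u (x a) * kernel_avg \<beta> v (x b) * chain_weight \<beta> a b x))"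
      by (simp add: mult_ac)
  qed
  finally show ?thesis by (simp add: weighted_block_def)
qed

text \<open>Each round integrates out one spin at either end. The observable stays on the inner
  block, and the distance to the boundary is converted into iterates of the Markov operator, to
  which the contraction applies.\<close>

lemma weighted_block_peel:
  assumes b: "\<beta> > 0" and f: "f \<in> borel_measurable borel" and B: "\<And>x. \<bar>f x\<bar> \<le> B"
    and dep: "\<And>x y. (\<And>i. i \<in> {a..b} \<Longrightarrow> x i = y i) \<Longrightarrow> f x = f y"
    and u: "u \<in> borel_measurable borel" "\<And>s. s \<in> S2 \<Longrightarrow> \<bar>u s\<bar> \<le> U"
    and v: "v \<in> borel_measurable borel" "\<And>s. s \<in> S2 \<Longrightarrow> \<bar>v s\<bar> \<le> V"
    and ab: "a \<le> b"
  shows "weighted_block \<beta> (a - int k) (b + int k) u v f =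
    kernel_mass \<beta> ^ (2 * k) * weighted_block \<beta> a b ((kernel_avg \<beta> ^^ k) u) ((kernel_avg \<beta> ^^ k) v) f"
  using u v
proof (induction k arbitrary: u v)
  case 0
  then show ?case by simp
next
  case (Suc k)
  have dep': "f x = f y" if "\<And>i. i \<in> {a - int k..b + int k} \<Longrightarrow> x i = y i" for x y
    by (rule dep) (use that in auto)
  have dep'': "f x = f y" if "\<And>i. i \<in> {a - int k - 1..b + int k} \<Longrightarrow> x i = y i" for x y
    by (rule dep) (use that in auto)
  note K = kernel_avg_measurable kernel_avg_bound[OF b]
  have "weighted_block \<beta> (a - int (Suc k)) (b + int (Suc k)) u v f =
     weighted_block \<beta> (a - int k - 1) (b + int k + 1) u v f"
    by (simp add: algebra_simps)
  also have "\<dots> = kernel_mass \<beta> * weighted_block \<beta> (a - int k - 1) (b + int k) u (kernel_avg \<beta> v) f"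
    by (rule weighted_block_peel_right[OF b f B dep'' Suc.prems]) (use ab in auto)
  also have "weighted_block \<beta> (a - int k - 1) (b + int k) u (kernel_avg \<beta> v) f =
      kernel_mass \<beta> * weighted_block \<beta> (a - int k) (b + int k) (kernel_avg \<beta> u) (kernel_avg \<beta> v) f"
    by (rule weighted_block_peel_left[OF b f B dep' Suc.prems(1,2), where V=V])
      (use ab Suc.prems K in auto)
  also have "weighted_block \<beta> (a - int k) (b + int k) (kernel_avg \<beta> u) (kernel_avg \<beta> v) f =
     kernel_mass \<beta> ^ (2 * k) * weighted_block \<beta> a b ((kernel_avg \<beta> ^^ k) (kernel_avg \<beta> u)) ((kernel_avg \<beta> ^^ k) (kernel_avg \<beta> v)) f"
    by (rule Suc.IH) (use Suc.prems K in auto)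
  finally show ?case by (simp add: funpow_Suc_right del: funpow.simps)
qed

lemma block_integral_eq:
  "block_integral \<beta> a b f l r = weighted_block \<beta> a b (spin_kernel \<beta> l) (\<lambda>s. spin_kernel \<beta> s r) f"
  by (simp add: block_integral_def weighted_block_def block_weight_def chain_weight_def)

definition chain_integral :: "real \<Rightarrow> int \<Rightarrow> int \<Rightarrow> ((int \<Rightarrow> real^3) \<Rightarrow> real) \<Rightarrow> real" where
  "chain_integral \<beta> a b f = (\<integral>s. f s * chain_weight \<beta> a b s \<partial>block_space {a..b})"

lemma kernel_avg_const: "\<beta> > 0 \<Longrightarrow> s \<in> S2 \<Longrightarrow> kernel_avg \<beta> (\<lambda>_. c) s = c"
  using kernel_mass_pos[of \<beta>] by (simp add: kernel_avg_def integral_spin_kernel')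

lemma chain_integral_1:
  assumes b: "\<beta> > 0"
  shows "chain_integral \<beta> a (a + int k) (\<lambda>_. 1) = 4 * pi * kernel_mass \<beta> ^ k"
proof (induction k)
  case 0
  have "chain_integral \<beta> a a (\<lambda>_. 1) = measure (block_space {a}) (space (block_space {a}))"
    by (simp add: chain_integral_def chain_weight_def)
  also have "\<dots> = 4 * pi"
    using sphere_prod.product_integral_singleton[of "\<lambda>_. 1::real" a] by (simp add: measure_sphere_area_S2)
  finally show ?case by simp
next
  case (Suc k)
  have "weighted_block \<beta> a (a + int k + 1) (\<lambda>_. 1) (\<lambda>_. 1) (\<lambda>_. 1) =
      kernel_mass \<beta> * weighted_block \<beta> a (a + int k) (\<lambda>_. 1) (kernel_avg \<beta> (\<lambda>_. 1)) (\<lambda>_. 1)"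
    by (rule weighted_block_peel_right[OF b, where B=1 and U=1 and V=1]) auto
  also have "weighted_block \<beta> a (a + int k) (\<lambda>_. 1) (kernel_avg \<beta> (\<lambda>_. 1)) (\<lambda>_. 1) =
      weighted_block \<beta> a (a + int k) (\<lambda>_. 1) (\<lambda>_. 1) (\<lambda>_. 1)"
    unfolding weighted_block_def
    by (intro Bochner_Integration.integral_cong refl)
      (use kernel_avg_const[OF b] in \<open>auto simp: space_block PiE_def Pi_def\<close>)
  finally show ?case using Suc by (simp add: chain_integral_def weighted_block_def add_ac)
qed


text \<open>When both end weights become the same constant, the boundary is forgotten and a chain
  with free ends is left. The factor \<open>c\<^sup>2\<close> cancels in the DLR quotient.\<close>

lemma weighted_block_tendsto:
  assumes b: "\<beta> > 0" and f: "f \<in> borel_measurable borel" and B: "\<And>x. \<bar>f x\<bar> \<le> B"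
    and u: "\<And>k. u k \<in> borel_measurable borel" "\<And>k s. s \<in> S2 \<Longrightarrow> \<bar>u k s\<bar> \<le> U" "\<And>s. s \<in> S2 \<Longrightarrow> (\<lambda>k. u k s) \<longlonglongrightarrow> c"
    and v: "\<And>k. v k \<in> borel_measurable borel" "\<And>k s. s \<in> S2 \<Longrightarrow> \<bar>v k s\<bar> \<le> U" "\<And>s. s \<in> S2 \<Longrightarrow> (\<lambda>k. v k s) \<longlonglongrightarrow> c"
    and ab: "a \<le> b"
  shows "(\<lambda>k. weighted_block \<beta> a b (u k) (v k) f) \<longlonglongrightarrow> c\<^sup>2 * chain_integral \<beta> a b f"
proof -
  let ?w = "B * (U * U * ((1 + 2 * \<beta>) / (4 * pi)) ^ card {a..<b})"
  have sp: "norm (x i) = 1" if "x \<in> space (block_space {a..b})" "i \<in> {a..b}" for x and i :: int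
    using that by (auto simp: space_block PiE_def Pi_def)
  have "(\<lambda>k. weighted_block \<beta> a b (u k) (v k) f) \<longlonglongrightarrow>
      (\<integral>s. f s * (c * c * chain_weight \<beta> a b s) \<partial>block_space {a..b})"
    unfolding weighted_block_def
  proof (rule integral_dominated_convergence[where w="\<lambda>_. ?w"])
    note [measurable] = chain_weight_measurable f
    show "(\<lambda>s. f s * (c * c * chain_weight \<beta> a b s)) \<in> borel_measurable (block_space {a..b})"
      by (intro borel_measurable_block) measurable
    show "(\<lambda>s. f s * (u k (s a) * v k (s b) * chain_weight \<beta> a b s)) \<in> borel_measurable (block_space {a..b})" for k
      using weighted_block_integrable(1)[OF b f B u(1,2) v(1,2), where I="{a..b}" and a=a and b=b] ab by auto
    show "integrable (block_space {a..b}) (\<lambda>_. ?w)"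
      using finite_measure_block[of "{a..b}"] by (simp add: finite_measure.integrable_const)
    show "AE s in block_space {a..b}. (\<lambda>k. f s * (u k (s a) * v k (s b) * chain_weight \<beta> a b s)) \<longlonglongrightarrow> f s * (c * c * chain_weight \<beta> a b s)"
    proof (rule AE_I2)
      fix s assume s: "s \<in> space (block_space {a..b})"
      have "s a \<in> S2" "s b \<in> S2" using sp[OF s, of a] sp[OF s, of b] ab by auto
      then show "(\<lambda>k. f s * (u k (s a) * v k (s b) * chain_weight \<beta> a b s)) \<longlonglongrightarrow> f s * (c * c * chain_weight \<beta> a b s)"
        using u(3) v(3) by (intro tendsto_intros) auto
    qed
    show "AE s in block_space {a..b}. norm (f s * (u k (s a) * v k (s b) * chain_weight \<beta> a b s)) \<le> ?w" for k
    proof (rule AE_I2, unfold real_norm_def)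
      fix s assume "s \<in> space (block_space {a..b})"
      from sp[OF this] show "\<bar>f s * (u k (s a) * v k (s b) * chain_weight \<beta> a b s)\<bar> \<le> ?w"
        by (intro weighted_block_integrable(2)[OF b f B u(1,2) v(1,2), where I="{a..b}"]) (use ab in auto)
    qed
  qed
  also have "(\<integral>s. f s * (c * c * chain_weight \<beta> a b s) \<partial>block_space {a..b}) = (\<integral>s. c\<^sup>2 * (f s * chain_weight \<beta> a b s) \<partial>block_space {a..b})"
    by (simp add: power2_eq_square mult_ac)
  finally show ?thesis by (simp add: chain_integral_def)
qed

lemma weighted_block_abs_le:
  assumes b: "\<beta> > 0" and f: "f \<in> borel_measurable borel" and B: "\<And>x. \<bar>f x\<bar> \<le> B"
    and u: "u \<in> borel_measurable borel" "\<And>s. s \<in> S2 \<Longrightarrow> \<bar>u s\<bar> \<le> U" "\<And>s. 0 \<le> u s"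
    and v: "v \<in> borel_measurable borel" "\<And>s. s \<in> S2 \<Longrightarrow> \<bar>v s\<bar> \<le> V" "\<And>s. 0 \<le> v s" and ab: "a \<le> b"
  shows "\<bar>weighted_block \<beta> a b u v f\<bar> \<le> B * weighted_block \<beta> a b u v (\<lambda>_. 1)"
proof -
  have i1: "integrable (block_space {a..b}) (\<lambda>s. f s * (u (s a) * v (s b) * chain_weight \<beta> a b s))"
    by (rule weighted_block_integrable(1)[OF b f B u(1,2) v(1,2)]) (use ab in auto)
  have i2: "integrable (block_space {a..b}) (\<lambda>s. 1 * (u (s a) * v (s b) * chain_weight \<beta> a b s))"
    by (rule weighted_block_integrable(1)[OF b _ _ u(1,2) v(1,2), where B=1]) (use ab in auto)
  have "\<bar>weighted_block \<beta> a b u v f\<bar> \<le> (\<integral>s. \<bar>f s * (u (s a) * v (s b) * chain_weight \<beta> a b s)\<bar> \<partial>block_space {a..b})"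
    unfolding weighted_block_def
    using integral_norm_bound[of "block_space {a..b}" "\<lambda>s. f s * (u (s a) * v (s b) * chain_weight \<beta> a b s)"] by simp
  also have "\<dots> \<le> (\<integral>s. B * (1 * (u (s a) * v (s b) * chain_weight \<beta> a b s)) \<partial>block_space {a..b})"
  proof (rule integral_mono)
    show "integrable (block_space {a..b}) (\<lambda>s. \<bar>f s * (u (s a) * v (s b) * chain_weight \<beta> a b s)\<bar>)"
      using i1 by (rule integrable_abs)
    show "integrable (block_space {a..b}) (\<lambda>s. B * (1 * (u (s a) * v (s b) * chain_weight \<beta> a b s)))"
      using i2 by (rule integrable_mult_right)
    show "\<bar>f s * (u (s a) * v (s b) * chain_weight \<beta> a b s)\<bar> \<le> B * (1 * (u (s a) * v (s b) * chain_weight \<beta> a b s))" for s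
      unfolding abs_mult using B[of s] u(3) v(3) chain_weight_nonneg[OF b, of a b s]
      by (auto intro!: mult_right_mono)
  qed
  finally show ?thesis by (simp add: weighted_block_def)
qed

section \<open>From the DLR condition to the laws of blocks\<close>

lemma space_spin_space: "space spin_space = (\<Pi>\<^sub>E i\<in>UNIV. S2)"
  by (simp add: spin_space_def space_PiM space_restrict_space)

lemma gibbs_space:
  assumes "is_gibbs_measure \<beta> \<mu>" "S \<in> space \<mu>"
  shows "S i \<in> S2"
proof -
  have "space \<mu> = space spin_space" using assms(1) unfolding is_gibbs_measure_def by (metis sets_eq_imp_space_eq)
  then show ?thesis using assms(2) by (auto simp: space_spin_space PiE_def Pi_def)
qed

lemma measurable_spin_borel: "(\<lambda>S. S) \<in> spin_space \<rightarrow>\<^sub>M (borel :: (int \<Rightarrow> real^3) measure)"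
proof -
  have "(\<lambda>S. S) \<in> spin_space \<rightarrow>\<^sub>M Pi\<^sub>M UNIV (\<lambda>_::int. borel :: (real^3) measure)"
  proof (rule measurable_PiM_single')
    fix i :: int
    have "(\<lambda>s. s) \<in> restrict_space borel S2 \<rightarrow>\<^sub>M (borel :: (real^3) measure)"
      by (rule measurable_restrict_space1) simp
    from measurable_compose[OF measurable_component_singleton[of i UNIV] this]
    show "(\<lambda>S. S i) \<in> borel_measurable spin_space" unfolding spin_space_def by simp
  qed (auto simp: space_PiM)
  then show ?thesis by (simp add: measurable_cong_sets[OF refl sets_PiM_equal_borel])
qed

lemma gibbs_borel_measurable:
  assumes "is_gibbs_measure \<beta> \<mu>" "f \<in> measurable borel N" shows "f \<in> measurable \<mu> N"
proof -
  have "sets \<mu> = sets spin_space" using assms(1) by (simp add: is_gibbs_measure_def)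
  then show ?thesis
    using measurable_compose[OF measurable_spin_borel assms(2)] measurable_cong_sets by blast
qed

text \<open>The observable is conditioned on the two spins at distance \<open>k + 1\<close> from the
  block. Every such conditional expectation has the same integral as the observable, while the DLR
  formula identifies it with a quotient that converges, as \<open>k\<close> grows, to a constant
  independent of the boundary spins. Bounded convergence makes this constant the
  expectation.\<close>

theorem gibbs_marginal:
  assumes b: "\<beta> > 0" and g: "is_gibbs_measure \<beta> \<mu>" and ab: "a \<le> b"
    and f: "continuous_on UNIV f" and B: "\<And>x. \<bar>f x\<bar> \<le> B"
  shows "(\<integral>S. f (restrict S {a..b}) \<partial>\<mu>) =
    chain_integral \<beta> a b (\<lambda>s. f (restrict s {a..b})) / chain_integral \<beta> a b (\<lambda>_. 1)"
proof -
  interpret prob_space \<mu> using g by (simp add: is_gibbs_measure_def)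
  define f' where "f' = (\<lambda>s::int \<Rightarrow> real^3. f (restrict s {a..b}))"
  have f'c: "continuous_on UNIV f'"
    unfolding f'_def using continuous_on_compose2[OF f continuous_on_restrict_config] by auto
  then have f'm: "f' \<in> borel_measurable borel" by (rule borel_measurable_continuous_onI)
  have f'B: "\<bar>f' x\<bar> \<le> B" for x unfolding f'_def by (rule B)
  have dep: "f' x = f' y" if "\<And>i. i \<in> {a..b} \<Longrightarrow> x i = y i" for x y
    unfolding f'_def using that by (metis (mono_tags, lifting) restrict_ext)
  have f'int: "integrable \<mu> f'"
    using f'B gibbs_borel_measurable[OF g f'm] by (intro integrable_const_bound[where B=B]) auto
  let ?a = "\<lambda>k. a - int k" and ?b = "\<lambda>k. b + int k"
  let ?F = "\<lambda>k. vimage_algebra (space \<mu>) (\<lambda>S. (S (?a k - 1), S (?b k + 1))) (borel :: ((real^3) \<times> (real^3)) measure)"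
  let ?r = "\<lambda>k S. block_integral \<beta> (?a k) (?b k) f' (S (?a k - 1)) (S (?b k + 1))
             / block_integral \<beta> (?a k) (?b k) (\<lambda>_. 1) (S (?a k - 1)) (S (?b k + 1))"
  \<comment> \<open>The mean over the sphere of a kernel with one argument fixed, hence the common
    limit of both iterated end weights.\<close>
  let ?c = "kernel_mass \<beta> / (4 * pi)"
  let ?K = "(1 + 2 * \<beta>) / (4 * pi)"
  define G where "G k = real_cond_exp \<mu> (?F k) f'" for k
  have AEG: "AE S in \<mu>. G k S = ?r k S" for k
  proof -
    have "continuous_on (\<Pi>\<^sub>E i\<in>{?a k..?b k}. S2) f'" "bounded (f' ` (\<Pi>\<^sub>E i\<in>{?a k..?b k}. S2))"
      using f'c f'B by (auto intro: continuous_on_subset simp: bounded_iff)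
    moreover have "?a k \<le> ?b k" using ab by simp
    ultimately have "AE S in \<mu>. real_cond_exp \<mu> (?F k) (\<lambda>S. f' (restrict S {?a k..?b k})) S = ?r k S"
      using g unfolding is_gibbs_measure_def by blast
    \<comment> \<open>The DLR condition of the larger block is applied to an observable that depends
      on the inner block only.\<close>
    moreover have "(\<lambda>S. f' (restrict S {?a k..?b k})) = f'"
      by (intro ext dep) auto
    ultimately show ?thesis unfolding G_def by simp
  qed
  have intG: "integrable \<mu> (G k) \<and> (\<integral>S. G k S \<partial>\<mu>) = (\<integral>S. f' S \<partial>\<mu>)" for k
  proof -
    have hm: "(\<lambda>S. (S (?a k - 1), S (?b k + 1))) \<in> \<mu> \<rightarrow>\<^sub>M (borel :: ((real^3) \<times> (real^3)) measure)"
      by (intro gibbs_borel_measurable[OF g] borel_measurable_continuous_onI continuous_on_Pair) auto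
    have "subalgebra \<mu> (?F k)"
      unfolding subalgebra_def using measurable_sets[OF hm] by (auto simp: sets_vimage_algebra2)
    then interpret finite_measure_subalgebra \<mu> "?F k" by unfold_locales
    show ?thesis unfolding G_def using real_cond_exp_int[OF f'int] by simp
  qed
  have rB: "\<bar>?r k S\<bar> \<le> B" and rlim: "(\<lambda>k. ?r k S) \<longlonglongrightarrow> chain_integral \<beta> a b f' / chain_integral \<beta> a b (\<lambda>_. 1)"
    if S: "S \<in> space \<mu>" for S k
  proof -
    have nS: "norm (S i) = 1" for i using gibbs_space[OF g S, of i] by simp
    define u where "u k = spin_kernel \<beta> (S (?a k - 1))" for k
    define v where "v k = (\<lambda>s. spin_kernel \<beta> s (S (?b k + 1)))" for k
    have vu: "v k = spin_kernel \<beta> (S (?b k + 1))" for k unfolding v_def by (rule ext) (rule spin_kernel_commute)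
    have um: "u k \<in> borel_measurable borel" "v k \<in> borel_measurable borel" for k
      unfolding u_def v_def by measurable
    have uB: "\<bar>u k s\<bar> \<le> ?K" "\<bar>v k s\<bar> \<le> ?K" if "s \<in> S2" for k s
      unfolding u_def v_def using that spin_kernel_nonneg[OF b] spin_kernel_le[OF b] nS by auto
    have u0: "0 \<le> u k s" "0 \<le> v k s" for k s unfolding u_def v_def using spin_kernel_nonneg[OF b] by auto
    have rw: "?r k S = weighted_block \<beta> (?a k) (?b k) (u k) (v k) f' / weighted_block \<beta> (?a k) (?b k) (u k) (v k) (\<lambda>_. 1)" for k
      unfolding block_integral_eq u_def v_def by simp
    have B0: "0 \<le> B" using f'B[of S] by linarith
    show "\<bar>?r k S\<bar> \<le> B"
    proof -
      have "\<bar>weighted_block \<beta> (?a k) (?b k) (u k) (v k) f'\<bar> \<le> B * weighted_block \<beta> (?a k) (?b k) (u k) (v k) (\<lambda>_. 1)"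
        by (rule weighted_block_abs_le[OF b f'm f'B um(1) uB(1) u0(1) um(2) uB(2) u0(2)]) (use ab in auto)
      moreover have "\<bar>weighted_block \<beta> (?a k) (?b k) (u k) (v k) (\<lambda>_. 1)\<bar> \<le> 1 * weighted_block \<beta> (?a k) (?b k) (u k) (v k) (\<lambda>_. 1)"
        by (rule weighted_block_abs_le[OF b _ _ um(1) uB(1) u0(1) um(2) uB(2) u0(2)]) (use ab in auto)
      \<comment> \<open>A vanishing denominator makes the quotient 0, for which the bound holds as
        well.\<close>
      ultimately show ?thesis unfolding rw abs_divide using B0
        by (cases "weighted_block \<beta> (?a k) (?b k) (u k) (v k) (\<lambda>_. 1) = 0") (auto simp: divide_le_eq)
    qed
    define U where "U k = (kernel_avg \<beta> ^^ k) (u k)" for k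
    define V where "V k = (kernel_avg \<beta> ^^ k) (v k)" for k
    have peel1: "weighted_block \<beta> (?a k) (?b k) (u k) (v k) f' = kernel_mass \<beta> ^ (2 * k) * weighted_block \<beta> a b (U k) (V k) f'" for k
      unfolding U_def V_def by (rule weighted_block_peel[OF b f'm f'B dep um(1) uB(1) um(2) uB(2) ab])
    have peel2: "weighted_block \<beta> (?a k) (?b k) (u k) (v k) (\<lambda>_. 1) = kernel_mass \<beta> ^ (2 * k) * weighted_block \<beta> a b (U k) (V k) (\<lambda>_. 1)" for k
      unfolding U_def V_def by (rule weighted_block_peel[OF b _ _ _ um(1) uB(1) um(2) uB(2) ab, where B=1]) auto
    have rw2: "?r k S = weighted_block \<beta> a b (U k) (V k) f' / weighted_block \<beta> a b (U k) (V k) (\<lambda>_. 1)" for k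
      unfolding rw peel1 peel2 using kernel_mass_pos[OF b] by simp
    have Um: "U k \<in> borel_measurable borel" "V k \<in> borel_measurable borel" for k
      unfolding U_def V_def using kernel_avg_iterate(1)[OF b um(1) uB(1)] kernel_avg_iterate(1)[OF b um(2) uB(2)] by auto
    have UB: "\<bar>U k s\<bar> \<le> ?K" "\<bar>V k s\<bar> \<le> ?K" if "s \<in> S2" for k s
      unfolding U_def V_def using that kernel_avg_iterate(2)[OF b um(1) uB(1)] kernel_avg_iterate(2)[OF b um(2) uB(2)] by auto
    have rate0: "(\<lambda>k. kernel_rate \<beta> ^ k * (2 * ?K)) \<longlonglongrightarrow> 0"
      using kernel_rate_bounds[OF b] by (intro tendsto_mult_left_zero LIMSEQ_power_zero) auto
    have Ulim: "(\<lambda>k. U k s) \<longlonglongrightarrow> ?c" "(\<lambda>k. V k s) \<longlonglongrightarrow> ?c" if s: "s \<in> S2" for s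
    proof -
      have iu: "(\<integral>s. u k s \<partial>sphere_area) = kernel_mass \<beta>" "(\<integral>s. v k s \<partial>sphere_area) = kernel_mass \<beta>" for k
        unfolding u_def vu using integral_spin_kernel[OF b nS] by auto
      have bd: "norm (U k s - ?c) \<le> kernel_rate \<beta> ^ k * (2 * ?K)" "norm (V k s - ?c) \<le> kernel_rate \<beta> ^ k * (2 * ?K)" for k
        unfolding U_def V_def real_norm_def
        using kernel_avg_iterate_mean[OF b um(1) uB(1) s, of k k] kernel_avg_iterate_mean[OF b um(2) uB(2) s, of k k] iu
        by auto
      have "(\<lambda>k. U k s - ?c) \<longlonglongrightarrow> 0"
        by (rule Lim_null_comparison[OF always_eventually rate0]) (intro allI bd)
      moreover have "(\<lambda>k. V k s - ?c) \<longlonglongrightarrow> 0"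
        by (rule Lim_null_comparison[OF always_eventually rate0]) (intro allI bd)
      ultimately show "(\<lambda>k. U k s) \<longlonglongrightarrow> ?c" "(\<lambda>k. V k s) \<longlonglongrightarrow> ?c"
        using Lim_null by auto
    qed
    have z: "chain_integral \<beta> a b (\<lambda>_. 1) > 0"
      using chain_integral_1[OF b, of a "nat (b - a)"] ab kernel_mass_pos[OF b] by simp
    have "(\<lambda>k. weighted_block \<beta> a b (U k) (V k) f' / weighted_block \<beta> a b (U k) (V k) (\<lambda>_. 1)) \<longlonglongrightarrow>
        (?c\<^sup>2 * chain_integral \<beta> a b f') / (?c\<^sup>2 * chain_integral \<beta> a b (\<lambda>_. 1))"
      using z kernel_mass_pos[OF b]
      by (intro tendsto_divide weighted_block_tendsto[OF b f'm f'B Um(1) UB(1) Ulim(1) Um(2) UB(2) Ulim(2) ab]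
          weighted_block_tendsto[OF b _ _ Um(1) UB(1) Ulim(1) Um(2) UB(2) Ulim(2) ab, where B=1]) auto
    then show "(\<lambda>k. ?r k S) \<longlonglongrightarrow> chain_integral \<beta> a b f' / chain_integral \<beta> a b (\<lambda>_. 1)"
      unfolding rw2 using kernel_mass_pos[OF b] by simp
  qed
  have AEall: "AE S in \<mu>. \<forall>k. G k S = ?r k S"
    using AEG by (simp add: AE_all_countable)
  have "(\<lambda>k. \<integral>S. G k S \<partial>\<mu>) \<longlonglongrightarrow> (\<integral>S. chain_integral \<beta> a b f' / chain_integral \<beta> a b (\<lambda>_. 1) \<partial>\<mu>)"
  proof (rule integral_dominated_convergence[where w="\<lambda>_. B"])
    show "G k \<in> borel_measurable \<mu>" for k using intG by auto
    show "AE S in \<mu>. (\<lambda>k. G k S) \<longlonglongrightarrow> chain_integral \<beta> a b f' / chain_integral \<beta> a b (\<lambda>_. 1)"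
      using AEall AE_space by eventually_elim (use rlim in simp)
    show "AE S in \<mu>. norm (G k S) \<le> B" for k
      using AEall AE_space by eventually_elim (use rB in simp)
  qed auto
  then have "(\<integral>S. f' S \<partial>\<mu>) = chain_integral \<beta> a b f' / chain_integral \<beta> a b (\<lambda>_. 1)"
    using intG by (simp add: prob_space LIMSEQ_const_iff)
  then show ?thesis unfolding f'_def .
qed


text \<open>Upgrades the formula from bounded continuous observables to all nonnegative measurable
  ones: both laws are transported to the Borel space of configurations and compared there by
  continuous test functions.\<close>

theorem gibbs_block_law:
  fixes G :: "(int \<Rightarrow> real^3) \<Rightarrow> ennreal"
  assumes b: "\<beta> > 0" and g: "is_gibbs_measure \<beta> \<mu>" and ab: "a \<le> b" and G: "G \<in> borel_measurable borel"
  shows "(\<integral>\<^sup>+S. G (restrict S {a..b}) \<partial>\<mu>) =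
    (\<integral>\<^sup>+s. G s * ennreal (chain_weight \<beta> a b s / chain_integral \<beta> a b (\<lambda>_. 1)) \<partial>block_space {a..b})"
proof -
  interpret prob_space \<mu> using g by (simp add: is_gibbs_measure_def)
  let ?w = "\<lambda>s. chain_weight \<beta> a b s / chain_integral \<beta> a b (\<lambda>_. 1)"
  define M where "M = distr \<mu> borel (\<lambda>S. restrict S {a..b})"
  define N where "N = distr (density (block_space {a..b}) (\<lambda>s. ennreal (?w s))) borel (\<lambda>s. s)"
  have z: "chain_integral \<beta> a b (\<lambda>_. 1) > 0"
    using chain_integral_1[OF b, of a "nat (b - a)"] ab kernel_mass_pos[OF b] by simp
  have wm: "?w \<in> borel_measurable (block_space {a..b})"
    using chain_weight_measurable by (intro borel_measurable_divide borel_measurable_block) auto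
  have w0: "0 \<le> ?w s" for s using chain_weight_nonneg[OF b] z by (simp add: less_imp_le)
  have wi: "integrable (block_space {a..b}) ?w"
    using weighted_block_integrable(1)[OF b, of "\<lambda>_. 1" 1 "\<lambda>_. 1" 1 "\<lambda>_. 1" 1 "{a..b}" a b] ab by simp
  have rm: "(\<lambda>S. restrict S {a..b}) \<in> \<mu> \<rightarrow>\<^sub>M (borel :: (int \<Rightarrow> real^3) measure)"
    using continuous_on_restrict_config by (intro gibbs_borel_measurable[OF g] borel_measurable_continuous_onI)
  have im: "(\<lambda>s. s) \<in> density (block_space {a..b}) (\<lambda>s. ennreal (?w s)) \<rightarrow>\<^sub>M (borel :: (int \<Rightarrow> real^3) measure)"
    using measurable_block_borel by simp
  have MN: "M = N"
  proof (rule finite_measure_eqI_continuous)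
    show "finite_measure M" unfolding M_def using rm by (rule finite_measure_distr)
    have "emeasure (density (block_space {a..b}) (\<lambda>s. ennreal (?w s))) (space (density (block_space {a..b}) (\<lambda>s. ennreal (?w s)))) =
        (\<integral>\<^sup>+s. ennreal (?w s) \<partial>block_space {a..b})"
      using wm by (simp add: emeasure_density cong: nn_integral_cong)
    also have "\<dots> < \<infinity>" using wi w0 by (simp add: nn_integral_eq_integral)
    finally have "finite_measure (density (block_space {a..b}) (\<lambda>s. ennreal (?w s)))"
      by (intro finite_measureI) auto
    then show "finite_measure N" unfolding N_def using im by (rule finite_measure.finite_measure_distr)
    fix f :: "(int \<Rightarrow> real^3) \<Rightarrow> real" assume f: "continuous_on UNIV f" and f01: "\<And>x. 0 \<le> f x \<and> f x \<le> 1"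
    have fm: "f \<in> borel_measurable borel" using f by (rule borel_measurable_continuous_onI)
    have "(\<integral>x. f x \<partial>M) = (\<integral>S. f (restrict S {a..b}) \<partial>\<mu>)"
      unfolding M_def using rm fm by (rule integral_distr)
    also have "\<dots> = chain_integral \<beta> a b (\<lambda>s. f (restrict s {a..b})) / chain_integral \<beta> a b (\<lambda>_. 1)"
      using f01 by (intro gibbs_marginal[OF b g ab f, where B=1]) auto
    also have "chain_integral \<beta> a b (\<lambda>s. f (restrict s {a..b})) = chain_integral \<beta> a b f"
      unfolding chain_integral_def
      by (intro Bochner_Integration.integral_cong refl) (auto simp: space_block PiE_restrict)
    also have "chain_integral \<beta> a b f / chain_integral \<beta> a b (\<lambda>_. 1) = (\<integral>s. ?w s * f s \<partial>block_space {a..b})"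
      unfolding chain_integral_def[of _ _ _ f] by (simp add: mult.commute integral_divide_zero)
    also have "\<dots> = (\<integral>s. f s \<partial>density (block_space {a..b}) (\<lambda>s. ennreal (?w s)))"
      using wm w0 borel_measurable_block[OF fm] by (subst integral_density) auto
    also have "\<dots> = (\<integral>x. f x \<partial>N)"
      unfolding N_def using im fm by (rule integral_distr[symmetric])
    finally show "(\<integral>x. f x \<partial>M) = (\<integral>x. f x \<partial>N)" .
  qed (auto simp: M_def N_def)
  have "(\<integral>\<^sup>+S. G (restrict S {a..b}) \<partial>\<mu>) = (\<integral>\<^sup>+x. G x \<partial>M)"
    unfolding M_def using G by (intro nn_integral_distr[symmetric, OF rm]) auto
  also have "\<dots> = (\<integral>\<^sup>+s. G s \<partial>density (block_space {a..b}) (\<lambda>s. ennreal (?w s)))"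
    unfolding MN N_def using im G by (intro nn_integral_distr) auto
  also have "\<dots> = (\<integral>\<^sup>+s. ennreal (?w s) * G s \<partial>block_space {a..b})"
    using wm borel_measurable_block[OF G] by (intro nn_integral_density) auto
  finally show ?thesis by (simp add: mult.commute)
qed

section \<open>Global solutions of Lipschitz equations\<close>

text \<open>The oriented integral from 0 to \<open>t\<close>: for either sign of \<open>t\<close>
  one of the two intervals is empty or a point. Time estimates thus cover both directions at
  once.\<close>

definition signed_integral :: "(real \<Rightarrow> 'a::banach) \<Rightarrow> real \<Rightarrow> 'a" where
  "signed_integral h t = integral {0..t} h - integral {t..0} h"

lemma signed_integral_0 [simp]: "signed_integral h 0 = 0"
  by (simp add: signed_integral_def)

lemma signed_integral_deriv:
  fixes h :: "real \<Rightarrow> 'a::banach"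
  assumes h: "continuous_on UNIV h"
  shows "(signed_integral h has_vector_derivative h t) (at t)"
proof -
  define R where "R = \<bar>t\<bar> + 1"
  have hc: "continuous_on S h" for S using h by (rule continuous_on_subset) auto
  have eq: "signed_integral h u = integral {-R..u} h - integral {-R..0} h" if u: "u \<in> {-R<..<R}" for u
  proof (cases "u \<ge> 0")
    case True
    have "integral {-R..0} h + integral {0..u} h = integral {-R..u} h"
      using True R_def by (intro Henstock_Kurzweil_Integration.integral_combine integrable_continuous_interval hc) auto
    moreover have "integral {u..0} h = 0" using True by (cases "u = 0") auto
    ultimately show ?thesis by (simp add: signed_integral_def algebra_simps)
  next
    case False
    have "integral {-R..u} h + integral {u..0} h = integral {-R..0} h"
      using False u by (intro Henstock_Kurzweil_Integration.integral_combine integrable_continuous_interval hc) auto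
    moreover have "integral {0..u} h = 0" using False by auto
    ultimately show ?thesis by (simp add: signed_integral_def algebra_simps)
  qed
  have t: "t \<in> {-R<..<R}" by (auto simp: R_def)
  have "((\<lambda>u. integral {-R..u} h) has_vector_derivative h t) (at t within {-R..R})"
    using t by (intro integral_has_vector_derivative hc) auto
  from has_vector_derivative_diff[OF this has_vector_derivative_const[of "integral {-R..0} h"]]
  have "((\<lambda>u. integral {-R..u} h - integral {-R..0} h) has_vector_derivative h t) (at t within {-R..R})"
    by simp
  then have "((\<lambda>u. integral {-R..u} h - integral {-R..0} h) has_vector_derivative h t) (at t within {-R<..<R})"
    by (rule has_vector_derivative_within_subset) auto
  then have "(signed_integral h has_vector_derivative h t) (at t within {-R<..<R})"
    by (rule has_vector_derivative_transform[OF t eq, rotated])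
  then show ?thesis using t by (simp add: at_within_open[of _ "{-R<..<R}"])
qed

lemma norm_diff_le_of_deriv:
  fixes f :: "real \<Rightarrow> 'a::real_normed_vector"
  assumes f: "\<And>s. s \<in> {a..b} \<Longrightarrow> (f has_vector_derivative f' s) (at s)"
    and p: "\<And>s. s \<in> {a..b} \<Longrightarrow> (p has_real_derivative p' s) (at s)"
    and le: "\<And>s. s \<in> {a..b} \<Longrightarrow> norm (f' s) \<le> p' s" and ab: "a \<le> b"
  shows "norm (f b - f a) \<le> p b - p a"
proof (cases "a = b")
  case False
  show ?thesis
  proof (rule differentiable_bound_general[where f'=f' and \<phi>'=p'])
    show "continuous_on {a..b} f"
      using f by (intro continuous_at_imp_continuous_on ballI has_vector_derivative_continuous) auto
    show "continuous_on {a..b} p"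
      using p by (intro continuous_at_imp_continuous_on ballI DERIV_isCont) auto
  qed (use False ab f p le in \<open>auto simp: has_real_derivative_iff_has_vector_derivative\<close>)
qed simp

text \<open>Integrating the exponential gains the factor \<open>1 / \<kappa>\<close>, the source of
  the contraction below. Negative times follow by reflecting \<open>f\<close>.\<close>

lemma norm_le_exp_of_deriv:
  fixes f :: "real \<Rightarrow> 'a::real_normed_vector"
  assumes f: "\<And>s. (f has_vector_derivative f' s) (at s)" and f0: "f 0 = 0"
    and le: "\<And>s. norm (f' s) \<le> M * exp (\<kappa> * \<bar>s\<bar>)" and l: "\<kappa> > 0" and M: "M \<ge> 0"
  shows "norm (f t) \<le> M / \<kappa> * exp (\<kappa> * \<bar>t\<bar>)"
proof -
  have key: "norm (F t) \<le> M / \<kappa> * exp (\<kappa> * t)"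
    if t: "t \<ge> 0" and F: "\<And>s. (F has_vector_derivative F' s) (at s)" and F0: "F 0 = 0"
      and Fl: "\<And>s. norm (F' s) \<le> M * exp (\<kappa> * \<bar>s\<bar>)" for F :: "real \<Rightarrow> 'a" and F' t
  proof -
    have "norm (F t - F 0) \<le> M / \<kappa> * exp (\<kappa> * t) - M / \<kappa> * exp (\<kappa> * 0)"
    proof (rule norm_diff_le_of_deriv)
      fix s assume s: "s \<in> {0..t}"
      show "(F has_vector_derivative F' s) (at s)" by (rule F)
      show "((\<lambda>s. M / \<kappa> * exp (\<kappa> * s)) has_real_derivative M * exp (\<kappa> * s)) (at s)"
        using l by (auto intro!: derivative_eq_intros)
      show "norm (F' s) \<le> M * exp (\<kappa> * s)" using Fl[of s] s by simp
    qed (rule t)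
    moreover have "0 \<le> M / \<kappa>" using M l by simp
    ultimately show ?thesis using F0 by simp
  qed
  show ?thesis
  proof (cases "t \<ge> 0")
    case True
    then show ?thesis using key[OF True f f0 le] by simp
  next
    case False
    have "((\<lambda>s. f (- s)) has_vector_derivative - f' (- s)) (at s)" for s
    proof -
      have "((\<lambda>s. - s) has_vector_derivative -1) (at s)"
        by (auto intro!: derivative_eq_intros simp: has_vector_derivative_def)
      from vector_diff_chain_at[OF this, of f "f' (- s)"] f[of "- s"] show ?thesis by (simp add: o_def)
    qed
    from key[of "- t" "\<lambda>s. f (- s)" "\<lambda>s. - f' (- s)", OF _ this] False f0 le show ?thesis
      by (simp add: le[of "- _", simplified])
  qed
qed

lemma exp_minus_mult_le:
  fixes x a c :: real
  assumes "x \<le> c * exp a" shows "exp (- a) * x \<le> c"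
proof -
  have "exp (- a) * x \<le> exp (- a) * (c * exp a)" using assms by (intro mult_left_mono) auto
  also have "\<dots> = c * (exp (- a) * exp a)" by (simp only: mult_ac)
  also have "\<dots> = c" by (simp add: exp_minus)
  finally show ?thesis .
qed

text \<open>Picard iteration on the whole time axis at once: the unknown \<open>y\<close> is the
  difference of the solution and \<open>x0\<close>, weighted by
  \<open>exp (- \<kappa> * \<bar>t\<bar>)\<close>, and is a bounded continuous function. In these
  terms integration is a contraction with constant \<open>L / \<kappa>\<close>, so the fixed point
  is a global solution directly.\<close>

theorem global_ode_exists:
  fixes f :: "'a::banach \<Rightarrow> 'a"
  assumes L: "L \<ge> 0" and lip: "\<And>x y. norm (f x - f y) \<le> L * norm (x - y)"
  shows "\<exists>x. x 0 = x0 \<and> (\<forall>t. (x has_vector_derivative f (x t)) (at t))"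
proof -
  \<comment> \<open>Any positive value above \<open>L\<close> gives a contraction; this one keeps
    \<open>L / \<kappa>\<close> below one half and is positive also for
    \<open>L = 0\<close>.\<close>
  define \<kappa> where "\<kappa> = 2 * L + 1"
  have l: "\<kappa> > 0" using L by (simp add: \<kappa>_def)
  have fc: "continuous_on UNIV f"
  proof (rule continuous_on_iff[THEN iffD2], intro ballI allI impI)
    fix x e assume "(e::real) > 0"
    have "dist (f y) (f x) < e" if "dist y x < e / (L + 1)" for y
    proof -
      have "dist (f y) (f x) \<le> L * dist y x" using lip by (simp add: dist_norm)
      also have "\<dots> \<le> (L + 1) * dist y x" by (intro mult_right_mono) auto
      also have "\<dots> < e" using that L by (simp add: pos_less_divide_eq mult.commute)
      finally show ?thesis .
    qed
    then show "\<exists>d>0. \<forall>y\<in>UNIV. dist y x < d \<longrightarrow> dist (f y) (f x) < e"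
      using \<open>e > 0\<close> L by (intro exI[of _ "e / (L + 1)"]) auto
  qed
  define h where "h y s = f (x0 + exp (\<kappa> * \<bar>s\<bar>) *\<^sub>R apply_bcontfun y s)" for y s
  have hc: "continuous_on UNIV (h y)" for y :: "real \<Rightarrow>\<^sub>C 'a"
    unfolding h_def by (intro continuous_on_compose2[OF fc] continuous_intros) auto
  have hb: "norm (h y s) \<le> (norm (f x0) + L * norm y) * exp (\<kappa> * \<bar>s\<bar>)" for y s
  proof -
    have "norm (h y s) \<le> norm (f x0) + norm (h y s - f x0)" by (metis add.commute diff_add_cancel norm_triangle_ineq)
    also have "norm (h y s - f x0) \<le> L * (exp (\<kappa> * \<bar>s\<bar>) * norm (apply_bcontfun y s))"
      unfolding h_def using lip[of "x0 + exp (\<kappa> * \<bar>s\<bar>) *\<^sub>R apply_bcontfun y s" x0] by simp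
    also have "\<dots> \<le> L * (exp (\<kappa> * \<bar>s\<bar>) * norm y)"
      using L norm_bounded[of y s] by (intro mult_left_mono) auto
    also have "norm (f x0) \<le> norm (f x0) * exp (\<kappa> * \<bar>s\<bar>)"
      using l mult_left_mono[of 1 "exp (\<kappa> * \<bar>s\<bar>)" "norm (f x0)"] by simp
    finally show ?thesis by (simp add: algebra_simps)
  qed
  define P0 where "P0 y t = exp (- \<kappa> * \<bar>t\<bar>) *\<^sub>R signed_integral (h y) t" for y t
  have P0b: "P0 y \<in> bcontfun" for y
  proof (rule bcontfun_normI)
    have "continuous_on UNIV (signed_integral (h y))"
      using signed_integral_deriv[OF hc]
      by (intro continuous_at_imp_continuous_on ballI has_vector_derivative_continuous)
    then show "continuous_on UNIV (P0 y)" unfolding P0_def by (intro continuous_intros)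
    fix t
    have "norm (signed_integral (h y) t) \<le> (norm (f x0) + L * norm y) / \<kappa> * exp (\<kappa> * \<bar>t\<bar>)"
      by (rule norm_le_exp_of_deriv[OF signed_integral_deriv[OF hc] _ hb l]) (use L in auto)
    from exp_minus_mult_le[OF this] show "norm (P0 y t) \<le> (norm (f x0) + L * norm y) / \<kappa>"
      unfolding P0_def by simp
  qed
  define P where "P y = Bcontfun (P0 y)" for y
  have Pa: "apply_bcontfun (P y) = P0 y" for y
    unfolding P_def by (rule Bcontfun_inverse[OF P0b])
  have "\<forall>y z. dist (P y) (P z) \<le> (L / \<kappa>) * dist y z"
  proof (intro allI)
    fix y z
    have D: "((\<lambda>t. signed_integral (h y) t - signed_integral (h z) t) has_vector_derivative (h y s - h z s)) (at s)" for s
      by (intro has_vector_derivative_diff signed_integral_deriv hc)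
    have hd: "norm (h y s - h z s) \<le> (L * dist y z) * exp (\<kappa> * \<bar>s\<bar>)" for s
    proof -
      have "norm (h y s - h z s) \<le> L * norm (exp (\<kappa> * \<bar>s\<bar>) *\<^sub>R apply_bcontfun y s - exp (\<kappa> * \<bar>s\<bar>) *\<^sub>R apply_bcontfun z s)"
        unfolding h_def using lip[of "x0 + exp (\<kappa> * \<bar>s\<bar>) *\<^sub>R apply_bcontfun y s" "x0 + exp (\<kappa> * \<bar>s\<bar>) *\<^sub>R apply_bcontfun z s"] by simp
      also have "\<dots> = L * (exp (\<kappa> * \<bar>s\<bar>) * dist (apply_bcontfun y s) (apply_bcontfun z s))"
        by (simp add: dist_norm flip: scaleR_diff_right)
      also have "\<dots> \<le> L * (exp (\<kappa> * \<bar>s\<bar>) * dist y z)"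
        using L dist_bounded[of y s z] by (intro mult_left_mono) auto
      finally show ?thesis by (simp add: mult_ac)
    qed
    show "dist (P y) (P z) \<le> (L / \<kappa>) * dist y z"
    proof (rule dist_bound)
      fix t
      have "norm (signed_integral (h y) t - signed_integral (h z) t) \<le> (L * dist y z) / \<kappa> * exp (\<kappa> * \<bar>t\<bar>)"
        by (rule norm_le_exp_of_deriv[OF D _ hd l]) (use L in auto)
      from exp_minus_mult_le[OF this] show "dist (apply_bcontfun (P y) t) (apply_bcontfun (P z) t) \<le> L / \<kappa> * dist y z"
        unfolding Pa P0_def by (simp add: dist_norm flip: scaleR_diff_right)
    qed
  qed
  moreover have "0 \<le> L / \<kappa>" "L / \<kappa> < 1" using L l by (auto simp: \<kappa>_def)
  ultimately obtain y where y: "P y = y"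
    using banach_fix_type[of "L / \<kappa>" P] by blast
  define x where "x t = x0 + exp (\<kappa> * \<bar>t\<bar>) *\<^sub>R apply_bcontfun y t" for t
  have xs: "x t = x0 + signed_integral (h y) t" for t
  proof -
    have "apply_bcontfun y t = P0 y t" using Pa[of y] y by simp
    then show ?thesis by (simp add: x_def P0_def exp_minus)
  qed
  have "(x has_vector_derivative h y t) (at t)" for t
    unfolding xs[abs_def] by (auto intro!: derivative_eq_intros signed_integral_deriv hc)
  moreover have "h y t = f (x t)" for t by (simp add: h_def x_def)
  moreover have "x 0 = x0" by (simp add: xs)
  ultimately show ?thesis by auto
qed

section \<open>Splitting finite spin chains into twists\<close>

text \<open>Bounded sequences indexed by the integers form a Banach space only once the integers carry a
  metric compatible with their discrete topology.\<close>

instantiation int :: metric_space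
begin

definition dist_int :: "int \<Rightarrow> int \<Rightarrow> real" where
  "dist_int m n = \<bar>real_of_int m - real_of_int n\<bar>"

definition uniformity_int :: "(int \<times> int) filter" where
  "uniformity_int = (INF e\<in>{0<..}. principal {(m, n). dist m n < e})"

instance
proof
  fix U :: "int set"
  have "\<forall>\<^sub>F (x', y) in uniformity. x' = x \<longrightarrow> y \<in> U" if "x \<in> U" for x
  proof -
    have "\<forall>\<^sub>F p in principal {(m, n :: int). dist m n < 1}. case p of (x', y) \<Rightarrow> x' = x \<longrightarrow> y \<in> U"
    proof -
      have "b = x" if "\<bar>real_of_int x - real_of_int b\<bar> < 1" for b using that by linarith
      then show ?thesis using that by (auto simp: eventually_principal dist_int_def)
    qed
    then show ?thesis
      unfolding uniformity_int_def by (rule eventually_INF1[rotated]) simp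
  qed
  then show "open U \<longleftrightarrow> (\<forall>x\<in>U. \<forall>\<^sub>F (x', y) in uniformity. x' = x \<longrightarrow> y \<in> U)"
    using Topological_Spaces.open_discrete[of U] by blast
qed (auto simp: dist_int_def uniformity_int_def)

end

instance bcontfun :: (metric_space, banach) banach ..

text \<open>A directed edge \<open>(n, m)\<close> turns spin \<open>n\<close> about spin
  \<open>m\<close> with angular velocity \<open>g (x n \<bullet> x m)\<close>. The edges form a list
  because the splitting applies them one after another.\<close>

definition edge_field :: "(real \<Rightarrow> real) \<Rightarrow> (int \<times> int) list \<Rightarrow> (int \<Rightarrow> real^3) \<Rightarrow> int \<Rightarrow> real^3" where
  "edge_field g es x n = (\<Sum>e\<leftarrow>es. if fst e = n then g (x n \<bullet> x (snd e)) *\<^sub>R (x (snd e) \<times> x n) else 0)"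

definition edge_sites :: "(int \<times> int) list \<Rightarrow> int set" where
  "edge_sites es = fst ` set es \<union> snd ` set es"

lemma norm_cross_le:
  fixes a b :: "real^3"
  shows "norm (a \<times> b) \<le> norm a * norm b"
proof (rule power2_le_imp_le)
  show "(norm (a \<times> b))\<^sup>2 \<le> (norm a * norm b)\<^sup>2"
    using norm_cross_dot[of a b] zero_le_power2[of "a \<bullet> b"] by linarith
qed simp

lemma cross_diff:
  fixes a b c d :: "real^3"
  shows "a \<times> b - c \<times> d = (a - c) \<times> b + c \<times> (b - d)"
  by (simp add: cross3_simps)

lemma inner_diff_le:
  fixes a b c d :: "real^3"
  assumes "norm b \<le> 1" "norm c \<le> 1" "norm (a - c) \<le> r" "norm (b - d) \<le> r"
  shows "\<bar>a \<bullet> b - c \<bullet> d\<bar> \<le> 2 * r"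
proof -
  have "a \<bullet> b - c \<bullet> d = (a - c) \<bullet> b + c \<bullet> (b - d)" by (simp add: algebra_simps)
  also have "\<bar>\<dots>\<bar> \<le> \<bar>(a - c) \<bullet> b\<bar> + \<bar>c \<bullet> (b - d)\<bar>" by (rule abs_triangle_ineq)
  also have "\<dots> \<le> norm (a - c) * norm b + norm c * norm (b - d)"
    by (intro add_mono Cauchy_Schwarz_ineq2)
  also have "\<dots> \<le> r * 1 + 1 * r"
    using assms by (intro add_mono mult_mono) (auto intro: order_trans[OF norm_ge_zero])
  finally show ?thesis by simp
qed

lemma cross_diff_le:
  fixes a b c d :: "real^3"
  assumes "norm b \<le> 1" "norm c \<le> 1" "norm (a - c) \<le> r" "norm (b - d) \<le> r"
  shows "norm (a \<times> b - c \<times> d) \<le> 2 * r"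
proof -
  have "norm (a \<times> b - c \<times> d) \<le> norm ((a - c) \<times> b) + norm (c \<times> (b - d))"
    unfolding cross_diff[of a b c d] by (rule norm_triangle_ineq)
  also have "\<dots> \<le> norm (a - c) * norm b + norm c * norm (b - d)"
    by (intro add_mono norm_cross_le)
  also have "\<dots> \<le> r * 1 + 1 * r"
    using assms by (intro add_mono mult_mono) (auto intro: order_trans[OF norm_ge_zero])
  finally show ?thesis by simp
qed

text \<open>A retraction onto the unit ball. The field is only locally Lipschitz; composition with
  \<open>clip\<close> makes it globally so, without effect on unit spins.\<close>

definition clip :: "real^3 \<Rightarrow> real^3" where
  "clip x = (1 / max 1 (norm x)) *\<^sub>R x"

lemma norm_clip: "norm (clip x) \<le> 1"
  by (simp add: clip_def divide_le_eq)

lemma clip_id: "norm x \<le> 1 \<Longrightarrow> clip x = x"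
  by (simp add: clip_def max_def)

lemma clip_diff_le: "norm (clip x - clip y) \<le> 2 * norm (x - y)"
proof -
  let ?a = "max 1 (norm x)" and ?b = "max 1 (norm y)"
  have "clip x - clip y = (1 / ?a) *\<^sub>R (x - y) + (1 / ?a - 1 / ?b) *\<^sub>R y"
    by (simp add: clip_def algebra_simps)
  then have "norm (clip x - clip y) \<le> (1 / ?a) * norm (x - y) + \<bar>1 / ?a - 1 / ?b\<bar> * norm y"
    by (metis (no_types, lifting) abs_of_nonneg divide_nonneg_nonneg max.coboundedI1 norm_scaleR norm_triangle_ineq zero_le_one)
  also have "(1 / ?a) * norm (x - y) \<le> 1 * norm (x - y)"
    by (intro mult_right_mono) auto
  also have "\<bar>1 / ?a - 1 / ?b\<bar> * norm y \<le> norm (x - y)"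
  proof -
    have "1 / ?a - 1 / ?b = (?b - ?a) / (?a * ?b)" by (simp add: field_simps)
    then have "\<bar>1 / ?a - 1 / ?b\<bar> * norm y = \<bar>?b - ?a\<bar> / ?a * (norm y / ?b)" by (simp add: abs_divide abs_mult)
    also have "\<dots> \<le> \<bar>?b - ?a\<bar> * 1"
      by (intro mult_mono) (auto simp: divide_le_eq mult_le_cancel_left1)
    also have "\<dots> \<le> norm (x - y)"
      using norm_triangle_ineq3[of x y] by (auto simp: max_def)
    finally show ?thesis .
  qed
  finally show ?thesis by simp
qed

text \<open>Assumptions that the singular coupling of the equation violates and that its cut-offs
  satisfy.\<close>

locale lipschitz_coupling =
  fixes g :: "real \<Rightarrow> real" and \<Gamma> L :: real
  assumes g_bound: "\<And>z. \<bar>g z\<bar> \<le> \<Gamma>" and g_lip: "\<And>y z. \<bar>g y - g z\<bar> \<le> L * \<bar>y - z\<bar>" and L_nonneg: "0 \<le> L"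
begin

lemma Gamma_nonneg: "0 \<le> \<Gamma>" using g_bound[of 0] by linarith

lemma g_cont: "continuous_on S g"
proof -
  have "L-lipschitz_on UNIV g" using g_lip L_nonneg by (auto simp: lipschitz_on_def dist_real_def)
  then have "continuous_on UNIV g" by (rule lipschitz_on_continuous_on)
  then show ?thesis by (rule continuous_on_subset) simp
qed

lemma edge_diff_le:
  fixes a b c d :: "real^3"
  assumes "norm a \<le> 1" "norm b \<le> 1" "norm c \<le> 1" "norm d \<le> 1" and r: "norm (a - c) \<le> r" "norm (b - d) \<le> r"
  shows "norm (g (a \<bullet> b) *\<^sub>R (b \<times> a) - g (c \<bullet> d) *\<^sub>R (d \<times> c)) \<le> 2 * (L + \<Gamma>) * r"
proof -
  have r0: "0 \<le> r" using r(1) norm_ge_zero order_trans by blast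
  have ba: "norm (b \<times> a) \<le> 1" using norm_cross_le[of b a] assms(1,2) mult_le_one[of "norm b" "norm a"] by auto
  have "g (a \<bullet> b) *\<^sub>R (b \<times> a) - g (c \<bullet> d) *\<^sub>R (d \<times> c) =
      (g (a \<bullet> b) - g (c \<bullet> d)) *\<^sub>R (b \<times> a) + g (c \<bullet> d) *\<^sub>R (b \<times> a - d \<times> c)"
    by (simp add: algebra_simps scaleR_diff_left scaleR_diff_right)
  then have "norm (g (a \<bullet> b) *\<^sub>R (b \<times> a) - g (c \<bullet> d) *\<^sub>R (d \<times> c)) \<le>
      \<bar>g (a \<bullet> b) - g (c \<bullet> d)\<bar> * norm (b \<times> a) + \<bar>g (c \<bullet> d)\<bar> * norm (b \<times> a - d \<times> c)"
    by (metis norm_scaleR norm_triangle_ineq)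
  also have "\<dots> \<le> (L * (2 * r)) * 1 + \<Gamma> * (2 * r)"
  proof (intro add_mono mult_mono)
    have "\<bar>g (a \<bullet> b) - g (c \<bullet> d)\<bar> \<le> L * \<bar>a \<bullet> b - c \<bullet> d\<bar>" by (rule g_lip)
    also have "\<dots> \<le> L * (2 * r)" using assms by (intro mult_left_mono inner_diff_le L_nonneg) auto
    finally show "\<bar>g (a \<bullet> b) - g (c \<bullet> d)\<bar> \<le> L * (2 * r)" .
    show "norm (b \<times> a - d \<times> c) \<le> 2 * r" using assms by (intro cross_diff_le) auto
  qed (use r0 L_nonneg Gamma_nonneg ba g_bound in auto)
  finally show ?thesis by (simp add: algebra_simps)
qed

lemma edge_field_diff_le:
  assumes "\<And>n. n \<in> edge_sites es \<Longrightarrow> norm (x n) \<le> 1 \<and> norm (y n) \<le> 1 \<and> norm (x n - y n) \<le> r" and r0: "0 \<le> r"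
  shows "norm (edge_field g es x n - edge_field g es y n) \<le> real (length es) * (2 * (L + \<Gamma>)) * r"
  using assms(1)
proof (induction es)
  case Nil
  then show ?case by (simp add: edge_field_def)
next
  case (Cons e es)
  let ?E = "\<lambda>x. if fst e = n then g (x n \<bullet> x (snd e)) *\<^sub>R (x (snd e) \<times> x n) else 0"
  have "norm (?E x - ?E y) \<le> 2 * (L + \<Gamma>) * r"
  proof (cases "fst e = n")
    case True
    then show ?thesis
      using Cons.prems[of n] Cons.prems[of "snd e"] edge_diff_le[of "x n" "x (snd e)" "y n" "y (snd e)" r]
      by (simp add: edge_sites_def)
  qed (use r0 L_nonneg Gamma_nonneg in simp)
  moreover have "norm (edge_field g es x n - edge_field g es y n) \<le> real (length es) * (2 * (L + \<Gamma>)) * r"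
    using Cons.prems by (intro Cons.IH) (auto simp: edge_sites_def)
  moreover have "edge_field g (e # es) x n - edge_field g (e # es) y n =
     (?E x - ?E y) + (edge_field g es x n - edge_field g es y n)"
    by (simp add: edge_field_def)
  ultimately have "norm (edge_field g (e # es) x n - edge_field g (e # es) y n) \<le>
      2 * (L + \<Gamma>) * r + real (length es) * (2 * (L + \<Gamma>)) * r"
    by (metis add_mono norm_triangle_mono)
  then show ?case by (simp add: algebra_simps)
qed

lemma edge_field_bound:
  assumes "\<And>n. n \<in> edge_sites es \<Longrightarrow> norm (x n) \<le> 1"
  shows "norm (edge_field g es x n) \<le> real (length es) * \<Gamma>"
  using assms
proof (induction es)
  case Nil
  then show ?case by (simp add: edge_field_def)
next
  case (Cons e es)
  let ?E = "if fst e = n then g (x n \<bullet> x (snd e)) *\<^sub>R (x (snd e) \<times> x n) else 0"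
  have "norm ?E \<le> \<Gamma>"
  proof (cases "fst e = n")
    case True
    have "norm (x (snd e) \<times> x n) \<le> 1"
      using norm_cross_le[of "x (snd e)" "x n"] Cons.prems[of n] Cons.prems[of "snd e"] True mult_le_one[of "norm (x (snd e))" "norm (x n)"]
      by (auto simp: edge_sites_def)
    then show ?thesis using mult_mono[OF g_bound[of "x n \<bullet> x (snd e)"], of "norm (x (snd e) \<times> x n)" 1] True Gamma_nonneg by simp
  qed (use Gamma_nonneg in simp)
  moreover have "norm (edge_field g es x n) \<le> real (length es) * \<Gamma>"
    using Cons.prems by (intro Cons.IH) (auto simp: edge_sites_def)
  moreover have "edge_field g (e # es) x n = ?E + edge_field g es x n"
    by (simp add: edge_field_def)
  ultimately have "norm (edge_field g (e # es) x n) \<le> \<Gamma> + real (length es) * \<Gamma>"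
    by (metis add_mono norm_triangle_mono)
  then show ?case by (simp add: algebra_simps)
qed

end

lemma bounded_linear_apply_bcontfun: "bounded_linear (\<lambda>x. apply_bcontfun x n)"
  by (rule bounded_linear_intro[where K=1]) (auto simp: plus_bcontfun.rep_eq scaleR_bcontfun.rep_eq norm_bounded)

text \<open>Unit length is required only on the sites of the edges; other sites do not move and may
  hold arbitrary vectors, such as the value \<open>undefined\<close> outside a block.\<close>

definition spin_trajectory :: "(real \<Rightarrow> real) \<Rightarrow> (int \<times> int) list \<Rightarrow> (real \<Rightarrow> int \<Rightarrow> real^3) \<Rightarrow> bool" where
  "spin_trajectory g es X \<longleftrightarrow>
    (\<forall>t n. ((\<lambda>t. X t n) has_vector_derivative edge_field g es (X t) n) (at t)) \<and>
    (\<forall>t. \<forall>n\<in>edge_sites es. norm (X t n) = 1)"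

lemma edge_field_outside: "n \<notin> fst ` set es \<Longrightarrow> edge_field g es x n = 0"
  by (induction es) (auto simp: edge_field_def)

lemma edge_field_cong: "(\<And>n. n \<in> edge_sites es \<Longrightarrow> x n = y n) \<Longrightarrow> edge_field g es x n = edge_field g es y n"
  unfolding edge_field_def
proof (rule arg_cong[where f=sum_list], rule map_cong[OF refl])
  fix e assume eq: "\<And>n. n \<in> edge_sites es \<Longrightarrow> x n = y n" and e: "e \<in> set es"
  have "x (fst e) = y (fst e)" "x (snd e) = y (snd e)" using e by (auto intro!: eq simp: edge_sites_def)
  then show "(if fst e = n then g (x n \<bullet> x (snd e)) *\<^sub>R (x (snd e) \<times> x n) else 0) =
      (if fst e = n then g (y n \<bullet> y (snd e)) *\<^sub>R (y (snd e) \<times> y n) else 0)" by auto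
qed

context lipschitz_coupling
begin

text \<open>The clipped field is bounded and globally Lipschitz on bounded sequences, so a global
  solution exists. Clipping rescales a spin without turning it; hence the field at a site is still
  orthogonal to the spin there, lengths are conserved, and along the solution the clip acts as the
  identity.\<close>

theorem spin_trajectory_exists:
  assumes x0: "\<And>n. n \<in> edge_sites es \<Longrightarrow> norm (x0 n) = 1"
  shows "\<exists>X. X 0 = x0 \<and> spin_trajectory g es X"
proof -
  define F where "F x = (\<lambda>n. edge_field g es (\<lambda>n. clip (apply_bcontfun x n)) n)" for x :: "int \<Rightarrow>\<^sub>C (real^3)"
  have FB: "F x \<in> bcontfun" for x
    by (rule bcontfun_normI[where b="real (length es) * \<Gamma>"])
      (auto simp: F_def intro!: edge_field_bound norm_clip continuous_on_discrete)
  define f where "f x = Bcontfun (F x)" for x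
  have fa: "apply_bcontfun (f x) = F x" for x
    unfolding f_def by (rule Bcontfun_inverse[OF FB])
  define \<Lambda> where "\<Lambda> = real (length es) * (2 * (L + \<Gamma>)) * 2"
  have lip: "norm (f x - f y) \<le> \<Lambda> * norm (x - y)" for x y
  proof -
    have "dist (f x) (f y) \<le> \<Lambda> * norm (x - y)"
    proof (rule dist_bound)
      fix n
      have "norm (edge_field g es (\<lambda>n. clip (apply_bcontfun x n)) n - edge_field g es (\<lambda>n. clip (apply_bcontfun y n)) n)
          \<le> real (length es) * (2 * (L + \<Gamma>)) * (2 * norm (x - y))"
      proof (rule edge_field_diff_le)
        fix n
        have "norm (clip (apply_bcontfun x n) - clip (apply_bcontfun y n)) \<le> 2 * norm (apply_bcontfun x n - apply_bcontfun y n)"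
          by (rule clip_diff_le)
        also have "norm (apply_bcontfun x n - apply_bcontfun y n) \<le> norm (x - y)"
          using norm_bounded[of "x - y" n] by simp
        finally show "norm (clip (apply_bcontfun x n)) \<le> 1 \<and> norm (clip (apply_bcontfun y n)) \<le> 1 \<and>
           norm (clip (apply_bcontfun x n) - clip (apply_bcontfun y n)) \<le> 2 * norm (x - y)"
          by (simp add: norm_clip)
      qed simp
      then show "dist (apply_bcontfun (f x) n) (apply_bcontfun (f y) n) \<le> \<Lambda> * norm (x - y)"
        unfolding fa F_def dist_norm \<Lambda>_def by (simp add: algebra_simps)
    qed
    then show ?thesis by (simp add: dist_norm)
  qed
  define y0 where "y0 = Bcontfun (\<lambda>n. if n \<in> edge_sites es then x0 n else 0)"
  have "(\<lambda>n. if n \<in> edge_sites es then x0 n else 0) \<in> bcontfun"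
    by (rule bcontfun_normI[where b=1]) (use x0 in \<open>auto intro!: continuous_on_discrete\<close>)
  then have y0: "apply_bcontfun y0 = (\<lambda>n. if n \<in> edge_sites es then x0 n else 0)"
    unfolding y0_def by (rule Bcontfun_inverse)
  have "0 \<le> \<Lambda>" unfolding \<Lambda>_def using L_nonneg Gamma_nonneg by simp
  from global_ode_exists[OF this lip, of y0] obtain z where z0: "z 0 = y0"
    and z: "\<And>t. (z has_vector_derivative f (z t)) (at t)" by blast
  have zn: "((\<lambda>t. apply_bcontfun (z t) n) has_vector_derivative F (z t) n) (at t)" for n t
    using bounded_linear.has_vector_derivative[OF bounded_linear_apply_bcontfun z, of n t] by (simp add: fa)
  have ortho: "apply_bcontfun x n \<bullet> F x n = 0" for x n
  proof -
    have "apply_bcontfun x n \<bullet> (a \<times> clip (apply_bcontfun x n)) = 0" for a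
      by (simp add: clip_def cross_mult_right dot_cross_self)
    then show ?thesis
      unfolding F_def edge_field_def by (induction es) (auto simp: inner_add_right)
  qed
  have nrm: "norm (apply_bcontfun (z t) n) = 1" if n: "n \<in> edge_sites es" for t n
  proof -
    have "((\<lambda>t. apply_bcontfun (z t) n \<bullet> apply_bcontfun (z t) n) has_real_derivative 0) (at t)" for t
    proof -
      have "((\<lambda>t. apply_bcontfun (z t) n \<bullet> apply_bcontfun (z t) n) has_vector_derivative
          (apply_bcontfun (z t) n \<bullet> F (z t) n + F (z t) n \<bullet> apply_bcontfun (z t) n)) (at t)"
        by (rule bounded_bilinear.has_vector_derivative[OF bounded_bilinear_inner zn zn])
      then show ?thesis
        using ortho[of "z t" n] by (simp add: inner_commute has_real_derivative_iff_has_vector_derivative)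
    qed
    then have "apply_bcontfun (z t) n \<bullet> apply_bcontfun (z t) n = apply_bcontfun (z 0) n \<bullet> apply_bcontfun (z 0) n"
      using DERIV_isconst_all by blast
    also have "\<dots> = 1" using n x0[OF n] by (simp add: z0 y0 dot_square_norm)
    finally show ?thesis by (simp add: norm_eq_sqrt_inner)
  qed
  \<comment> \<open>The bounded sequence was set to 0 off the edge sites, where the datum is not
    assumed bounded; the datum is put back here.\<close>
  define X where "X t n = (if n \<in> edge_sites es then apply_bcontfun (z t) n else x0 n)" for t n
  have Fe: "F (z t) n = edge_field g es (X t) n" for t n
    unfolding F_def using nrm by (intro edge_field_cong) (simp add: X_def clip_id)
  have "((\<lambda>t. X t n) has_vector_derivative edge_field g es (X t) n) (at t)" for t n
  proof (cases "n \<in> edge_sites es")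
    case True
    then show ?thesis using zn[of n t] unfolding Fe by (simp add: X_def)
  next
    case False
    then have "edge_field g es (X t) n = 0" by (intro edge_field_outside) (auto simp: edge_sites_def)
    then show ?thesis using False by (simp add: X_def)
  qed
  moreover have "norm (X t n) = 1" if "n \<in> edge_sites es" for t n
    using nrm[OF that] that by (simp add: X_def)
  moreover have "X 0 = x0" by (rule ext) (simp add: X_def z0 y0)
  ultimately show ?thesis unfolding spin_trajectory_def by blast
qed

end


section \<open>Convergence of compositions of twists\<close>

definition twist :: "(real \<Rightarrow> real) \<Rightarrow> real \<Rightarrow> int \<times> int \<Rightarrow> (int \<Rightarrow> real^3) \<Rightarrow> int \<Rightarrow> real^3" where
  "twist g h e x = x(fst e := rot (x (snd e)) (h * g (x (fst e) \<bullet> x (snd e))) (x (fst e)))"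

text \<open>Lie splitting of the edge field. A twist is the exact flow of one directed edge: with
  the axis spin held fixed the inner product is conserved, so the angular velocity is constant in
  time.\<close>

definition sweep :: "(real \<Rightarrow> real) \<Rightarrow> (int \<times> int) list \<Rightarrow> real \<Rightarrow> (int \<Rightarrow> real^3) \<Rightarrow> int \<Rightarrow> real^3" where
  "sweep g es h = fold (twist g h) es"

lemma sweep_Nil: "sweep g [] h x = x" and sweep_Cons: "sweep g (e # es) h x = sweep g es h (twist g h e x)"
  by (simp_all add: sweep_def)

lemma norm_triangle3: "norm (a + b + c) \<le> norm a + norm b + norm c" for a b c :: "'a::real_normed_vector"
  by (intro order_trans[OF norm_triangle_ineq] add_right_mono norm_triangle_ineq)

text \<open>Taylor bounds for the rotation, from
  \<open>1 - cos \<phi> \<le> \<phi>\<^sup>2 / 2\<close> and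
  \<open>\<bar>sin \<phi> - \<phi>\<bar> \<le> \<phi>\<^sup>2\<close>. The second one makes the
  local error of a twist quadratic in the step.\<close>

lemma rot_diff_bounds:
  assumes e: "norm e = 1" and s: "norm s = 1"
  shows "norm (rot e \<phi> s - s) \<le> 3 * \<bar>\<phi>\<bar>" "norm (rot e \<phi> s - s - \<phi> *\<^sub>R (e \<times> s)) \<le> 2 * \<phi>\<^sup>2"
proof -
  have es: "norm (e \<times> s) \<le> 1" using norm_cross_le[of e s] e s by simp
  have eds: "\<bar>e \<bullet> s\<bar> \<le> 1" using Cauchy_Schwarz_ineq2[of e s] e s by simp
  have c1: "\<bar>1 - cos \<phi>\<bar> \<le> \<phi>\<^sup>2 / 2"
  proof -
    have "1 - cos \<phi> = 2 * (sin (\<phi> / 2))\<^sup>2" using cos_double_sin[of "\<phi> / 2"] by simp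
    moreover have "(sin (\<phi> / 2))\<^sup>2 \<le> (\<phi> / 2)\<^sup>2"
      using abs_sin_x_le_abs_x[of "\<phi> / 2"] by (metis abs_le_square_iff)
    ultimately show ?thesis by (simp add: power2_eq_square)
  qed
  have c2: "\<bar>1 - cos \<phi>\<bar> \<le> \<bar>\<phi>\<bar>"
  proof (cases "\<bar>\<phi>\<bar> \<le> 2")
    case True
    have "\<phi>\<^sup>2 / 2 = \<bar>\<phi>\<bar> * \<bar>\<phi>\<bar> / 2" by (simp add: power2_eq_square)
    also have "\<dots> \<le> \<bar>\<phi>\<bar> * 2 / 2" using True by (intro divide_right_mono mult_left_mono) auto
    finally show ?thesis using c1 by simp
  next
    case False
    then show ?thesis using cos_ge_minus_one[of \<phi>] cos_le_one[of \<phi>] by linarith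
  qed
  have s1: "\<bar>sin \<phi>\<bar> \<le> \<bar>\<phi>\<bar>" by (rule abs_sin_x_le_abs_x)
  have s2: "\<bar>sin \<phi> - \<phi>\<bar> \<le> \<phi>\<^sup>2"
  proof -
    have key: "\<bar>sin z - z\<bar> \<le> z\<^sup>2" if z: "z \<ge> 0" for z :: real
    proof -
      have "norm ((sin z - z) - (sin 0 - 0)) \<le> z\<^sup>2 - 0\<^sup>2"
      proof (rule norm_diff_le_of_deriv[where f="\<lambda>z. sin z - z" and p="\<lambda>z. z\<^sup>2" and f'="\<lambda>z. cos z - 1" and p'="\<lambda>z. 2 * z"])
        fix y assume y: "y \<in> {0..z}"
        show "((\<lambda>z. sin z - z) has_vector_derivative cos y - 1) (at y)"
          unfolding has_real_derivative_iff_has_vector_derivative[symmetric]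
          by (auto intro!: derivative_eq_intros)
        show "((\<lambda>z. z\<^sup>2) has_real_derivative 2 * y) (at y)" by (auto intro!: derivative_eq_intros)
        have "\<bar>cos y - 1\<bar> \<le> 2 * y"
        proof -
          have "1 - cos y = 2 * (sin (y / 2))\<^sup>2" using cos_double_sin[of "y / 2"] by simp
          moreover have "(sin (y / 2))\<^sup>2 \<le> \<bar>sin (y/2)\<bar>"
            using mult_left_le[of "\<bar>sin (y/2)\<bar>" "\<bar>sin (y/2)\<bar>"] by (simp add: power2_eq_square abs_mult[symmetric])
          moreover have "\<bar>sin (y/2)\<bar> \<le> \<bar>y/2\<bar>" by (rule abs_sin_x_le_abs_x)
          moreover have "\<bar>y / 2\<bar> = y / 2" using y by simp
          moreover have "\<bar>cos y - 1\<bar> = 1 - cos y" using cos_le_one[of y] by simp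
          ultimately show ?thesis using y by simp
        qed
        then show "norm (cos y - 1) \<le> 2 * y" by simp
      qed (rule z)
      then show ?thesis by simp
    qed
    show ?thesis
    proof (cases "\<phi> \<ge> 0")
      case False
      then show ?thesis using key[of "- \<phi>"] by (simp add: abs_minus_commute)
    qed (rule key)
  qed
  have "rot e \<phi> s - s = (sin \<phi>) *\<^sub>R (e \<times> s) + ((1 - cos \<phi>) * (e \<bullet> s)) *\<^sub>R e + (- (1 - cos \<phi>)) *\<^sub>R s"
    by (simp add: rot_def algebra_simps)
  then have "norm (rot e \<phi> s - s) \<le> norm ((sin \<phi>) *\<^sub>R (e \<times> s)) + norm (((1 - cos \<phi>) * (e \<bullet> s)) *\<^sub>R e) + norm ((- (1 - cos \<phi>)) *\<^sub>R s)"
    by (simp only: norm_triangle3)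
  also have "\<dots> \<le> \<bar>\<phi>\<bar> * 1 + \<bar>\<phi>\<bar> * 1 + \<bar>\<phi>\<bar> * 1"
    unfolding norm_scaleR abs_mult abs_minus_cancel e s
    using s1 c2 es eds mult_mono[OF c2 eds] by (intro add_mono mult_mono) auto
  finally show "norm (rot e \<phi> s - s) \<le> 3 * \<bar>\<phi>\<bar>" by simp
  have "rot e \<phi> s - s - \<phi> *\<^sub>R (e \<times> s) = (sin \<phi> - \<phi>) *\<^sub>R (e \<times> s) + ((1 - cos \<phi>) * (e \<bullet> s)) *\<^sub>R e + (- (1 - cos \<phi>)) *\<^sub>R s"
    by (simp add: rot_def algebra_simps)
  then have "norm (rot e \<phi> s - s - \<phi> *\<^sub>R (e \<times> s)) \<le> norm ((sin \<phi> - \<phi>) *\<^sub>R (e \<times> s)) + norm (((1 - cos \<phi>) * (e \<bullet> s)) *\<^sub>R e) + norm ((- (1 - cos \<phi>)) *\<^sub>R s)"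
    by (simp only: norm_triangle3)
  also have "\<dots> \<le> \<phi>\<^sup>2 * 1 + \<phi>\<^sup>2 / 2 * 1 + \<phi>\<^sup>2 / 2 * 1"
    unfolding norm_scaleR abs_mult abs_minus_cancel e s
    using s2 c1 es eds mult_mono[OF c1 eds] by (intro add_mono mult_mono) auto
  finally show "norm (rot e \<phi> s - s - \<phi> *\<^sub>R (e \<times> s)) \<le> 2 * \<phi>\<^sup>2" by simp
qed

lemma norm_twist: 
  assumes "\<And>n. n \<in> A \<Longrightarrow> norm (x n) = 1" "fst e \<in> A" "snd e \<in> A" "n \<in> A"
  shows "norm (twist g h e x n) = 1"
  using assms by (simp add: twist_def)

lemma norm_sweep:
  assumes "\<And>n. n \<in> A \<Longrightarrow> norm (x n) = 1" "edge_sites es \<subseteq> A" "n \<in> A"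
  shows "norm (sweep g es h x n) = 1"
  using assms
proof (induction es arbitrary: x)
  case (Cons e es)
  have "norm (twist g h e x m) = 1" if "m \<in> A" for m
    using Cons.prems that by (intro norm_twist[where A=A]) (auto simp: edge_sites_def)
  then show ?case unfolding sweep_Cons using Cons.prems by (intro Cons.IH) (auto simp: edge_sites_def)
qed (simp add: sweep_Nil)

context lipschitz_coupling
begin

lemma twist_diff_bounds:
  assumes "norm (x (fst e)) = 1" "norm (x (snd e)) = 1"
  shows "norm (twist g h e x n - x n) \<le> 3 * \<Gamma> * \<bar>h\<bar>"
    "norm (twist g h e x n - x n - h *\<^sub>R edge_field g [e] x n) \<le> 2 * \<Gamma>\<^sup>2 * h\<^sup>2"
proof -
  let ?\<phi> = "h * g (x (fst e) \<bullet> x (snd e))"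
  have p: "\<bar>?\<phi>\<bar> \<le> \<Gamma> * \<bar>h\<bar>" unfolding abs_mult using mult_left_mono[OF g_bound[of "x (fst e) \<bullet> x (snd e)"], of "\<bar>h\<bar>"] by (simp add: mult.commute)
  then have "\<bar>?\<phi>\<bar>\<^sup>2 \<le> (\<Gamma> * \<bar>h\<bar>)\<^sup>2" by (intro power_mono) auto
  then have p2: "?\<phi>\<^sup>2 \<le> \<Gamma>\<^sup>2 * h\<^sup>2" by (simp add: power_mult_distrib)
  show "norm (twist g h e x n - x n) \<le> 3 * \<Gamma> * \<bar>h\<bar>"
  proof (cases "n = fst e")
    case True
    then show ?thesis using order_trans[OF rot_diff_bounds(1)[OF assms(2,1), of ?\<phi>]] p by (simp add: twist_def)
  qed (use Gamma_nonneg in \<open>simp add: twist_def\<close>)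
  show "norm (twist g h e x n - x n - h *\<^sub>R edge_field g [e] x n) \<le> 2 * \<Gamma>\<^sup>2 * h\<^sup>2"
  proof (cases "n = fst e")
    case True
    then show ?thesis using order_trans[OF rot_diff_bounds(2)[OF assms(2,1), of ?\<phi>]] p2
      by (simp add: twist_def edge_field_def)
  qed (simp add: twist_def edge_field_def)
qed

text \<open>Induction on the edges: the remaining edges see a configuration already twisted by the
  first one. Moving it by \<open>O(h)\<close> changes their field by \<open>O(h)\<close>, which is
  multiplied by \<open>h\<close> once more. The unit spins are prescribed on a fixed set
  \<open>A\<close>, since the induction shortens the list while the earlier twists involve further
  sites.\<close>

lemma sweep_local_error:
  "\<exists>C\<ge>0. \<forall>h x n. (\<forall>i\<in>A. norm (x i) = 1) \<longrightarrow> edge_sites es \<subseteq> A \<longrightarrow>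
     norm (sweep g es h x n - x n - h *\<^sub>R edge_field g es x n) \<le> C * h\<^sup>2"
proof (induction es)
  case Nil
  then show ?case by (intro exI[of _ 0]) (simp add: sweep_Nil edge_field_def)
next
  case (Cons e es)
  then obtain C where C: "C \<ge> 0" "\<And>h x n. (\<forall>i\<in>A. norm (x i) = 1) \<Longrightarrow> edge_sites es \<subseteq> A \<Longrightarrow>
     norm (sweep g es h x n - x n - h *\<^sub>R edge_field g es x n) \<le> C * h\<^sup>2" by auto
  let ?D = "real (length es) * (2 * (L + \<Gamma>)) * (3 * \<Gamma>)"
  show ?case
  proof (intro exI[of _ "C + 2 * \<Gamma>\<^sup>2 + ?D"] conjI allI impI)
    show "0 \<le> C + 2 * \<Gamma>\<^sup>2 + ?D" using C(1) L_nonneg Gamma_nonneg by simp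
    fix h x n assume x: "\<forall>i\<in>A. norm (x i :: real^3) = 1" and A: "edge_sites (e # es) \<subseteq> A"
    let ?y = "twist g h e x"
    have eA: "fst e \<in> A" "snd e \<in> A" "edge_sites es \<subseteq> A" using A by (auto simp: edge_sites_def)
    have y: "\<forall>i\<in>A. norm (?y i) = 1" using norm_twist[of A x e] x eA by auto
    have a: "norm (sweep g es h ?y n - ?y n - h *\<^sub>R edge_field g es ?y n) \<le> C * h\<^sup>2" by (rule C(2)[OF y eA(3)])
    have b: "norm (?y n - x n - h *\<^sub>R edge_field g [e] x n) \<le> 2 * \<Gamma>\<^sup>2 * h\<^sup>2" using x eA by (intro twist_diff_bounds) auto
    have c: "norm (h *\<^sub>R (edge_field g es ?y n - edge_field g es x n)) \<le> ?D * h\<^sup>2"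
    proof -
      have "norm (edge_field g es ?y n - edge_field g es x n) \<le> real (length es) * (2 * (L + \<Gamma>)) * (3 * \<Gamma> * \<bar>h\<bar>)"
      proof (rule edge_field_diff_le)
        fix m assume "m \<in> edge_sites es"
        then have "m \<in> A" using eA by auto
        then show "norm (?y m) \<le> 1 \<and> norm (x m) \<le> 1 \<and> norm (?y m - x m) \<le> 3 * \<Gamma> * \<bar>h\<bar>"
          using x y twist_diff_bounds(1)[of x e h m] eA by auto
      qed (use Gamma_nonneg in simp)
      then have "\<bar>h\<bar> * norm (edge_field g es ?y n - edge_field g es x n) \<le> \<bar>h\<bar> * (real (length es) * (2 * (L + \<Gamma>)) * (3 * \<Gamma> * \<bar>h\<bar>))"
        by (intro mult_left_mono) auto
      also have "\<dots> = ?D * (\<bar>h\<bar> * \<bar>h\<bar>)" by (simp only: mult_ac)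
      finally show ?thesis by (simp add: power2_eq_square)
    qed
    have "sweep g (e # es) h x n - x n - h *\<^sub>R edge_field g (e # es) x n =
       (sweep g es h ?y n - ?y n - h *\<^sub>R edge_field g es ?y n) + (?y n - x n - h *\<^sub>R edge_field g [e] x n)
       + h *\<^sub>R (edge_field g es ?y n - edge_field g es x n)"
      by (simp add: sweep_Cons edge_field_def scaleR_add_right scaleR_diff_right)
    also have "norm \<dots> \<le> C * h\<^sup>2 + 2 * \<Gamma>\<^sup>2 * h\<^sup>2 + ?D * h\<^sup>2"
      by (intro order_trans[OF norm_triangle_ineq] add_mono a b c)
    finally show "norm (sweep g (e # es) h x n - x n - h *\<^sub>R edge_field g (e # es) x n) \<le> (C + 2 * \<Gamma>\<^sup>2 + ?D) * h\<^sup>2"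
      by (simp add: distrib_right)
  qed
qed

lemma norm_step_le:
  fixes f :: "real \<Rightarrow> 'a::real_normed_vector"
  assumes f: "\<And>s. (f has_vector_derivative f' s) (at s)" and le: "\<And>s. \<bar>s - a\<bar> \<le> \<bar>b - a\<bar> \<Longrightarrow> norm (f' s) \<le> M"
  shows "norm (f b - f a) \<le> M * \<bar>b - a\<bar>"
proof (cases "a \<le> b")
  case True
  have "norm (f b - f a) \<le> M * b - M * a"
    using True le by (intro norm_diff_le_of_deriv[where p'="\<lambda>_. M" and f'=f'] f) (auto intro!: derivative_eq_intros)
  then show ?thesis using True by (simp add: algebra_simps)
next
  case False
  have "norm (f a - f b) \<le> M * a - M * b"
    using False le by (intro norm_diff_le_of_deriv[where p'="\<lambda>_. M" and f'=f'] f) (auto intro!: derivative_eq_intros)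
  then show ?thesis using False by (simp add: algebra_simps norm_minus_commute)
qed

lemma trajectory_local_error:
  assumes X: "spin_trajectory g es X"
  shows "norm (X (t + h) n - X t n - h *\<^sub>R edge_field g es (X t) n) \<le> (real (length es) * (2 * (L + \<Gamma>)) * (real (length es) * \<Gamma>)) * h\<^sup>2"
proof -
  have d: "((\<lambda>t. X t n) has_vector_derivative edge_field g es (X t) n) (at t)" for t n
    using X by (simp add: spin_trajectory_def)
  have nX: "norm (X t n) = 1" if "n \<in> edge_sites es" for t n using X that by (simp add: spin_trajectory_def)
  have eb: "norm (edge_field g es (X s) m) \<le> real (length es) * \<Gamma>" for s m
    using nX by (intro edge_field_bound) auto
  have lip: "norm (X s m - X t m) \<le> real (length es) * \<Gamma> * \<bar>s - t\<bar>" for s m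
    by (rule norm_step_le[OF d]) (rule eb)
  let ?f = "\<lambda>s. X s n - s *\<^sub>R edge_field g es (X t) n"
  have "norm (?f (t + h) - ?f t) \<le> (real (length es) * (2 * (L + \<Gamma>)) * (real (length es) * \<Gamma> * \<bar>h\<bar>)) * \<bar>t + h - t\<bar>"
  proof (rule norm_step_le)
    fix s
    show "(?f has_vector_derivative (edge_field g es (X s) n - edge_field g es (X t) n)) (at s)"
      by (auto intro!: derivative_eq_intros d)
    assume s: "\<bar>s - t\<bar> \<le> \<bar>t + h - t\<bar>"
    show "norm (edge_field g es (X s) n - edge_field g es (X t) n) \<le> real (length es) * (2 * (L + \<Gamma>)) * (real (length es) * \<Gamma> * \<bar>h\<bar>)"
    proof (rule edge_field_diff_le)
      fix m assume m: "m \<in> edge_sites es"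
      have "real (length es) * \<Gamma> * \<bar>s - t\<bar> \<le> real (length es) * \<Gamma> * \<bar>h\<bar>"
        using s Gamma_nonneg by (intro mult_left_mono) auto
      then show "norm (X s m) \<le> 1 \<and> norm (X t m) \<le> 1 \<and> norm (X s m - X t m) \<le> real (length es) * \<Gamma> * \<bar>h\<bar>"
        using lip[of s m] nX[OF m] by simp
    qed (use Gamma_nonneg in simp)
  qed
  moreover have "?f (t + h) - ?f t = X (t + h) n - X t n - h *\<^sub>R edge_field g es (X t) n"
    by (simp add: algebra_simps)
  ultimately show ?thesis by (simp add: power2_eq_square mult_ac)
qed

text \<open>Consistency and stability: both the sweep and the trajectory deviate from an Euler step
  by \<open>O(h\<^sup>2)\<close>, errors are amplified by at most
  \<open>exp (\<Lambda> * \<bar>h\<bar>)\<close> per step, and \<open>Suc k\<close> steps of size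
  \<open>t / real (Suc k)\<close> accumulate an error of order
  \<open>1 / real (Suc k)\<close>.\<close>

theorem sweep_tendsto_trajectory:
  assumes X: "spin_trajectory g es X"
  shows "(\<lambda>k. (sweep g es (t / real (Suc k)) ^^ Suc k) (X 0) n) \<longlonglongrightarrow> X t n"
proof -
  let ?A = "edge_sites es"
  obtain C where C: "C \<ge> 0" "\<And>h x n. (\<forall>i\<in>?A. norm (x i) = 1) \<Longrightarrow> ?A \<subseteq> ?A \<Longrightarrow>
     norm (sweep g es h x n - x n - h *\<^sub>R edge_field g es x n) \<le> C * h\<^sup>2"
    using sweep_local_error[of ?A es] by auto
  define C' where "C' = real (length es) * (2 * (L + \<Gamma>)) * (real (length es) * \<Gamma>)"
  define \<Lambda> where "\<Lambda> = real (length es) * (2 * (L + \<Gamma>))"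
  have c0: "0 \<le> C'" "0 \<le> \<Lambda>" unfolding C'_def \<Lambda>_def using L_nonneg Gamma_nonneg by auto
  have nX: "norm (X t n) = 1" if "n \<in> ?A" for t n using X that by (simp add: spin_trajectory_def)
  \<comment> \<open>The induction also carries the unit length of the swept spins, because the
    Lipschitz estimate of the field is available on the unit ball only.\<close>
  have err: "(\<forall>i\<in>?A. norm ((sweep g es h ^^ j) (X 0) i) = 1) \<and>
     (\<forall>n. norm ((sweep g es h ^^ j) (X 0) n - X (real j * h) n) \<le> real j * ((C + C') * h\<^sup>2) * exp (real j * (\<Lambda> * \<bar>h\<bar>)))" for h j
  proof (induction j)
    case 0
    then show ?case using nX by simp
  next
    case (Suc j)
    let ?x = "(sweep g es h ^^ j) (X 0)" and ?t = "real j * h"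
    define E where "E = real j * ((C + C') * h\<^sup>2) * exp (real j * (\<Lambda> * \<bar>h\<bar>))"
    have E0: "0 \<le> E" unfolding E_def using C(1) c0 by simp
    have nx: "\<forall>i\<in>?A. norm (?x i) = 1" using Suc by blast
    have IH: "norm (?x n - X ?t n) \<le> E" for n using Suc unfolding E_def by blast
    have S: "(sweep g es h ^^ Suc j) (X 0) = sweep g es h ?x" by simp
    have tt: "real (Suc j) * h = ?t + h" by (simp add: algebra_simps)
    have n1: "\<forall>i\<in>?A. norm (sweep g es h ?x i) = 1"
      using nx norm_sweep[of ?A ?x es _ g h] by auto
    have "norm (sweep g es h ?x n - X (?t + h) n) \<le> real (Suc j) * ((C + C') * h\<^sup>2) * exp (real (Suc j) * (\<Lambda> * \<bar>h\<bar>))" for n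
    proof -
      have eq: "sweep g es h ?x n - X (?t + h) n =
        (sweep g es h ?x n - ?x n - h *\<^sub>R edge_field g es ?x n) - (X (?t + h) n - X ?t n - h *\<^sub>R edge_field g es (X ?t) n)
        + (?x n - X ?t n) + h *\<^sub>R (edge_field g es ?x n - edge_field g es (X ?t) n)"
        by (simp add: scaleR_diff_right)
      have fd: "norm (h *\<^sub>R (edge_field g es ?x n - edge_field g es (X ?t) n)) \<le> \<bar>h\<bar> * (\<Lambda> * E)"
        unfolding norm_scaleR \<Lambda>_def using nx nX IH E0 by (intro mult_left_mono edge_field_diff_le) auto
      have "norm (sweep g es h ?x n - X (?t + h) n) \<le> C * h\<^sup>2 + C' * h\<^sup>2 + E + \<bar>h\<bar> * (\<Lambda> * E)"
        unfolding eq
        by (intro order_trans[OF norm_triangle_ineq] order_trans[OF norm_triangle_ineq4] add_mono fd IH C(2) nx order_refl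
            trajectory_local_error[OF X, folded C'_def])
      also have "\<dots> = (C + C') * h\<^sup>2 + (1 + \<Lambda> * \<bar>h\<bar>) * E" by (simp add: algebra_simps)
      also have "\<dots> \<le> (C + C') * h\<^sup>2 * exp (real (Suc j) * (\<Lambda> * \<bar>h\<bar>)) + exp (\<Lambda> * \<bar>h\<bar>) * E"
      proof (intro add_mono mult_right_mono E0)
        have "1 \<le> exp (real (Suc j) * (\<Lambda> * \<bar>h\<bar>))" using c0 by simp
        moreover have "0 \<le> (C + C') * h\<^sup>2" using C(1) c0 by simp
        ultimately show "(C + C') * h\<^sup>2 \<le> (C + C') * h\<^sup>2 * exp (real (Suc j) * (\<Lambda> * \<bar>h\<bar>))"
          using mult_left_mono[of 1 "exp (real (Suc j) * (\<Lambda> * \<bar>h\<bar>))" "(C + C') * h\<^sup>2"] by simp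
        show "1 + \<Lambda> * \<bar>h\<bar> \<le> exp (\<Lambda> * \<bar>h\<bar>)" by (rule exp_ge_add_one_self)
      qed
      also have "exp (\<Lambda> * \<bar>h\<bar>) * E = real j * ((C + C') * h\<^sup>2) * exp (real (Suc j) * (\<Lambda> * \<bar>h\<bar>))"
        unfolding E_def by (simp add: distrib_right exp_add)
      finally show ?thesis by (simp add: distrib_right)
    qed
    then show ?case unfolding S tt using n1 by blast
  qed
  let ?K = "(C + C') * t\<^sup>2 * exp (\<Lambda> * \<bar>t\<bar>)"
  have bd: "norm ((sweep g es (t / real (Suc k)) ^^ Suc k) (X 0) n - X t n) \<le> ?K * inverse (real (Suc k))" for k
  proof -
    have "real (Suc k) * (t / real (Suc k)) = t" by simp
    moreover have "real (Suc k) * ((C + C') * (t / real (Suc k))\<^sup>2) * exp (real (Suc k) * (\<Lambda> * \<bar>t / real (Suc k)\<bar>)) = ?K * inverse (real (Suc k))"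
    proof -
      have "real (Suc k) * (\<Lambda> * \<bar>t / real (Suc k)\<bar>) = \<Lambda> * \<bar>t\<bar>" by (simp add: abs_divide)
      moreover have "real (Suc k) * ((C + C') * (t / real (Suc k))\<^sup>2) = (C + C') * t\<^sup>2 * inverse (real (Suc k))"
        by (simp add: power2_eq_square field_simps del: of_nat_Suc)
      ultimately show ?thesis by (simp only: mult_ac)
    qed
    ultimately show ?thesis using err[where h="t / real (Suc k)" and j="Suc k"] by metis
  qed
  have "(\<lambda>k. ?K * inverse (real (Suc k))) \<longlonglongrightarrow> 0"
    using tendsto_mult[OF tendsto_const LIMSEQ_inverse_real_of_nat, of ?K] by simp
  then have "(\<lambda>k. (sweep g es (t / real (Suc k)) ^^ Suc k) (X 0) n - X t n) \<longlonglongrightarrow> 0"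
    by (rule Lim_null_comparison[OF always_eventually, rotated]) (intro allI bd)
  then show ?thesis using Lim_null by blast
qed

end

section \<open>The flow as a limit of sweeps, its measurability and invariance\<close>

lemma tendsto_config:
  fixes S :: "'a \<Rightarrow> 'b \<Rightarrow> 'c::topological_space"
  assumes "\<And>n. ((\<lambda>k. S k n) \<longlongrightarrow> L n) F"
  shows "(S \<longlongrightarrow> L) F"
proof -
  have "limitin (product_topology (\<lambda>_. euclidean) UNIV) S L F"
    using assms by (simp add: limitin_componentwise)
  then show ?thesis by (simp add: euclidean_product_topology)
qed

text \<open>A limit of explicit maps that, for Lipschitz \<open>g\<close>, are continuous in time
  and datum, so joint measurability is immediate. Where a trajectory exists, the limit is that
  trajectory.\<close>

definition spin_flow :: "(real \<Rightarrow> real) \<Rightarrow> (int \<times> int) list \<Rightarrow> real \<Rightarrow> (int \<Rightarrow> real^3) \<Rightarrow> int \<Rightarrow> real^3" where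
  "spin_flow g es t x n = lim (\<lambda>k. (sweep g es (t / real (Suc k)) ^^ Suc k) x n)"

context lipschitz_coupling
begin

lemma continuous_on_twist:
  fixes h :: "'a::t2_space \<Rightarrow> real" and x :: "'a \<Rightarrow> int \<Rightarrow> real^3"
  assumes h: "continuous_on UNIV h" and x: "continuous_on UNIV x"
  shows "continuous_on UNIV (\<lambda>p. twist g (h p) e (x p))"
proof (rule continuous_on_coordinatewise_then_product)
  fix i
  have xi: "continuous_on UNIV (\<lambda>p. x p j)" for j
    by (rule continuous_on_product_then_coordinatewise[OF x])
  show "continuous_on UNIV (\<lambda>p. twist g (h p) e (x p) i)"
  proof (cases "i = fst e")
    case True
    have "continuous_on UNIV (\<lambda>p. g (x p (fst e) \<bullet> x p (snd e)))"
      by (rule continuous_on_compose2[OF g_cont[of UNIV]]) (intro continuous_intros xi, simp)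
    then show ?thesis using True by (auto simp: twist_def intro!: continuous_on_rot continuous_on_mult h xi)
  qed (simp add: twist_def xi)
qed

lemma continuous_on_sweep:
  fixes h :: "'a::t2_space \<Rightarrow> real" and x :: "'a \<Rightarrow> int \<Rightarrow> real^3"
  assumes h: "continuous_on UNIV h" and x: "continuous_on UNIV x"
  shows "continuous_on UNIV (\<lambda>p. sweep g es (h p) (x p))"
  using x
proof (induction es arbitrary: x)
  case Nil
  then show ?case by (simp add: sweep_Nil)
next
  case (Cons e es)
  show ?case unfolding sweep_Cons by (rule Cons.IH) (rule continuous_on_twist[OF h Cons.prems])
qed

lemma continuous_on_sweep_funpow:
  fixes h :: "'a::t2_space \<Rightarrow> real" and x :: "'a \<Rightarrow> int \<Rightarrow> real^3"
  assumes h: "continuous_on UNIV h" and x: "continuous_on UNIV x"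
  shows "continuous_on UNIV (\<lambda>p. (sweep g es (h p) ^^ k) (x p))"
  by (induction k) (auto intro: x continuous_on_sweep[OF h])

lemma measurable_spin_flow:
  "(\<lambda>p. spin_flow g es (fst p) (snd p) n) \<in> borel_measurable (borel :: (real \<times> (int \<Rightarrow> real^3)) measure)"
  unfolding spin_flow_def
proof (rule borel_measurable_lim_metric, rule borel_measurable_continuous_onI)
  fix k
  have "continuous_on UNIV (\<lambda>p :: real \<times> (int \<Rightarrow> real^3). (sweep g es (fst p / real (Suc k)) ^^ Suc k) (snd p))"
    by (intro continuous_on_sweep_funpow continuous_intros) auto
  then show "continuous_on UNIV (\<lambda>p :: real \<times> (int \<Rightarrow> real^3). (sweep g es (fst p / real (Suc k)) ^^ Suc k) (snd p) n)"
    by (rule continuous_on_product_then_coordinatewise)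
qed

lemma measurable_spin_flow_config:
  "(\<lambda>s. spin_flow g es t s) \<in> borel_measurable (borel :: (int \<Rightarrow> real^3) measure)"
proof -
  have "(\<lambda>s. spin_flow g es t s) \<in> borel \<rightarrow>\<^sub>M Pi\<^sub>M UNIV (\<lambda>_::int. borel :: (real^3) measure)"
  proof (rule measurable_PiM_single')
    fix n
    have "(\<lambda>s. (t, s)) \<in> borel \<rightarrow>\<^sub>M (borel :: (real \<times> (int \<Rightarrow> real^3)) measure)"
      by (intro borel_measurable_continuous_onI continuous_intros)
    from measurable_compose[OF this measurable_spin_flow[of es n]]
    show "(\<lambda>s. spin_flow g es t s n) \<in> borel_measurable borel" by simp
  qed (auto simp: space_PiM)
  then show ?thesis by (simp add: measurable_cong_sets[OF refl sets_PiM_equal_borel])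
qed

lemma spin_flow_trajectory:
  assumes "spin_trajectory g es X" shows "spin_flow g es t (X 0) = X t"
  unfolding spin_flow_def using sweep_tendsto_trajectory[OF assms] by (intro ext limI)

text \<open>Fubini with the moving spin innermost: its axis is then a fixed unit vector, and the
  claim is the invariance of area under a twist of one sphere. This is where the two ends of an edge
  must differ.\<close>

lemma integral_twist_block:
  fixes F :: "(int \<Rightarrow> real^3) \<Rightarrow> real"
  assumes F: "continuous_on UNIV F" and B: "\<And>x. \<bar>F x\<bar> \<le> B" and I: "finite I" "fst e \<in> I" "snd e \<in> I" "fst e \<noteq> snd e"
  shows "(\<integral>s. F (twist g h e s) \<partial>block_space I) = (\<integral>s. F s \<partial>block_space I)"
proof -
  let ?n = "fst e" and ?m = "snd e"
  let ?J = "I - {?n}"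
  have IJ: "I = insert ?n ?J" using I by auto
  have Ft: "continuous_on UNIV (\<lambda>s. F (twist g h e s))"
    by (rule continuous_on_compose2[OF F continuous_on_twist]) (auto intro: continuous_intros)
  have i1: "integrable (block_space (insert ?n ?J)) F" "integrable (block_space (insert ?n ?J)) (\<lambda>s. F (twist g h e s))"
    using F Ft I B by (auto intro!: integrable_block[where B=B] borel_measurable_continuous_onI)
  have "(\<integral>s. F (twist g h e s) \<partial>block_space (insert ?n ?J)) =
     (\<integral>x. (\<integral>y. F (twist g h e (x(?n := y))) \<partial>sphere_area) \<partial>block_space ?J)"
    using I by (intro sphere_prod.product_integral_insert i1(2)) auto
  also have "\<dots> = (\<integral>x. (\<integral>y. F (x(?n := y)) \<partial>sphere_area) \<partial>block_space ?J)"
  proof (rule Bochner_Integration.integral_cong[OF refl])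
    fix x :: "int \<Rightarrow> real^3" assume x: "x \<in> space (block_space ?J)"
    have xm: "norm (x ?m) = 1" using x I by (auto simp: space_block PiE_def Pi_def)
    have upd: "continuous_on UNIV (\<lambda>y. x(?n := y))"
    proof (rule continuous_on_coordinatewise_then_product)
      fix i show "continuous_on UNIV (\<lambda>y. (x(?n := y)) i)" by (cases "i = ?n") auto
    qed
    have "(\<integral>y. F (twist g h e (x(?n := y))) \<partial>sphere_area) =
        (\<integral>y. F (x(?n := rot (x ?m) (h * g (x ?m \<bullet> y)) y)) \<partial>sphere_area)"
      using I(4) by (simp add: twist_def inner_commute)
    also have "\<dots> = (\<integral>y. F (x(?n := y)) \<partial>sphere_area)"
    proof (rule integral_twist[OF xm, where f="\<lambda>y. F (x(?n := y))" and \<theta>="\<lambda>z. h * g z"])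
      show "continuous_on UNIV (\<lambda>y. F (x(?n := y)))" by (rule continuous_on_compose2[OF F upd]) auto
      show "\<bar>F (x(?n := s))\<bar> \<le> B" for s by (rule B)
      show "continuous_on UNIV (\<lambda>z. h * g z)" by (intro continuous_intros g_cont)
    qed
    finally show "(\<integral>y. F (twist g h e (x(?n := y))) \<partial>sphere_area) = (\<integral>y. F (x(?n := y)) \<partial>sphere_area)" .
  qed
  also have "\<dots> = (\<integral>s. F s \<partial>block_space (insert ?n ?J))"
    using I by (intro sphere_prod.product_integral_insert[symmetric] i1(1)) auto
  finally show ?thesis using IJ by simp
qed

lemma integral_sweep_block:
  fixes F :: "(int \<Rightarrow> real^3) \<Rightarrow> real"
  assumes F: "continuous_on UNIV F" and B: "\<And>x. \<bar>F x\<bar> \<le> B" and I: "finite I" "edge_sites es \<subseteq> I"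
    and ne: "\<And>e. e \<in> set es \<Longrightarrow> fst e \<noteq> snd e"
  shows "(\<integral>s. F (sweep g es h s) \<partial>block_space I) = (\<integral>s. F s \<partial>block_space I)"
  using I(2) ne
proof (induction es)
  case Nil
  then show ?case by (simp add: sweep_Nil)
next
  case (Cons e es)
  have c: "continuous_on UNIV (\<lambda>s. F (sweep g es h s))"
    by (rule continuous_on_compose2[OF F continuous_on_sweep]) (auto intro: continuous_intros)
  have "(\<integral>s. F (sweep g (e # es) h s) \<partial>block_space I) = (\<integral>s. F (sweep g es h (twist g h e s)) \<partial>block_space I)"
    by (simp add: sweep_Cons)
  also have "\<dots> = (\<integral>s. F (sweep g es h s) \<partial>block_space I)"
    using Cons.prems I by (intro integral_twist_block[OF c B]) (auto simp: edge_sites_def)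
  also have "\<dots> = (\<integral>s. F s \<partial>block_space I)"
    using Cons.prems by (intro Cons.IH) (auto simp: edge_sites_def)
  finally show ?case .
qed

lemma integral_sweep_funpow_block:
  fixes F :: "(int \<Rightarrow> real^3) \<Rightarrow> real"
  assumes F: "continuous_on UNIV F" and B: "\<And>x. \<bar>F x\<bar> \<le> B" and I: "finite I" "edge_sites es \<subseteq> I"
    and ne: "\<And>e. e \<in> set es \<Longrightarrow> fst e \<noteq> snd e"
  shows "(\<integral>s. F ((sweep g es h ^^ k) s) \<partial>block_space I) = (\<integral>s. F s \<partial>block_space I)"
proof (induction k)
  case (Suc k)
  have c: "continuous_on UNIV (\<lambda>s. F ((sweep g es h ^^ k) s))"
    by (rule continuous_on_compose2[OF F continuous_on_sweep_funpow]) (auto intro: continuous_intros)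
  have "(\<integral>s. F ((sweep g es h ^^ Suc k) s) \<partial>block_space I) = (\<integral>s. F ((sweep g es h ^^ k) (sweep g es h s)) \<partial>block_space I)"
    by (simp add: funpow_Suc_right del: funpow.simps)
  also have "\<dots> = (\<integral>s. F ((sweep g es h ^^ k) s) \<partial>block_space I)"
    by (rule integral_sweep_block[OF c B I ne])
  finally show ?case using Suc by simp
qed simp

text \<open>The sweep converges to the flow and each of its twists is area preserving; this replaces
  Liouville's theorem.\<close>

theorem integral_spin_flow_block:
  fixes F :: "(int \<Rightarrow> real^3) \<Rightarrow> real"
  assumes F: "continuous_on UNIV F" and B: "\<And>x. \<bar>F x\<bar> \<le> B" and I: "finite I" "edge_sites es \<subseteq> I"
    and ne: "\<And>e. e \<in> set es \<Longrightarrow> fst e \<noteq> snd e"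
  shows "(\<integral>s. F (spin_flow g es t s) \<partial>block_space I) = (\<integral>s. F s \<partial>block_space I)"
proof -
  let ?S = "\<lambda>k s. (sweep g es (t / real (Suc k)) ^^ Suc k) s"
  have Sc: "continuous_on UNIV (?S k)" for k
    by (rule continuous_on_sweep_funpow) (auto intro: continuous_intros)
  have lim: "(\<lambda>k. ?S k s) \<longlonglongrightarrow> spin_flow g es t s" if s: "s \<in> space (block_space I)" for s
  proof -
    have "norm (s n) = 1" if "n \<in> edge_sites es" for n
      using s I that by (auto simp: space_block PiE_def Pi_def)
    then have "\<exists>X. X 0 = s \<and> spin_trajectory g es X" by (rule spin_trajectory_exists)
    then obtain X where X: "X 0 = s" "spin_trajectory g es X" by blast
    have "(\<lambda>k. ?S k s n) \<longlonglongrightarrow> spin_flow g es t s n" for n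
      using sweep_tendsto_trajectory[OF X(2), of t n] spin_flow_trajectory[OF X(2), of t] X(1) by simp
    then show ?thesis by (rule tendsto_config)
  qed
  note fm = measurable_spin_flow_config[of es t]
  have "(\<lambda>k. \<integral>s. F (?S k s) \<partial>block_space I) \<longlonglongrightarrow> (\<integral>s. F (spin_flow g es t s) \<partial>block_space I)"
  proof (rule integral_dominated_convergence[where w="\<lambda>_. B"])
    have Fm: "F \<in> borel_measurable borel" using F by (rule borel_measurable_continuous_onI)
    show "(\<lambda>s. F (spin_flow g es t s)) \<in> borel_measurable (block_space I)"
      by (intro borel_measurable_block measurable_compose[OF fm Fm])
    show "(\<lambda>s. F (?S k s)) \<in> borel_measurable (block_space I)" for k
      by (intro borel_measurable_block measurable_compose[OF borel_measurable_continuous_onI[OF Sc] Fm])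
    show "integrable (block_space I) (\<lambda>_. B)"
      using finite_measure_block[OF I(1)] by (simp add: finite_measure.integrable_const)
    show "AE s in block_space I. (\<lambda>k. F (?S k s)) \<longlonglongrightarrow> F (spin_flow g es t s)"
      using continuous_on_tendsto_compose[OF F lim] by (intro AE_I2) auto
  qed (use B in auto)
  moreover have "(\<integral>s. F (?S k s) \<partial>block_space I) = (\<integral>s. F s \<partial>block_space I)" for k
    by (rule integral_sweep_funpow_block[OF F B I ne])
  ultimately show ?thesis by (simp only: LIMSEQ_const_iff)
qed

end

section \<open>Finite chains with free ends\<close>

definition chain_edges :: "int \<Rightarrow> int \<Rightarrow> (int \<times> int) list" where
  "chain_edges a b = concat (map (\<lambda>n. [(n, n + 1), (n + 1, n)]) [a..b - 1])"

lemma chain_edges_ne: "e \<in> set (chain_edges a b) \<Longrightarrow> fst e \<noteq> snd e"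
  by (auto simp: chain_edges_def)

lemma edge_sites_chain: "a < b \<Longrightarrow> edge_sites (chain_edges a b) = {a..b}"
proof (intro equalityI subsetI)
  fix n assume ab: "a < b" and n: "n \<in> {a..b}"
  show "n \<in> edge_sites (chain_edges a b)"
  proof (cases "n = b")
    case True
    have "(b - 1, b - 1 + 1) \<in> set (chain_edges a b)" unfolding chain_edges_def using ab by auto
    then show ?thesis using True unfolding edge_sites_def by force
  next
    case False
    then have "(n, n + 1) \<in> set (chain_edges a b)" unfolding chain_edges_def using n by auto
    then show ?thesis unfolding edge_sites_def by force
  qed
qed (auto simp: edge_sites_def chain_edges_def)

text \<open>Continuing the coupling by 0 beyond the free ends gives end sites and interior sites the
  same formula.\<close>

definition chain_coupling :: "(real \<Rightarrow> real) \<Rightarrow> int \<Rightarrow> int \<Rightarrow> (int \<Rightarrow> real^3) \<Rightarrow> int \<Rightarrow> real" where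
  "chain_coupling g a b x n = (if a \<le> n \<and> n < b then g (x n \<bullet> x (n + 1)) else 0)"

lemma edge_field_append: "edge_field g (es @ fs) x n = edge_field g es x n + edge_field g fs x n"
  by (simp add: edge_field_def)

lemma edge_field_chain:
  "edge_field g (chain_edges a b) x n =
    (chain_coupling g a b x n *\<^sub>R x (n + 1) + chain_coupling g a b x (n - 1) *\<^sub>R x (n - 1)) \<times> x n"
proof (cases "a \<le> b")
  case True
  then show ?thesis
  proof (induction b rule: int_ge_induct)
    case base
    have "chain_coupling g a a x n = 0" "chain_coupling g a a x (n - 1) = 0"
      by (auto simp: chain_coupling_def)
    then show ?case by (simp add: chain_edges_def edge_field_def)
  next
    case (step b)
    have ce: "chain_edges a (b + 1) = chain_edges a b @ [(b, b + 1), (b + 1, b)]"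
      using step(1) by (simp add: chain_edges_def upto_rec2)
    show ?case
      unfolding ce edge_field_append step(2) using step(1)
      by (auto simp: edge_field_def chain_coupling_def cross_add_left cross_mult_left inner_commute)
  qed
qed (auto simp: chain_edges_def edge_field_def chain_coupling_def)

definition chain_energy :: "(real \<Rightarrow> real) \<Rightarrow> int \<Rightarrow> int \<Rightarrow> (int \<Rightarrow> real^3) \<Rightarrow> real" where
  "chain_energy G a b x = (\<Sum>n\<in>{a..<b}. G (x n \<bullet> x (n + 1)))"

text \<open>The gradient of the energy with respect to spin \<open>n\<close> is the vector whose
  cross product with that spin is the field at \<open>n\<close>. The two are orthogonal, so every
  site contributes 0 to the derivative. The computation regroups the sum over bonds into a sum over
  sites.\<close>

lemma chain_energy_const:
  assumes X: "spin_trajectory g (chain_edges a b) X" and G: "\<And>z. (G has_real_derivative g z) (at z)"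
  shows "chain_energy G a b (X t) = chain_energy G a b (X 0)"
proof -
  have "((\<lambda>t. chain_energy G a b (X t)) has_real_derivative 0) (at t)" for t
  proof -
    let ?c = "chain_coupling g a b (X t)" and ?F = "edge_field g (chain_edges a b) (X t)"
    have d: "((\<lambda>t. X t n) has_vector_derivative ?F n) (at t)" for n
      using X by (simp add: spin_trajectory_def)
    have di: "((\<lambda>t. X t n \<bullet> X t (n + 1)) has_real_derivative (X t n \<bullet> ?F (n + 1) + ?F n \<bullet> X t (n + 1))) (at t)" for n
      unfolding has_real_derivative_iff_has_vector_derivative
      by (rule bounded_bilinear.has_vector_derivative[OF bounded_bilinear_inner d d])
    have dG: "((\<lambda>t. G (X t n \<bullet> X t (n + 1))) has_real_derivative
        g (X t n \<bullet> X t (n + 1)) * (X t n \<bullet> ?F (n + 1) + ?F n \<bullet> X t (n + 1))) (at t)" for n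
      by (rule DERIV_chain2[OF G di])
    have "((\<lambda>t. chain_energy G a b (X t)) has_real_derivative
        (\<Sum>n\<in>{a..<b}. g (X t n \<bullet> X t (n + 1)) * (X t n \<bullet> ?F (n + 1) + ?F n \<bullet> X t (n + 1)))) (at t)"
      unfolding chain_energy_def by (intro DERIV_sum dG)
    also have "(\<Sum>n\<in>{a..<b}. g (X t n \<bullet> X t (n + 1)) * (X t n \<bullet> ?F (n + 1) + ?F n \<bullet> X t (n + 1))) =
        (\<Sum>n\<in>{a..<b}. ?c n * (X t n \<bullet> ?F (n + 1))) + (\<Sum>n\<in>{a..<b}. ?c n * (?F n \<bullet> X t (n + 1)))"
      unfolding sum.distrib[symmetric] by (intro sum.cong) (auto simp: chain_coupling_def distrib_left)
    \<comment> \<open>The couplings vanish beyond the ends, so both sums may be extended to all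
      sites of the block.\<close>
    also have "(\<Sum>n\<in>{a..<b}. ?c n * (?F n \<bullet> X t (n + 1))) = (\<Sum>n\<in>{a..b}. ?c n * (?F n \<bullet> X t (n + 1)))"
      by (rule sum.mono_neutral_left) (auto simp: chain_coupling_def)
    also have "(\<Sum>n\<in>{a..<b}. ?c n * (X t n \<bullet> ?F (n + 1))) = (\<Sum>n\<in>{a + 1..b}. ?c (n - 1) * (X t (n - 1) \<bullet> ?F n))"
      by (rule sum.reindex_bij_witness[of _ "\<lambda>n. n - 1" "\<lambda>n. n + 1"]) auto
    also have "\<dots> = (\<Sum>n\<in>{a..b}. ?c (n - 1) * (X t (n - 1) \<bullet> ?F n))"
      by (rule sum.mono_neutral_left) (auto simp: chain_coupling_def)
    also have "\<dots> + (\<Sum>n\<in>{a..b}. ?c n * (?F n \<bullet> X t (n + 1))) =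
        (\<Sum>n\<in>{a..b}. (?c n *\<^sub>R X t (n + 1) + ?c (n - 1) *\<^sub>R X t (n - 1)) \<bullet> ?F n)"
      unfolding sum.distrib[symmetric] by (intro sum.cong) (auto simp: inner_add_left inner_commute[of "?F n" "X t (n + 1)" for n])
    also have "\<dots> = 0" by (simp add: edge_field_chain dot_cross_self)
    finally show ?thesis .
  qed
  then show ?thesis using DERIV_isconst_all by blast
qed

section \<open>Cut-off couplings and the global flow of a finite chain\<close>

definition cut_coupling :: "nat \<Rightarrow> real \<Rightarrow> real" where
  "cut_coupling k z = 2 / max (1 + z) (1 / real (Suc k))"

text \<open>A primitive of \<open>cut_coupling\<close>: the function \<open>2 * ln (1 + z)\<close>,
  continued below the threshold by its tangent line.\<close>

definition cut_energy :: "nat \<Rightarrow> real \<Rightarrow> real" where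
  "cut_energy k z = 2 * ln (max (1 + z) (1 / real (Suc k)))
     + 2 * real (Suc k) * (min (1 + z) (1 / real (Suc k)) - 1 / real (Suc k))"

lemma cut_coupling_lipschitz: "lipschitz_coupling (cut_coupling k) (2 * real (Suc k)) (2 * (real (Suc k))\<^sup>2)"
proof
  let ?K = "real (Suc k)"
  have K: "?K > 0" by simp
  have inv: "1 / max (1 + z) (1 / ?K) \<le> ?K" "0 < max (1 + z) (1 / ?K)" for z
  proof -
    show pos: "0 < max (1 + z) (1 / ?K)" by (rule less_le_trans[OF _ max.cobounded2]) simp
    have "1 / max (1 + z) (1 / ?K) \<le> 1 / (1 / ?K)"
      by (intro divide_left_mono mult_pos_pos pos max.cobounded2) auto
    then show "1 / max (1 + z) (1 / ?K) \<le> ?K" by simp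
  qed
  show "\<bar>cut_coupling k z\<bar> \<le> 2 * ?K" for z
    using inv[of z] unfolding cut_coupling_def by (simp add: abs_divide)
  show "\<bar>cut_coupling k y - cut_coupling k z\<bar> \<le> 2 * ?K\<^sup>2 * \<bar>y - z\<bar>" for y z
  proof -
    let ?u = "max (1 + y) (1 / ?K)" and ?v = "max (1 + z) (1 / ?K)"
    have "cut_coupling k y - cut_coupling k z = 2 * (1 / ?u) * (1 / ?v) * (?v - ?u)"
      using inv(2)[of y] inv(2)[of z] unfolding cut_coupling_def by (simp add: field_simps)
    then have "\<bar>cut_coupling k y - cut_coupling k z\<bar> = \<bar>2 * (1 / ?u) * (1 / ?v)\<bar> * \<bar>?v - ?u\<bar>"
      by (simp only: abs_mult)
    also have "\<bar>2 * (1 / ?u) * (1 / ?v)\<bar> = 2 * (1 / ?u) * (1 / ?v)"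
      using inv(2)[of y] inv(2)[of z] by (intro abs_of_nonneg mult_nonneg_nonneg) (auto simp: less_imp_le)
    finally have "\<bar>cut_coupling k y - cut_coupling k z\<bar> = 2 * (1 / ?u) * (1 / ?v) * \<bar>?v - ?u\<bar>" .
    also have "\<dots> \<le> 2 * ?K * ?K * \<bar>y - z\<bar>"
    proof (intro mult_mono)
      show "\<bar>?v - ?u\<bar> \<le> \<bar>y - z\<bar>" unfolding max_def by (auto simp: abs_if)
    qed (use inv[of y] inv[of z] in \<open>auto simp: less_imp_le\<close>)
    finally show ?thesis by (simp only: power2_eq_square mult.assoc)
  qed
qed simp

lemma cut_energy_deriv: "(cut_energy k has_real_derivative cut_coupling k z) (at z)"
proof -
  let ?K = "real (Suc k)" and ?e = "1 / real (Suc k)"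
  have e: "?e > 0" by simp
  have lin: "((\<lambda>z. 2 * ln ?e + 2 * ?K * ((1 + z) - ?e)) has_real_derivative 2 * ?K) (at z)" for z
    by (auto intro!: derivative_eq_intros)
  have lo: "((\<lambda>z. 2 * ln (1 + z)) has_real_derivative 2 / (1 + z)) (at z)" if "1 + z > 0" for z
    using that by (auto intro!: derivative_eq_intros)
  consider "1 + z < ?e" | "1 + z > ?e" | "1 + z = ?e" by linarith
  then show ?thesis
  proof cases
    case 1
    have "\<forall>\<^sub>F y in nhds z. y < ?e - 1" using 1 eventually_nhds_in_open[of "{..<?e - 1}" z] by auto
    then have ev: "\<forall>\<^sub>F y in nhds z. 2 * ln ?e + 2 * ?K * ((1 + y) - ?e) = cut_energy k y"
      by eventually_elim (simp add: cut_energy_def max_def min_def)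
    have "cut_coupling k z = 2 * ?K" using 1 by (simp add: cut_coupling_def max_def)
    then show ?thesis using DERIV_cong_ev[OF refl ev refl] lin by metis
  next
    case 2
    have "\<forall>\<^sub>F y in nhds z. y > ?e - 1" using 2 eventually_nhds_in_open[of "{?e - 1<..}" z] by auto
    then have ev: "\<forall>\<^sub>F y in nhds z. 2 * ln (1 + y) = cut_energy k y"
      by eventually_elim (simp add: cut_energy_def max_def min_def)
    have "cut_coupling k z = 2 / (1 + z)" using 2 by (simp add: cut_coupling_def max_def)
    moreover have "1 + z > 0" using 2 e by linarith
    ultimately show ?thesis using DERIV_cong_ev[OF refl ev refl] lo by metis
  next
    \<comment> \<open>At the junction the difference quotients from the left and from the right are
      computed with the linear and with the logarithmic branch; both slopes are
      \<open>2 * ?K\<close>.\<close>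
    case 3
    have z0: "cut_energy k z = 2 * ln ?e + 2 * ?K * ((1 + z) - ?e)" "cut_energy k z = 2 * ln (1 + z)"
      using 3 by (simp_all add: cut_energy_def)
    have gz: "cut_coupling k z = 2 * ?K" "cut_coupling k z = 2 / (1 + z)"
      using 3 by (simp_all add: cut_coupling_def)
    have "((\<lambda>y. (cut_energy k y - cut_energy k z) / (y - z)) \<longlongrightarrow> cut_coupling k z) (at_left z)"
    proof -
      have "((\<lambda>y. (2 * ln ?e + 2 * ?K * ((1 + y) - ?e) - cut_energy k z) / (y - z)) \<longlongrightarrow> cut_coupling k z) (at_left z)"
        using lin[of z] unfolding gz(1) z0(1) has_field_derivative_iff by (rule filterlim_mono) (auto simp: at_le)
      moreover have "\<forall>\<^sub>F y in at_left z. (2 * ln ?e + 2 * ?K * ((1 + y) - ?e) - cut_energy k z) / (y - z) = (cut_energy k y - cut_energy k z) / (y - z)"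
        unfolding eventually_at_filter using 3 by (intro always_eventually) (auto simp: cut_energy_def max_def min_def)
      ultimately show ?thesis by (rule Lim_transform_eventually)
    qed
    moreover have "((\<lambda>y. (cut_energy k y - cut_energy k z) / (y - z)) \<longlongrightarrow> cut_coupling k z) (at_right z)"
    proof -
      have "1 + z > 0" using 3 e by linarith
      from lo[OF this] have "((\<lambda>y. (2 * ln (1 + y) - cut_energy k z) / (y - z)) \<longlongrightarrow> cut_coupling k z) (at_right z)"
        unfolding gz(2) z0(2) has_field_derivative_iff by (rule filterlim_mono) (auto simp: at_le)
      moreover have "\<forall>\<^sub>F y in at_right z. (2 * ln (1 + y) - cut_energy k z) / (y - z) = (cut_energy k y - cut_energy k z) / (y - z)"
        unfolding eventually_at_filter using 3 by (intro always_eventually) (auto simp: cut_energy_def max_def min_def)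
      ultimately show ?thesis by (rule Lim_transform_eventually)
    qed
    ultimately show ?thesis unfolding has_field_derivative_iff by (rule filterlim_split_at)
  qed
qed

lemma cut_energy_le: "z \<le> 1 \<Longrightarrow> cut_energy k z \<le> 2 * ln 2"
proof -
  assume z: "z \<le> 1"
  have p: "0 < max (1 + z) (1 / real (Suc k))" by (auto simp: less_max_iff_disj)
  have "max (1 + z) (1 / real (Suc k)) \<le> 2" using z by (auto simp: divide_le_eq)
  then have "ln (max (1 + z) (1 / real (Suc k))) \<le> ln 2" using p by (subst ln_le_cancel_iff) auto
  moreover have "2 * real (Suc k) * (min (1 + z) (1 / real (Suc k)) - 1 / real (Suc k)) \<le> 0"
    by (intro mult_nonneg_nonpos) auto
  ultimately show ?thesis unfolding cut_energy_def by linarith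
qed

lemma cut_energy_below:
  assumes "1 + z < 1 / real (Suc k)" shows "cut_energy k z < 2 * ln (1 / real (Suc k))"
proof -
  have "2 * real (Suc k) * (min (1 + z) (1 / real (Suc k)) - 1 / real (Suc k)) < 0"
    using assms by (intro mult_pos_neg) auto
  then show ?thesis unfolding cut_energy_def using assms by (simp add: max_def)
qed

lemma cut_energy_above: "1 / real (Suc k) \<le> 1 + z \<Longrightarrow> cut_energy k z = 2 * ln (1 + z)"
  by (simp add: cut_energy_def max_def min_def)

lemma cut_coupling_above: "1 / real (Suc k) \<le> 1 + z \<Longrightarrow> cut_coupling k z = 2 / (1 + z)"
  by (simp add: cut_coupling_def max_def)

text \<open>Conservation of energy keeps neighbouring spins away from antipodality.\<close>

lemma cut_trajectory_separated:
  assumes X: "spin_trajectory (cut_coupling k) (chain_edges a b) X" and ab: "a < b"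
    and e: "e \<le> chain_energy (cut_energy k) a b (X 0)"
    and k: "2 * ln (1 / real (Suc k)) \<le> e - 2 * ln 2 * real (card {a..<b})" and n: "n \<in> {a..<b}"
  shows "1 / real (Suc k) \<le> 1 + X t n \<bullet> X t (n + 1)"
proof (rule ccontr)
  assume "\<not> 1 / real (Suc k) \<le> 1 + X t n \<bullet> X t (n + 1)"
  then have lt: "cut_energy k (X t n \<bullet> X t (n + 1)) < 2 * ln (1 / real (Suc k))"
    by (intro cut_energy_below) auto
  have nX: "norm (X t i) = 1" if "i \<in> {a..b}" for i
    using X that unfolding spin_trajectory_def edge_sites_chain[OF ab] by auto
  have le: "cut_energy k (X t i \<bullet> X t (i + 1)) \<le> 2 * ln 2" if "i \<in> {a..<b}" for i
    using one_plus_inner_bounds(2)[OF nX[of i] nX[of "i + 1"]] that by (intro cut_energy_le) auto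
  have "e \<le> chain_energy (cut_energy k) a b (X t)"
    by (rule order_trans[OF e eq_refl]) (rule chain_energy_const[OF X cut_energy_deriv, symmetric])
  \<comment> \<open>Energy budget: every other bond contributes at most \<open>2 * ln 2\<close>, so
    one bond below the threshold would bring the total under the lower bound \<open>e\<close> of the
    conserved energy.\<close>
  also have "\<dots> = cut_energy k (X t n \<bullet> X t (n + 1)) + (\<Sum>i\<in>{a..<b} - {n}. cut_energy k (X t i \<bullet> X t (i + 1)))"
    unfolding chain_energy_def using n by (simp add: sum.remove)
  also have "(\<Sum>i\<in>{a..<b} - {n}. cut_energy k (X t i \<bullet> X t (i + 1))) \<le> (\<Sum>i\<in>{a..<b} - {n}. 2 * ln 2)"
    by (intro sum_mono le) auto
  also have "\<dots> \<le> 2 * ln 2 * real (card {a..<b})"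
    using card_mono[of "{a..<b}" "{a..<b} - {n}"] by (auto simp: mult.commute intro!: mult_right_mono)
  finally show False using lt k by linarith
qed

text \<open>Again a limit, for the sake of measurability. For unit spins without antipodal
  neighbours in the block the sequence is eventually constant.\<close>

definition chain_flow :: "int \<Rightarrow> int \<Rightarrow> real \<Rightarrow> (int \<Rightarrow> real^3) \<Rightarrow> int \<Rightarrow> real^3" where
  "chain_flow a b t x n = lim (\<lambda>k. spin_flow (cut_coupling k) (chain_edges a b) t x n)"

lemma measurable_chain_flow:
  "(\<lambda>p. chain_flow a b (fst p) (snd p) n) \<in> borel_measurable (borel :: (real \<times> (int \<Rightarrow> real^3)) measure)"
  unfolding chain_flow_def
  by (intro borel_measurable_lim_metric lipschitz_coupling.measurable_spin_flow[OF cut_coupling_lipschitz])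

lemma spin_trajectory_chain_cong:
  assumes X: "spin_trajectory g (chain_edges a b) X"
    and eq: "\<And>t n. n \<in> {a..<b} \<Longrightarrow> g (X t n \<bullet> X t (n + 1)) = g' (X t n \<bullet> X t (n + 1))"
  shows "spin_trajectory g' (chain_edges a b) X"
proof -
  have "chain_coupling g a b (X t) n = chain_coupling g' a b (X t) n" for t n
    using eq[of n t] by (simp add: chain_coupling_def)
  then have "edge_field g (chain_edges a b) (X t) n = edge_field g' (chain_edges a b) (X t) n" for t n
    by (simp add: edge_field_chain)
  then show ?thesis using X by (simp add: spin_trajectory_def)
qed

text \<open>The energy of the datum fixes a threshold that no bond ever crosses. A cut-off below
  that threshold is never felt, so one trajectory serves every larger \<open>k\<close>.\<close>

theorem chain_flow_trajectory:
  assumes ab: "a < b" and nx: "\<And>n. n \<in> {a..b} \<Longrightarrow> norm (x n) = 1"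
    and w: "\<And>n. n \<in> {a..<b} \<Longrightarrow> 0 < 1 + x n \<bullet> x (n + 1)"
  shows "\<exists>X k0. X 0 = x \<and> (\<forall>t. chain_flow a b t x = X t) \<and>
    (\<forall>k\<ge>k0. spin_trajectory (cut_coupling k) (chain_edges a b) X \<and> (\<forall>t. spin_flow (cut_coupling k) (chain_edges a b) t x = X t)) \<and>
    (\<forall>t. \<forall>n\<in>{a..<b}. 1 / real (Suc k0) \<le> 1 + X t n \<bullet> X t (n + 1))"
proof -
  define e where "e = (\<Sum>n\<in>{a..<b}. 2 * ln (1 + x n \<bullet> x (n + 1)))"
  have "\<exists>k0. \<forall>k\<ge>k0. 1 / real (Suc k) \<le> 1 + x n \<bullet> x (n + 1)" if "n \<in> {a..<b}" for n
  proof -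
    have "(\<lambda>k. inverse (real (Suc k))) \<longlonglongrightarrow> 0" by (rule LIMSEQ_inverse_real_of_nat)
    from order_tendstoD(2)[OF this w[OF that]] show ?thesis
      by (auto simp: eventually_sequentially inverse_eq_divide intro: less_imp_le)
  qed
  then obtain kf where kf: "\<And>n k. n \<in> {a..<b} \<Longrightarrow> kf n \<le> k \<Longrightarrow> 1 / real (Suc k) \<le> 1 + x n \<bullet> x (n + 1)"
    by metis
  \<comment> \<open>The level at which \<open>2 * ln ?q\<close> equals the energy left for a single
    bond when all bonds are granted the maximum \<open>2 * ln 2\<close>.\<close>
  let ?q = "exp ((e - 2 * ln 2 * real (card {a..<b})) / 2)"
  obtain k1 where k1: "1 / real (Suc k1) < ?q"
    using reals_Archimedean[of ?q] by (auto simp: inverse_eq_divide)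
  define k0 where "k0 = max k1 (Max (insert 0 (kf ` {a..<b})))"
  have above: "1 / real (Suc k) \<le> 1 + x n \<bullet> x (n + 1)" if "n \<in> {a..<b}" "k0 \<le> k" for n k
  proof (rule kf[OF that(1)])
    have "kf n \<le> Max (insert 0 (kf ` {a..<b}))" using that(1) by (intro Max_ge) auto
    also have "\<dots> \<le> k0" unfolding k0_def by (rule max.cobounded2)
    finally show "kf n \<le> k" using that(2) by (rule order_trans)
  qed
  have lnk: "2 * ln (1 / real (Suc k)) \<le> e - 2 * ln 2 * real (card {a..<b})" if "k0 \<le> k" for k
  proof -
    have "1 / real (Suc k) \<le> 1 / real (Suc k1)" using that unfolding k0_def by (intro divide_left_mono) auto
    then have "1 / real (Suc k) \<le> ?q" using k1 by linarith
    then have "ln (1 / real (Suc k)) \<le> (e - 2 * ln 2 * real (card {a..<b})) / 2"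
      using ln_le_cancel_iff[of "1 / real (Suc k)" ?q] by simp
    then show ?thesis by simp
  qed
  interpret k0: lipschitz_coupling "cut_coupling k0" "2 * real (Suc k0)" "2 * (real (Suc k0))\<^sup>2"
    by (rule cut_coupling_lipschitz)
  have "\<exists>X. X 0 = x \<and> spin_trajectory (cut_coupling k0) (chain_edges a b) X"
    by (rule k0.spin_trajectory_exists) (simp add: edge_sites_chain[OF ab] nx)
  then obtain X where X0: "X 0 = x" and X: "spin_trajectory (cut_coupling k0) (chain_edges a b) X" by blast
  have "e \<le> chain_energy (cut_energy k0) a b (X 0)"
    unfolding e_def chain_energy_def X0 using above[of _ k0] by (intro sum_mono) (simp add: cut_energy_above)
  from cut_trajectory_separated[OF X ab this lnk]
  have sep: "1 / real (Suc k0) \<le> 1 + X t n \<bullet> X t (n + 1)" if "n \<in> {a..<b}" for t n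
    using that by blast
  have trj: "spin_trajectory (cut_coupling k) (chain_edges a b) X" if k: "k0 \<le> k" for k
  proof (rule spin_trajectory_chain_cong[OF X])
    fix t n assume n: "n \<in> {a..<b}"
    have "1 / real (Suc k) \<le> 1 / real (Suc k0)" using k by (intro divide_left_mono) auto
    then show "cut_coupling k0 (X t n \<bullet> X t (n + 1)) = cut_coupling k (X t n \<bullet> X t (n + 1))"
      using sep[OF n, of t] by (simp add: cut_coupling_above)
  qed
  have fl: "spin_flow (cut_coupling k) (chain_edges a b) t x = X t" if "k0 \<le> k" for k t
    using lipschitz_coupling.spin_flow_trajectory[OF cut_coupling_lipschitz trj[OF that], of t] X0 by simp
  have "chain_flow a b t x = X t" for t
  proof (rule ext)
    fix n
    have "(\<lambda>k. spin_flow (cut_coupling k) (chain_edges a b) t x n) \<longlonglongrightarrow> X t n"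
      using fl by (intro tendsto_eventually eventually_sequentiallyI[of k0]) simp
    then show "chain_flow a b t x n = X t n" unfolding chain_flow_def by (rule limI)
  qed
  then show ?thesis using X0 trj fl sep by blast
qed

section \<open>Invariance of the weighted block measure\<close>

definition cut_density :: "real \<Rightarrow> nat \<Rightarrow> int \<Rightarrow> int \<Rightarrow> (int \<Rightarrow> real^3) \<Rightarrow> real" where
  "cut_density \<beta> k a b x = exp (\<beta> * chain_energy (\<lambda>z. cut_energy k (min 1 z)) a b x)"

lemma cut_energy_cont: "continuous_on S (cut_energy k)"
  by (intro continuous_at_imp_continuous_on ballI DERIV_isCont[OF cut_energy_deriv])

lemma cut_density_cont: "continuous_on UNIV (cut_density \<beta> k a b)"
  unfolding cut_density_def chain_energy_def
  by (intro continuous_intros continuous_on_compose2[OF cut_energy_cont[of UNIV]]) auto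

text \<open>The \<open>min 1\<close> in the density makes the upper bound hold for arbitrary
  configurations, so that \<open>cut_density\<close> is a bounded continuous observable; for unit
  spins it changes nothing.\<close>

lemma cut_density_bounds:
  assumes "\<beta> > 0"
  shows "0 \<le> cut_density \<beta> k a b x" "cut_density \<beta> k a b x \<le> exp (\<beta> * (2 * ln 2 * real (card {a..<b})))"
proof -
  have "chain_energy (\<lambda>z. cut_energy k (min 1 z)) a b x \<le> (\<Sum>n\<in>{a..<b}. 2 * ln 2)"
    unfolding chain_energy_def by (intro sum_mono cut_energy_le) auto
  then show "cut_density \<beta> k a b x \<le> exp (\<beta> * (2 * ln 2 * real (card {a..<b})))"
    unfolding cut_density_def using assms by (simp add: mult.commute)
qed (simp add: cut_density_def)

lemma cut_density_flow:
  assumes x: "\<And>n. n \<in> {a..b} \<Longrightarrow> norm (x n) = 1" and ab: "a < b"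
  shows "cut_density \<beta> k a b (spin_flow (cut_coupling k) (chain_edges a b) t x) = cut_density \<beta> k a b x"
proof -
  interpret lipschitz_coupling "cut_coupling k" "2 * real (Suc k)" "2 * (real (Suc k))\<^sup>2"
    by (rule cut_coupling_lipschitz)
  have "\<exists>X. X 0 = x \<and> spin_trajectory (cut_coupling k) (chain_edges a b) X"
    by (rule spin_trajectory_exists) (simp add: edge_sites_chain[OF ab] x)
  then obtain X where X0: "X 0 = x" and X: "spin_trajectory (cut_coupling k) (chain_edges a b) X" by blast
  have nX: "norm (X t i) = 1" if "i \<in> {a..b}" for i t
    using X that unfolding spin_trajectory_def edge_sites_chain[OF ab] by auto
  have eq: "chain_energy (\<lambda>z. cut_energy k (min 1 z)) a b (X t) = chain_energy (cut_energy k) a b (X t)" for t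
    unfolding chain_energy_def
  proof (intro sum.cong refl)
    fix n assume "n \<in> {a..<b}"
    then have "X t n \<bullet> X t (n + 1) \<le> 1" using one_plus_inner_bounds(2)[OF nX[of n t] nX[of "n + 1" t]] by auto
    then show "cut_energy k (min 1 (X t n \<bullet> X t (n + 1))) = cut_energy k (X t n \<bullet> X t (n + 1))" by simp
  qed
  show ?thesis
    using spin_flow_trajectory[OF X, of t] chain_energy_const[OF X cut_energy_deriv, of t]
    by (simp add: cut_density_def X0[symmetric] eq)
qed

text \<open>For an antipodal bond the tangent line gives \<open>cut_energy\<close> the value
  \<open>2 * ln (1 / real (Suc k)) - 2\<close>, so its factor is \<open>exp (- 2 * \<beta>)\<close>
  times a positive power of the threshold and tends to 0, the value of the limiting density.\<close>

lemma cut_density_tendsto: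
  assumes b: "\<beta> > 0" and x: "\<And>n. n \<in> {a..b} \<Longrightarrow> norm (x n) = 1"
  shows "(\<lambda>k. cut_density \<beta> k a b x) \<longlonglongrightarrow> (\<Prod>n\<in>{a..<b}. (1 + x n \<bullet> x (n + 1)) powr (2 * \<beta>))"
proof -
  have "(\<lambda>k. exp (\<beta> * cut_energy k (min 1 (x n \<bullet> x (n + 1))))) \<longlonglongrightarrow> (1 + x n \<bullet> x (n + 1)) powr (2 * \<beta>)"
    if n: "n \<in> {a..<b}" for n
  proof -
    let ?z = "x n \<bullet> x (n + 1)"
    have z: "0 \<le> 1 + ?z" "min 1 ?z = ?z" using one_plus_inner_bounds[OF x[of n] x[of "n + 1"]] n by auto
    have i0: "(\<lambda>k. 1 / real (Suc k)) \<longlonglongrightarrow> 0"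
      using LIMSEQ_inverse_real_of_nat by (simp add: inverse_eq_divide)
    show ?thesis
    proof (cases "1 + ?z = 0")
      case True
      have eq: "exp (\<beta> * cut_energy k ?z) = exp (- 2 * \<beta>) * (1 / real (Suc k)) powr (2 * \<beta>)" for k
      proof -
        define lk where "lk = ln (1 / real (Suc k))"
        have "cut_energy k ?z = 2 * lk - 2"
          unfolding cut_energy_def True lk_def by (simp add: max_def min_def field_simps del: of_nat_Suc)
        moreover have "(1 / real (Suc k)) powr (2 * \<beta>) = exp (2 * \<beta> * lk)"
          unfolding lk_def by (simp add: powr_def del: of_nat_Suc)
        ultimately show ?thesis by (simp only: exp_add[symmetric]) (simp add: algebra_simps)
      qed
      have "(\<lambda>k. (1 / real (Suc k)) powr (2 * \<beta>)) \<longlonglongrightarrow> 0"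
        by (rule tendsto_zero_powrI[OF i0 tendsto_const]) (use b in auto)
      from tendsto_mult[OF tendsto_const this, of "exp (- 2 * \<beta>)"] show ?thesis
        unfolding z(2) eq True by simp
    next
      case False
      then have zp: "0 < 1 + ?z" using z by simp
      from order_tendstoD(2)[OF i0 zp] have "\<forall>\<^sub>F k in sequentially. exp (\<beta> * cut_energy k ?z) = (1 + ?z) powr (2 * \<beta>)"
        by eventually_elim (use zp in \<open>simp add: cut_energy_above powr_def mult_ac\<close>)
      then show ?thesis unfolding z(2) by (rule tendsto_eventually)
    qed
  qed
  then have "(\<lambda>k. \<Prod>n\<in>{a..<b}. exp (\<beta> * cut_energy k (min 1 (x n \<bullet> x (n + 1))))) \<longlonglongrightarrow>
      (\<Prod>n\<in>{a..<b}. (1 + x n \<bullet> x (n + 1)) powr (2 * \<beta>))"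
    by (intro tendsto_prod) auto
  then show ?thesis
    by (simp add: cut_density_def chain_energy_def sum_distrib_left exp_sum)
qed


lemma measurable_chain_flow_config:
  "(\<lambda>x. chain_flow a b t x) \<in> borel_measurable (borel :: (int \<Rightarrow> real^3) measure)"
proof -
  have "(\<lambda>x. chain_flow a b t x) \<in> borel \<rightarrow>\<^sub>M Pi\<^sub>M UNIV (\<lambda>_::int. borel :: (real^3) measure)"
  proof (rule measurable_PiM_single')
    fix n
    have "(\<lambda>s. (t, s)) \<in> borel \<rightarrow>\<^sub>M (borel :: (real \<times> (int \<Rightarrow> real^3)) measure)"
      by (intro borel_measurable_continuous_onI continuous_intros)
    from measurable_compose[OF this measurable_chain_flow[of a b n]]
    show "(\<lambda>s. chain_flow a b t s n) \<in> borel_measurable borel" by simp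
  qed (auto simp: space_PiM)
  then show ?thesis by (simp add: measurable_cong_sets[OF refl sets_PiM_equal_borel])
qed

text \<open>For each cut-off the flow preserves the area and also \<open>cut_density\<close>, a
  function of its energy. In the limit the densities become a multiple of the chain weight. At
  configurations with an antipodal bond nothing is known about the limit of the flows, but the
  density vanishes there and the observable is bounded.\<close>

theorem integral_chain_flow:
  fixes F :: "(int \<Rightarrow> real^3) \<Rightarrow> real"
  assumes b: "\<beta> > 0" and ab: "a < b" and F: "continuous_on UNIV F" and B: "\<And>x. \<bar>F x\<bar> \<le> B"
  shows "(\<integral>s. F (chain_flow a b t s) * chain_weight \<beta> a b s \<partial>block_space {a..b}) =
    (\<integral>s. F s * chain_weight \<beta> a b s \<partial>block_space {a..b})"
proof -
  define R where "R x = (\<Prod>n\<in>{a..<b}. (1 + x n \<bullet> x (n + 1)) powr (2 * \<beta>))" for x :: "int \<Rightarrow> real^3"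
  define c where "c = ((1 + 2 * \<beta>) / (4 * pi) * (1 / 2) powr (2 * \<beta>)) ^ card {a..<b}"
  let ?M = "exp (\<beta> * (2 * ln 2 * real (card {a..<b})))"
  have ns: "norm (s n) = 1" if "s \<in> space (block_space {a..b})" "n \<in> {a..b}" for s and n :: int
    using that by (auto simp: space_block PiE_def Pi_def)
  have cw: "chain_weight \<beta> a b s = c * R s" if s: "s \<in> space (block_space {a..b})" for s
  proof -
    have "spin_kernel \<beta> (s n) (s (n + 1)) = ((1 + 2 * \<beta>) / (4 * pi) * (1 / 2) powr (2 * \<beta>)) * (1 + s n \<bullet> s (n + 1)) powr (2 * \<beta>)"
      if "n \<in> {a..<b}" for n
    proof -
      have "0 \<le> 1 + s n \<bullet> s (n + 1)" using that by (intro one_plus_inner_bounds ns[OF s]) auto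
      then show ?thesis using powr_mult[of "1 / 2" "1 + s n \<bullet> s (n + 1)" "2 * \<beta>"] by (simp add: spin_kernel_def)
    qed
    then have "chain_weight \<beta> a b s = (\<Prod>n\<in>{a..<b}. ((1 + 2 * \<beta>) / (4 * pi) * (1 / 2) powr (2 * \<beta>)) * (1 + s n \<bullet> s (n + 1)) powr (2 * \<beta>))"
      unfolding chain_weight_def by (rule prod.cong[OF refl])
    then show ?thesis unfolding c_def R_def by (simp only: prod.distrib prod_constant power_mult_distrib)
  qed
  have Fm: "F \<in> borel_measurable borel" using F by (rule borel_measurable_continuous_onI)
  note flm = measurable_chain_flow_config[of a b t]
  let ?fl = "\<lambda>k s. spin_flow (cut_coupling k) (chain_edges a b) t s"
  have Dm: "cut_density \<beta> k a b \<in> borel_measurable borel" for k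
    by (rule borel_measurable_continuous_onI[OF cut_density_cont])
  have dens: "(\<integral>s. F (?fl k s) * cut_density \<beta> k a b s \<partial>block_space {a..b}) = (\<integral>s. F s * cut_density \<beta> k a b s \<partial>block_space {a..b})" for k
  proof -
    interpret lipschitz_coupling "cut_coupling k" "2 * real (Suc k)" "2 * (real (Suc k))\<^sup>2"
      by (rule cut_coupling_lipschitz)
    \<comment> \<open>Conservation of energy moves the density under the flow; the integrand is then
      one observable composed with an area preserving map.\<close>
    have "(\<integral>s. F (?fl k s) * cut_density \<beta> k a b s \<partial>block_space {a..b}) =
        (\<integral>s. F (?fl k s) * cut_density \<beta> k a b (?fl k s) \<partial>block_space {a..b})"
    proof (rule Bochner_Integration.integral_cong[OF refl])
      fix s assume "s \<in> space (block_space {a..b})"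
      from cut_density_flow[OF ns[OF this] ab]
      show "F (?fl k s) * cut_density \<beta> k a b s = F (?fl k s) * cut_density \<beta> k a b (?fl k s)" by simp
    qed
    also have "\<dots> = (\<integral>s. F s * cut_density \<beta> k a b s \<partial>block_space {a..b})"
    proof (rule integral_spin_flow_block[where B="B * ?M"])
      show "continuous_on UNIV (\<lambda>s. F s * cut_density \<beta> k a b s)"
        by (intro continuous_intros F cut_density_cont)
      show "\<bar>F s * cut_density \<beta> k a b s\<bar> \<le> B * ?M" for s
        unfolding abs_mult using B[of s] cut_density_bounds[OF b, of k a b s] by (intro mult_mono) auto
      show "edge_sites (chain_edges a b) \<subseteq> {a..b}" using edge_sites_chain[OF ab] by simp
    qed (auto dest: chain_edges_ne)
    finally show ?thesis .
  qed
  have Rlim: "(\<lambda>k. cut_density \<beta> k a b s) \<longlonglongrightarrow> R s" if "s \<in> space (block_space {a..b})" for s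
    unfolding R_def by (rule cut_density_tendsto[OF b ns[OF that]])
  have Rm: "R \<in> borel_measurable borel"
  proof -
    note [measurable] = measurable_apply_borel
    show ?thesis unfolding R_def by measurable
  qed
  have lim1: "(\<lambda>k. F (?fl k s) * cut_density \<beta> k a b s) \<longlonglongrightarrow> F (chain_flow a b t s) * R s"
    if s: "s \<in> space (block_space {a..b})" for s
  proof (cases "\<forall>n\<in>{a..<b}. 0 < 1 + s n \<bullet> s (n + 1)")
    case True
    have "\<exists>X k0. X 0 = s \<and> (\<forall>t. chain_flow a b t s = X t) \<and>
      (\<forall>k\<ge>k0. spin_trajectory (cut_coupling k) (chain_edges a b) X \<and> (\<forall>t. spin_flow (cut_coupling k) (chain_edges a b) t s = X t)) \<and>
      (\<forall>t. \<forall>n\<in>{a..<b}. 1 / real (Suc k0) \<le> 1 + X t n \<bullet> X t (n + 1))"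
      by (rule chain_flow_trajectory[OF ab]) (use ns[OF s] True in auto)
    then obtain X k0 where "chain_flow a b t s = X t" "\<And>k. k \<ge> k0 \<Longrightarrow> ?fl k s = X t"
      by blast
    then have "\<forall>\<^sub>F k in sequentially. F (?fl k s) = F (chain_flow a b t s)"
      by (intro eventually_sequentiallyI[of k0]) simp
    then show ?thesis by (intro tendsto_mult Rlim[OF s] tendsto_eventually)
  next
    case False
    then obtain n where n: "n \<in> {a..<b}" "\<not> 0 < 1 + s n \<bullet> s (n + 1)" by blast
    moreover have "0 \<le> 1 + s n \<bullet> s (n + 1)" using n by (intro one_plus_inner_bounds ns[OF s]) auto
    ultimately have "1 + s n \<bullet> s (n + 1) = 0" by linarith
    then have R0: "R s = 0" unfolding R_def using n(1) by (intro prod_zero) (auto intro!: bexI[of _ n])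
    have "(\<lambda>k. B * cut_density \<beta> k a b s) \<longlonglongrightarrow> B * 0"
      using Rlim[OF s] unfolding R0 by (intro tendsto_mult tendsto_const)
    then have B0: "(\<lambda>k. B * cut_density \<beta> k a b s) \<longlonglongrightarrow> 0" by simp
    have "(\<lambda>k. F (?fl k s) * cut_density \<beta> k a b s) \<longlonglongrightarrow> 0"
    proof (rule Lim_null_comparison[OF always_eventually B0], intro allI)
      fix k show "norm (F (?fl k s) * cut_density \<beta> k a b s) \<le> B * cut_density \<beta> k a b s"
        unfolding real_norm_def abs_mult using B cut_density_bounds(1)[OF b, of k a b s] by (simp add: mult_right_mono)
    qed
    then show ?thesis by (simp add: R0)
  qed
  have bd: "norm (F y * cut_density \<beta> k a b s) \<le> B * ?M" for y k s
    unfolding real_norm_def abs_mult using B[of y] cut_density_bounds[OF b, of k a b s] by (intro mult_mono) auto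
  have ib: "integrable (block_space {a..b}) (\<lambda>_. B * ?M)"
    using finite_measure_block[of "{a..b}"] by (simp add: finite_measure.integrable_const)
  have "(\<lambda>k. \<integral>s. F (?fl k s) * cut_density \<beta> k a b s \<partial>block_space {a..b}) \<longlonglongrightarrow> (\<integral>s. F (chain_flow a b t s) * R s \<partial>block_space {a..b})"
  proof (rule integral_dominated_convergence[where w="\<lambda>_. B * ?M"])
    show "(\<lambda>s. F (chain_flow a b t s) * R s) \<in> borel_measurable (block_space {a..b})"
      by (intro borel_measurable_block borel_measurable_times measurable_compose[OF flm Fm] Rm)
    show "(\<lambda>s. F (?fl k s) * cut_density \<beta> k a b s) \<in> borel_measurable (block_space {a..b})" for k
    proof -
      interpret lipschitz_coupling "cut_coupling k" "2 * real (Suc k)" "2 * (real (Suc k))\<^sup>2"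
        by (rule cut_coupling_lipschitz)
      show ?thesis
        by (intro borel_measurable_block borel_measurable_times measurable_compose[OF measurable_spin_flow_config Fm] Dm)
    qed
    show "AE s in block_space {a..b}. (\<lambda>k. F (?fl k s) * cut_density \<beta> k a b s) \<longlonglongrightarrow> F (chain_flow a b t s) * R s"
      by (intro AE_I2 lim1)
  qed (use bd ib in auto)
  moreover have "(\<lambda>k. \<integral>s. F s * cut_density \<beta> k a b s \<partial>block_space {a..b}) \<longlonglongrightarrow> (\<integral>s. F s * R s \<partial>block_space {a..b})"
  proof (rule integral_dominated_convergence[where w="\<lambda>_. B * ?M"])
    show "AE s in block_space {a..b}. (\<lambda>k. F s * cut_density \<beta> k a b s) \<longlonglongrightarrow> F s * R s"
      by (intro AE_I2 tendsto_mult tendsto_const Rlim)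
  qed (use bd ib Fm Dm Rm in \<open>auto intro!: borel_measurable_block borel_measurable_times\<close>)
  ultimately have "(\<integral>s. F (chain_flow a b t s) * R s \<partial>block_space {a..b}) = (\<integral>s. F s * R s \<partial>block_space {a..b})"
    unfolding dens by (rule LIMSEQ_unique)
  moreover have "(\<integral>s. G s * chain_weight \<beta> a b s \<partial>block_space {a..b}) = c * (\<integral>s. G s * R s \<partial>block_space {a..b})" for G
    unfolding integral_mult_right_zero[symmetric]
    by (intro Bochner_Integration.integral_cong refl) (simp add: cw)
  ultimately show ?thesis by simp
qed

text \<open>The density of a Gibbs block is proportional to the chain weight, so the invariance of
  the finite flow becomes a statement on \<open>\<mu>\<close>; continuous test functions extend it
  to every measurable \<open>G\<close>.\<close>

theorem chain_flow_invariant: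
  fixes G :: "(int \<Rightarrow> real^3) \<Rightarrow> ennreal"
  assumes b: "\<beta> > 0" and g: "is_gibbs_measure \<beta> \<mu>" and ab: "a < b" and G: "G \<in> borel_measurable borel"
  shows "(\<integral>\<^sup>+S. G (chain_flow a b t (restrict S {a..b})) \<partial>\<mu>) = (\<integral>\<^sup>+S. G (restrict S {a..b}) \<partial>\<mu>)"
proof -
  interpret prob_space \<mu> using g by (simp add: is_gibbs_measure_def)
  have rm: "(\<lambda>S. restrict S {a..b}) \<in> \<mu> \<rightarrow>\<^sub>M (borel :: (int \<Rightarrow> real^3) measure)"
    using continuous_on_restrict_config by (intro gibbs_borel_measurable[OF g] borel_measurable_continuous_onI)
  note flm = measurable_chain_flow_config[of a b t]
  have rfm: "(\<lambda>S. chain_flow a b t (restrict S {a..b})) \<in> \<mu> \<rightarrow>\<^sub>M (borel :: (int \<Rightarrow> real^3) measure)"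
    by (rule measurable_compose[OF rm flm])
  define M where "M = distr \<mu> borel (\<lambda>S. chain_flow a b t (restrict S {a..b}))"
  define N where "N = distr \<mu> borel (\<lambda>S. restrict S {a..b} :: int \<Rightarrow> real^3)"
  let ?Z = "chain_integral \<beta> a b (\<lambda>_. 1)"
  have z: "?Z > 0"
    using chain_integral_1[OF b, of a "nat (b - a)"] ab kernel_mass_pos[OF b] by simp
  have "M = N"
  proof (rule finite_measure_eqI_continuous)
    show "finite_measure M" "finite_measure N" unfolding M_def N_def using rm rfm finite_measure_distr by blast+
    fix f :: "(int \<Rightarrow> real^3) \<Rightarrow> real" assume f: "continuous_on UNIV f" and f01: "\<And>x. 0 \<le> f x \<and> f x \<le> 1"
    have fm: "f \<in> borel_measurable borel" using f by (rule borel_measurable_continuous_onI)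
    have key: "ennreal (\<integral>S. h (restrict S {a..b}) \<partial>\<mu>) = ennreal ((\<integral>s. h s * chain_weight \<beta> a b s \<partial>block_space {a..b}) / ?Z)"
      if hm: "h \<in> borel_measurable borel" and h01: "\<And>x. 0 \<le> h x \<and> h x \<le> 1" for h :: "(int \<Rightarrow> real^3) \<Rightarrow> real"
    proof -
      have abs1: "\<bar>h x\<bar> \<le> 1" for x using h01[of x] by linarith
      have "integrable \<mu> (\<lambda>S. h (restrict S {a..b}))"
        using h01 measurable_compose[OF rm hm] by (intro integrable_const_bound[where B=1]) auto
      then have "ennreal (\<integral>S. h (restrict S {a..b}) \<partial>\<mu>) = (\<integral>\<^sup>+S. ennreal (h (restrict S {a..b})) \<partial>\<mu>)"
        using h01 by (intro nn_integral_eq_integral[symmetric]) auto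
      also have "\<dots> = (\<integral>\<^sup>+s. ennreal (h s) * ennreal (chain_weight \<beta> a b s / ?Z) \<partial>block_space {a..b})"
        using hm ab by (intro gibbs_block_law[OF b g]) auto
      also have "\<dots> = (\<integral>\<^sup>+s. ennreal (h s * chain_weight \<beta> a b s / ?Z) \<partial>block_space {a..b})"
        using h01 chain_weight_nonneg[OF b] z by (intro nn_integral_cong) (simp add: ennreal_mult'[symmetric] less_imp_le)
      also have "\<dots> = ennreal (\<integral>s. h s * chain_weight \<beta> a b s / ?Z \<partial>block_space {a..b})"
      proof (rule nn_integral_eq_integral)
        have "integrable (block_space {a..b}) (\<lambda>s. h s * (1 * 1 * chain_weight \<beta> a b s))"
          by (rule weighted_block_integrable(1)[OF b hm abs1, where U=1 and V=1]) (use ab in auto)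
        then show "integrable (block_space {a..b}) (\<lambda>s. h s * chain_weight \<beta> a b s / ?Z)" by simp
      qed (use h01 chain_weight_nonneg[OF b] z in \<open>auto simp: less_imp_le\<close>)
      finally show ?thesis by (simp add: integral_divide_zero)
    qed
    have absf: "\<bar>f x\<bar> \<le> 1" for x using f01[of x] by linarith
    have hm2: "(\<lambda>s. f (chain_flow a b t s)) \<in> borel_measurable borel" by (rule measurable_compose[OF flm fm])
    have "ennreal (\<integral>S. f (chain_flow a b t (restrict S {a..b})) \<partial>\<mu>) = ennreal (\<integral>S. f (restrict S {a..b}) \<partial>\<mu>)"
      using key[OF hm2 f01] key[OF fm f01] integral_chain_flow[OF b ab f absf, of t] by simp
    moreover have "0 \<le> (\<integral>S. f (chain_flow a b t (restrict S {a..b})) \<partial>\<mu>)" "0 \<le> (\<integral>S. f (restrict S {a..b}) \<partial>\<mu>)"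
      using f01 by (auto intro!: integral_nonneg)
    ultimately have "(\<integral>S. f (chain_flow a b t (restrict S {a..b})) \<partial>\<mu>) = (\<integral>S. f (restrict S {a..b}) \<partial>\<mu>)"
      by (simp add: ennreal_inj)
    then show "(\<integral>x. f x \<partial>M) = (\<integral>x. f x \<partial>N)"
      unfolding M_def N_def using fm by (simp only: integral_distr[OF rm] integral_distr[OF rfm])
  qed (auto simp: M_def N_def)
  have "(\<integral>\<^sup>+S. G (chain_flow a b t (restrict S {a..b})) \<partial>\<mu>) = (\<integral>\<^sup>+x. G x \<partial>M)"
    unfolding M_def by (rule nn_integral_distr[OF rfm, symmetric]) (use G in simp)
  also have "\<dots> = (\<integral>\<^sup>+S. G (restrict S {a..b}) \<partial>\<mu>)"
    unfolding \<open>M = N\<close> N_def by (rule nn_integral_distr[OF rm]) (use G in simp)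
  finally show ?thesis .
qed

section \<open>Comparison of finite chains\<close>

definition bond :: "(int \<Rightarrow> real^3) \<Rightarrow> int \<Rightarrow> real" where
  "bond x n = 1 + x n \<bullet> x (n + 1)"

definition lhm_field :: "(int \<Rightarrow> real^3) \<Rightarrow> int \<Rightarrow> real^3" where
  "lhm_field x n = - (x n \<times> ((2 / (1 + x n \<bullet> x (n + 1))) *\<^sub>R x (n + 1)
                        + (2 / (1 + x n \<bullet> x (n - 1))) *\<^sub>R x (n - 1)))"

text \<open>The equation is imposed in the interior only, the ends being arbitrary continuous unit
  spins. Thus finite chains with free ends, longer chains and infinite solutions all qualify and can
  be compared with one another.\<close>

definition local_lhm :: "int \<Rightarrow> (real \<Rightarrow> int \<Rightarrow> real^3) \<Rightarrow> bool" where
  "local_lhm N X \<longleftrightarrow>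
     (\<forall>t. \<forall>n\<in>{-N..N}. norm (X t n) = 1) \<and>
     (\<forall>n\<in>{-N..N}. continuous_on UNIV (\<lambda>t. X t n)) \<and>
     (\<forall>t. \<forall>n\<in>{-N..<N}. 0 < bond (X t) n) \<and>
     (\<forall>t. \<forall>n\<in>{-N<..<N}. ((\<lambda>t. X t n) has_vector_derivative lhm_field (X t) n) (at t))"

lemma lhm_field_eq:
  "lhm_field x n = - ((2 / bond x n) *\<^sub>R (x n \<times> x (n + 1)) + (2 / bond x (n - 1)) *\<^sub>R (x n \<times> x (n - 1)))"
  by (simp add: lhm_field_def bond_def cross_add_right cross_mult_right inner_commute)

lemma norm_cross_unit:
  fixes a b :: "real^3"
  assumes "norm a = 1" "norm b = 1"
  shows "(norm (a \<times> b))\<^sup>2 \<le> 2 * (1 + a \<bullet> b)"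
proof -
  have "(norm (a \<times> b))\<^sup>2 = 1 - (a \<bullet> b)\<^sup>2" using norm_cross_dot[of a b] assms by simp
  also have "\<dots> = 2 * (1 + a \<bullet> b) - (1 + a \<bullet> b)\<^sup>2" by (simp add: power2_eq_square algebra_simps)
  finally show ?thesis by simp
qed

lemma norm_add_unit:
  fixes a b :: "real^3"
  assumes "norm a = 1" "norm b = 1"
  shows "(norm (a + b))\<^sup>2 = 2 * (1 + a \<bullet> b)"
proof -
  have "a \<bullet> a = 1" "b \<bullet> b = 1" using assms by (simp_all add: dot_square_norm)
  then show ?thesis by (simp add: power2_norm_eq_inner inner_add_left inner_add_right inner_commute[of b a])
qed

text \<open>Differentiating \<open>2 / (1 + a \<bullet> b)\<close> alone would cost the inverse
  square of the bond, whose Gibbs expectation is infinite for small \<open>\<beta>\<close>. But the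
  cross product is at most \<open>sqrt 2\<close> times the root of the bond, and that root is
  \<open>norm (a + b) / sqrt 2\<close>, hence Lipschitz. Written in the roots \<open>W\<close> and
  \<open>V\<close>, the constant is of the order of the inverse bond.\<close>

lemma pair_field_diff:
  fixes a b c d :: "real^3"
  assumes u: "norm a = 1" "norm b = 1" "norm c = 1" "norm d = 1"
    and w: "0 < 1 + a \<bullet> b" "1 / (1 + a \<bullet> b) \<le> r" and v: "0 < 1 + c \<bullet> d" "1 / (1 + c \<bullet> d) \<le> r"
  shows "norm ((2 / (1 + a \<bullet> b)) *\<^sub>R (a \<times> b) - (2 / (1 + c \<bullet> d)) *\<^sub>R (c \<times> d)) \<le> 6 * r * (norm (a - c) + norm (b - d))"
proof -
  define W where "W = sqrt (1 + a \<bullet> b)"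
  define V where "V = sqrt (1 + c \<bullet> d)"
  define \<delta> where "\<delta> = norm (a - c) + norm (b - d)"
  have W: "0 < W" "1 + a \<bullet> b = W\<^sup>2" using w by (simp_all add: W_def)
  have V: "0 < V" "1 + c \<bullet> d = V\<^sup>2" using v by (simp_all add: V_def)
  have d0: "0 \<le> \<delta>" by (simp add: \<delta>_def)
  have sq: "(sqrt 2 * z)\<^sup>2 = 2 * z\<^sup>2" for z :: real by (simp add: power_mult_distrib)
  have cd: "norm (c \<times> d) \<le> sqrt 2 * V"
  proof (rule power2_le_imp_le)
    show "(norm (c \<times> d))\<^sup>2 \<le> (sqrt 2 * V)\<^sup>2" using norm_cross_unit[OF u(3,4)] unfolding sq V(2) .
  qed (use V in simp)
  have nab: "norm (a + b) = sqrt 2 * W"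
  proof (rule power2_eq_imp_eq)
    show "(norm (a + b))\<^sup>2 = (sqrt 2 * W)\<^sup>2" using norm_add_unit[OF u(1,2)] unfolding sq W(2) .
  qed (use W in auto)
  have ncd: "norm (c + d) = sqrt 2 * V"
  proof (rule power2_eq_imp_eq)
    show "(norm (c + d))\<^sup>2 = (sqrt 2 * V)\<^sup>2" using norm_add_unit[OF u(3,4)] unfolding sq V(2) .
  qed (use V in auto)
  have "\<bar>norm (a + b) - norm (c + d)\<bar> \<le> norm ((a + b) - (c + d))" by (rule norm_triangle_ineq3)
  also have "(a + b) - (c + d) = (a - c) + (b - d)" by simp
  also have "norm \<dots> \<le> \<delta>" unfolding \<delta>_def by (rule norm_triangle_ineq)
  finally have s2: "sqrt 2 * \<bar>W - V\<bar> \<le> \<delta>"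
    unfolding nab ncd by (simp add: abs_mult flip: right_diff_distrib)
  have eq: "(2 / W\<^sup>2) *\<^sub>R (a \<times> b) - (2 / V\<^sup>2) *\<^sub>R (c \<times> d) = (2 / W\<^sup>2) *\<^sub>R (a \<times> b - c \<times> d) + (2 / W\<^sup>2 - 2 / V\<^sup>2) *\<^sub>R (c \<times> d)"
    by (simp add: algebra_simps)
  have t1: "norm ((2 / W\<^sup>2) *\<^sub>R (a \<times> b - c \<times> d)) \<le> 2 * (1 / W\<^sup>2) * \<delta>"
  proof -
    have "norm (a \<times> b - c \<times> d) \<le> norm ((a - c) \<times> b) + norm (c \<times> (b - d))"
      unfolding cross_diff[of a b c d] by (rule norm_triangle_ineq)
    also have "\<dots> \<le> \<delta>" unfolding \<delta>_def using norm_cross_le[of "a - c" b] norm_cross_le[of c "b - d"] u by simp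
    finally show ?thesis using W by (simp add: divide_right_mono)
  qed
  have t2: "norm ((2 / W\<^sup>2 - 2 / V\<^sup>2) *\<^sub>R (c \<times> d)) \<le> (3 * (1 / W\<^sup>2) + 1 / V\<^sup>2) * \<delta>"
  proof -
    have "2 / W\<^sup>2 - 2 / V\<^sup>2 = 2 * (V - W) * (V + W) / (W\<^sup>2 * V\<^sup>2)"
      using W V by (simp add: field_simps power2_eq_square)
    moreover have "\<bar>2 * (V - W) * (V + W) / (W\<^sup>2 * V\<^sup>2)\<bar> = 2 * \<bar>V - W\<bar> * (V + W) / (W\<^sup>2 * V\<^sup>2)"
      by (subst abs_divide, subst abs_mult, subst abs_mult) (use W V in simp)
    ultimately have "\<bar>2 / W\<^sup>2 - 2 / V\<^sup>2\<bar> = 2 * \<bar>W - V\<bar> * (V + W) / (W\<^sup>2 * V\<^sup>2)"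
      by (simp only: abs_minus_commute)
    then have "norm ((2 / W\<^sup>2 - 2 / V\<^sup>2) *\<^sub>R (c \<times> d)) = (2 * \<bar>W - V\<bar> * (V + W) / (W\<^sup>2 * V\<^sup>2)) * norm (c \<times> d)"
      by simp
    also have "\<dots> \<le> (2 * \<bar>W - V\<bar> * (V + W) / (W\<^sup>2 * V\<^sup>2)) * (sqrt 2 * V)"
      using W V by (intro mult_left_mono cd) auto
    also have "\<dots> = (sqrt 2 * \<bar>W - V\<bar>) * (2 * (V + W) * V / (W\<^sup>2 * V\<^sup>2))" by (simp add: mult_ac)
    also have "\<dots> \<le> \<delta> * (2 * (V + W) * V / (W\<^sup>2 * V\<^sup>2))"
      using W V by (intro mult_right_mono s2) auto
    also have "\<dots> \<le> \<delta> * (3 * (1 / W\<^sup>2) + 1 / V\<^sup>2)"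
    proof (rule mult_left_mono[OF _ d0])
      \<comment> \<open>The mixed term \<open>1 / (W * V)\<close> is split by the
        arithmetic-geometric mean inequality, so that each inverse bond occurs by itself.\<close>
      have "2 * (V + W) * V / (W\<^sup>2 * V\<^sup>2) = 2 * (1 / W\<^sup>2) + 2 * ((1 / W) * (1 / V))"
        using W V by (simp add: field_simps power2_eq_square)
      also have "2 * ((1 / W) * (1 / V)) \<le> (1 / W)\<^sup>2 + (1 / V)\<^sup>2"
        using sum_squares_bound[of "1 / W" "1 / V"] by (simp add: mult.assoc)
      finally show "2 * (V + W) * V / (W\<^sup>2 * V\<^sup>2) \<le> 3 * (1 / W\<^sup>2) + 1 / V\<^sup>2"
        by (simp add: power_divide)
    qed
    finally show ?thesis by (simp only: mult.commute)
  qed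
  have "norm ((2 / W\<^sup>2) *\<^sub>R (a \<times> b) - (2 / V\<^sup>2) *\<^sub>R (c \<times> d)) \<le> 2 * (1 / W\<^sup>2) * \<delta> + (3 * (1 / W\<^sup>2) + 1 / V\<^sup>2) * \<delta>"
    unfolding eq by (intro order_trans[OF norm_triangle_ineq] add_mono t1 t2)
  also have "\<dots> = (5 * (1 / W\<^sup>2) + 1 / V\<^sup>2) * \<delta>" by (simp add: algebra_simps)
  also have "\<dots> \<le> (5 * r + r) * \<delta>"
    using w v W V d0 by (intro mult_right_mono add_mono mult_left_mono) auto
  finally show ?thesis unfolding W(2) V(2) \<delta>_def by simp
qed

lemma lhm_field_diff:
  assumes X: "local_lhm N X" and Z: "local_lhm N Z" and n: "n \<in> {-N<..<N}"
    and r: "\<And>n. n \<in> {-N..<N} \<Longrightarrow> 1 / bond (X t) n \<le> r" "\<And>n. n \<in> {-N..<N} \<Longrightarrow> 1 / bond (Z t) n \<le> r"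
  defines "D \<equiv> \<lambda>n. norm (X t n - Z t n)"
  shows "norm (lhm_field (X t) n - lhm_field (Z t) n) \<le> 6 * r * (2 * D n + D (n + 1) + D (n - 1))"
proof -
  have u: "norm (X t m) = 1" "norm (Z t m) = 1" if "m \<in> {-N..N}" for m
    using X Z that unfolding local_lhm_def by auto
  have w: "0 < bond (X t) m" "0 < bond (Z t) m" if "m \<in> {-N..<N}" for m
    using X Z that unfolding local_lhm_def by auto
  let ?E = "\<lambda>x m k. (2 / bond x k) *\<^sub>R (x n \<times> x m)"
  have e1: "norm (?E (X t) (n + 1) n - ?E (Z t) (n + 1) n) \<le> 6 * r * (D n + D (n + 1))"
    unfolding bond_def D_def using n u w[of n] r[of n] by (intro pair_field_diff) (auto simp: bond_def)
  have e2: "norm (?E (X t) (n - 1) (n - 1) - ?E (Z t) (n - 1) (n - 1)) \<le> 6 * r * (D n + D (n - 1))"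
  proof -
    have bm: "bond x (n - 1) = 1 + x n \<bullet> x (n - 1)" for x by (simp add: bond_def inner_commute)
    have n1: "n - 1 \<in> {-N..<N}" using n by auto
    show ?thesis
      unfolding D_def bm
      by (rule pair_field_diff) (use n u w[OF n1] r(1)[OF n1] r(2)[OF n1] in \<open>auto simp: bm\<close>)
  qed
  have "lhm_field (X t) n - lhm_field (Z t) n =
      - (?E (X t) (n + 1) n - ?E (Z t) (n + 1) n) - (?E (X t) (n - 1) (n - 1) - ?E (Z t) (n - 1) (n - 1))"
    by (simp add: lhm_field_eq)
  also have "norm \<dots> \<le> 6 * r * (D n + D (n + 1)) + 6 * r * (D n + D (n - 1))"
    by (rule order_trans[OF norm_triangle_ineq4]) (use e1 e2 in \<open>simp add: norm_minus_commute add_mono\<close>)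
  finally show ?thesis by (simp add: algebra_simps)
qed

text \<open>The quantity \<open>Y + \<delta>\<close> satisfies a homogeneous inequality, and
  multiplying it by the exponential of the integrated rate, with opposite signs for the two time
  directions, makes it monotone.\<close>

lemma gronwall:
  fixes Y :: "real \<Rightarrow> real"
  assumes Y: "\<And>t. (Y has_real_derivative Y' t) (at t)" and le: "\<And>t. \<bar>Y' t\<bar> \<le> c * r t * (Y t + \<delta>)"
    and r: "continuous_on UNIV r" and Y0: "Y 0 = 0" and d: "\<delta> \<ge> 0" and c: "c \<ge> 0"
  shows "Y t \<le> \<delta> * exp (c * \<bar>signed_integral r t\<bar>)"
proof -
  let ?B = "signed_integral r"
  have B: "(?B has_real_derivative r s) (at s)" for s
    using signed_integral_deriv[OF r] by (simp add: has_real_derivative_iff_has_vector_derivative)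
  have *: "Y t + \<delta> \<le> \<delta> * exp (c * \<bar>?B t\<bar>)"
  proof (cases "t \<ge> 0")
    case True
    have "(Y t + \<delta>) * exp (- c * ?B t) \<le> (Y 0 + \<delta>) * exp (- c * ?B 0)"
    proof (rule DERIV_nonpos_imp_nonincreasing[OF True, where f="\<lambda>t. (Y t + \<delta>) * exp (- c * ?B t)"])
      fix s
      have "((\<lambda>t. (Y t + \<delta>) * exp (- c * ?B t)) has_real_derivative
          (Y' s - c * r s * (Y s + \<delta>)) * exp (- c * ?B s)) (at s)"
        by (auto intro!: derivative_eq_intros Y B simp: algebra_simps)
      moreover have "(Y' s - c * r s * (Y s + \<delta>)) * exp (- c * ?B s) \<le> 0"
        using le[of s] by (intro mult_nonpos_nonneg) auto
      ultimately show "\<exists>y. ((\<lambda>t. (Y t + \<delta>) * exp (- c * ?B t)) has_real_derivative y) (at s) \<and> y \<le> 0" by blast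
    qed
    then have "(Y t + \<delta>) * exp (- c * ?B t) \<le> \<delta>" using Y0 by simp
    then have "Y t + \<delta> \<le> \<delta> * exp (c * ?B t)" by (simp add: exp_minus divide_le_eq flip: divide_inverse)
    also have "\<dots> \<le> \<delta> * exp (c * \<bar>?B t\<bar>)" using d c by (intro mult_left_mono) (auto intro: mult_left_mono)
    finally show ?thesis .
  next
    case False
    have "(Y t + \<delta>) * exp (c * ?B t) \<le> (Y 0 + \<delta>) * exp (c * ?B 0)"
    proof (rule DERIV_nonneg_imp_nondecreasing[where f="\<lambda>t. (Y t + \<delta>) * exp (c * ?B t)"])
      fix s
      have "((\<lambda>t. (Y t + \<delta>) * exp (c * ?B t)) has_real_derivative
          (Y' s + c * r s * (Y s + \<delta>)) * exp (c * ?B s)) (at s)"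
        by (auto intro!: derivative_eq_intros Y B simp: algebra_simps)
      moreover have "0 \<le> (Y' s + c * r s * (Y s + \<delta>)) * exp (c * ?B s)"
        using le[of s] by (intro mult_nonneg_nonneg) auto
      ultimately show "\<exists>y. ((\<lambda>t. (Y t + \<delta>) * exp (c * ?B t)) has_real_derivative y) (at s) \<and> 0 \<le> y" by blast
    qed (use False in simp)
    then have "(Y t + \<delta>) * exp (c * ?B t) \<le> \<delta>" using Y0 by simp
    then have "Y t + \<delta> \<le> \<delta> * exp (- (c * ?B t))" by (simp add: exp_minus pos_le_divide_eq flip: divide_inverse)
    also have "\<dots> \<le> \<delta> * exp (c * \<bar>?B t\<bar>)"
    proof -
      have "- (c * ?B t) \<le> c * \<bar>?B t\<bar>" using c mult_left_mono[of "- ?B t" "\<bar>?B t\<bar>" c] by simp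
      then show ?thesis using d by (intro mult_left_mono) auto
    qed
    finally show ?thesis .
  qed
  then show ?thesis using d by linarith
qed

text \<open>The exponential weight makes the influence of the ends of the block negligible.\<close>

theorem local_lhm_compare:
  assumes X: "local_lhm N X" and Z: "local_lhm N Z" and N: "N > 0"
    and r: "continuous_on UNIV r" "\<And>t n. n \<in> {-N..<N} \<Longrightarrow> 1 / bond (X t) n \<le> r t"
      "\<And>t n. n \<in> {-N..<N} \<Longrightarrow> 1 / bond (Z t) n \<le> r t"
    and init: "\<And>n. n \<in> {-N<..<N} \<Longrightarrow> X 0 n = Z 0 n" and n: "n \<in> {-N<..<N}"
  shows "exp (- \<bar>real_of_int n\<bar>) * (norm (X t n - Z t n))\<^sup>2 \<le> 4 * exp (- real_of_int N) * exp (72 * \<bar>signed_integral r t\<bar>)"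
proof -
  define D where "D t n = norm (X t n - Z t n)" for t n
  define e where "e n = exp (- \<bar>real_of_int n\<bar>)" for n
  define Y where "Y t = (\<Sum>n\<in>{-N<..<N}. e n * (D t n)\<^sup>2)" for t
  define Y' where "Y' t = (\<Sum>n\<in>{-N<..<N}. e n * (2 * ((X t n - Z t n) \<bullet> (lhm_field (X t) n - lhm_field (Z t) n))))" for t
  have u: "norm (X t m) = 1" "norm (Z t m) = 1" if "m \<in> {-N..N}" for m t
    using X Z that unfolding local_lhm_def by auto
  have D0: "0 \<le> D t n" for t n by (simp add: D_def)
  have e0: "0 < e n" for n by (simp add: e_def)
  have D2: "D t m \<le> 2" if "m \<in> {-N..N}" for t m
    unfolding D_def using norm_triangle_ineq4[of "X t m" "Z t m"] u[OF that] by simp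
  have r0: "0 \<le> r t" for t
  proof -
    have "-N \<in> {-N..<N}" using N by simp
    then have "0 < bond (X t) (-N)" "1 / bond (X t) (-N) \<le> r t" using X r(2) unfolding local_lhm_def by blast+
    then show ?thesis by (meson less_imp_le order_trans zero_le_divide_1_iff)
  qed
  have dY: "(Y has_real_derivative Y' t) (at t)" for t
  proof -
    have "((\<lambda>t. (D t n)\<^sup>2) has_real_derivative 2 * ((X t n - Z t n) \<bullet> (lhm_field (X t) n - lhm_field (Z t) n))) (at t)"
      if n: "n \<in> {-N<..<N}" for n
    proof -
      have d: "((\<lambda>t. X t n - Z t n) has_vector_derivative (lhm_field (X t) n - lhm_field (Z t) n)) (at t)"
        using X Z n unfolding local_lhm_def by (intro has_vector_derivative_diff) auto
      from bounded_bilinear.has_vector_derivative[OF bounded_bilinear_inner d d]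
      show ?thesis
        unfolding D_def power2_norm_eq_inner has_real_derivative_iff_has_vector_derivative by (simp add: inner_commute)
    qed
    then show ?thesis unfolding Y_def Y'_def by (intro DERIV_sum DERIV_cmult) auto
  qed
  \<comment> \<open>Neighbouring weights differ by a factor of at most \<open>exp 1 \<le> 3\<close>.
    The shifted sum reaches one site beyond the interior; there the spins differ by at most 2 and
    the weight is \<open>exp (- N)\<close>, so allowing for both ends adds
    \<open>8 * exp (- N)\<close>.\<close>
  have shift: "(\<Sum>n\<in>{-N<..<N}. e n * (D t (n + s))\<^sup>2) \<le> 3 * (Y t + 8 * exp (- real_of_int N))" if s: "s = 1 \<or> s = - 1" for s t
  proof -
    have "(\<Sum>n\<in>{-N<..<N}. e n * (D t (n + s))\<^sup>2) \<le> (\<Sum>n\<in>{-N<..<N}. 3 * (e (n + s) * (D t (n + s))\<^sup>2))"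
    proof (rule sum_mono)
      fix n
      have "e n \<le> exp 1 * e (n + s)" unfolding e_def exp_add[symmetric] using s by auto
      also have "\<dots> \<le> 3 * e (n + s)" using e0[of "n + s"] exp_le by (intro mult_right_mono) auto
      finally show "e n * (D t (n + s))\<^sup>2 \<le> 3 * (e (n + s) * (D t (n + s))\<^sup>2)"
        by (simp add: mult_right_mono flip: mult.assoc)
    qed
    also have "\<dots> = 3 * (\<Sum>m\<in>(\<lambda>n. n + s) ` {-N<..<N}. e m * (D t m)\<^sup>2)"
      by (simp add: sum_distrib_left sum.reindex)
    also have "(\<Sum>m\<in>(\<lambda>n. n + s) ` {-N<..<N}. e m * (D t m)\<^sup>2) \<le> (\<Sum>m\<in>insert N (insert (-N) {-N<..<N}). e m * (D t m)\<^sup>2)"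
      using s e0 by (intro sum_mono2) (auto simp: less_imp_le)
    also have "\<dots> = e N * (D t N)\<^sup>2 + (e (-N) * (D t (-N))\<^sup>2 + Y t)"
      unfolding Y_def using N by (subst sum.insert, simp, simp)+ simp
    also have "\<dots> \<le> exp (- real_of_int N) * 4 + (exp (- real_of_int N) * 4 + Y t)"
    proof -
      have "(D t N)\<^sup>2 \<le> 2\<^sup>2" by (rule power_mono[OF D2 D0]) (use N in simp)
      moreover have "(D t (-N))\<^sup>2 \<le> 2\<^sup>2" by (rule power_mono[OF D2 D0]) (use N in simp)
      moreover have "e N = exp (- real_of_int N)" "e (-N) = exp (- real_of_int N)" using N by (auto simp: e_def)
      ultimately show ?thesis by (intro add_mono mult_mono) auto
    qed
    finally show ?thesis by simp
  qed
  \<comment> \<open>The constants: a field difference costs \<open>6 * r\<close>, splitting the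
    products into squares leaves the coefficients 6, 1 and 1, and each shifted sum costs 3. So the
    rate is \<open>6 * (6 + 3 + 3) = 72\<close>, and the end terms give
    \<open>6 * (24 + 24) = 72 * 4\<close>.\<close>
  have Ybd: "\<bar>Y' t\<bar> \<le> 72 * r t * (Y t + 4 * exp (- real_of_int N))" for t
  proof -
    have "\<bar>Y' t\<bar> \<le> (\<Sum>n\<in>{-N<..<N}. \<bar>e n * (2 * ((X t n - Z t n) \<bullet> (lhm_field (X t) n - lhm_field (Z t) n)))\<bar>)"
      unfolding Y'_def by (rule sum_abs)
    also have "\<dots> \<le> (\<Sum>n\<in>{-N<..<N}. 6 * r t * (6 * (e n * (D t n)\<^sup>2) + e n * (D t (n + 1))\<^sup>2 + e n * (D t (n + - 1))\<^sup>2))"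
    proof (rule sum_mono)
      fix n assume n: "n \<in> {-N<..<N}"
      let ?d = "D t n" and ?p = "D t (n + 1)" and ?m = "D t (n - 1)"
      have "\<bar>(X t n - Z t n) \<bullet> (lhm_field (X t) n - lhm_field (Z t) n)\<bar> \<le> ?d * norm (lhm_field (X t) n - lhm_field (Z t) n)"
        unfolding D_def by (rule Cauchy_Schwarz_ineq2)
      also have "\<dots> \<le> ?d * (6 * r t * (2 * ?d + ?p + ?m))"
        using lhm_field_diff[OF X Z n r(2,3)] D0 unfolding D_def by (intro mult_left_mono) auto
      also have "\<dots> = 6 * r t * (2 * ?d\<^sup>2 + ?d * ?p + ?d * ?m)" by (simp add: algebra_simps power2_eq_square)
      also have "\<dots> \<le> 6 * r t * (2 * ?d\<^sup>2 + (?d\<^sup>2 + ?p\<^sup>2) / 2 + (?d\<^sup>2 + ?m\<^sup>2) / 2)"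
      proof (intro mult_left_mono add_mono order_refl)
        show "?d * ?p \<le> (?d\<^sup>2 + ?p\<^sup>2) / 2" "?d * ?m \<le> (?d\<^sup>2 + ?m\<^sup>2) / 2"
          using sum_squares_bound[of ?d ?p] sum_squares_bound[of ?d ?m] by (simp_all add: mult.assoc)
      qed (simp_all add: r0)
      also have "6 * r t * (2 * ?d\<^sup>2 + (?d\<^sup>2 + ?p\<^sup>2) / 2 + (?d\<^sup>2 + ?m\<^sup>2) / 2) = 6 * r t * (6 * ?d\<^sup>2 + ?p\<^sup>2 + ?m\<^sup>2) / 2"
        by (simp add: field_simps)
      finally have "2 * \<bar>(X t n - Z t n) \<bullet> (lhm_field (X t) n - lhm_field (Z t) n)\<bar> \<le> 6 * r t * (6 * ?d\<^sup>2 + ?p\<^sup>2 + ?m\<^sup>2)"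
        by linarith
      then have "e n * (2 * \<bar>(X t n - Z t n) \<bullet> (lhm_field (X t) n - lhm_field (Z t) n)\<bar>) \<le> e n * (6 * r t * (6 * ?d\<^sup>2 + ?p\<^sup>2 + ?m\<^sup>2))"
        using e0[of n] by (intro mult_left_mono) auto
      moreover have "\<bar>e n * (2 * A)\<bar> = e n * (2 * \<bar>A\<bar>)" for A
        using e0[of n] by (simp add: abs_mult)
      moreover have "e n * (6 * r t * (6 * ?d\<^sup>2 + ?p\<^sup>2 + ?m\<^sup>2)) =
          6 * r t * (6 * (e n * ?d\<^sup>2) + e n * ?p\<^sup>2 + e n * (D t (n + - 1))\<^sup>2)"
        by (simp add: algebra_simps)
      ultimately show "\<bar>e n * (2 * ((X t n - Z t n) \<bullet> (lhm_field (X t) n - lhm_field (Z t) n)))\<bar> \<le>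
          6 * r t * (6 * (e n * ?d\<^sup>2) + e n * ?p\<^sup>2 + e n * (D t (n + - 1))\<^sup>2)"
        by (simp only:)
    qed
    also have "\<dots> = 6 * r t * (6 * Y t + (\<Sum>n\<in>{-N<..<N}. e n * (D t (n + 1))\<^sup>2) + (\<Sum>n\<in>{-N<..<N}. e n * (D t (n + - 1))\<^sup>2))"
      unfolding Y_def by (simp add: sum_distrib_left sum.distrib distrib_left)
    also have "\<dots> \<le> 6 * r t * (6 * Y t + 3 * (Y t + 8 * exp (- real_of_int N)) + 3 * (Y t + 8 * exp (- real_of_int N)))"
      using r0[of t] shift[of 1 t] shift[of "- 1" t] by (intro mult_left_mono add_mono order_refl) auto
    also have "\<dots> = 72 * r t * (Y t + 4 * exp (- real_of_int N))" by (simp add: algebra_simps)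
    finally show ?thesis .
  qed
  have "Y t \<le> 4 * exp (- real_of_int N) * exp (72 * \<bar>signed_integral r t\<bar>)"
    by (rule gronwall[OF dY Ybd r(1)]) (auto simp: Y_def D_def init)
  moreover have "e n * (D t n)\<^sup>2 \<le> Y t"
    unfolding Y_def using n e0 by (intro member_le_sum) (auto simp: less_imp_le)
  ultimately show ?thesis unfolding e_def D_def by simp
qed

text \<open>Since \<open>a \<times> b\<close> is orthogonal to \<open>a\<close>, only the component
  of \<open>c\<close> orthogonal to \<open>a\<close> counts, and its length is
  \<open>norm (a \<times> c)\<close>. For unit \<open>b\<close> and \<open>c\<close> both factors
  are small near the antipode of \<open>a\<close>.\<close>

lemma triple_product_le:
  fixes a b c :: "real^3"
  assumes a: "norm a = 1"
  shows "\<bar>(a \<times> b) \<bullet> c\<bar> \<le> norm (a \<times> b) * norm (a \<times> c)"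
proof -
  have "(a \<times> b) \<bullet> c = (a \<times> (a \<times> b)) \<bullet> (a \<times> c)"
    using a by (simp add: dot_cross dot_cross_self dot_square_norm)
  also have "\<bar>\<dots>\<bar> \<le> norm (a \<times> (a \<times> b)) * norm (a \<times> c)" by (rule Cauchy_Schwarz_ineq2)
  also have "\<dots> \<le> norm (a \<times> b) * norm (a \<times> c)"
    using norm_cross_le[of a "a \<times> b"] a by (intro mult_right_mono) auto
  finally show ?thesis .
qed

text \<open>In the derivative of bond \<open>n\<close> its own singular coupling drops out, the
  corresponding cross product being orthogonal to both spins. The remaining two terms are triple
  products, of the order of the root of bond \<open>n\<close> over the root of an adjacent bond.
  After division by bond \<open>n\<close> only products of two inverse roots are left, so the
  logarithmic derivative is at most \<open>8 * r\<close>.\<close>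

theorem bond_lower_bound:
  assumes X: "local_lhm N X" and n: "-N < n" "n + 1 < N"
    and r: "continuous_on UNIV r" "\<And>t m. m \<in> {n - 1, n, n + 1} \<Longrightarrow> 1 / bond (X t) m \<le> r t"
  shows "bond (X 0) n * exp (- 8 * \<bar>signed_integral r t\<bar>) \<le> bond (X t) n"
proof -
  have u: "norm (X t m) = 1" if "m \<in> {-N..N}" for m t using X that unfolding local_lhm_def by auto
  have w: "0 < bond (X t) m" if "m \<in> {-N..<N}" for m t using X that unfolding local_lhm_def by auto
  have d: "((\<lambda>t. X t m) has_vector_derivative lhm_field (X t) m) (at t)" if "m \<in> {-N<..<N}" for m t
    using X that unfolding local_lhm_def by auto
  let ?d = "\<lambda>t. X t n \<bullet> lhm_field (X t) (n + 1) + lhm_field (X t) n \<bullet> X t (n + 1)"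
  have db: "((\<lambda>t. bond (X t) n) has_real_derivative ?d t) (at t)" for t
  proof -
    have "((\<lambda>t. X t n \<bullet> X t (n + 1)) has_real_derivative ?d t) (at t)"
      unfolding has_real_derivative_iff_has_vector_derivative
      by (rule bounded_bilinear.has_vector_derivative[OF bounded_bilinear_inner d d]) (use n in auto)
    from DERIV_add[OF DERIV_const[of 1] this] show ?thesis unfolding bond_def by simp
  qed
  have dbd: "\<bar>?d t\<bar> \<le> 8 * r t * bond (X t) n" for t
  proof -
    let ?x = "X t"
    define W where "W m = sqrt (bond ?x m)" for m
    have W: "0 < W m" "bond ?x m = (W m)\<^sup>2" if "m \<in> {n - 1, n, n + 1}" for m
      using w[of m t] that n by (auto simp: W_def)
    have cr: "norm (?x (n + 1) \<times> ?x n) \<le> sqrt 2 * W n" "norm (?x n \<times> ?x (n + 1)) \<le> sqrt 2 * W n"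
      "norm (?x n \<times> ?x (n - 1)) \<le> sqrt 2 * W (n - 1)" "norm (?x (n + 1) \<times> ?x (n + 2)) \<le> sqrt 2 * W (n + 1)"
    proof -
      have *: "norm (a \<times> b) \<le> sqrt 2 * sqrt (1 + a \<bullet> b)" if "norm a = 1" "norm b = 1" for a b :: "real^3"
        using real_le_rsqrt[OF norm_cross_unit[OF that]] unfolding real_sqrt_mult .
      show "norm (?x (n + 1) \<times> ?x n) \<le> sqrt 2 * W n" "norm (?x n \<times> ?x (n + 1)) \<le> sqrt 2 * W n"
        "norm (?x n \<times> ?x (n - 1)) \<le> sqrt 2 * W (n - 1)" "norm (?x (n + 1) \<times> ?x (n + 2)) \<le> sqrt 2 * W (n + 1)"
        using *[of "?x (n + 1)" "?x n"] *[of "?x n" "?x (n + 1)"] *[of "?x n" "?x (n - 1)"] *[of "?x (n + 1)" "?x (n + 2)"]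
          u[of _ t] n by (auto simp: W_def bond_def inner_commute add.commute)
    qed
    have e1: "lhm_field ?x n \<bullet> ?x (n + 1) = - (2 / bond ?x (n - 1)) * ((?x n \<times> ?x (n - 1)) \<bullet> ?x (n + 1))"
      by (simp add: lhm_field_eq inner_diff_left inner_add_left dot_cross_self)
    have e2: "?x n \<bullet> lhm_field ?x (n + 1) = - (2 / bond ?x (n + 1)) * ((?x (n + 1) \<times> ?x (n + 2)) \<bullet> ?x n)"
      by (simp add: lhm_field_eq inner_diff_right inner_add_right dot_cross_self inner_commute add.commute)
    have "\<bar>lhm_field ?x n \<bullet> ?x (n + 1)\<bar> \<le> (2 / (W (n - 1))\<^sup>2) * ((sqrt 2 * W (n - 1)) * (sqrt 2 * W n))"
      unfolding e1 abs_mult using W[of "n - 1"] W[of n] n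
      by (intro mult_mono order_trans[OF triple_product_le[OF u]] cr) auto
    also have "\<dots> = 4 * (1 / W (n - 1) * W n)" using W[of "n - 1"] by (simp add: field_simps power2_eq_square)
    finally have f1: "\<bar>lhm_field ?x n \<bullet> ?x (n + 1)\<bar> \<le> 4 * (1 / W (n - 1) * W n)" .
    have "\<bar>?x n \<bullet> lhm_field ?x (n + 1)\<bar> \<le> (2 / (W (n + 1))\<^sup>2) * ((sqrt 2 * W (n + 1)) * (sqrt 2 * W n))"
      unfolding e2 abs_mult using W[of "n + 1"] W[of n] n
      by (intro mult_mono order_trans[OF triple_product_le[OF u]] cr) auto
    also have "\<dots> = 4 * (1 / W (n + 1) * W n)" using W[of "n + 1"] by (simp add: field_simps power2_eq_square)
    finally have f2: "\<bar>?x n \<bullet> lhm_field ?x (n + 1)\<bar> \<le> 4 * (1 / W (n + 1) * W n)" .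
    \<comment> \<open>Twice the product of two inverse roots is at most the sum of the two inverse
      bonds, each bounded by \<open>r\<close>.\<close>
    have g: "1 / W m * W n \<le> r t * (W n)\<^sup>2" if m: "m \<in> {n - 1, n + 1}" for m
    proof -
      have "2 * (1 / W m * (1 / W n)) \<le> (1 / W m)\<^sup>2 + (1 / W n)\<^sup>2"
        using sum_squares_bound[of "1 / W m" "1 / W n"] by simp
      also have "\<dots> \<le> r t + r t"
        using r(2)[of m t] r(2)[of n t] W[of m] W[of n] m by (auto simp: power_divide)
      finally have "1 / W m * (1 / W n) \<le> r t" by simp
      then have "1 / W m * (1 / W n) * (W n)\<^sup>2 \<le> r t * (W n)\<^sup>2" by (intro mult_right_mono) auto
      then show ?thesis using W[of n] by (simp add: power2_eq_square)
    qed
    have "\<bar>?d t\<bar> \<le> 4 * (r t * (W n)\<^sup>2) + 4 * (r t * (W n)\<^sup>2)"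
      using f1 f2 g[of "n - 1"] g[of "n + 1"] by (intro order_trans[OF abs_triangle_ineq]) auto
    then show ?thesis using W(2)[of n] by simp
  qed
  have wn: "0 < bond (X t) n" for t using w[of n t] n by auto
  have dl: "((\<lambda>t. ln (bond (X t) n)) has_vector_derivative (?d t / bond (X t) n)) (at t)" for t
    unfolding has_real_derivative_iff_has_vector_derivative[symmetric]
    using wn[of t] db by (auto intro!: derivative_eq_intros simp: divide_inverse)
  have dlb: "norm (?d t / bond (X t) n) \<le> 8 * r t" for t
    using dbd[of t] wn[of t] by (simp add: abs_divide pos_divide_le_eq)
  have B: "((\<lambda>t. 8 * signed_integral r t) has_real_derivative 8 * r s) (at s)" for s
    using signed_integral_deriv[OF r(1)] by (intro DERIV_cmult) (simp add: has_real_derivative_iff_has_vector_derivative)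
  have "\<bar>ln (bond (X t) n) - ln (bond (X 0) n)\<bar> \<le> 8 * \<bar>signed_integral r t\<bar>"
  proof (cases "t \<ge> 0")
    case True
    have "norm (ln (bond (X t) n) - ln (bond (X 0) n)) \<le> 8 * signed_integral r t - 8 * signed_integral r 0"
      by (rule norm_diff_le_of_deriv[OF dl B dlb True])
    then show ?thesis by simp
  next
    case False
    have "norm (ln (bond (X 0) n) - ln (bond (X t) n)) \<le> 8 * signed_integral r 0 - 8 * signed_integral r t"
      by (rule norm_diff_le_of_deriv[OF dl B dlb]) (use False in simp)
    then show ?thesis by (simp add: abs_minus_commute)
  qed
  then have "ln (bond (X 0) n) - 8 * \<bar>signed_integral r t\<bar> \<le> ln (bond (X t) n)" by linarith
  then have "exp (ln (bond (X 0) n) - 8 * \<bar>signed_integral r t\<bar>) \<le> exp (ln (bond (X t) n))" by simp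
  then show ?thesis using wn by (simp add: exp_diff exp_minus divide_inverse)
qed

section \<open>Good solutions\<close>

lemma jbracket_ge_1: "1 \<le> jbracket n"
  by (simp add: jbracket_def)

lemma jbracket_ge_abs: "\<bar>real_of_int n\<bar> \<le> jbracket n"
  unfolding jbracket_def by (rule real_le_rsqrt) simp

lemma jbracket_mono: "\<bar>m\<bar> \<le> \<bar>n\<bar> \<Longrightarrow> jbracket m \<le> jbracket n"
proof -
  assume "\<bar>m\<bar> \<le> \<bar>n\<bar>"
  then have "\<bar>real_of_int m\<bar> \<le> \<bar>real_of_int n\<bar>" by linarith
  then have "(real_of_int m)\<^sup>2 \<le> (real_of_int n)\<^sup>2" by (simp add: abs_le_square_iff)
  then show ?thesis by (simp add: jbracket_def)
qed

lemma signed_integral_add: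
  assumes "continuous_on UNIV f" "continuous_on UNIV (g :: real \<Rightarrow> real)"
  shows "signed_integral (\<lambda>t. f t + g t) t = signed_integral f t + signed_integral g t"
proof -
  have "f integrable_on {a..b}" "g integrable_on {a..b}" for a b
    using assms by (auto intro!: integrable_continuous_interval intro: continuous_on_subset)
  then show ?thesis by (simp add: signed_integral_def integral_add)
qed

lemma signed_integral_abs_le:
  fixes \<phi> :: "real \<Rightarrow> real"
  assumes c: "continuous_on UNIV \<phi>" and p: "\<And>t. 0 \<le> \<phi> t" and t: "\<bar>t\<bar> \<le> T" and K: "0 \<le> K"
    and le: "(\<integral>\<^sup>+s\<in>{-T..T}. ennreal (\<phi> s) \<partial>lborel) \<le> ennreal K"
  shows "\<bar>signed_integral \<phi> t\<bar> \<le> K"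
proof -
  have i: "\<phi> integrable_on {a..b}" for a b
    using c by (auto intro!: integrable_continuous_interval intro: continuous_on_subset)
  have "ennreal (integral {-T..T} \<phi>) \<le> ennreal K"
    using nn_integral_has_integral_lebesgue'[of "{-T..T}" \<phi>, OF p integrable_integral[OF i]] le by simp
  then have K': "integral {-T..T} \<phi> \<le> K" using K by simp
  have sub: "0 \<le> integral {a..b} \<phi> \<and> integral {a..b} \<phi> \<le> K" if "-T \<le> a" "b \<le> T" for a b
    using integral_subset_le[OF _ i i, of a b "-T" T] that p K' integral_nonneg[OF i, of a b] by fastforce
  show ?thesis
  proof (cases "t \<ge> 0")
    case True
    then have "integral {t..0} \<phi> = 0" by (cases "t = 0") auto
    then show ?thesis using sub[of 0 t] t by (simp add: signed_integral_def)
  next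
    case False
    then show ?thesis using sub[of t 0] t by (simp add: signed_integral_def)
  qed
qed

lemma signed_integral_const: "signed_integral (\<lambda>_. c :: real) t = c * t"
  by (cases "t \<ge> 0") (simp_all add: signed_integral_def)

lemma signed_integral_cmult: "signed_integral (\<lambda>t. c * f t) t = c * signed_integral f t" for c :: real
  by (simp add: signed_integral_def right_diff_distrib)

text \<open>The part of the first condition of \<open>good_solution\<close> that is visible in a
  block: a finite sum, hence continuous in time along a \<open>local_lhm\<close>.\<close>

definition bond_sum :: "real \<Rightarrow> real \<Rightarrow> int \<Rightarrow> (int \<Rightarrow> real^3) \<Rightarrow> real" where
  "bond_sum p q M x = (\<Sum>n\<in>{-M..<M}. jbracket n powr (- q) / bond x n powr p)"

definition bond_rate :: "real \<Rightarrow> real \<Rightarrow> int \<Rightarrow> (int \<Rightarrow> real^3) \<Rightarrow> real" where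
  "bond_rate p q M x = jbracket M powr (q / p) * (1 + bond_sum p q M x)"

lemma bond_sum_nonneg: "0 \<le> bond_sum p q M x"
  unfolding bond_sum_def by (intro sum_nonneg) (simp add: jbracket_def)

text \<open>Rescaling \<open>v \<le> 1 + v powr p\<close> trades the \<open>p\<close>-th moment for the sublinear factor
  \<open>jbracket M powr (q / p)\<close>.\<close>

lemma inverse_bond_le_rate:
  assumes pq: "1 < q" "q < p" and n: "n \<in> {-M..<M}" and w: "0 < bond x n"
  shows "1 / bond x n \<le> bond_rate p q M x"
proof -
  let ?J = "jbracket M"
  have J: "1 \<le> ?J" by (rule jbracket_ge_1)
  define v where "v = 1 / bond x n / ?J powr (q / p)"
  have v0: "0 < v" using w J by (simp add: v_def)
  have "v \<le> 1 + v powr p"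
  proof (cases "v \<le> 1")
    case False
    then have "v powr 1 \<le> v powr p" using pq by (intro powr_mono) auto
    then show ?thesis using v0 by simp
  qed (use v0 in \<open>simp add: add_increasing2\<close>)
  also have "v powr p = ?J powr (- q) * (1 / bond x n powr p)"
  proof -
    have "v powr p = (1 / bond x n) powr p / (?J powr (q / p)) powr p"
      unfolding v_def using w J by (subst powr_divide) auto
    also have "(?J powr (q / p)) powr p = ?J powr q" using pq by (simp add: powr_powr)
    also have "(1 / bond x n) powr p = 1 / bond x n powr p" using w by (subst powr_divide) auto
    finally show ?thesis by (simp add: powr_minus divide_inverse mult.commute)
  qed
  also have "?J powr (- q) * (1 / bond x n powr p) \<le> jbracket n powr (- q) * (1 / bond x n powr p)"
  proof (intro mult_right_mono powr_mono2')
    show "jbracket n \<le> ?J" using n by (intro jbracket_mono) auto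
  qed (use pq jbracket_ge_1[of n] in auto)
  also have "jbracket n powr (- q) * (1 / bond x n powr p) \<le> bond_sum p q M x"
    using member_le_sum[OF n, of "\<lambda>n. jbracket n powr (- q) / bond x n powr p"]
    by (simp add: bond_sum_def)
  finally have "v * ?J powr (q / p) \<le> (1 + bond_sum p q M x) * ?J powr (q / p)"
    by (intro mult_right_mono) auto
  moreover have "v * ?J powr (q / p) = 1 / bond x n" using J by (simp add: v_def)
  ultimately show ?thesis by (simp add: bond_rate_def mult.commute)
qed

lemma local_lhm_mono: "local_lhm N X \<Longrightarrow> M \<le> N \<Longrightarrow> local_lhm M X"
  unfolding local_lhm_def by auto

lemma bond_continuous:
  assumes "local_lhm N X" "n \<in> {-N..<N}" shows "continuous_on UNIV (\<lambda>t. bond (X t) n)"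
  using assms unfolding bond_def local_lhm_def by (intro continuous_intros) auto

lemma bond_sum_continuous:
  assumes X: "local_lhm N X" and M: "M \<le> N" shows "continuous_on UNIV (\<lambda>t. bond_sum p q M (X t))"
  unfolding bond_sum_def
proof (intro continuous_on_sum continuous_on_divide continuous_on_const ballI)
  fix n assume n: "n \<in> {-M..<M}"
  then have w: "0 < bond (X t) n" for t using X M unfolding local_lhm_def by auto
  show "continuous_on UNIV (\<lambda>t. bond (X t) n powr p)"
    using w[THEN less_imp_neq] n M by (intro continuous_on_powr bond_continuous[OF X] continuous_on_const) auto
  show "bond (X t) n powr p \<noteq> 0" for t using w[of t] by simp
qed

lemma bond_rate_continuous:
  assumes X: "local_lhm N X" and M: "M \<le> N" shows "continuous_on UNIV (\<lambda>t. bond_rate p q M (X t))"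
  unfolding bond_rate_def by (intro continuous_intros bond_sum_continuous[OF assms])

text \<open>Here a moment bound becomes the exponent in Gronwall's inequality: a block of radius
  \<open>M\<close> loses only the power \<open>q / p\<close> of its size.\<close>

lemma bond_rate_integral:
  assumes X: "local_lhm N X" and M: "M \<le> N" and K: "0 \<le> K" and t: "\<bar>t\<bar> \<le> T"
    and le: "(\<integral>\<^sup>+s\<in>{-T..T}. ennreal (bond_sum p q M (X s)) \<partial>lborel) \<le> ennreal K"
  shows "\<bar>signed_integral (\<lambda>t. bond_rate p q M (X t)) t\<bar> \<le> jbracket M powr (q / p) * (T + K)"
proof -
  note c = bond_sum_continuous[OF X M, of p q]
  have "signed_integral (\<lambda>t. bond_rate p q M (X t)) t =
     jbracket M powr (q / p) * (t + signed_integral (\<lambda>t. bond_sum p q M (X t)) t)"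
    unfolding bond_rate_def signed_integral_cmult
    by (subst signed_integral_add) (use c in \<open>auto simp: signed_integral_const\<close>)
  moreover have "\<bar>signed_integral (\<lambda>t. bond_sum p q M (X t)) t\<bar> \<le> K"
    by (rule signed_integral_abs_le[OF c bond_sum_nonneg t K le])
  then have "\<bar>t + signed_integral (\<lambda>t. bond_sum p q M (X t)) t\<bar> \<le> T + K" using t by linarith
  ultimately show ?thesis by (simp add: abs_mult mult_left_mono)
qed

text \<open>Cauchy-Schwarz makes bonds nonnegative, so the non-vanishing clause of
  \<open>lhm_solution\<close> yields strict positivity.\<close>

lemma lhm_solution_local:
  assumes "lhm_solution S" shows "local_lhm N S"
proof -
  have n: "norm (S t n) = 1" for t n using assms by (simp add: lhm_solution_def)
  have w: "0 < bond (S t) n" for t n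
    using assms one_plus_inner_bounds(1)[OF n n, of t n t "n + 1"] unfolding lhm_solution_def bond_def
    by (metis less_eq_real_def)
  have d: "((\<lambda>t. S t n) has_vector_derivative lhm_field (S t) n) (at t)" for t n
    using assms unfolding lhm_solution_def lhm_field_def by blast
  have "continuous_on UNIV (\<lambda>t. S t n)" for n
    by (intro continuous_at_imp_continuous_on ballI has_vector_derivative_continuous[OF d])
  then show ?thesis using n w d unfolding local_lhm_def by blast
qed

lemma good_solution_moment:
  assumes "good_solution S"
  obtains p q where "1 < q" "q < p"
    "\<And>T. 0 < T \<Longrightarrow> \<exists>K\<ge>0. \<forall>M. (\<integral>\<^sup>+s\<in>{-T..T}. ennreal (bond_sum p q M (S s)) \<partial>lborel) \<le> ennreal K"
proof -
  obtain p q :: real where pq: "p > q" "q > 1" and fin: "\<And>T. T > 0 \<Longrightarrow>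
        (\<integral>\<^sup>+t\<in>{-T..T}. (\<integral>\<^sup>+n. ennreal (jbracket n powr (- q)
             / (1 + S t n \<bullet> S t (n + 1)) powr p) \<partial>count_space UNIV) \<partial>lborel) < \<infinity>"
    using assms unfolding good_solution_def by blast
  show thesis
  proof (rule that[OF pq(2,1)])
    fix T :: real assume T: "0 < T"
    define K where "K = enn2real (\<integral>\<^sup>+t\<in>{-T..T}. (\<integral>\<^sup>+n. ennreal (jbracket n powr (- q)
             / (1 + S t n \<bullet> S t (n + 1)) powr p) \<partial>count_space UNIV) \<partial>lborel)"
    have Ke: "ennreal K = (\<integral>\<^sup>+t\<in>{-T..T}. (\<integral>\<^sup>+n. ennreal (jbracket n powr (- q)
             / (1 + S t n \<bullet> S t (n + 1)) powr p) \<partial>count_space UNIV) \<partial>lborel)"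
      unfolding K_def using fin[OF T] by (intro ennreal_enn2real) auto
    have le: "ennreal (bond_sum p q M x) \<le> (\<integral>\<^sup>+n. ennreal (jbracket n powr (- q) / (1 + x n \<bullet> x (n + 1)) powr p) \<partial>count_space UNIV)" for M x
    proof -
      have "ennreal (bond_sum p q M x) = (\<Sum>n\<in>{-M..<M}. ennreal (jbracket n powr (- q) / (1 + x n \<bullet> x (n + 1)) powr p))"
        unfolding bond_sum_def bond_def by (rule sum_ennreal[symmetric]) auto
      also have "\<dots> = (\<integral>\<^sup>+n. ennreal (jbracket n powr (- q) / (1 + x n \<bullet> x (n + 1)) powr p) \<partial>count_space {-M..<M})"
        by (simp add: nn_integral_count_space_finite)
      also have "\<dots> = (\<integral>\<^sup>+n. ennreal (jbracket n powr (- q) / (1 + x n \<bullet> x (n + 1)) powr p) * indicator {-M..<M} n \<partial>count_space UNIV)"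
        by (simp add: nn_integral_count_space_indicator)
      also have "\<dots> \<le> (\<integral>\<^sup>+n. ennreal (jbracket n powr (- q) / (1 + x n \<bullet> x (n + 1)) powr p) \<partial>count_space UNIV)"
        by (intro nn_integral_mono) (auto simp: indicator_def)
      finally show ?thesis .
    qed
    show "\<exists>K\<ge>0. \<forall>M. (\<integral>\<^sup>+s\<in>{-T..T}. ennreal (bond_sum p q M (S s)) \<partial>lborel) \<le> ennreal K"
      unfolding Ke using le
      by (intro exI[of _ K] conjI allI, simp add: K_def, unfold Ke) (auto intro!: nn_integral_mono mult_right_mono)
  qed
qed

text \<open>Sublinear growth is absorbed into half of the linear exponent. The shift by 2 is there
  because the lower bound for bond \<open>n\<close> uses the rate of a block of radius
  \<open>\<bar>n\<bar> + 2\<close>.\<close>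

lemma sublinear_jbracket:
  assumes a: "0 \<le> \<alpha>" "\<alpha> < 1" and A: "0 \<le> A"
  shows "\<exists>C. \<forall>n. A * jbracket (\<bar>n\<bar> + 2) powr \<alpha> \<le> jbracket n / 2 + C"
proof -
  have "((\<lambda>y::real. 3 * A * y powr (\<alpha> - 1)) \<longlongrightarrow> 3 * A * 0) at_top"
    using a by (intro tendsto_mult tendsto_const tendsto_neg_powr filterlim_ident) simp
  then have "((\<lambda>y::real. 3 * A * y powr (\<alpha> - 1)) \<longlongrightarrow> 0) at_top" by simp
  from order_tendstoD(2)[OF this, of "1 / 2"]
  have "\<forall>\<^sub>F y::real in at_top. 3 * A * y powr (\<alpha> - 1) < 1 / 2" by simp
  then obtain Y where Y: "\<And>y. y \<ge> Y \<Longrightarrow> 3 * A * y powr (\<alpha> - 1) < 1 / 2"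
    by (auto simp: eventually_at_top_linorder)
  show ?thesis
  proof (intro exI[of _ "3 * A * (max 1 Y) powr \<alpha>"] allI)
    fix n
    let ?y = "jbracket n"
    have y: "1 \<le> ?y" by (rule jbracket_ge_1)
    have "1 + (real_of_int (\<bar>n\<bar> + 2))\<^sup>2 = (1 + (real_of_int n)\<^sup>2) + 4 * \<bar>real_of_int n\<bar> + 4"
      by (simp add: power2_eq_square algebra_simps)
    also have "\<dots> \<le> ?y\<^sup>2 + 4 * ?y + 4"
      using jbracket_ge_abs[of n] by (simp add: jbracket_def)
    also have "\<dots> = (?y + 2)\<^sup>2" by (simp add: power2_eq_square algebra_simps)
    finally have "jbracket (\<bar>n\<bar> + 2) \<le> ?y + 2"
      unfolding jbracket_def[of "\<bar>n\<bar> + 2"] using y by (intro real_le_lsqrt) auto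
    then have "jbracket (\<bar>n\<bar> + 2) \<le> 3 * ?y" using y by linarith
    then have "jbracket (\<bar>n\<bar> + 2) powr \<alpha> \<le> (3 * ?y) powr \<alpha>"
      using a jbracket_ge_1[of "\<bar>n\<bar> + 2"] by (intro powr_mono2) auto
    also have "\<dots> = 3 powr \<alpha> * ?y powr \<alpha>" using y by (simp add: powr_mult)
    also have "3 powr \<alpha> \<le> 3 powr 1" using a by (intro powr_mono) auto
    finally have J: "jbracket (\<bar>n\<bar> + 2) powr \<alpha> \<le> 3 * ?y powr \<alpha>" by (simp add: mult_right_mono)
    then have "A * jbracket (\<bar>n\<bar> + 2) powr \<alpha> \<le> A * (3 * ?y powr \<alpha>)" using A by (rule mult_left_mono)
    also have "\<dots> \<le> ?y / 2 + 3 * A * (max 1 Y) powr \<alpha>"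
    proof (cases "?y \<ge> Y")
      case True
      have "A * (3 * ?y powr \<alpha>) = (3 * A * ?y powr (\<alpha> - 1)) * ?y powr 1"
        using powr_add[of ?y "\<alpha> - 1" 1] by simp
      also have "\<dots> \<le> 1 / 2 * ?y" using Y[OF True] y by (simp add: mult_right_mono)
      moreover have "0 \<le> 3 * A * (max 1 Y) powr \<alpha>" using A by simp
      ultimately show ?thesis by linarith
    next
      case False
      have "?y powr \<alpha> \<le> (max 1 Y) powr \<alpha>" using False y a by (intro powr_mono2) auto
      then have "3 * A * ?y powr \<alpha> \<le> 3 * A * (max 1 Y) powr \<alpha>" using A by (intro mult_left_mono) auto
      then show ?thesis using y by (simp add: mult_ac)
    qed
    finally show "A * jbracket (\<bar>n\<bar> + 2) powr \<alpha> \<le> ?y / 2 + 3 * A * (max 1 Y) powr \<alpha>" .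
  qed
qed

text \<open>Two exponents occur because the two solutions to be compared may satisfy the
  integrability condition with different \<open>p\<close> and \<open>q\<close>; both are majorised
  by a common \<open>a < 1\<close>.\<close>

lemma exp_sublinear_tendsto_0:
  assumes "\<alpha> < 1" "\<alpha>' < 1"
  shows "(\<lambda>N::nat. 4 * exp (- real N) * exp (72 * (jbracket (int N) powr \<alpha> * c + jbracket (int N) powr \<alpha>' * c'))) \<longlonglongrightarrow> 0"
proof -
  define a where "a = max (max \<alpha> \<alpha>') (1/2)"
  define C where "C = 72 * (\<bar>c\<bar> + \<bar>c'\<bar>) + 1"
  have a: "0 < a" "a < 1" "\<alpha> \<le> a" "\<alpha>' \<le> a" using assms by (auto simp: a_def)
  have C: "0 < C" by (simp add: C_def add_nonneg_pos)
  obtain C' where C': "\<And>n. C * jbracket (\<bar>n\<bar> + 2) powr a \<le> jbracket n / 2 + C'"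
    using sublinear_jbracket[of a C] a C by auto
  have bd: "4 * exp (- real N) * exp (C * jbracket (int N) powr a) \<le> 4 * exp (1 / 2 + C') * exp (- (1 / 2)) ^ N" for N
  proof -
    have "C * jbracket (int N) powr a \<le> C * jbracket (\<bar>int N\<bar> + 2) powr a"
      using C a jbracket_ge_1[of "int N"] by (intro mult_left_mono powr_mono2 jbracket_mono) auto
    also have "\<dots> \<le> jbracket (int N) / 2 + C'" by (rule C')
    also have "jbracket (int N) \<le> real N + 1"
      unfolding jbracket_def by (rule real_le_lsqrt) (simp_all add: power2_eq_square algebra_simps)
    finally have "- real N + C * jbracket (int N) powr a \<le> (1 / 2 + C') + real N * (- (1 / 2))" by (simp add: add_divide_distrib)
    then have "exp (- real N + C * jbracket (int N) powr a) \<le> exp ((1 / 2 + C') + real N * (- (1 / 2)))" by simp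
    also have "\<dots> = exp (1 / 2 + C') * exp (- (1 / 2)) ^ N"
      by (simp only: exp_add exp_of_nat_mult)
    finally show ?thesis unfolding exp_add[of "- real N"] by simp
  qed
  have "(\<lambda>N. 4 * exp (1 / 2 + C') * exp (- (1 / 2)) ^ N :: real) \<longlonglongrightarrow> 4 * exp (1 / 2 + C') * 0"
    by (intro tendsto_mult tendsto_const LIMSEQ_power_zero) simp
  then have lim0: "(\<lambda>N. 4 * exp (1 / 2 + C') * exp (- (1 / 2)) ^ N :: real) \<longlonglongrightarrow> 0" by simp
  have lim: "(\<lambda>N::nat. 4 * exp (- real N) * exp (C * jbracket (int N) powr a)) \<longlonglongrightarrow> 0"
  proof (rule tendsto_sandwich[OF always_eventually always_eventually tendsto_const lim0]; intro allI)
    fix N :: nat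
    show "4 * exp (- real N) * exp (C * jbracket (int N) powr a) \<le> 4 * exp (1 / 2 + C') * exp (- (1 / 2)) ^ N" by (rule bd)
  qed simp
  have le: "jbracket n powr b * d \<le> jbracket n powr a * \<bar>d\<bar>" if "b \<le> a" for n b d
  proof -
    have "jbracket n powr b * d \<le> jbracket n powr b * \<bar>d\<bar>" by (intro mult_left_mono) auto
    also have "\<dots> \<le> jbracket n powr a * \<bar>d\<bar>"
      using that jbracket_ge_1 by (intro mult_right_mono powr_mono) auto
    finally show ?thesis .
  qed
  show ?thesis
  proof (rule tendsto_sandwich[OF always_eventually always_eventually tendsto_const lim]; intro allI)
    fix N :: nat
    have "72 * (jbracket (int N) powr \<alpha> * c + jbracket (int N) powr \<alpha>' * c') \<le> 72 * (jbracket (int N) powr a * \<bar>c\<bar> + jbracket (int N) powr a * \<bar>c'\<bar>)"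
      using le[OF a(3)] le[OF a(4)] by (intro mult_left_mono add_mono) auto
    also have "\<dots> \<le> C * jbracket (int N) powr a" by (simp add: C_def algebra_simps)
    finally show "4 * exp (- real N) * exp (72 * (jbracket (int N) powr \<alpha> * c + jbracket (int N) powr \<alpha>' * c')) \<le>
        4 * exp (- real N) * exp (C * jbracket (int N) powr a)" by simp
  qed simp
qed

text \<open>The sum of the two rates dominates the inverse bonds of both solutions. On the block up
  to \<open>N\<close> its time integral grows like a power of \<open>N\<close> below 1, so the end
  terms, of weight \<open>exp (- N)\<close>, vanish in the limit at every fixed site.\<close>

theorem good_solution_unique:
  assumes S: "good_solution S" and S': "good_solution S'" and eq: "S 0 = S' 0"
  shows "S = S'"
proof (intro ext)
  fix t :: real and n :: int
  obtain p q where pq: "1 < q" "q < p" and K: "\<And>T. 0 < T \<Longrightarrow> \<exists>K\<ge>0. \<forall>M. (\<integral>\<^sup>+s\<in>{-T..T}. ennreal (bond_sum p q M (S s)) \<partial>lborel) \<le> ennreal K"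
    by (rule good_solution_moment[OF S]) (rule that; assumption)
  obtain p' q' where pq': "1 < q'" "q' < p'" and K': "\<And>T. 0 < T \<Longrightarrow> \<exists>K\<ge>0. \<forall>M. (\<integral>\<^sup>+s\<in>{-T..T}. ennreal (bond_sum p' q' M (S' s)) \<partial>lborel) \<le> ennreal K"
    by (rule good_solution_moment[OF S']) (rule that; assumption)
  define T where "T = \<bar>t\<bar> + 1"
  have T: "0 < T" "\<bar>t\<bar> \<le> T" by (auto simp: T_def)
  obtain k where k: "0 \<le> k" "\<And>M. (\<integral>\<^sup>+s\<in>{-T..T}. ennreal (bond_sum p q M (S s)) \<partial>lborel) \<le> ennreal k" using K[OF T(1)] by blast
  obtain k' where k': "0 \<le> k'" "\<And>M. (\<integral>\<^sup>+s\<in>{-T..T}. ennreal (bond_sum p' q' M (S' s)) \<partial>lborel) \<le> ennreal k'" using K'[OF T(1)] by blast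
  have loc: "local_lhm N S" "local_lhm N S'" for N
    using S S' unfolding good_solution_def by (auto intro: lhm_solution_local)
  have w: "0 < bond (S t) n" "0 < bond (S' t) n" for t n
  proof -
    have "n \<in> {- (\<bar>n\<bar> + 1)..<\<bar>n\<bar> + 1}" by auto
    then show "0 < bond (S t) n" "0 < bond (S' t) n"
      using loc[of "\<bar>n\<bar> + 1"] unfolding local_lhm_def by blast+
  qed
  have bd: "exp (- \<bar>real_of_int n\<bar>) * (norm (S t n - S' t n))\<^sup>2 \<le>
      4 * exp (- real N) * exp (72 * (jbracket (int N) powr (q / p) * (T + k) + jbracket (int N) powr (q' / p') * (T + k')))"
    if N: "\<bar>n\<bar> < int N" for N
  proof -
    let ?a = "\<lambda>t. bond_rate p q (int N) (S t)" and ?b = "\<lambda>t. bond_rate p' q' (int N) (S' t)"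
    have nonneg: "0 \<le> ?a t" "0 \<le> ?b t" for t
      unfolding bond_rate_def by (auto intro!: mult_nonneg_nonneg add_nonneg_nonneg bond_sum_nonneg)
    have c: "continuous_on UNIV ?a" "continuous_on UNIV ?b"
      by (rule bond_rate_continuous[OF loc(1) order_refl], rule bond_rate_continuous[OF loc(2) order_refl])
    have "exp (- \<bar>real_of_int n\<bar>) * (norm (S t n - S' t n))\<^sup>2 \<le>
        4 * exp (- real_of_int (int N)) * exp (72 * \<bar>signed_integral (\<lambda>t. ?a t + ?b t) t\<bar>)"
    proof (rule local_lhm_compare[OF loc(1) loc(2)])
      show "continuous_on UNIV (\<lambda>t. ?a t + ?b t)" by (intro continuous_intros c)
      show "1 / bond (S t) m \<le> ?a t + ?b t" if "m \<in> {- int N..<int N}" for t m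
        using inverse_bond_le_rate[OF pq that w(1), of t] nonneg(2)[of t] by linarith
      show "1 / bond (S' t) m \<le> ?a t + ?b t" if "m \<in> {- int N..<int N}" for t m
        using inverse_bond_le_rate[OF pq' that w(2), of t] nonneg(1)[of t] by linarith
    qed (use N eq in auto)
    also have "\<bar>signed_integral (\<lambda>t. ?a t + ?b t) t\<bar> \<le> jbracket (int N) powr (q / p) * (T + k) + jbracket (int N) powr (q' / p') * (T + k')"
      unfolding signed_integral_add[OF c]
      by (intro order_trans[OF abs_triangle_ineq] add_mono bond_rate_integral[OF loc(1) order_refl k(1) T(2) k(2)]
          bond_rate_integral[OF loc(2) order_refl k'(1) T(2) k'(2)])
    finally show ?thesis by (simp add: mult_left_mono)
  qed
  have "(\<lambda>N::nat. 4 * exp (- real N) * exp (72 * (jbracket (int N) powr (q / p) * (T + k) + jbracket (int N) powr (q' / p') * (T + k')))) \<longlonglongrightarrow> 0"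
    using pq pq' by (intro exp_sublinear_tendsto_0) auto
  then have "exp (- \<bar>real_of_int n\<bar>) * (norm (S t n - S' t n))\<^sup>2 \<le> 0"
  proof (rule LIMSEQ_le_const, intro exI[of _ "nat (\<bar>n\<bar> + 1)"] allI impI)
    fix N assume "nat (\<bar>n\<bar> + 1) \<le> N"
    then have "\<bar>n\<bar> < int N" by linarith
    then show "exp (- \<bar>real_of_int n\<bar>) * (norm (S t n - S' t n))\<^sup>2 \<le>
      4 * exp (- real N) * exp (72 * (jbracket (int N) powr (q / p) * (T + k) + jbracket (int N) powr (q' / p') * (T + k')))"
      by (rule bd)
  qed
  then show "S t n = S' t n" by (simp add: mult_le_0_iff)
qed

section \<open>Existence from converging finite chains\<close>

lemma uniform_limit_geometric:
  fixes f :: "nat \<Rightarrow> 'a \<Rightarrow> 'b::banach"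
  assumes le: "\<And>j t. j \<ge> m \<Longrightarrow> t \<in> A \<Longrightarrow> norm (f j t - f (Suc j) t) \<le> c * \<rho> ^ j" and \<rho>: "0 \<le> \<rho>" "\<rho> < 1"
  shows "uniform_limit A f (\<lambda>t. lim (\<lambda>j. f j t)) sequentially"
proof -
  have "uniformly_convergent_on A (\<lambda>n t. \<Sum>i<n. f (Suc (i + m)) t - f (i + m) t)"
  proof (rule Weierstrass_m_test')
    show "norm (f (Suc (i + m)) t - f (i + m) t) \<le> c * \<rho> ^ (i + m)" if "t \<in> A" for i t
      using le[of "i + m" t] that by (simp add: norm_minus_commute)
    show "summable (\<lambda>i. c * \<rho> ^ (i + m))"
      using \<rho> by (intro summable_mult summable_ignore_initial_segment summable_geometric) simp
  qed
  then obtain l where l: "uniform_limit A (\<lambda>n t. \<Sum>i<n. f (Suc (i + m)) t - f (i + m) t) l sequentially"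
    unfolding uniformly_convergent_on_def by blast
  have tel: "(\<Sum>i<n. f (Suc (i + m)) t - f (i + m) t) = f (n + m) t - f m t" for n t
    using sum_lessThan_telescope[of "\<lambda>i. f (i + m) t" n] by simp
  have "uniform_limit A (\<lambda>n t. (f (n + m) t - f m t) + f m t) (\<lambda>t. l t + f m t) sequentially"
  proof (rule uniform_limit_add)
    show "uniform_limit A (\<lambda>n t. f (n + m) t - f m t) l sequentially" using l unfolding tel .
    show "uniform_limit A (\<lambda>n t. f m t) (\<lambda>t. f m t) sequentially" by (simp add: uniform_limit_iff)
  qed
  then have "uniform_limit A (\<lambda>n. f (n + m)) (\<lambda>t. l t + f m t) sequentially"
    by simp
  then have "uniform_limit A f (\<lambda>t. l t + f m t) sequentially"
    unfolding uniform_limit_iff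
  proof (intro allI impI)
    fix e :: real assume "0 < e" "\<forall>e>0. \<forall>\<^sub>F n in sequentially. \<forall>x\<in>A. dist (f (n + m) x) (l x + f m x) < e"
    then show "\<forall>\<^sub>F n in sequentially. \<forall>x\<in>A. dist (f n x) (l x + f m x) < e"
      using eventually_sequentially_seg[of "\<lambda>n. \<forall>x\<in>A. dist (f n x) (l x + f m x) < e" m] by blast
  qed
  then show ?thesis
    using uniformly_convergentI uniformly_convergent_uniform_limit_iff by blast
qed

text \<open>The weight \<open>exp (- \<bar>t\<bar>)\<close> lets one bound on the whole time axis
  control every window: the window up to \<open>T\<close> is recovered at the cost of
  \<open>exp T\<close>.\<close>

lemma weighted_bond_sum_le:
  assumes c: "continuous_on UNIV (\<lambda>t. bond_sum p q N (X t))" and K: "0 \<le> K" and M: "M \<le> N" and T: "0 < T"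
    and le: "(\<integral>\<^sup>+t. ennreal (exp (- \<bar>t\<bar>) * bond_sum p q N (X t)) \<partial>lborel) \<le> ennreal K"
  shows "(\<integral>\<^sup>+t\<in>{-T..T}. ennreal (bond_sum p q M (X t)) \<partial>lborel) \<le> ennreal (exp T * K)"
proof -
  have MN: "bond_sum p q M x \<le> bond_sum p q N x" for x
    unfolding bond_sum_def using M by (intro sum_mono2) (auto simp: jbracket_def)
  have "(\<integral>\<^sup>+t\<in>{-T..T}. ennreal (bond_sum p q M (X t)) \<partial>lborel) \<le>
      (\<integral>\<^sup>+t. ennreal (exp T) * ennreal (exp (- \<bar>t\<bar>) * bond_sum p q N (X t)) \<partial>lborel)"
  proof (rule nn_integral_mono)
    fix t
    show "ennreal (bond_sum p q M (X t)) * indicator {-T..T} t \<le> ennreal (exp T) * ennreal (exp (- \<bar>t\<bar>) * bond_sum p q N (X t))"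
    proof (cases "t \<in> {-T..T}")
      case True
      have "bond_sum p q M (X t) \<le> 1 * bond_sum p q N (X t)" using MN by simp
      also have "\<dots> \<le> (exp T * exp (- \<bar>t\<bar>)) * bond_sum p q N (X t)"
        using True by (intro mult_right_mono bond_sum_nonneg) (auto simp: exp_add[symmetric])
      finally show ?thesis using True by (simp add: ennreal_mult'[symmetric] mult.assoc ennreal_leI)
    qed simp
  qed
  also have "\<dots> = ennreal (exp T) * (\<integral>\<^sup>+t. ennreal (exp (- \<bar>t\<bar>) * bond_sum p q N (X t)) \<partial>lborel)"
  proof (rule nn_integral_cmult)
    have "continuous_on UNIV (\<lambda>t. exp (- \<bar>t\<bar>) * bond_sum p q N (X t))" by (intro continuous_intros c)
    then have "(\<lambda>t. exp (- \<bar>t\<bar>) * bond_sum p q N (X t)) \<in> borel_measurable lborel"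
      using borel_measurable_continuous_onI by simp
    then show "(\<lambda>t. ennreal (exp (- \<bar>t\<bar>) * bond_sum p q N (X t))) \<in> borel_measurable lborel"
      by (rule measurable_compose[OF _ measurable_ennreal])
  qed
  also have "\<dots> \<le> ennreal (exp T) * ennreal K" by (intro mult_left_mono le) auto
  finally show ?thesis using K by (simp add: ennreal_mult)
qed

text \<open>This is the exponent in Gronwall's inequality at block size \<open>2 ^ j\<close>, with
  moments that may grow like \<open>2 powr (\<epsilon> * real j)\<close>. The total power
  \<open>\<alpha> + \<epsilon>\<close> is below 1, so at most half of the decay
  \<open>exp (- 2 ^ j)\<close> is lost.\<close>

lemma sublinear_dyadic:
  assumes a: "0 \<le> \<alpha>" "0 \<le> \<epsilon>" "\<alpha> + \<epsilon> < 1" and A: "0 \<le> A" and B: "0 \<le> B"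
  shows "\<exists>j0. \<forall>j\<ge>j0. jbracket (2 ^ j) powr \<alpha> * (A + B * 2 powr (\<epsilon> * real j)) \<le> 2 ^ j / 2"
proof -
  define \<delta> where "\<delta> = \<alpha> + \<epsilon>"
  have "((\<lambda>N::real. 2 * (A + B) * N powr (\<delta> - 1)) \<longlongrightarrow> 2 * (A + B) * 0) at_top"
    using a by (intro tendsto_mult tendsto_const tendsto_neg_powr filterlim_ident) (simp add: \<delta>_def)
  then have "((\<lambda>N::real. 2 * (A + B) * N powr (\<delta> - 1)) \<longlongrightarrow> 0) at_top" by simp
  from order_tendstoD(2)[OF this, of "1 / 2"]
  have "\<forall>\<^sub>F N::real in at_top. 2 * (A + B) * N powr (\<delta> - 1) < 1 / 2" by simp
  moreover have "filterlim (\<lambda>j. 2 ^ j :: real) at_top sequentially"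
    by (rule filterlim_at_top_mono[OF filterlim_real_sequentially]) (simp add: less_imp_le)
  ultimately have "\<forall>\<^sub>F j in sequentially. 2 * (A + B) * (2 ^ j) powr (\<delta> - 1) < 1 / 2"
    by (rule eventually_compose_filterlim)
  then obtain j0 where j0: "\<And>j. j \<ge> j0 \<Longrightarrow> 2 * (A + B) * (2 ^ j) powr (\<delta> - 1) < 1 / 2"
    by (auto simp: eventually_sequentially)
  show ?thesis
  proof (intro exI[of _ j0] allI impI)
    fix j assume j: "j0 \<le> j"
    let ?N = "2 ^ j :: real"
    have N: "1 \<le> ?N" by simp
    have "jbracket (2 ^ j) \<le> 2 * ?N"
    proof -
      have "1 \<le> ?N\<^sup>2" using N by (intro one_le_power) auto
      moreover have "(2 * ?N)\<^sup>2 = 4 * ?N\<^sup>2" by (simp only: power_mult_distrib) simp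
      ultimately have "1 + ?N\<^sup>2 \<le> (2 * ?N)\<^sup>2" by linarith
      then have "sqrt (1 + ?N\<^sup>2) \<le> 2 * ?N" using N by (intro real_le_lsqrt) auto
      then show ?thesis by (simp add: jbracket_def)
    qed
    then have "jbracket (2 ^ j) powr \<alpha> \<le> (2 * ?N) powr \<alpha>"
      using a jbracket_ge_1[of "2 ^ j"] by (intro powr_mono2) auto
    also have "\<dots> = 2 powr \<alpha> * ?N powr \<alpha>" by (simp add: powr_mult)
    also have "2 powr \<alpha> \<le> 2 powr 1" using a by (intro powr_mono) auto
    finally have J: "jbracket (2 ^ j) powr \<alpha> \<le> 2 * ?N powr \<alpha>" by (simp add: mult_right_mono)
    have e: "2 powr (\<epsilon> * real j) = ?N powr \<epsilon>"
      by (simp add: powr_realpow[symmetric] powr_powr mult.commute)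
    have "A * 1 \<le> A * ?N powr \<epsilon>" using A a N by (intro mult_left_mono ge_one_powr_ge_zero) auto
    then have "A + B * 2 powr (\<epsilon> * real j) \<le> (A + B) * ?N powr \<epsilon>" unfolding e by (simp add: distrib_right)
    then have "jbracket (2 ^ j) powr \<alpha> * (A + B * 2 powr (\<epsilon> * real j)) \<le> (2 * ?N powr \<alpha>) * ((A + B) * ?N powr \<epsilon>)"
      using A B by (intro mult_mono J) auto
    also have "\<dots> = (2 * (A + B) * ?N powr (\<delta> - 1)) * ?N"
    proof -
      have "?N powr \<alpha> * ?N powr \<epsilon> = ?N powr (\<delta> - 1) * ?N powr 1"
        unfolding powr_add[symmetric] \<delta>_def by simp
      then show ?thesis by (simp add: mult_ac)
    qed
    also have "\<dots> \<le> 1 / 2 * ?N" using j0[OF j] N by (intro mult_right_mono) auto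
    finally show "jbracket (2 ^ j) powr \<alpha> * (A + B * 2 powr (\<epsilon> * real j)) \<le> 2 ^ j / 2" by simp
  qed
qed

lemma uniform_limit_pair_field:
  fixes a b :: "nat \<Rightarrow> 'a \<Rightarrow> real^3"
  assumes a: "uniform_limit A a a' sequentially" and b: "uniform_limit A b b' sequentially"
    and n: "\<And>t. t \<in> A \<Longrightarrow> norm (a' t) = 1" "\<And>t. t \<in> A \<Longrightarrow> norm (b' t) = 1"
    and m: "0 < m" "\<And>t. t \<in> A \<Longrightarrow> m \<le> 1 + a' t \<bullet> b' t"
  shows "uniform_limit A (\<lambda>k t. (2 / (1 + a k t \<bullet> b k t)) *\<^sub>R (a k t \<times> b k t))
    (\<lambda>t. (2 / (1 + a' t \<bullet> b' t)) *\<^sub>R (a' t \<times> b' t)) sequentially"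
proof -
  have bd: "bounded (a' ` A)" "bounded (b' ` A)"
    using n by (auto simp: bounded_iff intro!: exI[of _ 1])
  have bc: "bounded_bilinear ((\<times>) :: real^3 \<Rightarrow> real^3 \<Rightarrow> real^3)"
    using bilinear_cross by (simp add: bilinear_conv_bounded_bilinear)
  have i: "uniform_limit A (\<lambda>k t. 1 + a k t \<bullet> b k t) (\<lambda>t. 1 + a' t \<bullet> b' t) sequentially"
    by (intro uniform_limit_intros a b bd)
  have d: "uniform_limit A (\<lambda>k t. 2 / (1 + a k t \<bullet> b k t)) (\<lambda>t. 2 / (1 + a' t \<bullet> b' t)) sequentially"
  proof (rule uniform_lim_divide[OF uniform_limit_const i _ _ m(1)])
    show "bounded ((\<lambda>_. 2 :: real) ` A)" by (auto simp: bounded_iff)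
    show "m \<le> norm (1 + a' t \<bullet> b' t)" if "t \<in> A" for t
      using m(2)[OF that] by simp
  qed
  have c: "uniform_limit A (\<lambda>k t. a k t \<times> b k t) (\<lambda>t. a' t \<times> b' t) sequentially"
    by (rule bounded_bilinear.bounded_uniform_limit[OF bc a b bd(2,1)])
  have b1: "bounded ((\<lambda>t. a' t \<times> b' t) ` A)"
    unfolding bounded_iff
  proof (intro exI[of _ 1] ballI)
    fix y assume "y \<in> (\<lambda>t. a' t \<times> b' t) ` A"
    then obtain t where t: "t \<in> A" "y = a' t \<times> b' t" by blast
    then show "norm y \<le> 1" using norm_cross_le[of "a' t" "b' t"] n[of t] by simp
  qed
  have b2: "bounded ((\<lambda>t. 2 / (1 + a' t \<bullet> b' t)) ` A)"
    unfolding bounded_iff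
  proof (intro exI[of _ "2 / m"] ballI)
    fix y assume "y \<in> (\<lambda>t. 2 / (1 + a' t \<bullet> b' t)) ` A"
    then obtain t where t: "t \<in> A" "y = 2 / (1 + a' t \<bullet> b' t)" by blast
    have "2 / (1 + a' t \<bullet> b' t) \<le> 2 / m" using m(2)[OF t(1)] m(1) by (intro divide_left_mono) auto
    then show "norm y \<le> 2 / m" unfolding t(2) using m(2)[OF t(1)] m(1) by simp
  qed
  show ?thesis
    by (rule bounded_bilinear.bounded_uniform_limit[OF bounded_bilinear_scaleR d c b1 b2])
qed


text \<open>The lower bounds on bonds hold along a subsequence that depends on the datum;
  convergence of the full sequence lets the limit inherit them.\<close>

lemma frequently_le_tendsto:
  fixes f :: "nat \<Rightarrow> real"
  assumes "f \<longlonglongrightarrow> l" "\<exists>\<^sub>F j in sequentially. c \<le> f j"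
  shows "c \<le> l"
proof (rule ccontr)
  assume "\<not> c \<le> l"
  then have "\<forall>\<^sub>F j in sequentially. f j < c" using order_tendstoD(2)[OF assms(1)] by simp
  then show False using assms(2) by (simp add: frequently_def not_le)
qed

text \<open>The deterministic half of the existence proof, with two separate moment hypotheses. A
  bound growing like \<open>2 powr (\<epsilon> * real j)\<close> at every scale gives convergence,
  as the loss in Gronwall's inequality stays sublinear in the block size. A bound independent of the
  scale, available infinitely often, gives the separation of the limiting bonds and, by Fatou, the
  integrability in \<open>good_solution\<close>.\<close>

theorem good_solution_exists:
  fixes X :: "nat \<Rightarrow> real \<Rightarrow> int \<Rightarrow> real^3"
  assumes pq: "1 < q" "q < p" and e: "0 \<le> \<epsilon>" "q / p + \<epsilon> < 1"
    and X: "\<And>j. local_lhm (2 ^ j) (X j)"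
    and init: "\<And>j n. n \<in> {-(2 ^ j)..2 ^ j} \<Longrightarrow> X j 0 n = x n"
    and K: "0 \<le> K" "\<And>j. (\<integral>\<^sup>+t. ennreal (exp (- \<bar>t\<bar>) * bond_sum p q (2 ^ j) (X j t)) \<partial>lborel) \<le> ennreal (K * 2 powr (\<epsilon> * real j))"
    and C: "0 \<le> C" "\<exists>\<^sub>F j in sequentially. (\<integral>\<^sup>+t. ennreal (exp (- \<bar>t\<bar>) * bond_sum p q (2 ^ j) (X j t)) \<partial>lborel) \<le> ennreal C"
    and A: "(\<integral>\<^sup>+n. ennreal (exp (- jbracket n / 2) / bond x n) \<partial>count_space UNIV) < \<infinity>"
  shows "\<exists>S. good_solution S \<and> S 0 = x \<and> (\<forall>t n. (\<lambda>j. X j t n) \<longlonglongrightarrow> S t n)"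
proof -
  define \<alpha> where "\<alpha> = q / p"
  have \<alpha>: "0 \<le> \<alpha>" "\<alpha> < 1" "\<alpha> + \<epsilon> < 1" using pq e by (auto simp: \<alpha>_def)
  have powj: "int j < 2 ^ j" for j
    using less_exp[of j] by (metis of_nat_less_iff of_nat_numeral of_nat_power)
  have w: "0 < bond (X j t) n" if "n \<in> {-(2 ^ j)..<2 ^ j}" for j t n
    using X[of j] that unfolding local_lhm_def by blast
  have sumc: "continuous_on UNIV (\<lambda>t. bond_sum p q (2 ^ j) (X j t))" for j
    by (rule bond_sum_continuous[OF X order_refl])
  have rate: "\<bar>signed_integral (\<lambda>t. bond_rate p q M (X j t)) t\<bar> \<le> jbracket M powr \<alpha> * (T + exp T * k)"
    if le: "(\<integral>\<^sup>+t. ennreal (exp (- \<bar>t\<bar>) * bond_sum p q (2 ^ j) (X j t)) \<partial>lborel) \<le> ennreal k"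
      and M: "M \<le> 2 ^ j" and k: "0 \<le> k" and T: "0 < T" "\<bar>t\<bar> \<le> T" for j M t T k
    unfolding \<alpha>_def
    by (rule bond_rate_integral[OF X M _ T(2) weighted_bond_sum_le[OF sumc k M T(1) le]]) (use k in simp)
  define S where "S t n = lim (\<lambda>j. X j t n)" for t n
  have unif: "uniform_limit {-T..T} (\<lambda>j t. X j t n) (\<lambda>t. S t n) sequentially" if T: "0 < T" for T n
  proof -
    \<comment> \<open>Both chains contribute a rate: \<open>144 = 2 * 72\<close>, and
      \<open>1 + 2 powr \<epsilon>\<close> adds the moment bounds of the scales \<open>j\<close> and
      \<open>Suc j\<close>.\<close>
    define A0 where "A0 = 144 * T"
    define B0 where "B0 = 72 * (exp T * K * (1 + 2 powr \<epsilon>))"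
    obtain j0 where j0: "\<And>j. j0 \<le> j \<Longrightarrow> jbracket (2 ^ j) powr \<alpha> * (A0 + B0 * 2 powr (\<epsilon> * real j)) \<le> 2 ^ j / 2"
      using sublinear_dyadic[OF \<alpha>(1) e(1) \<alpha>(3), of A0 B0] T K(1) by (auto simp: A0_def B0_def)
    have D: "norm (X j t n - X (Suc j) t n) \<le> (2 * exp (\<bar>real_of_int n\<bar> / 2)) * exp (- (1 / 4)) ^ j"
      if j: "max j0 (nat \<bar>n\<bar> + 1) \<le> j" and t: "t \<in> {-T..T}" for j t
    proof -
      have nj: "\<bar>n\<bar> < 2 ^ j" using j powj[of j] by linarith
      let ?N = "2 ^ j :: int"
      let ?a = "\<lambda>t. bond_rate p q ?N (X j t)" and ?b = "\<lambda>t. bond_rate p q ?N (X (Suc j) t)"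
      have loc: "local_lhm ?N (X (Suc j))" by (rule local_lhm_mono[OF X]) simp
      have nonneg: "0 \<le> ?a t" "0 \<le> ?b t" for t
        unfolding bond_rate_def by (auto intro!: mult_nonneg_nonneg add_nonneg_nonneg bond_sum_nonneg)
      have c: "continuous_on UNIV ?a" "continuous_on UNIV ?b"
        by (rule bond_rate_continuous[OF X order_refl], rule bond_rate_continuous[OF loc order_refl])
      have "exp (- \<bar>real_of_int n\<bar>) * (norm (X j t n - X (Suc j) t n))\<^sup>2 \<le>
          4 * exp (- real_of_int ?N) * exp (72 * \<bar>signed_integral (\<lambda>t. ?a t + ?b t) t\<bar>)"
      proof (rule local_lhm_compare[OF X loc])
        show "continuous_on UNIV (\<lambda>t. ?a t + ?b t)" by (intro continuous_intros c)
        show "1 / bond (X j t) m \<le> ?a t + ?b t" if "m \<in> {- ?N..<?N}" for t m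
          using inverse_bond_le_rate[OF pq that w[OF that], of t] nonneg(2)[of t] by linarith
        show "1 / bond (X (Suc j) t) m \<le> ?a t + ?b t" if m: "m \<in> {- ?N..<?N}" for t m
        proof -
          have "0 < bond (X (Suc j) t) m" using m loc unfolding local_lhm_def by blast
          from inverse_bond_le_rate[OF pq m this] show ?thesis using nonneg(1)[of t] by linarith
        qed
      qed (use nj init[of _ j] init[of _ "Suc j"] in auto)
      also have "\<dots> \<le> 4 * exp (- real_of_int ?N) * exp (2 ^ j / 2)"
      proof -
        have "\<bar>signed_integral (\<lambda>t. ?a t + ?b t) t\<bar> \<le> jbracket ?N powr \<alpha> * (T + exp T * (K * 2 powr (\<epsilon> * real j)))
            + jbracket ?N powr \<alpha> * (T + exp T * (K * 2 powr (\<epsilon> * real (Suc j))))"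
          unfolding signed_integral_add[OF c]
          by (intro order_trans[OF abs_triangle_ineq] add_mono rate K(2)) (use T t K(1) in auto)
        also have "2 powr (\<epsilon> * real (Suc j)) = 2 powr \<epsilon> * 2 powr (\<epsilon> * real j)"
          by (simp add: powr_add[symmetric] algebra_simps)
        finally have "72 * \<bar>signed_integral (\<lambda>t. ?a t + ?b t) t\<bar> \<le> jbracket ?N powr \<alpha> * (A0 + B0 * 2 powr (\<epsilon> * real j))"
          unfolding A0_def B0_def by (simp add: algebra_simps)
        also have "\<dots> \<le> 2 ^ j / 2" using j0[of j] j by simp
        finally show ?thesis by simp
      qed
      also have "\<dots> = 4 * exp (- (2 ^ j / 2))"
        unfolding mult.assoc exp_add[symmetric] by simp
      \<comment> \<open>The decay is weakened to a geometric one, whose square root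
        \<open>exp (- (1 / 4)) ^ j\<close> feeds the Weierstrass test.\<close>
      also have "\<dots> \<le> 4 * exp (- (real j / 2))"
        using less_exp[of j] by (simp add: of_nat_less_two_power less_imp_le)
      finally have "exp \<bar>real_of_int n\<bar> * (exp (- \<bar>real_of_int n\<bar>) * (norm (X j t n - X (Suc j) t n))\<^sup>2) \<le>
          exp \<bar>real_of_int n\<bar> * (4 * exp (- (real j / 2)))" by (intro mult_left_mono) auto
      then have "(norm (X j t n - X (Suc j) t n))\<^sup>2 \<le> exp \<bar>real_of_int n\<bar> * (4 * exp (- (real j / 2)))"
        by (simp add: mult.assoc[symmetric] exp_add[symmetric])
      also have "\<dots> = ((2 * exp (\<bar>real_of_int n\<bar> / 2)) * exp (- (1 / 4)) ^ j)\<^sup>2"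
      proof -
        have "(exp (\<bar>real_of_int n\<bar> / 2))\<^sup>2 = exp \<bar>real_of_int n\<bar>" by (simp add: exp_double[symmetric])
        moreover have "(exp (- (1 / 4)) ^ j)\<^sup>2 = exp (- (real j / 2))"
          by (simp add: exp_of_nat_mult[symmetric] exp_double[symmetric])
        ultimately show ?thesis by (simp add: power_mult_distrib)
      qed
      finally show ?thesis by (rule power2_le_imp_le) simp
    qed
    show ?thesis
      unfolding S_def by (rule uniform_limit_geometric[where m="max j0 (nat \<bar>n\<bar> + 1)"], rule D) auto
  qed
  have lim: "(\<lambda>j. X j t n) \<longlonglongrightarrow> S t n" for t n
    by (rule tendsto_uniform_limitI[OF unif[of "\<bar>t\<bar> + 1"]]) auto
  have evX: "\<forall>\<^sub>F j in sequentially. n \<in> {-(2 ^ j)<..<2 ^ j}" for n :: int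
  proof (rule eventually_sequentiallyI[of "nat \<bar>n\<bar> + 1"])
    fix j assume "nat \<bar>n\<bar> + 1 \<le> j"
    then have "\<bar>n\<bar> < 2 ^ j" using powj[of j] by linarith
    then show "n \<in> {-(2 ^ j)<..<2 ^ j}" by (auto simp: abs_less_iff)
  qed
  have S0: "S 0 = x"
  proof (rule ext)
    fix n
    have "(\<lambda>j. X j 0 n) \<longlonglongrightarrow> x n"
      by (rule tendsto_eventually) (use evX[of n] in eventually_elim, use init in auto)
    then show "S 0 n = x n" using LIMSEQ_unique[OF lim] by blast
  qed
  have nS: "norm (S t n) = 1" for t n
  proof -
    have "(\<lambda>j. norm (X j t n)) \<longlonglongrightarrow> 1"
      by (rule tendsto_eventually, use evX[of n] in eventually_elim) (use X in \<open>auto simp: local_lhm_def\<close>)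
    then show ?thesis using LIMSEQ_unique[OF tendsto_norm[OF lim]] by blast
  qed
  have bondlim: "(\<lambda>j. bond (X j t) n) \<longlonglongrightarrow> bond (S t) n" for t n
    unfolding bond_def by (intro tendsto_intros lim)
  have x0: "0 < bond x n" for n
  proof -
    obtain j where "n \<in> {-(2 ^ j)<..<2 ^ j}" using evX[of n] by (auto simp: eventually_sequentially)
    then show ?thesis using w[of n j 0] init[of n j] init[of "n + 1" j] by (simp add: bond_def)
  qed
  \<comment> \<open>The rate on the block of radius \<open>\<bar>n\<bar> + 2\<close> enters, so the
    loss in the exponent is a sublinear power of the site. The bound holds at the scales where the
    moment is at most \<open>C\<close>, and these suffice for the limit.\<close>
  have lower: "bond x n * exp (- 8 * (jbracket (\<bar>n\<bar> + 2) powr \<alpha> * (T + exp T * C))) \<le> bond (S t) n"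
    if T: "0 < T" "\<bar>t\<bar> \<le> T" for T t n
  proof (rule frequently_le_tendsto[OF bondlim])
    show "\<exists>\<^sub>F j in sequentially. bond x n * exp (- 8 * (jbracket (\<bar>n\<bar> + 2) powr \<alpha> * (T + exp T * C))) \<le> bond (X j t) n"
      using C(2)
    proof (rule frequently_rev_mp, use evX[of "\<bar>n\<bar> + 3"] in eventually_elim, intro impI)
      fix j assume nj: "\<bar>n\<bar> + 3 \<in> {-(2 ^ j)<..<2 ^ j}"
        and le: "(\<integral>\<^sup>+t. ennreal (exp (- \<bar>t\<bar>) * bond_sum p q (2 ^ j) (X j t)) \<partial>lborel) \<le> ennreal C"
      let ?r = "\<lambda>t. bond_rate p q (\<bar>n\<bar> + 2) (X j t)"
      have "bond (X j 0) n * exp (- 8 * \<bar>signed_integral ?r t\<bar>) \<le> bond (X j t) n"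
      proof (rule bond_lower_bound[OF X])
        show "continuous_on UNIV ?r" by (rule bond_rate_continuous[OF X]) (use nj in auto)
        show "1 / bond (X j t) m \<le> ?r t" if "m \<in> {n - 1, n, n + 1}" for t m
          by (rule inverse_bond_le_rate[OF pq _ w]) (use that nj in auto)
      qed (use nj in auto)
      moreover have "\<bar>signed_integral ?r t\<bar> \<le> jbracket (\<bar>n\<bar> + 2) powr \<alpha> * (T + exp T * C)"
        by (rule rate[OF le _ C(1) T]) (use nj in auto)
      moreover have "bond (X j 0) n = bond x n"
      proof -
        have "n \<in> {-(2 ^ j)..2 ^ j}" "n + 1 \<in> {-(2 ^ j)..2 ^ j}" using nj by auto
        then show ?thesis using init[of n j] init[of "n + 1" j] by (simp add: bond_def)
      qed
      ultimately show "bond x n * exp (- 8 * (jbracket (\<bar>n\<bar> + 2) powr \<alpha> * (T + exp T * C))) \<le> bond (X j t) n"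
        using x0[of n] by (elim order_trans[rotated]) (auto intro!: mult_left_mono)
    qed
  qed
  \<comment> \<open>Spins converge uniformly on the time window and the limiting bonds next to
    \<open>n\<close> are bounded below there, so the right-hand sides converge uniformly and limit
    and derivative may be exchanged. The index is shifted by \<open>j0\<close> so that
    \<open>n\<close> is an interior site of every chain in the sequence.\<close>
  have ode: "((\<lambda>t. S t n) has_vector_derivative lhm_field (S t) n) (at t)" for t n
  proof -
    define T where "T = \<bar>t\<bar> + 1"
    have T: "0 < T" by (simp add: T_def)
    let ?I = "{-T<..<T}"
    have tI: "t \<in> ?I" by (auto simp: T_def)
    obtain j0 where j0: "\<And>j. j0 \<le> j \<Longrightarrow> n \<in> {-(2 ^ j)<..<2 ^ j}" using evX[of n] by (auto simp: eventually_sequentially)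
    define f where "f k s = X (k + j0) s n" for k s
    have U: "uniform_limit ?I (\<lambda>k s. X (k + j0) s m) (\<lambda>s. S s m) sequentially" for m
    proof -
      have "uniform_limit ?I (\<lambda>j s. X j s m) (\<lambda>s. S s m) sequentially"
        by (rule uniform_limit_on_subset[OF unif[OF T]]) auto
      from filterlim_compose[OF this filterlim_add_const_nat_at_top] show ?thesis .
    qed
    have fe: "lhm_field y n = - ((2 / (1 + y n \<bullet> y (n + 1))) *\<^sub>R (y n \<times> y (n + 1)) + (2 / (1 + y n \<bullet> y (n - 1))) *\<^sub>R (y n \<times> y (n - 1)))" for y
      by (simp add: lhm_field_def cross_add_right cross_mult_right)
    define m where "m = (\<lambda>n. bond x n * exp (- 8 * (jbracket (\<bar>n\<bar> + 2) powr \<alpha> * (T + exp T * C))))"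
    have m0: "0 < m n" for n unfolding m_def using x0 by simp
    have ml: "m n \<le> bond (S s) n" if "s \<in> ?I" for s n
      unfolding m_def by (rule lower[OF T]) (use that in auto)
    have FU: "uniform_limit ?I (\<lambda>k s. lhm_field (X (k + j0) s) n) (\<lambda>s. lhm_field (S s) n) sequentially"
      unfolding fe
    proof (intro uniform_limit_uminus uniform_limit_add)
      show "uniform_limit ?I (\<lambda>k s. (2 / (1 + X (k + j0) s n \<bullet> X (k + j0) s (n + 1))) *\<^sub>R (X (k + j0) s n \<times> X (k + j0) s (n + 1)))
          (\<lambda>s. (2 / (1 + S s n \<bullet> S s (n + 1))) *\<^sub>R (S s n \<times> S s (n + 1))) sequentially"
        by (rule uniform_limit_pair_field[OF U U nS nS m0[of n]]) (use ml[of _ n] in \<open>auto simp: bond_def\<close>)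
      show "uniform_limit ?I (\<lambda>k s. (2 / (1 + X (k + j0) s n \<bullet> X (k + j0) s (n - 1))) *\<^sub>R (X (k + j0) s n \<times> X (k + j0) s (n - 1)))
          (\<lambda>s. (2 / (1 + S s n \<bullet> S s (n - 1))) *\<^sub>R (S s n \<times> S s (n - 1))) sequentially"
        by (rule uniform_limit_pair_field[OF U U nS nS m0[of "n - 1"]]) (use ml[of _ "n - 1"] in \<open>auto simp: bond_def inner_commute\<close>)
    qed
    have "\<exists>g. \<forall>s\<in>?I. (\<lambda>k. f k s) \<longlonglongrightarrow> g s \<and> (g has_derivative (\<lambda>h. h *\<^sub>R lhm_field (S s) n)) (at s within ?I)"
    proof (rule has_derivative_sequence[where f'="\<lambda>k s h. h *\<^sub>R lhm_field (X (k + j0) s) n"])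
      fix k s
      have "((\<lambda>s. X (k + j0) s n) has_vector_derivative lhm_field (X (k + j0) s) n) (at s)"
        using X[of "k + j0"] j0[of "k + j0"] unfolding local_lhm_def by auto
      then show "(f k has_derivative (\<lambda>h. h *\<^sub>R lhm_field (X (k + j0) s) n)) (at s within ?I)"
        unfolding f_def has_vector_derivative_def by (rule has_derivative_at_withinI)
    next
      fix e :: real assume "0 < e"
      from uniform_limitD[OF FU this]
      show "\<forall>\<^sub>F k in sequentially. \<forall>s\<in>?I. \<forall>h. norm (h *\<^sub>R lhm_field (X (k + j0) s) n - h *\<^sub>R lhm_field (S s) n) \<le> e * norm h"
      proof eventually_elim
        case (elim k)
        show ?case
        proof (intro ballI allI)
          fix s h assume "s \<in> ?I"
          then have "norm (lhm_field (X (k + j0) s) n - lhm_field (S s) n) \<le> e"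
            using elim by (auto simp: dist_norm less_imp_le)
          then have "\<bar>h\<bar> * norm (lhm_field (X (k + j0) s) n - lhm_field (S s) n) \<le> \<bar>h\<bar> * e" by (intro mult_left_mono) auto
          then show "norm (h *\<^sub>R lhm_field (X (k + j0) s) n - h *\<^sub>R lhm_field (S s) n) \<le> e * norm h"
            by (simp add: scaleR_diff_right[symmetric] mult.commute)
        qed
      qed
    next
      show "(\<lambda>k. f k t) \<longlonglongrightarrow> S t n" unfolding f_def using lim by (rule LIMSEQ_ignore_initial_segment)
    qed (use tI in auto)
    then obtain g where g: "\<And>s. s \<in> ?I \<Longrightarrow> (\<lambda>k. f k s) \<longlonglongrightarrow> g s"
      "\<And>s. s \<in> ?I \<Longrightarrow> (g has_derivative (\<lambda>h. h *\<^sub>R lhm_field (S s) n)) (at s within ?I)" by blast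
    have gS: "g s = S s n" if "s \<in> ?I" for s
    proof (rule LIMSEQ_unique[OF g(1)[OF that]])
      show "(\<lambda>k. f k s) \<longlonglongrightarrow> S s n" unfolding f_def using lim by (rule LIMSEQ_ignore_initial_segment)
    qed
    have "(g has_derivative (\<lambda>h. h *\<^sub>R lhm_field (S t) n)) (at t)"
      using g(2)[OF tI] tI by (simp add: at_within_open[of _ ?I])
    then show ?thesis
      unfolding has_vector_derivative_def by (rule has_derivative_transform_within_open[OF _ _ tI]) (use gS in auto)
  qed
  have wS: "0 < bond (S t) n" for t n
    using lower[of "\<bar>t\<bar> + 1" t n] x0[of n] by (intro less_le_trans[OF _ lower[of "\<bar>t\<bar> + 1" t n]]) auto
  have lhm: "lhm_solution S"
    unfolding lhm_solution_def using nS wS ode by (auto simp: bond_def lhm_field_def less_imp_neq[THEN not_sym])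
  have moment: "(\<integral>\<^sup>+t\<in>{-T..T}. (\<integral>\<^sup>+n. ennreal (jbracket n powr (- q)
             / (1 + S t n \<bullet> S t (n + 1)) powr p) \<partial>count_space UNIV) \<partial>lborel) < \<infinity>" if T: "0 < T" for T
  proof -
    define h where "h j t = ennreal (exp (- \<bar>t\<bar>) * bond_sum p q (2 ^ j) (X j t))" for j t
    define a where "a t n = jbracket n powr (- q) / bond (S t) n powr p" for t n
    have hm: "h j \<in> borel_measurable lborel" for j
    proof -
      have "continuous_on UNIV (\<lambda>t. exp (- \<bar>t\<bar>) * bond_sum p q (2 ^ j) (X j t))" by (intro continuous_intros sumc)
      then have "(\<lambda>t. exp (- \<bar>t\<bar>) * bond_sum p q (2 ^ j) (X j t)) \<in> borel_measurable lborel"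
        using borel_measurable_continuous_onI by simp
      then show ?thesis unfolding h_def by (rule measurable_compose[OF _ measurable_ennreal])
    qed
    \<comment> \<open>Fatou in the site variable; the indicator in \<open>b\<close> accounts for the
      growing blocks.\<close>
    have pt: "(\<integral>\<^sup>+n. ennreal (exp (- \<bar>t\<bar>) * a t n) \<partial>count_space UNIV) \<le> liminf (\<lambda>j. h j t)" for t
    proof -
      define b where "b j n = ennreal (exp (- \<bar>t\<bar>) * (jbracket n powr (- q) / bond (X j t) n powr p)) * indicator {-(2 ^ j)..<2 ^ j} n" for j n
      have bl: "(\<lambda>j. b j n) \<longlonglongrightarrow> ennreal (exp (- \<bar>t\<bar>) * a t n)" for n
      proof -
        have "(\<lambda>j. bond (X j t) n powr p) \<longlonglongrightarrow> bond (S t) n powr p"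
          using wS[of t n] by (intro tendsto_powr bondlim tendsto_const) simp
        then have "(\<lambda>j. ennreal (exp (- \<bar>t\<bar>) * (jbracket n powr (- q) / bond (X j t) n powr p))) \<longlonglongrightarrow> ennreal (exp (- \<bar>t\<bar>) * a t n)"
          unfolding a_def using wS[of t n] by (intro tendsto_ennrealI tendsto_mult tendsto_divide tendsto_const) auto
        moreover have "\<forall>\<^sub>F j in sequentially. ennreal (exp (- \<bar>t\<bar>) * (jbracket n powr (- q) / bond (X j t) n powr p)) = b j n"
          using evX[of n] by eventually_elim (auto simp: b_def)
        ultimately show ?thesis by (rule Lim_transform_eventually)
      qed
      have "(\<integral>\<^sup>+n. ennreal (exp (- \<bar>t\<bar>) * a t n) \<partial>count_space UNIV) = (\<integral>\<^sup>+n. liminf (\<lambda>j. b j n) \<partial>count_space UNIV)"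
        by (intro nn_integral_cong lim_imp_Liminf[symmetric] bl) simp
      also have "\<dots> \<le> liminf (\<lambda>j. \<integral>\<^sup>+n. b j n \<partial>count_space UNIV)"
        by (rule nn_integral_liminf) simp
      also have "(\<lambda>j. \<integral>\<^sup>+n. b j n \<partial>count_space UNIV) = (\<lambda>j. h j t)"
      proof (rule ext)
        fix j
        have "(\<integral>\<^sup>+n. b j n \<partial>count_space UNIV) = (\<integral>\<^sup>+n. ennreal (exp (- \<bar>t\<bar>) * (jbracket n powr (- q) / bond (X j t) n powr p)) \<partial>count_space {-(2 ^ j)..<2 ^ j})"
          unfolding b_def by (simp add: nn_integral_count_space_indicator)
        also have "\<dots> = (\<Sum>n\<in>{-(2 ^ j)..<2 ^ j}. ennreal (exp (- \<bar>t\<bar>) * (jbracket n powr (- q) / bond (X j t) n powr p)))"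
          by (simp add: nn_integral_count_space_finite)
        also have "\<dots> = h j t"
          unfolding h_def bond_sum_def sum_distrib_left by (rule sum_ennreal) simp
        finally show "(\<integral>\<^sup>+n. b j n \<partial>count_space UNIV) = h j t" .
      qed
      finally show ?thesis .
    qed
    \<comment> \<open>Fatou in time leaves a lower limit, which a bound attained infinitely often
      controls.\<close>
    have lC: "liminf (\<lambda>j. \<integral>\<^sup>+t. h j t \<partial>lborel) \<le> ennreal C"
    proof (rule ccontr)
      assume "\<not> liminf (\<lambda>j. \<integral>\<^sup>+t. h j t \<partial>lborel) \<le> ennreal C"
      then have "\<forall>\<^sub>F j in sequentially. ennreal C < (\<integral>\<^sup>+t. h j t \<partial>lborel)"
        by (intro less_LiminfD) simp
      then show False using C(2) unfolding h_def by (simp add: frequently_def not_le)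
    qed
    have "(\<integral>\<^sup>+t\<in>{-T..T}. (\<integral>\<^sup>+n. ennreal (jbracket n powr (- q) / (1 + S t n \<bullet> S t (n + 1)) powr p) \<partial>count_space UNIV) \<partial>lborel)
       \<le> (\<integral>\<^sup>+t. ennreal (exp T) * liminf (\<lambda>j. h j t) \<partial>lborel)"
    proof (rule nn_integral_mono)
      fix t
      show "(\<integral>\<^sup>+n. ennreal (jbracket n powr (- q) / (1 + S t n \<bullet> S t (n + 1)) powr p) \<partial>count_space UNIV) * indicator {-T..T} t
          \<le> ennreal (exp T) * liminf (\<lambda>j. h j t)"
      proof (cases "t \<in> {-T..T}")
        case True
        have "(\<integral>\<^sup>+n. ennreal (jbracket n powr (- q) / (1 + S t n \<bullet> S t (n + 1)) powr p) \<partial>count_space UNIV) \<le>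
            (\<integral>\<^sup>+n. ennreal (exp T) * ennreal (exp (- \<bar>t\<bar>) * a t n) \<partial>count_space UNIV)"
        proof (rule nn_integral_mono)
          fix n
          have "1 * a t n \<le> (exp T * exp (- \<bar>t\<bar>)) * a t n"
            using True by (intro mult_right_mono) (auto simp: a_def exp_add[symmetric])
          then show "ennreal (jbracket n powr (- q) / (1 + S t n \<bullet> S t (n + 1)) powr p) \<le> ennreal (exp T) * ennreal (exp (- \<bar>t\<bar>) * a t n)"
            unfolding a_def bond_def by (simp add: ennreal_mult'[symmetric] mult.assoc ennreal_leI)
        qed
        also have "\<dots> = ennreal (exp T) * (\<integral>\<^sup>+n. ennreal (exp (- \<bar>t\<bar>) * a t n) \<partial>count_space UNIV)"
          by (rule nn_integral_cmult) simp
        also have "\<dots> \<le> ennreal (exp T) * liminf (\<lambda>j. h j t)" by (intro mult_left_mono pt) simp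
        finally show ?thesis using True by simp
      qed simp
    qed
    also have "\<dots> = ennreal (exp T) * (\<integral>\<^sup>+t. liminf (\<lambda>j. h j t) \<partial>lborel)"
      using hm by (intro nn_integral_cmult borel_measurable_liminf)
    also have "\<dots> \<le> ennreal (exp T) * ennreal C"
      by (intro mult_left_mono order_trans[OF nn_integral_liminf[OF hm] lC]) simp
    also have "\<dots> < \<infinity>" by (simp add: ennreal_mult_less_top)
    finally show ?thesis .
  qed
  \<comment> \<open>The constant is \<open>c = 1\<close>: half of the exponent
    \<open>jbracket n\<close> absorbs the loss in the lower bound of the bonds, and the other half
    is the weight in the assumption on the initial datum.\<close>
  have second: "(SUP t\<in>{-T..T}. \<integral>\<^sup>+n. ennreal (exp (- 1 * jbracket n)
             / (1 + S t n \<bullet> S t (n + 1))) \<partial>count_space UNIV) < \<infinity>" if T: "0 < T" for T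
  proof -
    have exp_div: "exp a / (b * exp (- m)) = exp (a + m) / b" for a b m :: real
      by (simp add: exp_add exp_minus divide_inverse)
    obtain C' where C': "\<And>n. 8 * (T + exp T * C) * jbracket (\<bar>n\<bar> + 2) powr \<alpha> \<le> jbracket n / 2 + C'"
      using sublinear_jbracket[OF \<alpha>(1,2), of "8 * (T + exp T * C)"] T C(1) by auto
    have "(SUP t\<in>{-T..T}. \<integral>\<^sup>+n. ennreal (exp (- 1 * jbracket n) / (1 + S t n \<bullet> S t (n + 1))) \<partial>count_space UNIV)
        \<le> (\<integral>\<^sup>+n. ennreal (exp C') * ennreal (exp (- jbracket n / 2) / bond x n) \<partial>count_space UNIV)"
    proof (intro SUP_least nn_integral_mono)
      fix t n assume t: "t \<in> {-T..T}"
      let ?m = "8 * (jbracket (\<bar>n\<bar> + 2) powr \<alpha> * (T + exp T * C))"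
      have low: "bond x n * exp (- ?m) \<le> bond (S t) n" using lower[OF T, of t n] t by (simp add: abs_le_iff)
      have "exp (- jbracket n) / bond (S t) n \<le> exp (- jbracket n) / (bond x n * exp (- ?m))"
        using x0[of n] wS[of t n] by (intro divide_left_mono low) auto
      also have "\<dots> = exp (- jbracket n + ?m) / bond x n" by (rule exp_div)
      also have "\<dots> \<le> exp (C' + - jbracket n / 2) / bond x n"
      proof -
        have "?m = 8 * (T + exp T * C) * jbracket (\<bar>n\<bar> + 2) powr \<alpha>" by simp
        then have "- jbracket n + ?m \<le> C' + - jbracket n / 2" using C'[of n] by linarith
        then show ?thesis using x0[of n] by (intro divide_right_mono) auto
      qed
      also have "\<dots> = exp C' * (exp (- jbracket n / 2) / bond x n)" unfolding exp_add by simp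
      finally show "ennreal (exp (- 1 * jbracket n) / (1 + S t n \<bullet> S t (n + 1))) \<le> ennreal (exp C') * ennreal (exp (- jbracket n / 2) / bond x n)"
        using x0[of n] by (simp add: bond_def ennreal_mult[symmetric] ennreal_leI)
    qed
    also have "\<dots> = ennreal (exp C') * (\<integral>\<^sup>+n. ennreal (exp (- jbracket n / 2) / bond x n) \<partial>count_space UNIV)"
      by (rule nn_integral_cmult) simp
    also have "\<dots> < \<infinity>" using A by (simp add: ennreal_mult_less_top)
    finally show ?thesis .
  qed
  have "good_solution S"
    unfolding good_solution_def using lhm pq moment second
    by (intro conjI exI[of _ p] exI[of _ q] exI[of _ "1::real"]) auto
  then show ?thesis using S0 lim by blast
qed

section \<open>Almost sure convergence and invariance\<close>

text \<open>The integers are covered by two copies of the naturals, with 0 counted twice.\<close>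

lemma nn_integral_int_le:
  fixes f :: "int \<Rightarrow> real" and h :: "nat \<Rightarrow> real"
  assumes f: "\<And>n. 0 \<le> f n" "\<And>n. f n \<le> h (nat \<bar>n\<bar>)" and h: "\<And>k. 0 \<le> h k" "summable h"
  shows "(\<integral>\<^sup>+n. ennreal (f n) \<partial>count_space UNIV) \<le> ennreal (2 * suminf h)"
proof -
  have half: "(\<integral>\<^sup>+n. ennreal (f n) * indicator (range g) n \<partial>count_space UNIV) \<le> ennreal (suminf h)"
    if g: "inj g" "\<And>k. h (nat \<bar>g k\<bar>) \<le> h k" for g :: "nat \<Rightarrow> int"
  proof -
    have "(\<integral>\<^sup>+n. ennreal (f n) * indicator (range g) n \<partial>count_space UNIV) = (\<integral>\<^sup>+n. ennreal (f n) \<partial>count_space (range g))"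
      by (simp add: nn_integral_count_space_indicator)
    also have "\<dots> = (\<integral>\<^sup>+k. ennreal (f (g k)) \<partial>count_space UNIV)"
      using g(1) by (intro nn_integral_bij_count_space[symmetric]) (simp add: bij_betw_def)
    also have "\<dots> \<le> (\<integral>\<^sup>+k. ennreal (h k) \<partial>count_space UNIV)"
      using f(2) g(2) by (intro nn_integral_mono ennreal_leI) (auto intro: order_trans)
    also have "\<dots> = ennreal (suminf h)"
      using h by (simp add: nn_integral_count_space_nat suminf_ennreal2)
    finally show ?thesis .
  qed
  have "(\<integral>\<^sup>+n. ennreal (f n) \<partial>count_space UNIV) \<le>
      (\<integral>\<^sup>+n. ennreal (f n) * indicator (range int) n + ennreal (f n) * indicator (range (\<lambda>k. - int k)) n \<partial>count_space UNIV)"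
  proof (rule nn_integral_mono)
    fix n :: int
    have "n \<in> range int \<or> n \<in> range (\<lambda>k. - int k)"
    proof (cases "0 \<le> n")
      case True
      then have "n = int (nat n)" by simp
      then show ?thesis by blast
    next
      case False
      then have "n = - int (nat (- n))" by simp
      then show ?thesis by blast
    qed
    then show "ennreal (f n) \<le> ennreal (f n) * indicator (range int) n + ennreal (f n) * indicator (range (\<lambda>k. - int k)) n"
      by (auto simp: indicator_def)
  qed
  also have "\<dots> = (\<integral>\<^sup>+n. ennreal (f n) * indicator (range int) n \<partial>count_space UNIV) +
      (\<integral>\<^sup>+n. ennreal (f n) * indicator (range (\<lambda>k. - int k)) n \<partial>count_space UNIV)"
    by (rule nn_integral_add) auto
  also have "\<dots> \<le> ennreal (suminf h) + ennreal (suminf h)"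
    by (intro add_mono half) (auto simp: inj_def)
  also have "\<dots> = ennreal (2 * suminf h)"
    using suminf_nonneg[OF h(2,1)] by (subst ennreal_plus[symmetric]) auto
  finally show ?thesis .
qed

section \<open>Moments of the bonds under the Gibbs measure\<close>

lemma bond_measurable: "(\<lambda>x. bond x n) \<in> borel_measurable borel"
proof -
  note [measurable] = measurable_apply_borel
  show ?thesis unfolding bond_def by measurable
qed

lemma bond_sum_measurable: "bond_sum p q M \<in> borel_measurable borel"
proof -
  note [measurable] = bond_measurable
  show ?thesis unfolding bond_sum_def[abs_def] by measurable
qed

lemma bond_restrict: "n \<in> {-M..<M} \<Longrightarrow> bond (restrict x {-M..M}) n = bond x n"
  by (auto simp: bond_def)

lemma bond_sum_restrict: "bond_sum p q M (restrict x {-M..M}) = bond_sum p q M x"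
  unfolding bond_sum_def by (intro sum.cong refl) (simp add: bond_restrict)

text \<open>The law of two adjacent spins, with spin \<open>n\<close> integrated first: for fixed
  \<open>x (n + 1)\<close> the bond is a function of one spin on the sphere. The normalisation is
  that of a chain with two sites.\<close>

lemma nn_integral_bond_pair:
  fixes G :: "real \<Rightarrow> ennreal"
  assumes b: "\<beta> > 0" and g: "is_gibbs_measure \<beta> \<mu>" and G: "G \<in> borel_measurable borel"
  shows "(\<integral>\<^sup>+S. G (bond S n) \<partial>\<mu>) =
    (\<integral>\<^sup>+x. (\<integral>\<^sup>+y. G (1 + x (n + 1) \<bullet> y) * ennreal (spin_kernel \<beta> (x (n + 1)) y / (4 * pi * kernel_mass \<beta>)) \<partial>sphere_area) \<partial>block_space {n + 1})"
proof -
  let ?F = "\<lambda>s. G (bond s n) * ennreal (chain_weight \<beta> n (n + 1) s / chain_integral \<beta> n (n + 1) (\<lambda>_. 1))"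
  have Gb: "(\<lambda>s. G (bond s n)) \<in> borel_measurable borel" by (rule measurable_compose[OF bond_measurable G])
  have Fm: "?F \<in> borel_measurable borel"
    using Gb chain_weight_measurable by (intro borel_measurable_times_ennreal measurable_compose[OF _ measurable_ennreal] borel_measurable_divide) auto
  have I: "{n..n + 1} = insert n {n + 1}" by auto
  have z: "chain_integral \<beta> n (n + 1) (\<lambda>_. 1) = 4 * pi * kernel_mass \<beta>"
    using chain_integral_1[OF b, of n 1] by simp
  have "(\<integral>\<^sup>+S. G (bond S n) \<partial>\<mu>) = (\<integral>\<^sup>+S. G (bond (restrict S {n..n + 1}) n) \<partial>\<mu>)"
    by (simp add: bond_def)
  also have "\<dots> = (\<integral>\<^sup>+s. ?F s \<partial>block_space {n..n + 1})"
    by (rule gibbs_block_law[OF b g _ Gb]) simp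
  also have "\<dots> = (\<integral>\<^sup>+x. (\<integral>\<^sup>+y. ?F (x(n := y)) \<partial>sphere_area) \<partial>block_space {n + 1})"
    unfolding I by (rule sphere_prod.product_nn_integral_insert) (use Fm in \<open>auto intro: borel_measurable_block\<close>)
  also have "\<dots> = (\<integral>\<^sup>+x. (\<integral>\<^sup>+y. G (1 + x (n + 1) \<bullet> y) * ennreal (spin_kernel \<beta> (x (n + 1)) y / (4 * pi * kernel_mass \<beta>)) \<partial>sphere_area) \<partial>block_space {n + 1})"
  proof (intro nn_integral_cong)
    fix x y
    have "{n..<n + 1} = {n}" by auto
    then show "?F (x(n := y)) = G (1 + x (n + 1) \<bullet> y) * ennreal (spin_kernel \<beta> (x (n + 1)) y / (4 * pi * kernel_mass \<beta>))"
      unfolding z by (simp add: bond_def chain_weight_def inner_commute spin_kernel_commute)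
  qed
  finally show ?thesis .
qed

lemma emeasure_block_singleton: "emeasure (block_space {n}) (space (block_space {n})) = ennreal (4 * pi)"
  using sphere_prod.product_nn_integral_singleton[of "\<lambda>_. 1" n] by (simp add: emeasure_sphere_area_space)

text \<open>The density contributes the power \<open>2 * \<beta>\<close> of the bond, which leaves
  the negative power of order \<open>p - 2 * \<beta> < 1\<close>, integrable near the
  antipode.\<close>

lemma gibbs_bond_moment:
  assumes b: "\<beta> > 0" and p: "p < 1 + 2 * \<beta>"
  shows "\<exists>C\<ge>0. \<forall>\<mu> n. is_gibbs_measure \<beta> \<mu> \<longrightarrow> (\<integral>\<^sup>+S. ennreal (1 / bond S n powr p) \<partial>\<mu>) \<le> ennreal C"
proof -
  obtain C where C: "0 \<le> C" "\<And>e. norm e = 1 \<Longrightarrow> (\<integral>\<^sup>+s. ennreal ((1 + e \<bullet> s) powr (- (p - 2 * \<beta>))) \<partial>sphere_area) \<le> ennreal C"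
    using nn_integral_cap_powr[of "p - 2 * \<beta>"] p by auto
  define c where "c = (1 + 2 * \<beta>) / (4 * pi) * (1 / 2) powr (2 * \<beta>) / (4 * pi * kernel_mass \<beta>)"
  have c0: "0 \<le> c" unfolding c_def using b kernel_mass_pos[OF b] by simp
  show ?thesis
  proof (intro exI[of _ "c * C * (4 * pi)"] conjI allI impI)
    fix \<mu> n assume g: "is_gibbs_measure \<beta> \<mu>"
    have "(\<integral>\<^sup>+S. ennreal (1 / bond S n powr p) \<partial>\<mu>) =
      (\<integral>\<^sup>+x. (\<integral>\<^sup>+y. ennreal (1 / (1 + x (n + 1) \<bullet> y) powr p) * ennreal (spin_kernel \<beta> (x (n + 1)) y / (4 * pi * kernel_mass \<beta>)) \<partial>sphere_area) \<partial>block_space {n + 1})"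
      by (rule nn_integral_bond_pair[OF b g, where G="\<lambda>z. ennreal (1 / z powr p)"]) measurable
    also have "\<dots> \<le> (\<integral>\<^sup>+x. ennreal (c * C) \<partial>block_space {n + 1})"
    proof (rule nn_integral_mono)
      fix x assume "x \<in> space (block_space {n + 1})"
      then have x: "norm (x (n + 1)) = 1" by (auto simp: space_block PiE_def Pi_def)
      have "(\<integral>\<^sup>+y. ennreal (1 / (1 + x (n + 1) \<bullet> y) powr p) * ennreal (spin_kernel \<beta> (x (n + 1)) y / (4 * pi * kernel_mass \<beta>)) \<partial>sphere_area) \<le>
        (\<integral>\<^sup>+y. ennreal c * ennreal ((1 + x (n + 1) \<bullet> y) powr (- (p - 2 * \<beta>))) \<partial>sphere_area)"
      proof (rule nn_integral_mono)
        fix y :: "real^3" assume "y \<in> space sphere_area"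
        then have w: "0 \<le> 1 + x (n + 1) \<bullet> y" using one_plus_inner_bounds[OF x, of y] by simp
        let ?w = "1 + x (n + 1) \<bullet> y"
        have "1 / ?w powr p * (spin_kernel \<beta> (x (n + 1)) y / (4 * pi * kernel_mass \<beta>)) = c * (?w powr (2 * \<beta>) / ?w powr p)"
          using powr_mult[of "1 / 2" ?w "2 * \<beta>"] w by (simp add: spin_kernel_def c_def mult_ac)
        also have "?w powr (2 * \<beta>) / ?w powr p = ?w powr (- (p - 2 * \<beta>))"
          by (simp add: powr_diff[symmetric])
        finally show "ennreal (1 / ?w powr p) * ennreal (spin_kernel \<beta> (x (n + 1)) y / (4 * pi * kernel_mass \<beta>)) \<le>
            ennreal c * ennreal (?w powr (- (p - 2 * \<beta>)))"
          using c0 by (simp add: ennreal_mult'[symmetric])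
      qed
      also have "\<dots> = ennreal c * (\<integral>\<^sup>+y. ennreal ((1 + x (n + 1) \<bullet> y) powr (- (p - 2 * \<beta>))) \<partial>sphere_area)"
        by (intro nn_integral_cmult borel_measurable_sphere_area) measurable
      also have "\<dots> \<le> ennreal c * ennreal C" by (intro mult_left_mono C(2)[OF x]) simp
      finally show "(\<integral>\<^sup>+y. ennreal (1 / (1 + x (n + 1) \<bullet> y) powr p) * ennreal (spin_kernel \<beta> (x (n + 1)) y / (4 * pi * kernel_mass \<beta>)) \<partial>sphere_area) \<le> ennreal (c * C)"
        using c0 C(1) by (simp add: ennreal_mult)
    qed
    also have "\<dots> = ennreal (c * C) * ennreal (4 * pi)"
      by (subst nn_integral_const) (simp only: emeasure_block_singleton)
    also have "\<dots> = ennreal (c * C * (4 * pi))"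
      using c0 C(1) by (simp add: ennreal_mult)
    finally show "(\<integral>\<^sup>+S. ennreal (1 / bond S n powr p) \<partial>\<mu>) \<le> ennreal (c * C * (4 * pi))" .
  qed (use c0 C(1) in simp)
qed

text \<open>The kernel is 0 at antipodal pairs, so a vanishing bond has density 0; the countably
  many sites share one null set.\<close>

lemma gibbs_bond_pos:
  assumes b: "\<beta> > 0" and g: "is_gibbs_measure \<beta> \<mu>"
  shows "AE S in \<mu>. \<forall>n. 0 < bond S n"
proof -
  have "AE S in \<mu>. 0 < bond S n" for n
  proof -
    have "(\<integral>\<^sup>+S. indicator {0} (bond S n) \<partial>\<mu>) =
      (\<integral>\<^sup>+x. (\<integral>\<^sup>+y. indicator {0} (1 + x (n + 1) \<bullet> y) * ennreal (spin_kernel \<beta> (x (n + 1)) y / (4 * pi * kernel_mass \<beta>)) \<partial>sphere_area) \<partial>block_space {n + 1})"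
      by (rule nn_integral_bond_pair[OF b g]) measurable
    also have "\<dots> = (\<integral>\<^sup>+x. (\<integral>\<^sup>+y. 0 \<partial>sphere_area) \<partial>block_space {n + 1})"
      using b by (intro nn_integral_cong) (auto simp: indicator_def spin_kernel_def)
    finally have "(\<integral>\<^sup>+S. indicator {0} (bond S n) \<partial>\<mu>) = 0" by simp
    moreover have "(\<lambda>S. indicator {0} (bond S n) :: ennreal) \<in> borel_measurable \<mu>"
      by (intro gibbs_borel_measurable[OF g] measurable_compose[OF bond_measurable]) measurable
    ultimately have "AE S in \<mu>. indicator {0} (bond S n) = (0 :: ennreal)"
      by (simp add: nn_integral_0_iff_AE)
    then show ?thesis using AE_space
    proof eventually_elim
      case (elim S)
      have "0 \<le> bond S n" unfolding bond_def
        using gibbs_space[OF g elim(2)] by (intro one_plus_inner_bounds) auto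
      then show ?case using elim(1) by (auto simp: indicator_def split: if_splits)
    qed
  qed
  then show ?thesis by (simp add: AE_all_countable)
qed

section \<open>Finite flows under the Gibbs measure\<close>

definition block_flow :: "int \<Rightarrow> (int \<Rightarrow> real^3) \<Rightarrow> real \<Rightarrow> int \<Rightarrow> real^3" where
  "block_flow N S t = chain_flow (- N) N t (restrict S {-N..N})"

lemma block_flow_local:
  assumes N: "0 < N" and u: "\<And>n. norm (S n) = 1" and w: "\<And>n. 0 < bond S n"
  shows "local_lhm N (block_flow N S)" "block_flow N S 0 = restrict S {-N..N}"
proof -
  let ?x = "restrict S {-N..N}"
  have "\<exists>X k0. X 0 = ?x \<and> (\<forall>t. chain_flow (-N) N t ?x = X t) \<and>
    (\<forall>k\<ge>k0. spin_trajectory (cut_coupling k) (chain_edges (-N) N) X \<and> (\<forall>t. spin_flow (cut_coupling k) (chain_edges (-N) N) t ?x = X t)) \<and>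
    (\<forall>t. \<forall>n\<in>{-N..<N}. 1 / real (Suc k0) \<le> 1 + X t n \<bullet> X t (n + 1))"
    by (rule chain_flow_trajectory) (use N u w in \<open>auto simp: bond_def\<close>)
  then obtain X k0 where X: "X 0 = ?x" "\<And>t. chain_flow (-N) N t ?x = X t"
    "spin_trajectory (cut_coupling k0) (chain_edges (-N) N) X"
    "\<And>t n. n \<in> {-N..<N} \<Longrightarrow> 1 / real (Suc k0) \<le> 1 + X t n \<bullet> X t (n + 1)" by blast
  have bf: "block_flow N S = X" by (rule ext) (simp add: block_flow_def X(2))
  show "block_flow N S 0 = ?x" unfolding bf by (rule X(1))
  have es: "edge_sites (chain_edges (-N) N) = {-N..N}" using N by (intro edge_sites_chain) simp
  have d: "((\<lambda>t. X t n) has_vector_derivative edge_field (cut_coupling k0) (chain_edges (-N) N) (X t) n) (at t)" for t n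
    using X(3) by (simp add: spin_trajectory_def)
  have cont: "continuous_on UNIV (\<lambda>t. X t n)" for n
    by (intro continuous_at_imp_continuous_on ballI has_vector_derivative_continuous[OF d])
  have nX: "norm (X t n) = 1" if "n \<in> {-N..N}" for t n
    using X(3) that es by (simp add: spin_trajectory_def)
  have bp: "0 < bond (X t) n" if "n \<in> {-N..<N}" for t n
    unfolding bond_def by (rule less_le_trans[OF _ X(4)[OF that]]) simp
  have fe: "edge_field (cut_coupling k0) (chain_edges (-N) N) (X t) n = lhm_field (X t) n" if n: "n \<in> {-N<..<N}" for t n
  proof -
    have c1: "chain_coupling (cut_coupling k0) (-N) N (X t) n = 2 / (1 + X t n \<bullet> X t (n + 1))"
      using n X(4)[of n t] by (simp add: chain_coupling_def cut_coupling_above)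
    have c2: "chain_coupling (cut_coupling k0) (-N) N (X t) (n - 1) = 2 / (1 + X t n \<bullet> X t (n - 1))"
      using n X(4)[of "n - 1" t] by (simp add: chain_coupling_def cut_coupling_above inner_commute)
    show ?thesis unfolding edge_field_chain lhm_field_def c1 c2 by (rule cross_skew)
  qed
  show "local_lhm N (block_flow N S)"
    unfolding bf local_lhm_def using nX bp cont d fe by (auto simp del: of_nat_Suc) (metis d fe greaterThanLessThan_iff)
qed

lemma block_flow_measurable_pair:
  assumes g: "is_gibbs_measure \<beta> \<mu>"
  shows "(\<lambda>(S, t). block_flow N S t) \<in> \<mu> \<Otimes>\<^sub>M lborel \<rightarrow>\<^sub>M (borel :: (int \<Rightarrow> real^3) measure)"
proof -
  have r: "(\<lambda>p. restrict (fst p) {-N..N}) \<in> \<mu> \<Otimes>\<^sub>M lborel \<rightarrow>\<^sub>M (borel :: (int \<Rightarrow> real^3) measure)"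
    using continuous_on_restrict_config
    by (intro measurable_compose[OF measurable_fst] gibbs_borel_measurable[OF g] borel_measurable_continuous_onI)
  have "(\<lambda>p. (snd p, restrict (fst p) {-N..N})) \<in> \<mu> \<Otimes>\<^sub>M lborel \<rightarrow>\<^sub>M borel \<Otimes>\<^sub>M (borel :: (int \<Rightarrow> real^3) measure)"
    using r by (intro measurable_Pair) auto
  then have pm: "(\<lambda>p. (snd p, restrict (fst p) {-N..N})) \<in> \<mu> \<Otimes>\<^sub>M lborel \<rightarrow>\<^sub>M (borel :: (real \<times> (int \<Rightarrow> real^3)) measure)"
    by (simp add: borel_prod)
  have "(\<lambda>p. block_flow N (fst p) (snd p)) \<in> \<mu> \<Otimes>\<^sub>M lborel \<rightarrow>\<^sub>M Pi\<^sub>M UNIV (\<lambda>_::int. borel :: (real^3) measure)"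
  proof (rule measurable_PiM_single')
    fix n
    show "(\<lambda>p. block_flow N (fst p) (snd p) n) \<in> borel_measurable (\<mu> \<Otimes>\<^sub>M lborel)"
      using measurable_compose[OF pm measurable_chain_flow[of "-N" N n]] by (simp add: block_flow_def)
  qed (auto simp: space_PiM)
  then show ?thesis by (simp add: measurable_cong_sets[OF refl sets_PiM_equal_borel] case_prod_unfold)
qed

lemma nn_integral_exp_abs: "(\<integral>\<^sup>+t. ennreal (exp (- \<bar>t\<bar>)) \<partial>lborel) \<le> ennreal 2"
proof -
  have tl: "((\<lambda>t::real. - exp (- t)) \<longlongrightarrow> - 0) at_top"
    by (intro tendsto_minus filterlim_compose[OF exp_at_bot] filterlim_uminus_at_bot_at_top)
  have pos: "(\<integral>\<^sup>+t. ennreal (exp (- t)) * indicator {0..} t \<partial>lborel) = ennreal (- 0 - (- exp (- 0)))"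
    by (rule nn_integral_FTC_atLeast[OF _ _ _ tl]) (auto intro!: derivative_eq_intros)
  have neg: "(\<integral>\<^sup>+t. ennreal (exp t) * indicator {..0} t \<partial>lborel) = (\<integral>\<^sup>+t. ennreal (exp (- t)) * indicator {0..} t \<partial>lborel)"
    using nn_integral_real_affine[of "\<lambda>t. ennreal (exp t) * indicator {..0} t" "-1" 0] by (simp add: indicator_def)
  have "(\<integral>\<^sup>+t. ennreal (exp (- \<bar>t\<bar>)) \<partial>lborel) \<le>
      (\<integral>\<^sup>+t. ennreal (exp (- t)) * indicator {0..} t + ennreal (exp t) * indicator {..0} t \<partial>lborel)"
    by (intro nn_integral_mono) (auto simp: indicator_def abs_if)
  also have "\<dots> = (\<integral>\<^sup>+t. ennreal (exp (- t)) * indicator {0..} t \<partial>lborel) + (\<integral>\<^sup>+t. ennreal (exp t) * indicator {..0} t \<partial>lborel)"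
    by (rule nn_integral_add) auto
  also have "\<dots> = ennreal 2" unfolding neg pos by (simp flip: ennreal_plus)
  finally show ?thesis .
qed


lemma block_flow_time_measurable:
  assumes g: "is_gibbs_measure \<beta> \<mu>"
  shows "(\<lambda>(S, t). ennreal (exp (- \<bar>t\<bar>) * bond_sum p q N (block_flow N S t))) \<in> borel_measurable (\<mu> \<Otimes>\<^sub>M lborel)"
proof -
  have "(\<lambda>p. block_flow N (fst p) (snd p)) \<in> \<mu> \<Otimes>\<^sub>M lborel \<rightarrow>\<^sub>M (borel :: (int \<Rightarrow> real^3) measure)"
    using block_flow_measurable_pair[OF g] by (simp add: case_prod_unfold)
  from measurable_compose[OF this bond_sum_measurable]
  have "(\<lambda>x. exp (- \<bar>snd x\<bar>) * bond_sum p q N (block_flow N (fst x) (snd x))) \<in> borel_measurable (\<mu> \<Otimes>\<^sub>M lborel)"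
    by (intro borel_measurable_times) auto
  then show ?thesis by (simp add: case_prod_unfold)
qed

text \<open>Invariance replaces the flow at each time by the initial datum, whose moments are
  bounded uniformly in the site. The weights are summable because \<open>q > 1\<close>, and the time
  weight has total mass at most 2, so the bound does not depend on \<open>N\<close>.\<close>

lemma gibbs_flow_moment:
  assumes b: "\<beta> > 0" and g: "is_gibbs_measure \<beta> \<mu>" and p: "p < 1 + 2 * \<beta>" and q: "1 < q"
  shows "\<exists>C\<ge>0. \<forall>N>0. (\<integral>\<^sup>+S. (\<integral>\<^sup>+t. ennreal (exp (- \<bar>t\<bar>) * bond_sum p q N (block_flow N S t)) \<partial>lborel) \<partial>\<mu>) \<le> ennreal C"
proof -
  interpret prob_space \<mu> using g by (simp add: is_gibbs_measure_def)
  interpret P: pair_sigma_finite \<mu> lborel by standard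
  obtain C where C: "0 \<le> C" "\<And>n. (\<integral>\<^sup>+S. ennreal (1 / bond S n powr p) \<partial>\<mu>) \<le> ennreal C"
    using gibbs_bond_moment[OF b p] g by blast
  \<comment> \<open>The summand at \<open>k = 0\<close> is a correction: \<open>0 powr (- q)\<close>
    is 0, whereas the weight of the site 0 is 1.\<close>
  define h where "h k = real k powr (- q) + (if k = 0 then 1 else 0)" for k :: nat
  have h: "0 \<le> h k" "summable h" for k
  proof -
    show "0 \<le> h k" by (simp add: h_def)
    have "summable (\<lambda>k. real k powr (- q))" using q by (simp add: summable_real_powr_iff)
    moreover have "summable (\<lambda>k. if k = 0 then 1 else 0 :: real)" by (rule summable_finite[of "{0}"]) auto
    ultimately show "summable h" unfolding h_def by (rule summable_add)
  qed
  have jb: "jbracket n powr (- q) \<le> h (nat \<bar>n\<bar>)" for n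
  proof (cases "n = 0")
    case True
    then show ?thesis by (simp add: h_def jbracket_def)
  next
    case False
    then have "jbracket n powr (- q) \<le> \<bar>real_of_int n\<bar> powr (- q)"
      using q jbracket_ge_abs[of n] by (intro powr_mono2') auto
    also have "\<dots> = h (nat \<bar>n\<bar>)" using False by (simp add: h_def)
    finally show ?thesis .
  qed
  define Q where "Q = 2 * suminf h"
  have Q0: "0 \<le> Q" unfolding Q_def using suminf_nonneg[OF h(2,1)] by simp
  have Q: "(\<Sum>n\<in>{-N..<N}. ennreal (jbracket n powr (- q))) \<le> ennreal Q" for N
  proof -
    have "(\<Sum>n\<in>{-N..<N}. ennreal (jbracket n powr (- q))) = (\<integral>\<^sup>+n. ennreal (jbracket n powr (- q)) * indicator {-N..<N} n \<partial>count_space UNIV)"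
      by (simp add: nn_integral_count_space_finite flip: nn_integral_count_space_indicator)
    also have "\<dots> \<le> (\<integral>\<^sup>+n. ennreal (jbracket n powr (- q)) \<partial>count_space UNIV)"
      by (intro nn_integral_mono) (auto simp: indicator_def)
    also have "\<dots> \<le> ennreal Q" unfolding Q_def by (rule nn_integral_int_le[OF _ jb h]) simp
    finally show ?thesis .
  qed
  have fixed: "(\<integral>\<^sup>+S. ennreal (bond_sum p q N (block_flow N S t)) \<partial>\<mu>) \<le> ennreal (Q * C)" if N: "0 < N" for N t
  proof -
    have "(\<integral>\<^sup>+S. ennreal (bond_sum p q N (block_flow N S t)) \<partial>\<mu>) = (\<integral>\<^sup>+S. ennreal (bond_sum p q N (restrict S {-N..N})) \<partial>\<mu>)"
      unfolding block_flow_def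
      by (rule chain_flow_invariant[OF b g]) (use N in \<open>auto intro: measurable_compose[OF bond_sum_measurable measurable_ennreal]\<close>)
    also have "\<dots> = (\<integral>\<^sup>+S. (\<Sum>n\<in>{-N..<N}. ennreal (jbracket n powr (- q)) * ennreal (1 / bond S n powr p)) \<partial>\<mu>)"
    proof (rule nn_integral_cong)
      fix S :: "int \<Rightarrow> real^3"
      have "ennreal (bond_sum p q N S) = (\<Sum>n\<in>{-N..<N}. ennreal (jbracket n powr (- q) * (1 / bond S n powr p)))"
        unfolding bond_sum_def times_divide_eq_right mult_1_right by (rule sum_ennreal[symmetric]) simp
      also have "\<dots> = (\<Sum>n\<in>{-N..<N}. ennreal (jbracket n powr (- q)) * ennreal (1 / bond S n powr p))"
        by (intro sum.cong refl ennreal_mult') simp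
      finally show "ennreal (bond_sum p q N (restrict S {-N..N})) = (\<Sum>n\<in>{-N..<N}. ennreal (jbracket n powr (- q)) * ennreal (1 / bond S n powr p))"
        by (simp only: bond_sum_restrict)
    qed
    also have "\<dots> = (\<Sum>n\<in>{-N..<N}. \<integral>\<^sup>+S. ennreal (jbracket n powr (- q)) * ennreal (1 / bond S n powr p) \<partial>\<mu>)"
    proof (rule nn_integral_sum)
      fix n
      note [measurable] = bond_measurable
      show "(\<lambda>S. ennreal (jbracket n powr (- q)) * ennreal (1 / bond S n powr p)) \<in> borel_measurable \<mu>"
        by (rule gibbs_borel_measurable[OF g]) measurable
    qed
    also have "\<dots> = (\<Sum>n\<in>{-N..<N}. ennreal (jbracket n powr (- q)) * (\<integral>\<^sup>+S. ennreal (1 / bond S n powr p) \<partial>\<mu>))"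
    proof (intro sum.cong refl nn_integral_cmult)
      fix n
      note [measurable] = bond_measurable
      show "(\<lambda>S. ennreal (1 / bond S n powr p)) \<in> borel_measurable \<mu>"
        by (rule gibbs_borel_measurable[OF g]) measurable
    qed
    also have "\<dots> \<le> (\<Sum>n\<in>{-N..<N}. ennreal (jbracket n powr (- q)) * ennreal C)"
      by (intro sum_mono mult_left_mono C(2)) simp
    also have "\<dots> = (\<Sum>n\<in>{-N..<N}. ennreal (jbracket n powr (- q))) * ennreal C"
      by (rule sum_distrib_right[symmetric])
    also have "\<dots> \<le> ennreal Q * ennreal C" by (intro mult_right_mono Q) simp
    finally show ?thesis using Q0 C(1) by (simp add: ennreal_mult)
  qed
  show ?thesis
  proof (intro exI[of _ "2 * (Q * C)"] conjI allI impI)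
    fix N :: int assume N: "0 < N"
    have "(\<integral>\<^sup>+S. (\<integral>\<^sup>+t. ennreal (exp (- \<bar>t\<bar>) * bond_sum p q N (block_flow N S t)) \<partial>lborel) \<partial>\<mu>) =
        (\<integral>\<^sup>+t. (\<integral>\<^sup>+S. ennreal (exp (- \<bar>t\<bar>) * bond_sum p q N (block_flow N S t)) \<partial>\<mu>) \<partial>lborel)"
      by (rule P.Fubini'[OF block_flow_time_measurable[OF g], symmetric])
    also have "\<dots> \<le> (\<integral>\<^sup>+t. ennreal (exp (- \<bar>t\<bar>)) * ennreal (Q * C) \<partial>lborel)"
    proof (rule nn_integral_mono)
      fix t
      have m: "(\<lambda>S. ennreal (bond_sum p q N (block_flow N S t))) \<in> borel_measurable \<mu>"
        unfolding block_flow_def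
        by (intro gibbs_borel_measurable[OF g] measurable_compose[OF _ measurable_ennreal]
            measurable_compose[OF _ bond_sum_measurable] measurable_compose[OF _ measurable_chain_flow_config]
            borel_measurable_continuous_onI continuous_on_restrict_config)
      have "(\<integral>\<^sup>+S. ennreal (exp (- \<bar>t\<bar>) * bond_sum p q N (block_flow N S t)) \<partial>\<mu>) =
        (\<integral>\<^sup>+S. ennreal (exp (- \<bar>t\<bar>)) * ennreal (bond_sum p q N (block_flow N S t)) \<partial>\<mu>)"
        by (intro nn_integral_cong) (simp add: ennreal_mult bond_sum_nonneg)
      also have "\<dots> = ennreal (exp (- \<bar>t\<bar>)) * (\<integral>\<^sup>+S. ennreal (bond_sum p q N (block_flow N S t)) \<partial>\<mu>)"
        by (rule nn_integral_cmult[OF m])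
      also have "\<dots> \<le> ennreal (exp (- \<bar>t\<bar>)) * ennreal (Q * C)" by (intro mult_left_mono fixed[OF N]) simp
      finally show "(\<integral>\<^sup>+S. ennreal (exp (- \<bar>t\<bar>) * bond_sum p q N (block_flow N S t)) \<partial>\<mu>) \<le> ennreal (exp (- \<bar>t\<bar>)) * ennreal (Q * C)" .
    qed
    also have "\<dots> = (\<integral>\<^sup>+t. ennreal (exp (- \<bar>t\<bar>)) \<partial>lborel) * ennreal (Q * C)"
      by (rule nn_integral_multc) measurable
    also have "\<dots> \<le> ennreal 2 * ennreal (Q * C)" by (intro mult_right_mono nn_integral_exp_abs) simp
    also have "\<dots> = ennreal (2 * (Q * C))" using Q0 C(1) by (subst ennreal_mult) auto
    finally show "(\<integral>\<^sup>+S. (\<integral>\<^sup>+t. ennreal (exp (- \<bar>t\<bar>) * bond_sum p q N (block_flow N S t)) \<partial>lborel) \<partial>\<mu>) \<le> ennreal (2 * (Q * C))" .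
  qed (use Q0 C(1) in simp)
qed

text \<open>The first inverse moment is finite because \<open>1 < 1 + 2 * \<beta>\<close>. The
  weight is the half of the exponent that \<open>good_solution_exists\<close> leaves for the initial
  datum.\<close>

lemma gibbs_initial_moment:
  assumes b: "\<beta> > 0" and g: "is_gibbs_measure \<beta> \<mu>"
  shows "AE S in \<mu>. (\<integral>\<^sup>+n. ennreal (exp (- jbracket n / 2) / bond S n) \<partial>count_space UNIV) < \<infinity>"
proof -
  interpret prob_space \<mu> using g by (simp add: is_gibbs_measure_def)
  obtain C where C: "0 \<le> C" "\<And>n. (\<integral>\<^sup>+S. ennreal (1 / bond S n powr 1) \<partial>\<mu>) \<le> ennreal C"
    using gibbs_bond_moment[OF b, of 1] b g by auto
  note [measurable] = bond_measurable
  have m: "(\<lambda>S. ennreal (exp (- jbracket n / 2) / bond S n)) \<in> borel_measurable \<mu>" for n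
    by (rule gibbs_borel_measurable[OF g]) measurable
  have m1: "(\<lambda>S. ennreal (1 / bond S n powr 1)) \<in> borel_measurable \<mu>" for n
    by (rule gibbs_borel_measurable[OF g]) measurable
  have "(\<integral>\<^sup>+S. (\<integral>\<^sup>+n. ennreal (exp (- jbracket n / 2) / bond S n) \<partial>count_space UNIV) \<partial>\<mu>) =
      (\<integral>\<^sup>+n. (\<integral>\<^sup>+S. ennreal (exp (- jbracket n / 2) / bond S n) \<partial>\<mu>) \<partial>count_space UNIV)"
    by (rule nn_integral_count_space_nn_integral[OF _ m]) simp
  also have "\<dots> \<le> (\<integral>\<^sup>+n. ennreal (exp (- jbracket n / 2)) * ennreal C \<partial>count_space UNIV)"
  proof (rule nn_integral_mono)
    fix n
    have "(\<integral>\<^sup>+S. ennreal (exp (- jbracket n / 2) / bond S n) \<partial>\<mu>) = (\<integral>\<^sup>+S. ennreal (exp (- jbracket n / 2)) * ennreal (1 / bond S n powr 1) \<partial>\<mu>)"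
    proof (rule nn_integral_cong)
      fix S assume S: "S \<in> space \<mu>"
      have "0 \<le> bond S n" unfolding bond_def using gibbs_space[OF g S] by (intro one_plus_inner_bounds) auto
      then show "ennreal (exp (- jbracket n / 2) / bond S n) = ennreal (exp (- jbracket n / 2)) * ennreal (1 / bond S n powr 1)"
        by (simp add: ennreal_mult[symmetric])
    qed
    also have "\<dots> = ennreal (exp (- jbracket n / 2)) * (\<integral>\<^sup>+S. ennreal (1 / bond S n powr 1) \<partial>\<mu>)"
      by (rule nn_integral_cmult[OF m1])
    also have "\<dots> \<le> ennreal (exp (- jbracket n / 2)) * ennreal C" by (intro mult_left_mono C(2)) simp
    finally show "(\<integral>\<^sup>+S. ennreal (exp (- jbracket n / 2) / bond S n) \<partial>\<mu>) \<le> ennreal (exp (- jbracket n / 2)) * ennreal C" .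
  qed
  also have "\<dots> = (\<integral>\<^sup>+n. ennreal (exp (- jbracket n / 2)) \<partial>count_space UNIV) * ennreal C"
    by (rule nn_integral_multc) simp
  also have "\<dots> < \<infinity>"
  proof -
    have "(\<integral>\<^sup>+n. ennreal (exp (- jbracket n / 2)) \<partial>count_space UNIV) \<le> ennreal (2 * suminf (\<lambda>k. exp (- (1/2)) ^ k))"
    proof (rule nn_integral_int_le)
      fix n :: int
      have "- jbracket n / 2 \<le> real (nat \<bar>n\<bar>) * (- (1 / 2))" using jbracket_ge_abs[of n] by simp
      then have "exp (- jbracket n / 2) \<le> exp (real (nat \<bar>n\<bar>) * (- (1 / 2)))" by (subst exp_le_cancel_iff)
      then show "exp (- jbracket n / 2) \<le> exp (- (1/2)) ^ nat \<bar>n\<bar>" by (simp only: exp_of_nat_mult)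
      show "summable (\<lambda>k. exp (- (1/2)) ^ k :: real)" by (rule summable_geometric) simp
    qed auto
    also have "\<dots> < \<top>" by simp
    finally show ?thesis by (simp add: ennreal_mult_less_top)
  qed
  finally have fin: "(\<integral>\<^sup>+S. (\<integral>\<^sup>+n. ennreal (exp (- jbracket n / 2) / bond S n) \<partial>count_space UNIV) \<partial>\<mu>) \<noteq> \<infinity>" by simp
  have "(\<lambda>S. \<integral>\<^sup>+n. ennreal (exp (- jbracket n / 2) / bond S n) \<partial>count_space UNIV) \<in> borel_measurable \<mu>"
  proof -
    have "(\<lambda>p. ennreal (exp (- jbracket (snd p) / 2) / bond (fst p) (snd p))) \<in> borel_measurable (\<mu> \<Otimes>\<^sub>M count_space UNIV)"
      by (rule measurable_compose_countable[OF _ measurable_snd, of "\<lambda>n p. ennreal (exp (- jbracket n / 2) / bond (fst p) n)"])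
        (rule measurable_compose[OF measurable_fst m])
    then show ?thesis
      by (intro sigma_finite_measure.borel_measurable_nn_integral)
        (auto simp: case_prod_unfold sigma_finite_measure_count_space)
  qed
  from nn_integral_PInf_AE[OF this fin] show ?thesis by (auto simp: less_top)
qed

text \<open>The expectations of the moments \<open>k j\<close> are bounded uniformly in
  \<open>j\<close>, which does not bound \<open>k j S\<close> for all \<open>j\<close> at once. Two
  weaker facts follow almost surely: the series with weights
  \<open>2 powr (- \<epsilon> * real j)\<close> converges, so \<open>k j S\<close> grows at most
  like \<open>2 powr (\<epsilon> * real j)\<close>; and by Fatou the lower limit is finite. These
  are the two moment hypotheses of \<open>good_solution_exists\<close>.\<close>

theorem gibbs_solution_exists:
  assumes b: "\<beta> > 0" and g: "is_gibbs_measure \<beta> \<mu>"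
  shows "AE S0 in \<mu>. \<exists>S. good_solution S \<and> S 0 = S0 \<and> (\<forall>t n. (\<lambda>j. block_flow (2 ^ j) S0 t n) \<longlonglongrightarrow> S t n)"
proof -
  interpret prob_space \<mu> using g by (simp add: is_gibbs_measure_def)
  \<comment> \<open>Any exponents with \<open>1 < q < p < 1 + 2 * \<beta>\<close> would do;
    \<open>\<epsilon>\<close> is half of the gap \<open>1 - q / p\<close>, so that
    \<open>q / p + \<epsilon>\<close> stays below 1.\<close>
  define p where "p = 1 + \<beta>"
  define q where "q = 1 + \<beta> / 2"
  define \<epsilon> where "\<epsilon> = (1 - q / p) / 2"
  have pq: "1 < q" "q < p" "p < 1 + 2 * \<beta>" using b by (auto simp: p_def q_def)
  then have "q / p < 1" by simp
  then have e: "0 < \<epsilon>" "q / p + \<epsilon> < 1" by (auto simp: \<epsilon>_def field_simps)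
  define k where "k j S = (\<integral>\<^sup>+t. ennreal (exp (- \<bar>t\<bar>) * bond_sum p q (2 ^ j) (block_flow (2 ^ j) S t)) \<partial>lborel)" for j :: nat and S
  obtain C where C: "0 \<le> C" "\<And>N. 0 < N \<Longrightarrow> (\<integral>\<^sup>+S. (\<integral>\<^sup>+t. ennreal (exp (- \<bar>t\<bar>) * bond_sum p q N (block_flow N S t)) \<partial>lborel) \<partial>\<mu>) \<le> ennreal C"
    using gibbs_flow_moment[OF b g pq(3,1)] by blast
  have kC: "(\<integral>\<^sup>+S. k j S \<partial>\<mu>) \<le> ennreal C" for j unfolding k_def by (rule C(2)) simp
  have km: "k j \<in> borel_measurable \<mu>" for j
    unfolding k_def by (rule lborel.borel_measurable_nn_integral[OF block_flow_time_measurable[OF g]])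
  have "(\<integral>\<^sup>+S. (\<Sum>j. ennreal (2 powr (- \<epsilon> * real j)) * k j S) \<partial>\<mu>) = (\<Sum>j. ennreal (2 powr (- \<epsilon> * real j)) * (\<integral>\<^sup>+S. k j S \<partial>\<mu>))"
    using km by (simp add: nn_integral_suminf nn_integral_cmult)
  also have "\<dots> \<le> (\<Sum>j. ennreal (2 powr (- \<epsilon> * real j) * C))"
    using C(1) kC by (intro suminf_le) (auto simp: ennreal_mult intro!: mult_left_mono)
  also have "\<dots> < \<infinity>"
  proof -
    have eq: "2 powr (- \<epsilon> * real j) * C = (2 powr (- \<epsilon>)) ^ j * C" for j
    proof -
      have "(2 powr (- \<epsilon>)) ^ j = (2 powr (- \<epsilon>)) powr real j" by (simp add: powr_realpow)
      then show ?thesis by (simp add: powr_powr)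
    qed
    have "2 powr (- \<epsilon>) < 2 powr 0" using e by (intro powr_less_mono) auto
    then have s: "summable (\<lambda>j. (2 powr (- \<epsilon>)) ^ j * C)" by (intro summable_mult2 summable_geometric) simp
    have "(\<Sum>j. ennreal (2 powr (- \<epsilon> * real j) * C)) = ennreal (\<Sum>j. (2 powr (- \<epsilon>)) ^ j * C)"
      unfolding eq using C(1) s by (intro suminf_ennreal2) auto
    then show ?thesis by simp
  qed
  finally have fin1: "(\<integral>\<^sup>+S. (\<Sum>j. ennreal (2 powr (- \<epsilon> * real j)) * k j S) \<partial>\<mu>) \<noteq> \<infinity>" by simp
  have AE1: "AE S in \<mu>. (\<Sum>j. ennreal (2 powr (- \<epsilon> * real j)) * k j S) \<noteq> \<infinity>"
    by (rule nn_integral_PInf_AE[OF _ fin1]) (use km in measurable)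
  have "(\<integral>\<^sup>+S. liminf (\<lambda>j. k j S) \<partial>\<mu>) \<le> liminf (\<lambda>j. \<integral>\<^sup>+S. k j S \<partial>\<mu>)"
    by (rule nn_integral_liminf[OF km])
  also have "\<dots> \<le> liminf (\<lambda>j::nat. ennreal C)"
    by (intro Liminf_mono always_eventually allI kC)
  also have "\<dots> < \<infinity>" by (simp add: Liminf_const)
  finally have fin2: "(\<integral>\<^sup>+S. liminf (\<lambda>j. k j S) \<partial>\<mu>) \<noteq> \<infinity>" by simp
  have AE2: "AE S in \<mu>. liminf (\<lambda>j. k j S) \<noteq> \<infinity>"
    by (rule nn_integral_PInf_AE[OF borel_measurable_liminf[OF km] fin2])
  show ?thesis
    using AE1 AE2 gibbs_bond_pos[OF b g] gibbs_initial_moment[OF b g] AE_space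
  proof eventually_elim
    case (elim S)
    have u: "norm (S n) = 1" for n using gibbs_space[OF g elim(5), of n] by simp
    have w: "0 < bond S n" for n using elim(3) by blast
    define s where "s = (\<Sum>j. ennreal (2 powr (- \<epsilon> * real j)) * k j S)"
    define K where "K = enn2real s"
    have Ke: "ennreal K = s" unfolding K_def s_def using elim(1) by (intro ennreal_enn2real) (simp add: less_top)
    have kK: "k j S \<le> ennreal (K * 2 powr (\<epsilon> * real j))" for j
    proof -
      have "ennreal (2 powr (- \<epsilon> * real j)) * k j S \<le> s"
        unfolding s_def using sum_le_suminf[of "\<lambda>j. ennreal (2 powr (- \<epsilon> * real j)) * k j S" "{j}"] by simp
      then have "ennreal (2 powr (\<epsilon> * real j)) * (ennreal (2 powr (- \<epsilon> * real j)) * k j S) \<le> ennreal (2 powr (\<epsilon> * real j)) * ennreal K"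
        unfolding Ke by (intro mult_left_mono) auto
      moreover have "ennreal (2 powr (\<epsilon> * real j)) * ennreal (2 powr (- \<epsilon> * real j)) = 1"
        by (simp add: ennreal_mult[symmetric] powr_add[symmetric])
      ultimately have "k j S \<le> ennreal (2 powr (\<epsilon> * real j)) * ennreal K"
        by (simp only: mult.assoc[symmetric] mult_1_left)
      also have "\<dots> = ennreal (K * 2 powr (\<epsilon> * real j))"
        by (subst ennreal_mult''[symmetric]) (simp_all add: K_def mult.commute)
      finally show ?thesis .
    qed
    \<comment> \<open>The added 1 makes the inequality strict, so that values up to \<open>D\<close>
      occur infinitely often.\<close>
    define D where "D = enn2real (liminf (\<lambda>j. k j S)) + 1"
    have Dl: "liminf (\<lambda>j. k j S) < ennreal D"
    proof -
      have "liminf (\<lambda>j. k j S) = ennreal (enn2real (liminf (\<lambda>j. k j S)))"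
        using elim(2) by (intro ennreal_enn2real[symmetric]) (simp add: less_top)
      also have "\<dots> < ennreal D" unfolding D_def by (intro ennreal_lessI add_nonneg_pos) auto
      finally show ?thesis .
    qed
    have freq: "\<exists>\<^sub>F j in sequentially. k j S \<le> ennreal D"
    proof (rule ccontr)
      assume "\<not> (\<exists>\<^sub>F j in sequentially. k j S \<le> ennreal D)"
      then have "\<forall>\<^sub>F j in sequentially. ennreal D \<le> k j S"
        unfolding not_frequently by (rule eventually_mono) simp
      then have "ennreal D \<le> liminf (\<lambda>j. k j S)" by (rule Liminf_bounded)
      then show False using Dl by simp
    qed
    show ?case
    proof (rule good_solution_exists[OF pq(1,2) less_imp_le[OF e(1)] e(2), where K=K and C=D])
      show "local_lhm (2 ^ j) (block_flow (2 ^ j) S)" for j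
        by (rule block_flow_local(1)[OF _ u w]) simp
      show "block_flow (2 ^ j) S 0 n = S n" if "n \<in> {-(2 ^ j)..2 ^ j}" for j n
        using block_flow_local(2)[OF _ u w, of "2 ^ j"] that by simp
    qed (use kK freq elim(4) in \<open>auto simp: k_def K_def D_def\<close>)
  qed
qed

section \<open>Invariance of the law in the limit\<close>

lemma spin_space_subset_borel:
  assumes "A \<in> sets spin_space"
  shows "\<exists>B\<in>sets (borel :: (int \<Rightarrow> real^3) measure). A = B \<inter> space spin_space"
proof -
  let ?P = "space spin_space"
  have "(\<lambda>x. x) \<in> restrict_space borel ?P \<rightarrow>\<^sub>M spin_space"
    unfolding spin_space_def
  proof (rule measurable_PiM_single')
    fix i :: int
    show "(\<lambda>x. x i) \<in> restrict_space borel (space (Pi\<^sub>M UNIV (\<lambda>_. restrict_space borel S2))) \<rightarrow>\<^sub>M restrict_space borel S2"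
      by (rule measurable_restrict_space2)
        (auto simp: space_restrict_space space_PiM intro!: measurable_restrict_space1 measurable_apply_borel)
  qed (auto simp: space_restrict_space space_PiM)
  from measurable_sets[OF this assms] have "A \<inter> ?P \<in> sets (restrict_space borel ?P)"
    by (simp add: space_restrict_space)
  moreover have "A \<inter> ?P = A" using sets.sets_into_space[OF assms] by auto
  ultimately show ?thesis by (auto simp: sets_restrict_space)
qed

text \<open>At each scale the flow preserves the law of the block. For a continuous test function
  one side converges by the almost sure convergence of the chains, the other because restrictions to
  growing blocks converge to the configuration in the product topology.\<close>

theorem gibbs_limit_law:
  assumes b: "\<beta> > 0" and g: "is_gibbs_measure \<beta> \<mu>" and G: "G \<in> \<mu> \<rightarrow>\<^sub>M spin_space"
    and lim: "AE S in \<mu>. \<forall>n. (\<lambda>j. block_flow (2 ^ j) S t n) \<longlonglongrightarrow> G S n"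
  shows "distr \<mu> spin_space G = \<mu>"
proof -
  interpret prob_space \<mu> using g by (simp add: is_gibbs_measure_def)
  have sets\<mu>: "sets \<mu> = sets spin_space" using g by (simp add: is_gibbs_measure_def)
  have sp: "space \<mu> = space spin_space" using sets\<mu> by (rule sets_eq_imp_space_eq)
  have Gb: "G \<in> \<mu> \<rightarrow>\<^sub>M (borel :: (int \<Rightarrow> real^3) measure)" by (rule measurable_compose[OF G measurable_spin_borel])
  have Ib: "(\<lambda>S. S) \<in> \<mu> \<rightarrow>\<^sub>M (borel :: (int \<Rightarrow> real^3) measure)"
    by (rule gibbs_borel_measurable[OF g]) simp
  have eq: "distr \<mu> borel G = distr \<mu> borel (\<lambda>S. S)"
  proof (rule finite_measure_eqI_continuous)
    show "finite_measure (distr \<mu> borel G)" "finite_measure (distr \<mu> borel (\<lambda>S. S))"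
      using Gb Ib by (auto intro: finite_measure_distr)
    fix f :: "(int \<Rightarrow> real^3) \<Rightarrow> real" assume f: "continuous_on UNIV f" and f01: "\<And>x. 0 \<le> f x \<and> f x \<le> 1"
    have fm: "f \<in> borel_measurable borel" using f by (rule borel_measurable_continuous_onI)
    have rm: "(\<lambda>S. restrict S {-N..N}) \<in> \<mu> \<rightarrow>\<^sub>M (borel :: (int \<Rightarrow> real^3) measure)" for N
      using continuous_on_restrict_config by (intro gibbs_borel_measurable[OF g] borel_measurable_continuous_onI)
    have bm: "(\<lambda>S. block_flow N S t) \<in> \<mu> \<rightarrow>\<^sub>M (borel :: (int \<Rightarrow> real^3) measure)" for N
      unfolding block_flow_def by (rule measurable_compose[OF rm measurable_chain_flow_config])
    have int: "integrable \<mu> (\<lambda>S. f (h S))" if "h \<in> \<mu> \<rightarrow>\<^sub>M borel" for h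
      using f01 measurable_compose[OF that fm] by (intro integrable_const_bound[where B=1]) auto
    have inv: "(\<integral>S. f (block_flow (2 ^ j) S t) \<partial>\<mu>) = (\<integral>S. f (restrict S {-(2 ^ j)..2 ^ j}) \<partial>\<mu>)" for j :: nat
    proof -
      have "ennreal (\<integral>S. f (block_flow (2 ^ j) S t) \<partial>\<mu>) = (\<integral>\<^sup>+S. ennreal (f (block_flow (2 ^ j) S t)) \<partial>\<mu>)"
        using f01 by (intro nn_integral_eq_integral[symmetric] int bm) auto
      also have "\<dots> = (\<integral>\<^sup>+S. ennreal (f (restrict S {-(2 ^ j)..2 ^ j})) \<partial>\<mu>)"
      proof -
        have "- (2 ^ j :: int) < 2 ^ j" using zero_less_power[of "2::int" j] by linarith
        then show ?thesis
          unfolding block_flow_def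
          by (rule chain_flow_invariant[OF b g]) (rule measurable_compose[OF fm measurable_ennreal])
      qed
      also have "\<dots> = ennreal (\<integral>S. f (restrict S {-(2 ^ j)..2 ^ j}) \<partial>\<mu>)"
        using f01 by (intro nn_integral_eq_integral int rm) auto
      finally show ?thesis
        using f01 by (subst (asm) ennreal_inj) (auto intro!: integral_nonneg)
    qed
    have "(\<lambda>j. \<integral>S. f (block_flow (2 ^ j) S t) \<partial>\<mu>) \<longlonglongrightarrow> (\<integral>S. f (G S) \<partial>\<mu>)"
    proof (rule integral_dominated_convergence[where w="\<lambda>_. 1"])
      show "AE S in \<mu>. (\<lambda>j. f (block_flow (2 ^ j) S t)) \<longlonglongrightarrow> f (G S)"
        using lim
      proof eventually_elim
        case (elim S)
        have "(\<lambda>j. block_flow (2 ^ j) S t) \<longlonglongrightarrow> G S" by (rule tendsto_config) (use elim in blast)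
        from continuous_on_tendsto_compose[OF f this] show ?case by simp
      qed
    qed (use f01 measurable_compose[OF bm fm] measurable_compose[OF Gb fm] in auto)
    moreover have "(\<lambda>j. \<integral>S. f (restrict S {-(2 ^ j)..2 ^ j}) \<partial>\<mu>) \<longlonglongrightarrow> (\<integral>S. f S \<partial>\<mu>)"
    proof (rule integral_dominated_convergence[where w="\<lambda>_. 1"])
      show "AE S in \<mu>. (\<lambda>j. f (restrict S {-(2 ^ j)..2 ^ j})) \<longlonglongrightarrow> f S"
      proof (rule AE_I2)
        fix S :: "int \<Rightarrow> real^3"
        have "(\<lambda>j. restrict S {-(2 ^ j)..2 ^ j}) \<longlonglongrightarrow> S"
        proof (rule tendsto_config, rule tendsto_eventually, rule eventually_sequentiallyI)
          fix n :: int and j assume "nat \<bar>n\<bar> \<le> j"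
          moreover have "int j < 2 ^ j" using less_exp[of j] by (metis of_nat_less_iff of_nat_numeral of_nat_power)
          ultimately have "\<bar>n\<bar> \<le> 2 ^ j" by linarith
          then show "restrict S {-(2 ^ j)..2 ^ j} n = S n" by (auto simp: abs_le_iff)
        qed
        from continuous_on_tendsto_compose[OF f this]
        show "(\<lambda>j. f (restrict S {-(2 ^ j)..2 ^ j})) \<longlonglongrightarrow> f S" by simp
      qed
    qed (use f01 measurable_compose[OF rm fm] measurable_compose[OF Ib fm] in auto)
    ultimately have "(\<integral>S. f (G S) \<partial>\<mu>) = (\<integral>S. f S \<partial>\<mu>)" unfolding inv by (rule LIMSEQ_unique)
    then show "(\<integral>x. f x \<partial>distr \<mu> borel G) = (\<integral>x. f x \<partial>distr \<mu> borel (\<lambda>S. S))"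
      by (simp only: integral_distr[OF Gb fm] integral_distr[OF Ib fm])
  qed auto
  show ?thesis
  proof (rule measure_eqI)
    fix A assume "A \<in> sets (distr \<mu> spin_space G)"
    then have A: "A \<in> sets spin_space" by simp
    then obtain B where B: "B \<in> sets borel" "A = B \<inter> space spin_space" using spin_space_subset_borel by blast
    have "emeasure (distr \<mu> spin_space G) A = emeasure \<mu> (G -` A \<inter> space \<mu>)"
      by (rule emeasure_distr[OF G A])
    also have "G -` A \<inter> space \<mu> = G -` B \<inter> space \<mu>"
      using measurable_space[OF G] unfolding B(2) by auto
    also have "emeasure \<mu> \<dots> = emeasure (distr \<mu> borel G) B" by (rule emeasure_distr[OF Gb B(1), symmetric])
    also have "\<dots> = emeasure \<mu> ((\<lambda>S. S) -` B \<inter> space \<mu>)" unfolding eq by (rule emeasure_distr[OF Ib B(1)])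
    also have "(\<lambda>S. S) -` B \<inter> space \<mu> = A" unfolding B(2) sp by auto
    finally show "emeasure (distr \<mu> spin_space G) A = emeasure \<mu> A" .
  qed (simp add: sets\<mu>)
qed

theorem theorem1p2:
  fixes \<beta> :: real and \<mu> :: "(int \<Rightarrow> real^3) measure"
  assumes "\<beta> > 0"
    and "is_gibbs_measure \<beta> \<mu>"
  shows "(AE S0 in \<mu>. \<exists>!S. good_solution S \<and> S 0 = S0) \<and>
         (\<forall>t. lhm_flow t \<in> completion \<mu> \<rightarrow>\<^sub>M spin_space \<and>
              distr (completion \<mu>) spin_space (lhm_flow t) = \<mu>)"
proof -
  note b = assms(1) and g = assms(2)
  interpret prob_space \<mu> using g by (simp add: is_gibbs_measure_def)
  have sets\<mu>: "sets \<mu> = sets spin_space" using g by (simp add: is_gibbs_measure_def)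
  have sp: "space \<mu> = space spin_space" using sets\<mu> by (rule sets_eq_imp_space_eq)
  let ?P = "\<lambda>S0. (\<exists>!S. good_solution S \<and> S 0 = S0) \<and> (\<forall>t n. (\<lambda>j. block_flow (2 ^ j) S0 t n) \<longlonglongrightarrow> lhm_flow t S0 n)"
  have AE: "AE S0 in \<mu>. ?P S0"
    using gibbs_solution_exists[OF b g]
  proof eventually_elim
    case (elim S0)
    then obtain S where S: "good_solution S" "S 0 = S0" "\<And>t n. (\<lambda>j. block_flow (2 ^ j) S0 t n) \<longlonglongrightarrow> S t n" by blast
    have ex1: "\<exists>!S. good_solution S \<and> S 0 = S0"
      using S(1,2) good_solution_unique by blast
    then have "(THE S. good_solution S \<and> S 0 = S0) = S" using S(1,2) by (intro the1_equality conjI)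
    then have "lhm_flow t S0 = S t" for t unfolding lhm_flow_def using ex1 by simp
    then show ?case using ex1 S(3) by simp
  qed
  from AE_E[OF AE] obtain Z where Z: "{S \<in> space \<mu>. \<not> ?P S} \<subseteq> Z" "emeasure \<mu> Z = 0" "Z \<in> sets \<mu>" by blast
  have Z0: "Z \<in> null_sets \<mu>" using Z by (auto simp: null_sets_def)
  have flow_S2: "lhm_flow t S0 n \<in> S2" if "S0 \<in> space \<mu>" for t S0 n
  proof (cases "\<exists>!S. good_solution S \<and> S 0 = S0")
    case True
    then have "good_solution (THE S. good_solution S \<and> S 0 = S0)" using theI'[OF True] by blast
    then have "(THE S. good_solution S \<and> S 0 = S0) t n \<in> S2" unfolding good_solution_def lhm_solution_def by blast
    moreover have "lhm_flow t S0 = (THE S. good_solution S \<and> S 0 = S0) t" unfolding lhm_flow_def by (rule if_P[OF True])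
    ultimately show ?thesis by simp
  next
    case False
    then have "lhm_flow t S0 = S0" by (simp add: lhm_flow_def)
    then show ?thesis using gibbs_space[OF g that] by simp
  qed
  have main: "lhm_flow t \<in> completion \<mu> \<rightarrow>\<^sub>M spin_space \<and> distr (completion \<mu>) spin_space (lhm_flow t) = \<mu>" for t
  proof -
    \<comment> \<open>The exceptional data lie in the measurable null set \<open>Z\<close>, and the
      flow is replaced there by the identity. The result is a pointwise limit of measurable maps,
      hence measurable for \<open>\<mu>\<close> itself and not only for its completion.\<close>
    define G where "G S = (if S \<in> Z then S else lhm_flow t S)" for S
    have Glim: "(\<lambda>j. if S \<in> Z then S n else block_flow (2 ^ j) S t n) \<longlonglongrightarrow> G S n" if "S \<in> space \<mu>" for S n
    proof (cases "S \<in> Z")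
      case False
      then have "?P S" using that Z(1) by blast
      then show ?thesis using False by (simp add: G_def)
    qed (simp add: G_def)
    have GS2: "G S n \<in> S2" if "S \<in> space \<mu>" for S n
      using flow_S2[OF that] gibbs_space[OF g that] by (simp add: G_def)
    have Gm: "G \<in> \<mu> \<rightarrow>\<^sub>M spin_space"
      unfolding spin_space_def
    proof (rule measurable_PiM_single')
      fix n :: int
      have "(\<lambda>S. G S n) \<in> borel_measurable \<mu>"
      proof (rule borel_measurable_LIMSEQ_metric[OF _ Glim])
        fix j
        have "(\<lambda>S. block_flow (2 ^ j) S t n) \<in> borel_measurable \<mu>"
          unfolding block_flow_def
          by (intro gibbs_borel_measurable[OF g] measurable_compose[OF _ measurable_apply_borel]
              measurable_compose[OF _ measurable_chain_flow_config] borel_measurable_continuous_onI continuous_on_restrict_config)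
        moreover have "(\<lambda>S. S n) \<in> borel_measurable \<mu>"
          by (rule gibbs_borel_measurable[OF g measurable_apply_borel])
        ultimately show "(\<lambda>S. if S \<in> Z then S n else block_flow (2 ^ j) S t n) \<in> borel_measurable \<mu>"
          using Z(3) by (intro measurable_If_set) auto
      qed
      then show "(\<lambda>S. G S n) \<in> \<mu> \<rightarrow>\<^sub>M restrict_space borel S2"
        by (rule measurable_restrict_space2[rotated]) (use GS2 in auto)
    qed (use GS2 in \<open>auto simp: space_restrict_space\<close>)
    have AEG: "AE S in \<mu>. G S = lhm_flow t S"
      by (rule AE_I'[OF Z0]) (auto simp: G_def)
    have fm: "lhm_flow t \<in> completion \<mu> \<rightarrow>\<^sub>M spin_space"
    proof (rule measurableI)
      fix S assume "S \<in> space (completion \<mu>)"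
      then show "lhm_flow t S \<in> space spin_space" using flow_S2 by (auto simp: space_spin_space)
    next
      fix A assume A: "A \<in> sets spin_space"
      \<comment> \<open>The preimage differs from a measurable set only inside \<open>Z\<close>, all
        of whose subsets are measurable for the completion.\<close>
      have "lhm_flow t -` A \<inter> space \<mu> = (G -` A \<inter> space \<mu> - Z) \<union> (lhm_flow t -` A \<inter> space \<mu> \<inter> Z)"
        by (auto simp: G_def)
      moreover have "lhm_flow t -` A \<inter> space \<mu> \<inter> Z \<in> null_sets (completion \<mu>)"
        by (rule null_sets_completion_subset[OF Int_lower2 null_sets_completionI[OF Z0]])
      moreover have "G -` A \<inter> space \<mu> - Z \<in> sets (completion \<mu>)"
        using measurable_sets[OF Gm A] Z(3) by (intro sets_completionI_sets sets.Diff)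
      ultimately show "lhm_flow t -` A \<inter> space (completion \<mu>) \<in> sets (completion \<mu>)"
        by (metis null_setsD2 sets.Un space_completion)
    qed
    have "distr (completion \<mu>) spin_space (lhm_flow t) = distr (completion \<mu>) spin_space G"
      using AE_completion[OF AEG] fm measurable_completion[OF Gm] by (intro distr_cong_AE) auto
    also have "\<dots> = distr \<mu> spin_space G"
    proof (rule measure_eqI)
      fix A assume "A \<in> sets (distr (completion \<mu>) spin_space G)"
      then have A: "A \<in> sets spin_space" by simp
      show "emeasure (distr (completion \<mu>) spin_space G) A = emeasure (distr \<mu> spin_space G) A"
        using measurable_sets[OF Gm A] A
        by (simp add: emeasure_distr[OF Gm] emeasure_distr[OF measurable_completion[OF Gm]])
    qed simp
    also have "\<dots> = \<mu>"
    proof (rule gibbs_limit_law[OF b g Gm])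
      show "AE S in \<mu>. \<forall>n. (\<lambda>j. block_flow (2 ^ j) S t n) \<longlonglongrightarrow> G S n"
        using AE AEG by eventually_elim simp
    qed
    finally show ?thesis using fm by blast
  qed
  have "AE S0 in \<mu>. \<exists>!S. good_solution S \<and> S 0 = S0" using AE by eventually_elim blast
  then show ?thesis using main by blast
qed

end
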